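(* Let a root datum of finite type be given and let $\mathcal{A}=\mathbb{Z}[v,v^{-1}]$. Let $\dot{\theta}:{}_{\mathcal{A}}\dot{\mathbf{U}}\to{}_{\mathcal{A}}\widehat{\mathbf{U}}$ be the unique $\mathcal{A}$-algebra homomorphism with $\widehat{p}_\pi\circ\dot{\theta}=\dot{p}_\pi$ on ${}_{\mathcal{A}}\dot{\mathbf{U}}$ for every finite saturated $\pi\subset X^+$. Then $\dot{\theta}$ is an injective algebra homomorphism sending $E_{\pm i}^{(m)}1_\lambda$ to $\widehat{E}_{\pm i}^{(m)}\widehat{1}_\lambda$ for all $i\in I$, $m\ge0$, $\lambda\in X$. Hence the (not necessarily unital) $\mathcal{A}$-subalgebra of ${}_{\mathcal{A}}\widehat{\mathbf{U}}$ generated by the $\widehat{E}_{\pm i}^{(m)}\widehat{1}_\lambda$ ($i\in I$, $m\ge0$, $\lambda\in X$) is isomorphic to ${}_{\mathcal{A}}\dot{\mathbf{U}}$.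
   Context: **Root datum.** A Cartan datum is a finite set $I$ with a symmetric $\mathbb{Z}$-valued bilinear form $(\ ,\ )$ on $\mathbb{Z}[I]$ such that $(i,i)\in\{2,4,6,\dots\}$ for $i\in I$ and $2(i,j)/(i,i)\in\{0,-1,-2,\dots\}$ for $i\neq j$. It is of finite type if the matrix $((i,j))_{i,j\in I}$ is positive definite. A root datum for it consists of finitely generated free abelian groups $X,Y$, a perfect pairing $\langle\ ,\ \rangle:Y\times X\to\mathbb{Z}$, and embeddings $I\to Y$ ($i\mapsto h_i$), $I\to X$ ($i\mapsto\alpha_i$) with $\langle h_i,\alpha_j\rangle=2(i,j)/(i,i)$. Throughout it is of finite type. Put $d_i=(i,i)/2$; $\mathbb{N}=\{0,1,2,\dots\}$; $X^+=\{\lambda\in X:\langle h_i,\lambda\rangle\in\mathbb{N}\ \forall i\in I\}$; $\lambda\le\lambda'$ iff $\lambda'-\lambda\in\sum_i\mathbb{N}\alpha_i$. $W$ is the (finite) Weyl group acting on $X$, generated by $\lambda\mapsto\lambda-\langle h_i,\lambda\rangle\alpha_i$. **Quantum numbers.** $v$ is an indeterminate, $v_i=v^{d_i}$; for $P\in\mathbb{Q}(v)$, $P_i$ is $P$ with $v$ replaced by $v_i$. $[n]=(v^n-v^{-n})/(v-v^{-1})$ for $n\in\mathbb{Z}$, $[n]^!=[1][2]\cdots[n]$ for $n\in\mathbb{N}$. Divided powers: $E_{\pm i}^{(m)}=E_{\pm i}^m/[m]_i^!$, and likewise $\widehat{E}_{\pm i}^{(m)}=\widehat{E}_{\pm i}^m/[m]_i^!$.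 **The algebra $\mathbf{U}$** is the unital associative $\mathbb{Q}(v)$-algebra with generators $E_i,E_{-i}$ ($i\in I$), $K_h$ ($h\in Y$) and relations: $K_hK_{h'}=K_{h+h'}$, $K_0=1$; $K_hE_{\pm i}=v^{\pm\langle h,\alpha_i\rangle}E_{\pm i}K_h$; $E_iE_{-j}-E_{-j}E_i=\delta_{ij}\frac{K_{d_ih_i}-K_{-d_ih_i}}{v_i-v_i^{-1}}$; $\sum_{s+s'=1-\langle h_i,\alpha_j\rangle}(-1)^{s'}E_{\pm i}^{(s)}E_{\pm j}E_{\pm i}^{(s')}=0$ for $i\ne j$. It is graded, $\mathbf{U}=\bigoplus_{\nu\in\sum\mathbb{Z}\alpha_i}\mathbf{U}(\nu)$, with $K_h\in\mathbf{U}(0)$, $E_{\pm i}\in\mathbf{U}(\pm\alpha_i)$. **The modified form $\dot{\mathbf{U}}$.** For $\lambda,\lambda'\in X$ let ${}_\lambda\mathbf{U}_{\lambda'}=\mathbf{U}/\big(\sum_{h\in Y}(K_h-v^{\langle h,\lambda\rangle})\mathbf{U}+\sum_{h\in Y}\mathbf{U}(K_h-v^{\langle h,\lambda'\rangle})\big)$ (quotient vector space) with canonical projection $\pi_{\lambda,\lambda'}$, and $\dot{\mathbf{U}}=\bigoplus_{\lambda,\lambda'\in X}{}_\lambda\mathbf{U}_{\lambda'}$. Multiplication: for $t\in\mathbf{U}(\lambda_1-\lambda_1')$, $s\in\mathbf{U}(\lambda_2-\lambda_2')$, $\pi_{\lambda_1,\lambda_1'}(t)\pi_{\lambda_2,\lambda_2'}(s)=\pi_{\lambda_1,\lambda_2'}(ts)$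 if $\lambda_1'=\lambda_2$ and $0$ otherwise. Put $1_\lambda=\pi_{\lambda,\lambda}(1)$ and $E_{\pm i}^{(m)}1_\lambda=\pi_{\lambda\pm m\alpha_i,\lambda}(E_{\pm i}^{(m)})$. **The algebras $\mathbf{S}(\pi)$.** A nonempty subset $\pi\subset X^+$ is saturated if $\lambda\in X^+$, $\mu\in\pi$, $\lambda\le\mu$ imply $\lambda\in\pi$. For finite saturated $\pi$, $\mathbf{S}(\pi)$ is the unital associative $\mathbb{Q}(v)$-algebra with generators $E_i,E_{-i}$ ($i\in I$), $1_\lambda$ ($\lambda\in W\pi$) and, with the convention $1_\lambda=0$ for $\lambda\in X\setminus W\pi$, relations (for all $i,j\in I$, $\lambda,\lambda'\in X$): $1_\lambda1_{\lambda'}=\delta_{\lambda,\lambda'}1_\lambda$, $\sum_{\lambda\in X}1_\lambda=1$; $E_{\pm i}1_\lambda=1_{\lambda\pm\alpha_i}E_{\pm i}$; $E_iE_{-j}-E_{-j}E_i=\delta_{ij}\sum_{\lambda\in X}[\langle h_i,\lambda\rangle]_i1_\lambda$; $\sum_{s+s'=1-\langle h_i,\alpha_j\rangle}(-1)^{s'}E_{\pm i}^{(s)}E_{\pm j}E_{\pm i}^{(s')}=0$ for $i\neq j$. It is finite dimensional. In $\mathbf{S}(\pi)$ put $K_h=\sum_{\lambda\in W\pi}v^{\langle h,\lambda\rangle}1_\lambda$ ($h\in Y$). **Inverse limit.** For $\pi\subset\pi'$, $f_{\pi,\pi'}:\mathbf{S}(\pi')\to\mathbf{S}(\pi)$ is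 the surjective algebra map $E_{\pm i}\mapsto E_{\pm i}$, $1_\lambda\mapsto1_\lambda$. $\widehat{\mathbf{U}}=\varprojlim\mathbf{S}(\pi)=\{(a_\pi)_\pi\in\prod_\pi\mathbf{S}(\pi): a_\pi=f_{\pi,\pi'}(a_{\pi'})\text{ for }\pi\subset\pi'\}$, over all finite saturated $\pi\subset X^+$, with componentwise operations; $\widehat{p}_\pi:\widehat{\mathbf{U}}\to\mathbf{S}(\pi)$ is the projection. Put $\widehat{E}_{\pm i}=(E_{\pm i})_\pi$, $\widehat{1}_\lambda=(1_\lambda)_\pi$. **The maps $\dot{p}_\pi$.** $p_\pi:\mathbf{U}\to\mathbf{S}(\pi)$ is the algebra map $E_{\pm i}\mapsto E_{\pm i}$, $K_h\mapsto K_h$. $\dot{p}_\pi:\dot{\mathbf{U}}\to\mathbf{S}(\pi)$ is the surjective algebra map $\pi_{\lambda,\lambda'}(u)\mapsto1_\lambda p_\pi(u)1_{\lambda'}$; it sends $1_\lambda\mapsto1_\lambda$, $E_{\pm i}1_\lambda\mapsto E_{\pm i}1_\lambda$. **Integral forms.** ${}_{\mathcal{A}}\dot{\mathbf{U}}$ is the (not necessarily unital) $\mathcal{A}$-subalgebra of $\dot{\mathbf{U}}$ generated by all $E_{\pm i}^{(m)}1_\lambda$ ($i\in I$, $m\ge0$, $\lambda\in X$). ${}_{\mathcal{A}}\mathbf{S}(\pi)$ is the $\mathcal{A}$-subalgebra of $\mathbf{S}(\pi)$ generated by all $E_{\pm i}^{(m)}$ ($i\in I$, $m\ge0$) and $1_\lambda$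 ($\lambda\in W\pi$); $\dot{p}_\pi$ restricts to a surjection ${}_{\mathcal{A}}\dot{\mathbf{U}}\to{}_{\mathcal{A}}\mathbf{S}(\pi)$. ${}_{\mathcal{A}}\widehat{\mathbf{U}}$ is the $\mathcal{A}$-subalgebra of $\widehat{\mathbf{U}}$ consisting of all $(a_\pi)_\pi\in\widehat{\mathbf{U}}$ with $a_\pi\in{}_{\mathcal{A}}\mathbf{S}(\pi)$ for all $\pi$ (it is $\varprojlim{}_{\mathcal{A}}\mathbf{S}(\pi)$). *)

theory Defs
  imports
    "HOL-Algebra.QuotRing"
    "HOL-Algebra.Module"
    "HOL-Algebra.Product_Groups"
    "HOL-Algebra.Bij"
    "HOL-Library.Poly_Mapping"
    "HOL-Computational_Algebra.Polynomial"
    "HOL-Computational_Algebra.Fraction_Field"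
begin

section \<open>Coefficients and quantum numbers\<close>

type_synonym qv = "rat poly fract"

definition vv :: qv where
  "vv = Fract [:0, 1:] 1"

text \<open>The ring \<open>\<int>[v, v\<^sup>-\<^sup>1]\<close> as a subset of \<open>\<rat>(v)\<close>.\<close>
definition laurent :: "qv set" where
  "laurent = {\<Sum>k\<in>S. of_int (c k) * vv powi k | (c :: int \<Rightarrow> int) S. finite S}"

text \<open>Quantum numbers in an arbitrary base; \<open>[n]\<^sub>i\<close> is \<open>q_int (vv ^ d\<^sub>i) n\<close>.\<close>
definition q_int :: "qv \<Rightarrow> int \<Rightarrow> qv" where
  "q_int q n = (q powi n - q powi (- n)) / (q - inverse q)"

definition q_fact :: "qv \<Rightarrow> nat \<Rightarrow> qv" where
  "q_fact q m = (\<Prod>k = 1..m. q_int q (int k))"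

section \<open>Algebras given by generators and relations\<close>

text \<open>
  The record \<^typ>\<open>('a, 'b) module\<close> serves as the type of (associative, not necessarily
  commutative) algebras: it provides the operations of a ring and a scalar multiplication.
\<close>

definition divpow :: "(qv, 'a, 'm) module_scheme \<Rightarrow> qv \<Rightarrow> 'a \<Rightarrow> nat \<Rightarrow> 'a" where
  "divpow A q x m = inverse (q_fact q m) \<odot>\<^bsub>A\<^esub> (x [^]\<^bsub>A\<^esub> m)"

text \<open>The free monoid, so that \<open>'g word \<Rightarrow>\<^sub>0 qv\<close> with its convolution product is the free algebra
  on \<open>'g\<close>.\<close>
datatype 'g word = Word (letters: "'g list")

instantiation word :: (type) monoid_add
begin

definition zero_word :: "'a word" where
  "0 = Word []"

definition plus_word :: "'a word \<Rightarrow> 'a word \<Rightarrow> 'a word" where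
  "u + w = Word (letters u @ letters w)"

instance
  by standard (simp_all add: zero_word_def plus_word_def)

end

definition scalar :: "qv \<Rightarrow> 'g word \<Rightarrow>\<^sub>0 qv" where
  "scalar c = Poly_Mapping.single 0 c"

definition gen :: "'g \<Rightarrow> 'g word \<Rightarrow>\<^sub>0 qv" where
  "gen g = Poly_Mapping.single (Word [g]) 1"

definition free_algebra :: "'g set \<Rightarrow> (qv, 'g word \<Rightarrow>\<^sub>0 qv) module" where
  "free_algebra G =
    \<lparr> carrier = {p. \<forall>w\<in>Poly_Mapping.keys p. set (letters w) \<subseteq> G},
      monoid.mult = (*), one = 1, ring.zero = 0, add = (+),
      module.smult = (\<lambda>c p. scalar c * p) \<rparr>"

text \<open>\<^const>\<open>genideal\<close> is the two-sided ideal generated by a set.\<close>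
definition quotient_algebra ::
  "(qv, 'a, 'm) module_scheme \<Rightarrow> 'a set \<Rightarrow> (qv, 'a set) module" where
  "quotient_algebra A J =
    ring.extend (A Quot J) \<lparr> module.smult = (\<lambda>c C. \<Union>x\<in>C. J +>\<^bsub>A\<^esub> (c \<odot>\<^bsub>A\<^esub> x)) \<rparr>"

definition word_eval :: "('a, 'm) monoid_scheme \<Rightarrow> ('g \<Rightarrow> 'a) \<Rightarrow> 'g word \<Rightarrow> 'a" where
  "word_eval B \<phi> w = foldr (\<lambda>g x. \<phi> g \<otimes>\<^bsub>B\<^esub> x) (letters w) \<one>\<^bsub>B\<^esub>"

definition free_eval ::
  "(qv, 'a, 'm) module_scheme \<Rightarrow> ('g \<Rightarrow> 'a) \<Rightarrow> ('g word \<Rightarrow>\<^sub>0 qv) \<Rightarrow> 'a" where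
  "free_eval B \<phi> p =
    (\<Oplus>\<^bsub>B\<^esub>w\<in>Poly_Mapping.keys p. Poly_Mapping.lookup p w \<odot>\<^bsub>B\<^esub> word_eval B \<phi> w)"

text \<open>The algebra map out of a quotient of a free algebra that sends the class of each
  generator \<open>g\<close> to \<open>\<phi> g\<close> (meaningful if \<open>\<phi>\<close> respects the relations, as always below).\<close>
definition induced_map ::
  "(qv, 'a, 'm) module_scheme \<Rightarrow> ('g \<Rightarrow> 'a) \<Rightarrow> ('g word \<Rightarrow>\<^sub>0 qv) set \<Rightarrow> 'a" where
  "induced_map B \<phi> C = the_elem (free_eval B \<phi> ` C)"

section \<open>Homomorphisms and subalgebras over a ring of scalars\<close>

text \<open>Units are deliberately ignored here, since the modified form has none.\<close>

definition alg_hom ::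
  "qv set \<Rightarrow> (qv, 'a, 'm) module_scheme \<Rightarrow> (qv, 'b, 'n) module_scheme \<Rightarrow> ('a \<Rightarrow> 'b) set" where
  "alg_hom R A B =
    {f \<in> carrier A \<rightarrow> carrier B.
      (\<forall>x\<in>carrier A. \<forall>y\<in>carrier A.
        f (x \<oplus>\<^bsub>A\<^esub> y) = f x \<oplus>\<^bsub>B\<^esub> f y \<and> f (x \<otimes>\<^bsub>A\<^esub> y) = f x \<otimes>\<^bsub>B\<^esub> f y) \<and>
      (\<forall>c\<in>R. \<forall>x\<in>carrier A. f (c \<odot>\<^bsub>A\<^esub> x) = c \<odot>\<^bsub>B\<^esub> f x)}"

definition alg_iso ::
  "qv set \<Rightarrow> (qv, 'a, 'm) module_scheme \<Rightarrow> (qv, 'b, 'n) module_scheme \<Rightarrow> ('a \<Rightarrow> 'b) set" where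
  "alg_iso R A B = {f \<in> alg_hom R A B. bij_betw f (carrier A) (carrier B)}"

inductive_set subalgebra_gen ::
  "qv set \<Rightarrow> (qv, 'a, 'm) module_scheme \<Rightarrow> 'a set \<Rightarrow> 'a set"
  for R :: "qv set" and A :: "(qv, 'a, 'm) module_scheme" and G :: "'a set" where
  zero: "\<zero>\<^bsub>A\<^esub> \<in> subalgebra_gen R A G"
| gen: "x \<in> G \<Longrightarrow> x \<in> subalgebra_gen R A G"
| add: "x \<in> subalgebra_gen R A G \<Longrightarrow> y \<in> subalgebra_gen R A G \<Longrightarrow>
    x \<oplus>\<^bsub>A\<^esub> y \<in> subalgebra_gen R A G"
| mult: "x \<in> subalgebra_gen R A G \<Longrightarrow> y \<in> subalgebra_gen R A G \<Longrightarrow>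
    x \<otimes>\<^bsub>A\<^esub> y \<in> subalgebra_gen R A G"
| smult: "c \<in> R \<Longrightarrow> x \<in> subalgebra_gen R A G \<Longrightarrow> c \<odot>\<^bsub>A\<^esub> x \<in> subalgebra_gen R A G"

section \<open>Root data\<close>

definition zmul :: "int \<Rightarrow> 'a :: ab_group_add \<Rightarrow> 'a" where
  "zmul n x = (\<Sum>k<nat n. x) - (\<Sum>k<nat (- n). x)"

definition fg_free_abelian :: "'a :: ab_group_add itself \<Rightarrow> bool" where
  "fg_free_abelian _ \<longleftrightarrow>
    (\<exists>B :: 'a set. finite B \<and>
      (\<forall>x. \<exists>!c. (\<forall>b. b \<notin> B \<longrightarrow> c b = 0) \<and> x = (\<Sum>b\<in>B. zmul (c b) b)))"

text \<open>
  The lattices \<open>X\<close> and \<open>Y\<close> are the types \<^typ>\<open>'x\<close> and \<^typ>\<open>'y\<close>; the form on \<open>\<int>[I]\<close> is given by its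
  values on the basis \<open>I\<close>.
\<close>
record ('i, 'x, 'y) root_data =
  index :: "'i set"
  form :: "'i \<Rightarrow> 'i \<Rightarrow> int"
  pairing :: "'y \<Rightarrow> 'x \<Rightarrow> int"
  simple_coroot :: "'i \<Rightarrow> 'y"
  simple_root :: "'i \<Rightarrow> 'x"

definition cartan_datum :: "('i, 'x, 'y) root_data \<Rightarrow> bool" where
  "cartan_datum D \<longleftrightarrow>
    finite (index D) \<and>
    (\<forall>i\<in>index D. \<forall>j\<in>index D. form D i j = form D j i) \<and>
    (\<forall>i\<in>index D. form D i i > 0 \<and> even (form D i i)) \<and>
    (\<forall>i\<in>index D. \<forall>j\<in>index D. i \<noteq> j \<longrightarrow>
      (\<exists>n :: nat. 2 * rat_of_int (form D i j) / rat_of_int (form D i i) = - of_nat n))"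

definition finite_type :: "('i, 'x, 'y) root_data \<Rightarrow> bool" where
  "finite_type D \<longleftrightarrow>
    (\<forall>c :: 'i \<Rightarrow> real. (\<exists>i\<in>index D. c i \<noteq> 0) \<longrightarrow>
      (\<Sum>i\<in>index D. \<Sum>j\<in>index D. c i * of_int (form D i j) * c j) > 0)"

definition root_datum :: "('i, 'x :: ab_group_add, 'y :: ab_group_add) root_data \<Rightarrow> bool" where
  "root_datum D \<longleftrightarrow>
    cartan_datum D \<and>
    fg_free_abelian TYPE('x) \<and> fg_free_abelian TYPE('y) \<and>
    (\<forall>h. additive (pairing D h)) \<and> (\<forall>\<kappa>. additive (\<lambda>h. pairing D h \<kappa>)) \<and>
    (\<forall>f. additive f \<longrightarrow> (\<exists>!h. f = pairing D h)) \<and>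
    (\<forall>f. additive f \<longrightarrow> (\<exists>!\<kappa>. f = (\<lambda>h. pairing D h \<kappa>))) \<and>
    inj_on (simple_coroot D) (index D) \<and> inj_on (simple_root D) (index D) \<and>
    (\<forall>i\<in>index D. \<forall>j\<in>index D.
      rat_of_int (pairing D (simple_coroot D i) (simple_root D j)) =
        2 * rat_of_int (form D i j) / rat_of_int (form D i i))"

definition dd :: "('i, 'x, 'y) root_data \<Rightarrow> 'i \<Rightarrow> nat" where
  "dd D i = nat (form D i i div 2)"

definition vi :: "('i, 'x, 'y) root_data \<Rightarrow> 'i \<Rightarrow> qv" where
  "vi D i = vv ^ dd D i"

definition dominant :: "('i, 'x, 'y) root_data \<Rightarrow> 'x set" where
  "dominant D = {\<kappa>. \<forall>i\<in>index D. pairing D (simple_coroot D i) \<kappa> \<ge> 0}"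

definition dom_le :: "('i, 'x :: ab_group_add, 'y) root_data \<Rightarrow> 'x \<Rightarrow> 'x \<Rightarrow> bool" where
  "dom_le D \<kappa> \<mu> \<longleftrightarrow> (\<exists>c :: 'i \<Rightarrow> nat. \<mu> - \<kappa> = (\<Sum>i\<in>index D. zmul (int (c i)) (simple_root D i)))"

definition reflection :: "('i, 'x :: ab_group_add, 'y) root_data \<Rightarrow> 'i \<Rightarrow> 'x \<Rightarrow> 'x" where
  "reflection D i \<kappa> = \<kappa> - zmul (pairing D (simple_coroot D i) \<kappa>) (simple_root D i)"

definition weyl_group :: "('i, 'x :: ab_group_add, 'y) root_data \<Rightarrow> ('x \<Rightarrow> 'x) set" where
  "weyl_group D = generate (BijGroup UNIV) (reflection D ` index D)"

definition weyl_orbit :: "('i, 'x :: ab_group_add, 'y) root_data \<Rightarrow> 'x set \<Rightarrow> 'x set" where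
  "weyl_orbit D P = {w \<kappa> | w \<kappa>. w \<in> weyl_group D \<and> \<kappa> \<in> P}"

definition saturated :: "('i, 'x :: ab_group_add, 'y) root_data \<Rightarrow> 'x set \<Rightarrow> bool" where
  "saturated D P \<longleftrightarrow>
    P \<noteq> {} \<and> P \<subseteq> dominant D \<and>
    (\<forall>\<kappa>\<in>dominant D. \<forall>\<mu>\<in>P. dom_le D \<kappa> \<mu> \<longrightarrow> \<kappa> \<in> P)"

definition finite_saturated :: "('i, 'x :: ab_group_add, 'y) root_data \<Rightarrow> 'x set set" where
  "finite_saturated D = {P. finite P \<and> saturated D P}"

section \<open>The quantized enveloping algebra\<close>

datatype sign = Plus | Minus

fun sg :: "sign \<Rightarrow> int" where
  "sg Plus = 1"
| "sg Minus = - 1"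

text \<open>\<open>UE Plus i\<close> and \<open>UE Minus i\<close> stand for \<open>E\<^sub>i\<close> and \<open>E\<^sub>-\<^sub>i\<close>.\<close>
datatype ('i, 'y) U_gen = UE sign 'i | UK 'y

text \<open>The quantum Serre element for the generators \<open>E s i\<close> and \<open>E s j\<close> (same sign), over a free
  algebra; divided powers are taken in base \<open>v\<^sub>i\<close>.\<close>
definition serre ::
  "('i, 'x, 'y) root_data \<Rightarrow> 'i \<Rightarrow> 'i \<Rightarrow> ('g word \<Rightarrow>\<^sub>0 qv) \<Rightarrow> ('g word \<Rightarrow>\<^sub>0 qv) \<Rightarrow> ('g word \<Rightarrow>\<^sub>0 qv)"
  where
  "serre D i j x y =
    (\<Sum>(s, s') \<in> {(s, s'). int s + int s' = 1 - pairing D (simple_coroot D i) (simple_root D j)}.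
      (- 1) ^ s' * divpow (free_algebra UNIV) (vi D i) x s * y *
        divpow (free_algebra UNIV) (vi D i) x s')"

definition U_gens :: "('i, 'x, 'y) root_data \<Rightarrow> ('i, 'y) U_gen set" where
  "U_gens D = {UE s i | s i. i \<in> index D} \<union> range UK"

definition U_rels ::
  "('i, 'x :: ab_group_add, 'y :: ab_group_add) root_data \<Rightarrow> (('i, 'y) U_gen word \<Rightarrow>\<^sub>0 qv) set" where
  "U_rels D =
    {gen (UK h) * gen (UK h') - gen (UK (h + h')) | h h'. True} \<union>
    {gen (UK 0) - 1} \<union>
    {gen (UK h) * gen (UE s i) -
       scalar (vv powi (sg s * pairing D h (simple_root D i))) * gen (UE s i) * gen (UK h) | h s i.
       i \<in> index D} \<union>
    {gen (UE Plus i) * gen (UE Minus j) - gen (UE Minus j) * gen (UE Plus i) -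
       (if i = j
        then scalar (1 / (vi D i - inverse (vi D i))) *
          (gen (UK (zmul (int (dd D i)) (simple_coroot D i))) -
           gen (UK (- zmul (int (dd D i)) (simple_coroot D i))))
        else 0) | i j. i \<in> index D \<and> j \<in> index D} \<union>
    {serre D i j (gen (UE s i)) (gen (UE s j)) | s i j. i \<in> index D \<and> j \<in> index D \<and> i \<noteq> j}"

type_synonym ('i, 'y) U_elem = "(('i, 'y) U_gen word \<Rightarrow>\<^sub>0 qv) set"

definition U_ideal ::
  "('i, 'x :: ab_group_add, 'y :: ab_group_add) root_data \<Rightarrow> (('i, 'y) U_gen word \<Rightarrow>\<^sub>0 qv) set" where
  "U_ideal D = genideal (free_algebra (U_gens D)) (U_rels D)"

definition U_alg ::
  "('i, 'x :: ab_group_add, 'y :: ab_group_add) root_data \<Rightarrow> (qv, ('i, 'y) U_elem) module" where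
  "U_alg D = quotient_algebra (free_algebra (U_gens D)) (U_ideal D)"

definition U_class ::
  "('i, 'x :: ab_group_add, 'y :: ab_group_add) root_data \<Rightarrow> (('i, 'y) U_gen word \<Rightarrow>\<^sub>0 qv) \<Rightarrow>
    ('i, 'y) U_elem" where
  "U_class D p = U_ideal D +>\<^bsub>free_algebra (U_gens D)\<^esub> p"

definition U_E :: "('i, 'x :: ab_group_add, 'y :: ab_group_add) root_data \<Rightarrow> sign \<Rightarrow> 'i \<Rightarrow>
    ('i, 'y) U_elem" where
  "U_E D s i = U_class D (gen (UE s i))"

definition U_K :: "('i, 'x :: ab_group_add, 'y :: ab_group_add) root_data \<Rightarrow> 'y \<Rightarrow>
    ('i, 'y) U_elem" where
  "U_K D h = U_class D (gen (UK h))"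

fun U_gen_weight :: "('i, 'x :: ab_group_add, 'y) root_data \<Rightarrow> ('i, 'y) U_gen \<Rightarrow> 'x" where
  "U_gen_weight D (UE s i) = zmul (sg s) (simple_root D i)"
| "U_gen_weight D (UK h) = 0"

text \<open>\<open>\<^bold>U(\<nu>)\<close>, spanned by the monomials of weight \<open>\<nu>\<close>; it is \<open>0\<close> for \<open>\<nu>\<close> outside the root lattice.\<close>
definition U_homogeneous ::
  "('i, 'x :: ab_group_add, 'y :: ab_group_add) root_data \<Rightarrow> 'x \<Rightarrow> ('i, 'y) U_elem set" where
  "U_homogeneous D \<nu> =
    {U_class D p | p. p \<in> carrier (free_algebra (U_gens D)) \<and>
      (\<forall>w\<in>Poly_Mapping.keys p. sum_list (map (U_gen_weight D) (letters w)) = \<nu>)}"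

section \<open>The modified form\<close>

text \<open>
  \<open>mod_sub D \<kappa> \<kappa>'\<close> is the subspace \<open>\<Sum>\<^sub>h (K\<^sub>h - v\<^bsup>\<langle>h,\<kappa>\<rangle>\<^esup>)\<^bold>U + \<Sum>\<^sub>h \<^bold>U(K\<^sub>h - v\<^bsup>\<langle>h,\<kappa>'\<rangle>\<^esup>)\<close>; a sum of subspaces is the
  additive subgroup generated by their union.
\<close>
definition mod_sub ::
  "('i, 'x :: ab_group_add, 'y :: ab_group_add) root_data \<Rightarrow> 'x \<Rightarrow> 'x \<Rightarrow> ('i, 'y) U_elem set" where
  "mod_sub D \<kappa> \<kappa>' = generate (add_monoid (U_alg D))
    ({(U_K D h \<ominus>\<^bsub>U_alg D\<^esub> vv powi (pairing D h \<kappa>) \<odot>\<^bsub>U_alg D\<^esub> \<one>\<^bsub>U_alg D\<^esub>) \<otimes>\<^bsub>U_alg D\<^esub> u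
        | h u. u \<in> carrier (U_alg D)} \<union>
     {u \<otimes>\<^bsub>U_alg D\<^esub> (U_K D h \<ominus>\<^bsub>U_alg D\<^esub> vv powi (pairing D h \<kappa>') \<odot>\<^bsub>U_alg D\<^esub> \<one>\<^bsub>U_alg D\<^esub>)
        | h u. u \<in> carrier (U_alg D)})"

text \<open>The additive group of \<open>\<^sub>\<kappa>\<^bold>U\<^sub>\<kappa>\<^sub>'\<close>, written multiplicatively as a quotient group, and the
  projection \<open>\<pi>\<^bsub>\<kappa>,\<kappa>'\<^esub>\<close> onto it.\<close>
definition mod_comp ::
  "('i, 'x :: ab_group_add, 'y :: ab_group_add) root_data \<Rightarrow> 'x \<Rightarrow> 'x \<Rightarrow>
    ('i, 'y) U_elem set monoid" where
  "mod_comp D \<kappa> \<kappa>' = U_alg D A_Mod mod_sub D \<kappa> \<kappa>'"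

definition mod_proj ::
  "('i, 'x :: ab_group_add, 'y :: ab_group_add) root_data \<Rightarrow> 'x \<Rightarrow> 'x \<Rightarrow>
    ('i, 'y) U_elem \<Rightarrow> ('i, 'y) U_elem set" where
  "mod_proj D \<kappa> \<kappa>' u = mod_sub D \<kappa> \<kappa>' +>\<^bsub>U_alg D\<^esub> u"

type_synonym ('i, 'x, 'y) Udot_elem = "'x \<times> 'x \<Rightarrow> ('i, 'y) U_elem set"

definition Udot_space ::
  "('i, 'x :: ab_group_add, 'y :: ab_group_add) root_data \<Rightarrow> ('i, 'x, 'y) Udot_elem monoid" where
  "Udot_space D = sum_group UNIV (\<lambda>(\<kappa>, \<kappa>'). mod_comp D \<kappa> \<kappa>')"

text \<open>
  The product \<open>\<^sub>\<kappa>\<^bold>U\<^sub>\<mu> \<times> \<^sub>\<mu>\<^bold>U\<^sub>\<nu> \<rightarrow> \<^sub>\<kappa>\<^bold>U\<^sub>\<nu>\<close>, computed on homogeneous representatives \<open>t \<in> \<^bold>U(\<kappa> - \<mu>)\<close> and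
  \<open>s \<in> \<^bold>U(\<mu> - \<nu>)\<close>; the cosets in the union all coincide (cf. \<^const>\<open>rcoset_mult\<close>).
\<close>
definition comp_mult ::
  "('i, 'x :: ab_group_add, 'y :: ab_group_add) root_data \<Rightarrow> 'x \<Rightarrow> 'x \<Rightarrow> 'x \<Rightarrow>
    ('i, 'y) U_elem set \<Rightarrow> ('i, 'y) U_elem set \<Rightarrow> ('i, 'y) U_elem set" where
  "comp_mult D \<kappa> \<mu> \<nu> C C' =
    (\<Union>t \<in> C \<inter> U_homogeneous D (\<kappa> - \<mu>). \<Union>s \<in> C' \<inter> U_homogeneous D (\<mu> - \<nu>).
      mod_proj D \<kappa> \<nu> (t \<otimes>\<^bsub>U_alg D\<^esub> s))"

text \<open>
  Products of summands whose inner weights differ vanish, so that multiplication is matrix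
  multiplication; \<^const>\<open>finprod\<close> is the sum in the additive group \<^term>\<open>mod_comp D \<kappa> \<nu>\<close>. The
  algebra has no unit, and the field \<^const>\<open>one\<close> is not used.
\<close>
definition Udot ::
  "('i, 'x :: ab_group_add, 'y :: ab_group_add) root_data \<Rightarrow>
    (qv, ('i, 'x, 'y) Udot_elem) module" where
  "Udot D =
    \<lparr> carrier = carrier (Udot_space D),
      monoid.mult = (\<lambda>f g (\<kappa>, \<nu>).
        finprod (mod_comp D \<kappa> \<nu>) (\<lambda>\<mu>. comp_mult D \<kappa> \<mu> \<nu> (f (\<kappa>, \<mu>)) (g (\<mu>, \<nu>)))
          {\<mu>. f (\<kappa>, \<mu>) \<noteq> \<one>\<^bsub>mod_comp D \<kappa> \<mu>\<^esub> \<and> g (\<mu>, \<nu>) \<noteq> \<one>\<^bsub>mod_comp D \<mu> \<nu>\<^esub>}),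
      one = undefined,
      ring.zero = \<one>\<^bsub>Udot_space D\<^esub>,
      add = monoid.mult (Udot_space D),
      module.smult = (\<lambda>c f (\<kappa>, \<kappa>'). \<Union>u \<in> f (\<kappa>, \<kappa>'). mod_proj D \<kappa> \<kappa>' (c \<odot>\<^bsub>U_alg D\<^esub> u)) \<rparr>"

text \<open>\<open>\<pi>\<^bsub>\<kappa>,\<kappa>'\<^esub>(u)\<close> as an element of the direct sum.\<close>
definition Udot_in ::
  "('i, 'x :: ab_group_add, 'y :: ab_group_add) root_data \<Rightarrow> 'x \<Rightarrow> 'x \<Rightarrow>
    ('i, 'y) U_elem \<Rightarrow> ('i, 'x, 'y) Udot_elem" where
  "Udot_in D \<kappa> \<kappa>' u = (\<one>\<^bsub>Udot_space D\<^esub>) ((\<kappa>, \<kappa>') := mod_proj D \<kappa> \<kappa>' u)"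

definition Udot_E ::
  "('i, 'x :: ab_group_add, 'y :: ab_group_add) root_data \<Rightarrow> sign \<Rightarrow> 'i \<Rightarrow> nat \<Rightarrow> 'x \<Rightarrow>
    ('i, 'x, 'y) Udot_elem" where
  "Udot_E D s i m \<kappa> =
    Udot_in D (\<kappa> + zmul (sg s * int m) (simple_root D i)) \<kappa> (divpow (U_alg D) (vi D i) (U_E D s i) m)"

section \<open>Generalized \<open>q\<close>-Schur algebras\<close>

datatype ('i, 'x) S_gen = SE sign 'i | SI 'x

definition S_gens :: "('i, 'x :: ab_group_add, 'y) root_data \<Rightarrow> 'x set \<Rightarrow> ('i, 'x) S_gen set" where
  "S_gens D P = {SE s i | s i. i \<in> index D} \<union> SI ` weyl_orbit D P"

definition S_idem ::
  "('i, 'x :: ab_group_add, 'y) root_data \<Rightarrow> 'x set \<Rightarrow> 'x \<Rightarrow> ('i, 'x) S_gen word \<Rightarrow>\<^sub>0 qv" where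
  "S_idem D P \<kappa> = (if \<kappa> \<in> weyl_orbit D P then gen (SI \<kappa>) else 0)"

definition S_rels ::
  "('i, 'x :: ab_group_add, 'y) root_data \<Rightarrow> 'x set \<Rightarrow> (('i, 'x) S_gen word \<Rightarrow>\<^sub>0 qv) set" where
  "S_rels D P =
    {S_idem D P \<kappa> * S_idem D P \<kappa>' - (if \<kappa> = \<kappa>' then S_idem D P \<kappa> else 0) | \<kappa> \<kappa>'. True} \<union>
    {(\<Sum>\<kappa>\<in>weyl_orbit D P. S_idem D P \<kappa>) - 1} \<union>
    {gen (SE s i) * S_idem D P \<kappa> -
       S_idem D P (\<kappa> + zmul (sg s) (simple_root D i)) * gen (SE s i) | s i \<kappa>. i \<in> index D} \<union>
    {gen (SE Plus i) * gen (SE Minus j) - gen (SE Minus j) * gen (SE Plus i) -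
       (if i = j
        then (\<Sum>\<kappa>\<in>weyl_orbit D P.
          scalar (q_int (vi D i) (pairing D (simple_coroot D i) \<kappa>)) * S_idem D P \<kappa>)
        else 0) | i j. i \<in> index D \<and> j \<in> index D} \<union>
    {serre D i j (gen (SE s i)) (gen (SE s j)) | s i j. i \<in> index D \<and> j \<in> index D \<and> i \<noteq> j}"

type_synonym ('i, 'x) S_elem = "(('i, 'x) S_gen word \<Rightarrow>\<^sub>0 qv) set"

definition S_ideal ::
  "('i, 'x :: ab_group_add, 'y) root_data \<Rightarrow> 'x set \<Rightarrow> (('i, 'x) S_gen word \<Rightarrow>\<^sub>0 qv) set" where
  "S_ideal D P = genideal (free_algebra (S_gens D P)) (S_rels D P)"

definition S_alg ::
  "('i, 'x :: ab_group_add, 'y) root_data \<Rightarrow> 'x set \<Rightarrow> (qv, ('i, 'x) S_elem) module" where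
  "S_alg D P = quotient_algebra (free_algebra (S_gens D P)) (S_ideal D P)"

definition S_class ::
  "('i, 'x :: ab_group_add, 'y) root_data \<Rightarrow> 'x set \<Rightarrow> (('i, 'x) S_gen word \<Rightarrow>\<^sub>0 qv) \<Rightarrow>
    ('i, 'x) S_elem" where
  "S_class D P p = S_ideal D P +>\<^bsub>free_algebra (S_gens D P)\<^esub> p"

definition S_E ::
  "('i, 'x :: ab_group_add, 'y) root_data \<Rightarrow> 'x set \<Rightarrow> sign \<Rightarrow> 'i \<Rightarrow> ('i, 'x) S_elem" where
  "S_E D P s i = S_class D P (gen (SE s i))"

definition S_one ::
  "('i, 'x :: ab_group_add, 'y) root_data \<Rightarrow> 'x set \<Rightarrow> 'x \<Rightarrow> ('i, 'x) S_elem" where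
  "S_one D P \<kappa> = S_class D P (S_idem D P \<kappa>)"

definition S_K ::
  "('i, 'x :: ab_group_add, 'y) root_data \<Rightarrow> 'x set \<Rightarrow> 'y \<Rightarrow> ('i, 'x) S_elem" where
  "S_K D P h =
    (\<Oplus>\<^bsub>S_alg D P\<^esub>\<kappa>\<in>weyl_orbit D P. vv powi (pairing D h \<kappa>) \<odot>\<^bsub>S_alg D P\<^esub> S_one D P \<kappa>)"

text \<open>The transition map \<open>f\<^bsub>\<pi>,\<pi>'\<^esub>\<close> for \<open>P = \<pi> \<subseteq> \<pi>'\<close>; the larger set determines only the domain,
  so that it does not enter the formula.\<close>
definition S_trans ::
  "('i, 'x :: ab_group_add, 'y) root_data \<Rightarrow> 'x set \<Rightarrow> ('i, 'x) S_elem \<Rightarrow> ('i, 'x) S_elem" where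
  "S_trans D P =
    induced_map (S_alg D P) (\<lambda>g. case g of SE s i \<Rightarrow> S_E D P s i | SI \<kappa> \<Rightarrow> S_one D P \<kappa>)"

definition p_map ::
  "('i, 'x :: ab_group_add, 'y :: ab_group_add) root_data \<Rightarrow> 'x set \<Rightarrow>
    ('i, 'y) U_elem \<Rightarrow> ('i, 'x) S_elem" where
  "p_map D P =
    induced_map (S_alg D P) (\<lambda>g. case g of UE s i \<Rightarrow> S_E D P s i | UK h \<Rightarrow> S_K D P h)"

text \<open>The linear map \<open>\<pi>\<^bsub>\<kappa>,\<kappa>'\<^esub>(u) \<mapsto> 1\<^sub>\<kappa> p\<^sub>\<pi>(u) 1\<^sub>\<kappa>\<^sub>'\<close>: on each component of an element it is evaluated
  at any representative.\<close>
definition pdot_map ::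
  "('i, 'x :: ab_group_add, 'y :: ab_group_add) root_data \<Rightarrow> 'x set \<Rightarrow>
    ('i, 'x, 'y) Udot_elem \<Rightarrow> ('i, 'x) S_elem" where
  "pdot_map D P f =
    finsum (S_alg D P)
      (\<lambda>(\<kappa>, \<kappa>').
        the_elem ((\<lambda>u. S_one D P \<kappa> \<otimes>\<^bsub>S_alg D P\<^esub> p_map D P u \<otimes>\<^bsub>S_alg D P\<^esub> S_one D P \<kappa>') ` f (\<kappa>, \<kappa>')))
      {(\<kappa>, \<kappa>'). f (\<kappa>, \<kappa>') \<noteq> \<one>\<^bsub>mod_comp D \<kappa> \<kappa>'\<^esub>}"

section \<open>The inverse limit\<close>

type_synonym ('i, 'x) Uhat_elem = "'x set \<Rightarrow> ('i, 'x) S_elem"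

definition Uhat ::
  "('i, 'x :: ab_group_add, 'y) root_data \<Rightarrow> (qv, ('i, 'x) Uhat_elem) module" where
  "Uhat D =
    \<lparr> carrier =
        {a \<in> \<Pi>\<^sub>E P\<in>finite_saturated D. carrier (S_alg D P).
          \<forall>P\<in>finite_saturated D. \<forall>P'\<in>finite_saturated D. P \<subseteq> P' \<longrightarrow> a P = S_trans D P (a P')},
      monoid.mult = (\<lambda>a b. \<lambda>P\<in>finite_saturated D. a P \<otimes>\<^bsub>S_alg D P\<^esub> b P),
      one = (\<lambda>P\<in>finite_saturated D. \<one>\<^bsub>S_alg D P\<^esub>),
      ring.zero = (\<lambda>P\<in>finite_saturated D. \<zero>\<^bsub>S_alg D P\<^esub>),
      add = (\<lambda>a b. \<lambda>P\<in>finite_saturated D. a P \<oplus>\<^bsub>S_alg D P\<^esub> b P),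
      module.smult = (\<lambda>c a. \<lambda>P\<in>finite_saturated D. c \<odot>\<^bsub>S_alg D P\<^esub> a P) \<rparr>"

definition phat_map :: "'x set \<Rightarrow> ('i, 'x) Uhat_elem \<Rightarrow> ('i, 'x) S_elem" where
  "phat_map P a = a P"

definition Uhat_E ::
  "('i, 'x :: ab_group_add, 'y) root_data \<Rightarrow> sign \<Rightarrow> 'i \<Rightarrow> ('i, 'x) Uhat_elem" where
  "Uhat_E D s i = (\<lambda>P\<in>finite_saturated D. S_E D P s i)"

definition Uhat_one ::
  "('i, 'x :: ab_group_add, 'y) root_data \<Rightarrow> 'x \<Rightarrow> ('i, 'x) Uhat_elem" where
  "Uhat_one D \<kappa> = (\<lambda>P\<in>finite_saturated D. S_one D P \<kappa>)"

definition Uhat_E1 ::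
  "('i, 'x :: ab_group_add, 'y) root_data \<Rightarrow> sign \<Rightarrow> 'i \<Rightarrow> nat \<Rightarrow> 'x \<Rightarrow> ('i, 'x) Uhat_elem" where
  "Uhat_E1 D s i m \<kappa> = divpow (Uhat D) (vi D i) (Uhat_E D s i) m \<otimes>\<^bsub>Uhat D\<^esub> Uhat_one D \<kappa>"

section \<open>Integral forms\<close>

definition A_Udot ::
  "('i, 'x :: ab_group_add, 'y :: ab_group_add) root_data \<Rightarrow>
    (qv, ('i, 'x, 'y) Udot_elem) module" where
  "A_Udot D = (Udot D)
    \<lparr> carrier := subalgebra_gen laurent (Udot D) {Udot_E D s i m \<kappa> | s i m \<kappa>. i \<in> index D} \<rparr>"

definition A_S_alg ::
  "('i, 'x :: ab_group_add, 'y) root_data \<Rightarrow> 'x set \<Rightarrow> (qv, ('i, 'x) S_elem) module" where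
  "A_S_alg D P = (S_alg D P)
    \<lparr> carrier := subalgebra_gen laurent (S_alg D P)
        ({divpow (S_alg D P) (vi D i) (S_E D P s i) m | s i m. i \<in> index D} \<union>
         S_one D P ` weyl_orbit D P) \<rparr>"

definition A_Uhat ::
  "('i, 'x :: ab_group_add, 'y) root_data \<Rightarrow> (qv, ('i, 'x) Uhat_elem) module" where
  "A_Uhat D = (Uhat D)
    \<lparr> carrier := {a \<in> carrier (Uhat D). \<forall>P\<in>finite_saturated D. a P \<in> carrier (A_S_alg D P)} \<rparr>"

definition A_Uhat_sub ::
  "('i, 'x :: ab_group_add, 'y) root_data \<Rightarrow> (qv, ('i, 'x) Uhat_elem) module" where
  "A_Uhat_sub D = (A_Uhat D)
    \<lparr> carrier := subalgebra_gen laurent (A_Uhat D) {Uhat_E1 D s i m \<kappa> | s i m \<kappa>. i \<in> index D} \<rparr>"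

text \<open>The characterization of \<open>\<theta>\<close>; \<^const>\<open>extensional\<close> fixes its junk values off its domain.\<close>
definition is_dot_theta ::
  "('i, 'x :: ab_group_add, 'y :: ab_group_add) root_data \<Rightarrow>
    (('i, 'x, 'y) Udot_elem \<Rightarrow> ('i, 'x) Uhat_elem) \<Rightarrow> bool" where
  "is_dot_theta D \<theta> \<longleftrightarrow>
    \<theta> \<in> alg_hom laurent (A_Udot D) (A_Uhat D) \<and>
    \<theta> \<in> extensional (carrier (A_Udot D)) \<and>
    (\<forall>P\<in>finite_saturated D. \<forall>x\<in>carrier (A_Udot D). phat_map P (\<theta> x) = pdot_map D P x)"

end

theory Submission
  imports Defs
begin

text \<open>Only injectivity needs an idea. By the triangular decomposition an element of the component of
  \<open>1\<^sub>\<lambda>\<close> is a combination of products \<open>F\<^sub>A E\<^sub>B 1\<^sub>\<lambda>\<close> of monomials. For dominant \<open>a\<close>, \<open>b\<close> with \<open>b - a = \<lambda>\<close>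
  it acts on the tensor product of the maximal integrable modules generated by a lowest weight vector
  \<open>\<xi>\<close> of weight \<open>- a\<close> and a highest weight vector \<open>\<eta>\<close> of weight \<open>b\<close>, which has finitely many weights.
  A module with finitely many weights satisfies the Serre relations automatically and is a module over
  some \<open>S(\<pi>)\<close>, so an element killed in all \<open>S(\<pi>)\<close> acts by zero. On \<open>\<xi> \<otimes> \<eta>\<close>, the part of top degree in
  \<open>E\<close> of this action is the sum of the terms \<open>E\<^sub>B \<xi> \<otimes> F\<^sub>A \<eta>\<close> up to nonzero scalars. For large \<open>a\<close>, \<open>b\<close>
  the two modules agree in low degrees with the algebras generated by the \<open>E\<^sub>i\<close> and by the \<open>E\<^sub>-\<^sub>i\<close>, so this
  top part is a combination of Serre elements, that is, zero in the modified form, and one descends on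
  the degree.\<close>

section \<open>Linear algebra on finitely supported functions\<close>

text \<open>No basis of the positive or negative part is constructed, and neither a PBW theorem nor
  a nondegenerate form enters. Products of words are only known to span, so a vanishing action has
  to be traced back to Serre elements directly. This dictates how the modules are presented: by
  multiples of Serre elements, by the powers \<open>gen i ^ Suc (nat (pr i b))\<close>, and by words
  with letters outside the index set. Among words of length at most \<open>d\<close> the powers are
  invisible once all coordinates of the weights are at least \<open>d\<close>. Two factors are
  needed since a highest weight vector alone is killed by every raising operator, a lowest weight
  vector by every lowering one. The modules are kept as free spaces on words together with a
  subspace of relations. The Serre relations are left out of the notion of module, which saves
  computing the coproduct of a Serre element. Finite type makes a reflection-stable set of weights
  below a bound finite, which yields the finite saturated set, and it provides a weight with
  positive coordinates, by which \<open>a\<close> and \<open>b\<close> are enlarged without changing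
  their difference.\<close>

definition scl :: "qv \<Rightarrow> ('a \<Rightarrow>\<^sub>0 qv) \<Rightarrow> ('a \<Rightarrow>\<^sub>0 qv)" where
  "scl c p = Poly_Mapping.map ((*) c) p"

lemma lookup_scl [simp]: "Poly_Mapping.lookup (scl c p) k = c * Poly_Mapping.lookup p k"
  unfolding scl_def by transfer (simp add: when_def)

interpretation pm: vector_space "scl :: qv \<Rightarrow> ('a \<Rightarrow>\<^sub>0 qv) \<Rightarrow> ('a \<Rightarrow>\<^sub>0 qv)"
  by standard (rule poly_mapping_eqI; simp add: lookup_add algebra_simps)+

lemma keys_scl: "Poly_Mapping.keys (scl c p) \<subseteq> Poly_Mapping.keys p"
  by (auto simp: in_keys_iff)

lemma scl_single [simp]: "scl c (Poly_Mapping.single k d) = Poly_Mapping.single k (c * d)"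
  by (rule poly_mapping_eqI) (simp add: lookup_single when_def)

definition mon :: "'a \<Rightarrow> 'a \<Rightarrow>\<^sub>0 qv" where
  "mon a = Poly_Mapping.single a 1"

lemma keys_mon [simp]: "Poly_Mapping.keys (mon a) = {a}"
  by (simp add: mon_def)

lemma lookup_mon: "Poly_Mapping.lookup (mon a) k = (if a = k then 1 else 0)"
  by (simp add: mon_def lookup_single when_def)

lemma single_eq_scl_mon: "Poly_Mapping.single k c = scl c (mon k)"
  by (simp add: mon_def)

lemma sum_mon: "p = (\<Sum>k\<in>Poly_Mapping.keys p. scl (Poly_Mapping.lookup p k) (mon k))"
  by (rule poly_mapping_eqI)
     (auto simp: lookup_sum lookup_mon if_distrib in_keys_iff sum.delta cong: if_cong)

section \<open>Linear maps between free spaces\<close>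

definition lmap :: "(('a \<Rightarrow>\<^sub>0 qv) \<Rightarrow> ('b \<Rightarrow>\<^sub>0 qv)) \<Rightarrow> bool" where
  "lmap f \<longleftrightarrow> (\<forall>x y. f (x + y) = f x + f y) \<and> (\<forall>c x. f (scl c x) = scl c (f x))"

lemma lmapI: "(\<And>x y. f (x + y) = f x + f y) \<Longrightarrow> (\<And>c x. f (scl c x) = scl c (f x)) \<Longrightarrow> lmap f"
  by (simp add: lmap_def)

lemma lmap_add: "lmap f \<Longrightarrow> f (x + y) = f x + f y"
  and lmap_scl: "lmap f \<Longrightarrow> f (scl c x) = scl c (f x)"
  by (simp_all add: lmap_def)

lemma lmap_zero: "lmap f \<Longrightarrow> f 0 = 0"
  using lmap_scl[of f 0 0] by simp

lemma lmap_uminus: "lmap f \<Longrightarrow> f (- x) = - f x"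
  using lmap_scl[of f "-1" x] by simp

lemma lmap_diff: "lmap f \<Longrightarrow> f (x - y) = f x - f y"
  using lmap_add[of f x "- y"] by (simp add: lmap_uminus)

lemma lmap_sum: "lmap f \<Longrightarrow> f (sum g A) = (\<Sum>a\<in>A. f (g a))"
  by (induction A rule: infinite_finite_induct) (auto simp: lmap_add lmap_zero)

lemmas lmap_simps = lmap_add lmap_scl lmap_zero lmap_uminus lmap_diff lmap_sum

lemma lmap_id: "lmap (\<lambda>x. x)"
  by (simp add: lmap_def)

lemma lmap_const0: "lmap (\<lambda>x. 0)"
  by (simp add: lmap_def)

lemma lmap_plus: "lmap f \<Longrightarrow> lmap g \<Longrightarrow> lmap (\<lambda>x. f x + g x)"
  by (simp add: lmap_def algebra_simps pm.scale_right_distrib)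

lemma lmap_minus: "lmap f \<Longrightarrow> lmap g \<Longrightarrow> lmap (\<lambda>x. f x - g x)"
  by (simp add: lmap_def algebra_simps pm.scale_right_diff_distrib)

lemma lmap_scale: "lmap f \<Longrightarrow> lmap (\<lambda>x. scl c (f x))"
  by (simp add: lmap_def pm.scale_right_distrib mult.commute)

lemma lmap_comp: "lmap f \<Longrightarrow> lmap g \<Longrightarrow> lmap (\<lambda>x. f (g x))"
  by (simp add: lmap_def)

lemma lmap_big_sum: "(\<And>a. a \<in> A \<Longrightarrow> lmap (f a)) \<Longrightarrow> lmap (\<lambda>x. \<Sum>a\<in>A. f a x)"
  by (induction A rule: infinite_finite_induct) (auto intro: lmap_const0 lmap_plus)

lemma lmap_funpow: "lmap f \<Longrightarrow> lmap (f ^^ n)" for f :: "('a \<Rightarrow>\<^sub>0 qv) \<Rightarrow> ('a \<Rightarrow>\<^sub>0 qv)"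
  by (induction n) (auto simp: lmap_def)

text \<open>Claims that operators agree, vanish or land in a subspace are reduced to basis vectors
  this way. Restricting to the keys of \<open>p\<close> lets support conditions on \<open>p\<close>,
  such as homogeneity, be used for the basis vector.\<close>

lemma lmap_mem:
  assumes "lmap f" "pm.subspace N" "\<And>k. k \<in> Poly_Mapping.keys p \<Longrightarrow> f (mon k) \<in> N"
  shows "f p \<in> N"
proof -
  have "f p = (\<Sum>k\<in>Poly_Mapping.keys p. scl (Poly_Mapping.lookup p k) (f (mon k)))"
    by (subst sum_mon) (simp add: lmap_sum[OF assms(1)] lmap_scl[OF assms(1)])
  then show ?thesis
    using assms by (auto intro!: pm.subspace_sum pm.subspace_scale)
qed

lemma lmap_eqI:
  assumes "lmap f" "lmap g" "\<And>k. k \<in> Poly_Mapping.keys p \<Longrightarrow> f (mon k) = g (mon k)"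
  shows "f p = g p"
  using lmap_mem[OF lmap_minus[OF assms(1,2)], of "{0}" p] assms(3) by (simp add: pm.subspace_def)

lemma lmap_span:
  assumes "lmap f" "pm.subspace N" "\<And>x. x \<in> G \<Longrightarrow> f x \<in> N" "x \<in> pm.span G"
  shows "f x \<in> N"
proof -
  have "pm.subspace {x. f x \<in> N}"
    using assms(1,2) by (auto simp: pm.subspace_def lmap_simps)
  then have "pm.span G \<subseteq> {x. f x \<in> N}"
    using assms(3) by (intro pm.span_minimal) auto
  then show ?thesis using assms(4) by auto
qed

definition lext :: "('a \<Rightarrow> 'b \<Rightarrow>\<^sub>0 qv) \<Rightarrow> ('a \<Rightarrow>\<^sub>0 qv) \<Rightarrow> ('b \<Rightarrow>\<^sub>0 qv)" where
  "lext f p = (\<Sum>k\<in>Poly_Mapping.keys p. scl (Poly_Mapping.lookup p k) (f k))"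

lemma lext_superset:
  assumes "finite A" "Poly_Mapping.keys p \<subseteq> A"
  shows "lext f p = (\<Sum>k\<in>A. scl (Poly_Mapping.lookup p k) (f k))"
  unfolding lext_def using assms by (intro sum.mono_neutral_left) (auto simp: in_keys_iff)

lemma lmap_lext: "lmap (lext f)"
proof (rule lmapI)
  fix x y :: "'a \<Rightarrow>\<^sub>0 qv" and c
  let ?A = "Poly_Mapping.keys x \<union> Poly_Mapping.keys y"
  have "lext f (x + y) = (\<Sum>k\<in>?A. scl (Poly_Mapping.lookup (x + y) k) (f k))"
    by (rule lext_superset) (auto dest: subsetD[OF keys_add])
  also have "\<dots> = lext f x + lext f y"
    by (simp add: lext_superset[of ?A] lookup_add pm.scale_left_distrib sum.distrib)
  finally show "lext f (x + y) = lext f x + lext f y" .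
  show "lext f (scl c x) = scl c (lext f x)"
    by (subst lext_superset[OF _ keys_scl]) (auto simp: lext_def pm.scale_sum_right)
qed

lemma lext_mon [simp]: "lext f (mon k) = f k"
  by (simp add: lext_def lookup_mon)

lemma lext_cong: "(\<And>k. k \<in> Poly_Mapping.keys p \<Longrightarrow> f k = g k) \<Longrightarrow> lext f p = lext g p"
  by (simp add: lext_def)

section \<open>Coordinate projections and homogeneous vectors\<close>

definition filt :: "('a \<Rightarrow> bool) \<Rightarrow> ('a \<Rightarrow>\<^sub>0 qv) \<Rightarrow> ('a \<Rightarrow>\<^sub>0 qv)" where
  "filt P = lext (\<lambda>k. if P k then mon k else 0)"

lemma lmap_filt: "lmap (filt P)"
  by (simp add: filt_def lmap_lext)

lemma filt_mon [simp]: "filt P (mon k) = (if P k then mon k else 0)"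
  by (simp add: filt_def)

lemma filt_id: "(\<And>k. k \<in> Poly_Mapping.keys p \<Longrightarrow> P k) \<Longrightarrow> filt P p = p"
  by (rule lmap_eqI[OF lmap_filt lmap_id]) auto

lemma filt_0: "(\<And>k. k \<in> Poly_Mapping.keys p \<Longrightarrow> \<not> P k) \<Longrightarrow> filt P p = 0"
  by (rule lmap_eqI[OF lmap_filt lmap_const0]) auto

lemma lookup_filt: "Poly_Mapping.lookup (filt P p) k = (if P k then Poly_Mapping.lookup p k else 0)"
proof -
  have "Poly_Mapping.lookup (filt P p) k =
    (\<Sum>x\<in>Poly_Mapping.keys p. if x = k then (if P k then Poly_Mapping.lookup p k else 0) else 0)"
    unfolding filt_def lext_def lookup_sum by (intro sum.cong) (auto simp: lookup_mon)
  then show ?thesis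
    by (simp add: in_keys_iff)
qed

lemma keys_filt: "Poly_Mapping.keys (filt P p) = {k \<in> Poly_Mapping.keys p. P k}"
  by (auto simp: in_keys_iff lookup_filt split: if_splits)

text \<open>The grading is by an arbitrary type: besides weights and lengths, the Boolean predicate
  \<open>bad\<close> is used as a degree. The zero vector is homogeneous of every degree.\<close>

definition homog :: "('a \<Rightarrow> 'g) \<Rightarrow> 'g \<Rightarrow> ('a \<Rightarrow>\<^sub>0 qv) \<Rightarrow> bool" where
  "homog d \<mu> p \<longleftrightarrow> (\<forall>k\<in>Poly_Mapping.keys p. d k = \<mu>)"

lemma homog_mon [simp]: "homog d \<mu> (mon k) \<longleftrightarrow> d k = \<mu>"
  by (simp add: homog_def)

lemma homog_subspace: "pm.subspace {p. homog d \<mu> p}"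
  by (auto simp: pm.subspace_def homog_def dest!: subsetD[OF keys_add] subsetD[OF keys_scl])

lemma homog_zero [simp]: "homog d \<mu> 0"
  by (simp add: homog_def)

lemma homog_add: "homog d \<mu> p \<Longrightarrow> homog d \<mu> q \<Longrightarrow> homog d \<mu> (p + q)"
  and homog_scl: "homog d \<mu> p \<Longrightarrow> homog d \<mu> (scl c p)"
  and homog_diff: "homog d \<mu> p \<Longrightarrow> homog d \<mu> q \<Longrightarrow> homog d \<mu> (p - q)"
  using homog_subspace[of d \<mu>] pm.subspace_diff[OF homog_subspace[of d \<mu>]]
  by (auto simp: pm.subspace_def)

lemma homog_filt: "homog d \<mu> (filt (\<lambda>k. d k = \<mu>) p)"
  by (simp add: homog_def keys_filt)

lemma homog_lmap:
  assumes "lmap f" "\<And>k. d k = \<mu> \<Longrightarrow> homog d' \<nu> (f (mon k))" "homog d \<mu> p"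
  shows "homog d' \<nu> (f p)"
  using lmap_mem[OF assms(1) homog_subspace[of d' \<nu>], of p] assms(2,3) by (auto simp: homog_def)

section \<open>Free algebras\<close>

lemma letters_zero [simp]: "letters 0 = []"
  by (simp add: zero_word_def)

lemma letters_plus [simp]: "letters (u + w) = letters u @ letters w"
  by (simp add: plus_word_def)

lemma mon_mult: "mon u * mon w = mon (u + w)" for u w :: "'a::monoid_add"
  by (simp add: mon_def mult_single)

lemma mon_zero [simp]: "mon 0 = (1 :: 'a::monoid_add \<Rightarrow>\<^sub>0 qv)"
  by (simp add: mon_def)

lemma mon_Nil [simp]: "mon (Word []) = 1"
  using mon_zero[where 'a = "'a word"] by (simp add: zero_word_def)

lemma scalar_mult: "scalar c * p = scl c p"
  by (simp add: scalar_def scl_def mult_map_scale_conv_mult)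

lemma scalar_eq: "scalar c = scl c 1"
  using scalar_mult[of c 1] by simp

lemma scl_mult_left: "scl c p * q = scl c (p * q)" for p q :: "'a::monoid_add \<Rightarrow>\<^sub>0 qv"
  by (simp add: scl_def mult_map_scale_conv_mult mult.assoc)

text \<open>Words do not commute, but the empty word commutes with all of them; this is why scalars
  are central in the free algebra.\<close>

lemma single_zero_mult_commute:
  "p * Poly_Mapping.single 0 c = Poly_Mapping.single 0 c * p" for p :: "'a::monoid_add \<Rightarrow>\<^sub>0 qv"
proof -
  define S where "S = Poly_Mapping.lookup p"
  have S: "(\<Sum>k\<in>Poly_Mapping.keys p. Poly_Mapping.single k (S k)) = p"
    unfolding S_def by (subst (3) sum_mon) (simp only: single_eq_scl_mon)
  have "(\<Sum>k\<in>K. Poly_Mapping.single k (S k)) * Poly_Mapping.single 0 c =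
      Poly_Mapping.single 0 c * (\<Sum>k\<in>K. Poly_Mapping.single k (S k))" for K
    by (simp add: sum_distrib_left sum_distrib_right mult_single mult.commute)
  from this[of "Poly_Mapping.keys p"] show ?thesis
    unfolding S .
qed

lemma scl_mult_right: "p * scl c q = scl c (p * q)" for p q :: "'a::monoid_add \<Rightarrow>\<^sub>0 qv"
proof -
  have "p * scl c q = (p * Poly_Mapping.single 0 c) * q"
    by (simp add: scl_def mult_map_scale_conv_mult mult.assoc)
  then show ?thesis
    by (simp add: single_zero_mult_commute scl_def mult_map_scale_conv_mult mult.assoc)
qed

lemma lmap_mult_left: "lmap (\<lambda>x. p * x)" for p :: "'a::monoid_add \<Rightarrow>\<^sub>0 qv"
  by (simp add: lmap_def scl_mult_right distrib_left)

lemma lmap_mult_right: "lmap (\<lambda>x. x * p)" for p :: "'a::monoid_add \<Rightarrow>\<^sub>0 qv"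
  by (simp add: lmap_def scl_mult_left distrib_right)

lemma gen_eq_mon: "gen g = mon (Word [g])"
  by (simp add: gen_def mon_def)

lemma gen_mult_mon: "gen g * mon (Word w) = mon (Word (g # w))"
  by (simp add: gen_eq_mon mon_mult plus_word_def)

section \<open>Actions of and substitutions into free algebras\<close>

definition act :: "('g \<Rightarrow> ('b \<Rightarrow>\<^sub>0 qv) \<Rightarrow> ('b \<Rightarrow>\<^sub>0 qv)) \<Rightarrow> ('g word \<Rightarrow>\<^sub>0 qv) \<Rightarrow> ('b \<Rightarrow>\<^sub>0 qv) \<Rightarrow> ('b \<Rightarrow>\<^sub>0 qv)" where
  "act A p t = lext (\<lambda>w. foldr A (letters w) t) p"

lemma act_mon [simp]: "act A (mon w) t = foldr A (letters w) t"
  by (simp add: act_def)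

lemma lmap_act1: "lmap (\<lambda>p. act A p t)"
  by (simp add: act_def lmap_lext)

lemma lmap_foldr: "(\<And>g. lmap (A g)) \<Longrightarrow> lmap (foldr A w)"
  by (induction w) (auto simp: lmap_def)

lemma lmap_act2: "(\<And>g. lmap (A g)) \<Longrightarrow> lmap (act A p)"
  unfolding act_def[abs_def] lext_def
  by (intro lmap_big_sum lmap_scale lmap_foldr)

lemma act_gen [simp]: "act A (gen g) t = A g t"
  by (simp add: gen_eq_mon)

lemma act_one [simp]: "act A 1 t = t"
  using act_mon[of A 0 t] by (simp del: act_mon)

lemma act_mult:
  assumes "\<And>g. lmap (A g)"
  shows "act A (p * q) t = act A p (act A q t)"
proof (rule lmap_eqI[of "\<lambda>p. act A (p * q) t"])
  show "lmap (\<lambda>p. act A (p * q) t)"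
    by (rule lmap_comp[OF lmap_act1 lmap_mult_right])
  show "lmap (\<lambda>p. act A p (act A q t))"
    by (rule lmap_act1)
  fix w
  show "act A (mon w * q) t = act A (mon w) (act A q t)"
    by (rule lmap_eqI[of "\<lambda>q. act A (mon w * q) t" "\<lambda>q. act A (mon w) (act A q t)"])
       (auto intro!: lmap_comp[OF lmap_act1 lmap_mult_left] lmap_comp[OF lmap_act2 lmap_act1] assms
          simp: mon_mult simp del: act_mon, simp)
qed

definition subst :: "('g \<Rightarrow> ('h word \<Rightarrow>\<^sub>0 qv)) \<Rightarrow> ('g word \<Rightarrow>\<^sub>0 qv) \<Rightarrow> ('h word \<Rightarrow>\<^sub>0 qv)" where
  "subst \<phi> = lext (\<lambda>w. prod_list (map \<phi> (letters w)))"

lemma lmap_subst: "lmap (subst \<phi>)"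
  by (simp add: subst_def lmap_lext)

lemmas subst_simps = lmap_simps[OF lmap_subst]

lemma subst_mon: "subst \<phi> (mon w) = prod_list (map \<phi> (letters w))"
  by (simp add: subst_def)

lemma subst_one [simp]: "subst \<phi> 1 = 1"
  using subst_mon[of \<phi> 0] by simp

lemma subst_gen [simp]: "subst \<phi> (gen g) = \<phi> g"
  by (simp add: gen_eq_mon subst_mon)

lemma subst_mult: "subst \<phi> (p * q) = subst \<phi> p * subst \<phi> q"
proof (rule lmap_eqI[of "\<lambda>p. subst \<phi> (p * q)" "\<lambda>p. subst \<phi> p * subst \<phi> q"])
  show "lmap (\<lambda>p. subst \<phi> (p * q))" "lmap (\<lambda>p. subst \<phi> p * subst \<phi> q)"
    by (auto intro: lmap_comp[OF lmap_subst lmap_mult_right] lmap_comp[OF lmap_mult_right lmap_subst])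
  fix w
  show "subst \<phi> (mon w * q) = subst \<phi> (mon w) * subst \<phi> q"
    by (rule lmap_eqI[of "\<lambda>q. subst \<phi> (mon w * q)" "\<lambda>q. subst \<phi> (mon w) * subst \<phi> q"])
       (auto intro: lmap_comp[OF lmap_subst lmap_mult_left] lmap_comp[OF lmap_mult_left lmap_subst]
          simp: mon_mult subst_mon)
qed

lemma subst_power: "subst \<phi> (p ^ n) = subst \<phi> p ^ n"
  by (induction n) (simp_all add: subst_mult)

lemma act_subst:
  assumes "\<And>g. lmap (A g)"
  shows "act A (subst \<phi> p) t = act (\<lambda>g. act A (\<phi> g)) p t"
proof (rule lmap_eqI[of "\<lambda>p. act A (subst \<phi> p) t"])
  show "lmap (\<lambda>p. act A (subst \<phi> p) t)"
    by (rule lmap_comp[OF lmap_act1 lmap_subst])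
  show "lmap (\<lambda>p. act (\<lambda>g. act A (\<phi> g)) p t)"
    by (rule lmap_act1)
  have "act A (prod_list (map \<phi> w)) t = foldr (\<lambda>g. act A (\<phi> g)) w t" for w
    by (induction w) (simp_all add: act_mult[OF assms])
  then show "act A (subst \<phi> (mon w)) t = act (\<lambda>g. act A (\<phi> g)) (mon w) t" for w
    by (simp add: subst_mon)
qed

section \<open>Polynomials in a given set of letters\<close>

definition FA :: "'g set \<Rightarrow> ('g word \<Rightarrow>\<^sub>0 qv) set" where
  "FA G = carrier (free_algebra G)"

lemma FA_iff: "p \<in> FA G \<longleftrightarrow> (\<forall>w\<in>Poly_Mapping.keys p. set (letters w) \<subseteq> G)"
  by (simp add: FA_def free_algebra_def)

lemma FA_subspace: "pm.subspace (FA G)"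
  by (auto simp: pm.subspace_def FA_iff dest!: subsetD[OF keys_add] subsetD[OF keys_scl]) blast+

lemma FA_zero [simp]: "0 \<in> FA G"
  and FA_add: "p \<in> FA G \<Longrightarrow> q \<in> FA G \<Longrightarrow> p + q \<in> FA G"
  and FA_scl: "p \<in> FA G \<Longrightarrow> scl c p \<in> FA G"
  using FA_subspace[of G] by (auto simp: pm.subspace_def)

lemma FA_diff: "p \<in> FA G \<Longrightarrow> q \<in> FA G \<Longrightarrow> p - q \<in> FA G"
  by (rule pm.subspace_diff[OF FA_subspace])

lemma FA_uminus: "p \<in> FA G \<Longrightarrow> - p \<in> FA G"
  by (rule pm.subspace_neg[OF FA_subspace])

lemma FA_sum: "(\<And>a. a \<in> A \<Longrightarrow> f a \<in> FA G) \<Longrightarrow> sum f A \<in> FA G"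
  by (rule pm.subspace_sum[OF FA_subspace])

lemma FA_one [simp]: "1 \<in> FA G"
  by (simp add: FA_iff)

lemma FA_mult: "p \<in> FA G \<Longrightarrow> q \<in> FA G \<Longrightarrow> p * q \<in> FA G"
  unfolding FA_iff by (auto dest!: subsetD[OF keys_mult]; blast)

lemma FA_scalar [simp]: "scalar c \<in> FA G"
  by (simp add: scalar_eq FA_scl)

lemma FA_gen [simp]: "gen g \<in> FA G \<longleftrightarrow> g \<in> G"
  by (simp add: FA_iff gen_eq_mon)

lemma FA_mon [simp]: "mon w \<in> FA G \<longleftrightarrow> set (letters w) \<subseteq> G"
  by (simp add: FA_iff)

lemma FA_power: "p \<in> FA G \<Longrightarrow> p ^ n \<in> FA G"
  by (induction n) (auto intro: FA_mult)

lemma FA_prod_list: "(\<And>x. x \<in> set xs \<Longrightarrow> x \<in> FA G) \<Longrightarrow> prod_list xs \<in> FA G"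
  by (induction xs) (auto intro: FA_mult)

lemmas FA_intros = FA_add FA_scl FA_diff FA_uminus FA_sum FA_mult FA_power FA_prod_list

lemma FA_filt: "p \<in> FA G \<Longrightarrow> filt P p \<in> FA G"
  by (auto simp: FA_iff keys_filt)

lemma FA_subst:
  assumes "p \<in> FA G" "\<And>g. g \<in> G \<Longrightarrow> \<phi> g \<in> FA H"
  shows "subst \<phi> p \<in> FA H"
proof (rule lmap_mem[OF lmap_subst FA_subspace])
  fix w assume "w \<in> Poly_Mapping.keys p"
  then have "set (letters w) \<subseteq> G"
    using assms(1) by (simp add: FA_iff)
  then show "subst \<phi> (mon w) \<in> FA H"
    unfolding subst_mon using assms(2) by (intro FA_prod_list) auto
qed

lemma free_algebra_simps:
  "monoid.mult (free_algebra G) = (*)" "one (free_algebra G) = 1"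
  "ring.zero (free_algebra G) = 0" "add (free_algebra G) = (+)"
  "module.smult (free_algebra G) c p = scl c p"
  "carrier (free_algebra G) = FA G"
  by (simp_all add: FA_def) (simp_all add: free_algebra_def scalar_mult)

lemma free_algebra_pow: "x [^]\<^bsub>free_algebra G\<^esub> (n::nat) = x ^ n"
  by (induction n) (simp_all add: free_algebra_simps power_commutes)

lemma divpow_free_algebra: "divpow (free_algebra G) q x m = scl (inverse (q_fact q m)) (x ^ m)"
  unfolding divpow_def free_algebra_simps free_algebra_pow ..

lemma subst_serre: "subst \<phi> (serre D i j x y) = serre D i j (subst \<phi> x) (subst \<phi> y)"
proof -
  have m1: "subst \<phi> (- 1) = - 1"
    by (simp add: lmap_uminus[OF lmap_subst])
  show ?thesis
    unfolding serre_def lmap_sum[OF lmap_subst] divpow_free_algebra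
    by (rule sum.cong) (simp_all only: split_beta subst_mult subst_power m1 lmap_scl[OF lmap_subst])
qed

lemma FA_serre: "x \<in> FA G \<Longrightarrow> y \<in> FA G \<Longrightarrow> serre D i j x y \<in> FA G"
  unfolding serre_def divpow_free_algebra by (rule FA_sum) (auto intro!: FA_intros)

section \<open>Algebras presented by generators and relations\<close>

text \<open>Ideals restated with the bare operations on polynomials. Negatives and scalar multiples
  are covered as products with \<open>- 1\<close> and with constants.\<close>

definition pideal :: "'g set \<Rightarrow> ('g word \<Rightarrow>\<^sub>0 qv) set \<Rightarrow> bool" where
  "pideal G J \<longleftrightarrow> J \<subseteq> FA G \<and> 0 \<in> J \<and> (\<forall>x\<in>J. \<forall>y\<in>J. x + y \<in> J) \<and>
    (\<forall>a\<in>FA G. \<forall>x\<in>J. a * x \<in> J \<and> x * a \<in> J)"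

lemma ring_free_algebra: "ring (free_algebra G)"
proof (rule ringI)
  show "abelian_group (free_algebra G)"
  proof (rule abelian_groupI)
    fix x assume "x \<in> carrier (free_algebra G)"
    then show "\<exists>y\<in>carrier (free_algebra G). y \<oplus>\<^bsub>free_algebra G\<^esub> x = \<zero>\<^bsub>free_algebra G\<^esub>"
      by (intro bexI[of _ "- x"]) (auto simp: free_algebra_simps intro: FA_uminus)
  qed (auto simp: free_algebra_simps algebra_simps intro: FA_add)
  show "Group.monoid (free_algebra G)"
    by (rule monoidI) (auto simp: free_algebra_simps algebra_simps intro: FA_mult)
qed (auto simp: free_algebra_simps algebra_simps)

lemma pideal_uminus: "pideal G J \<Longrightarrow> x \<in> J \<Longrightarrow> - x \<in> J"
proof -
  assume "pideal G J" "x \<in> J"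
  then have "(- 1) * x \<in> J"
    unfolding pideal_def using FA_uminus[OF FA_one, of G] by blast
  then show ?thesis by simp
qed

lemma pideal_imp_ideal:
  assumes "pideal G J"
  shows "ideal J (free_algebra G)"
proof (rule idealI[OF ring_free_algebra])
  interpret ring "free_algebra G" by (rule ring_free_algebra)
  show "subgroup J (add_monoid (free_algebra G))"
  proof (rule group.subgroupI[OF a_group])
    fix a assume a: "a \<in> J"
    then have "\<ominus>\<^bsub>free_algebra G\<^esub> a = - a"
      using assms by (intro minus_equality) (auto simp: free_algebra_simps pideal_def intro: FA_uminus)
    then show "inv\<^bsub>add_monoid (free_algebra G)\<^esub> a \<in> J"
      using pideal_uminus[OF assms a] by (simp add: a_inv_def)
  qed (use assms in \<open>auto simp: pideal_def free_algebra_simps\<close>)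
qed (use assms in \<open>auto simp: pideal_def free_algebra_simps\<close>)

lemma ideal_imp_pideal:
  assumes "ideal J (free_algebra G)"
  shows "pideal G J"
proof -
  interpret ideal J "free_algebra G" by fact
  show ?thesis
    unfolding pideal_def using a_subset additive_subgroup.zero_closed[OF is_additive_subgroup]
      additive_subgroup.a_closed[OF is_additive_subgroup] I_l_closed I_r_closed
    by (auto simp: free_algebra_simps)
qed

locale presentation =
  fixes G :: "'g set" and R :: "('g word \<Rightarrow>\<^sub>0 qv) set"
  assumes rels: "R \<subseteq> FA G"
begin

definition "J = genideal (free_algebra G) R"
definition "Q = quotient_algebra (free_algebra G) J"
definition "cls p = J +>\<^bsub>free_algebra G\<^esub> p"

lemma ideal_J: "ideal J (free_algebra G)"
  unfolding J_def using rels
  by (intro ring.genideal_ideal[OF ring_free_algebra]) (simp add: free_algebra_simps)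

lemma pideal_J: "pideal G J"
  by (rule ideal_imp_pideal[OF ideal_J])

lemma J_FA: "x \<in> J \<Longrightarrow> x \<in> FA G"
  and J_zero [simp]: "0 \<in> J"
  and J_add: "x \<in> J \<Longrightarrow> y \<in> J \<Longrightarrow> x + y \<in> J"
  and J_left: "a \<in> FA G \<Longrightarrow> x \<in> J \<Longrightarrow> a * x \<in> J"
  and J_right: "a \<in> FA G \<Longrightarrow> x \<in> J \<Longrightarrow> x * a \<in> J"
  using pideal_J by (auto simp: pideal_def)

lemma J_uminus: "x \<in> J \<Longrightarrow> - x \<in> J"
  by (rule pideal_uminus[OF pideal_J])

lemma J_diff: "x \<in> J \<Longrightarrow> y \<in> J \<Longrightarrow> x - y \<in> J"
  using J_add[OF _ J_uminus] by fastforce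

lemma J_scl: "x \<in> J \<Longrightarrow> scl c x \<in> J"
  using J_left[of "scalar c" x] by (simp add: scalar_mult)

lemma J_subspace: "pm.subspace J"
  by (auto simp: pm.subspace_def J_add J_scl)

lemma J_rel: "x \<in> R \<Longrightarrow> x \<in> J"
  using ring.genideal_self[OF ring_free_algebra, of R G] rels
  by (auto simp: J_def free_algebra_simps)

lemma J_minimal: "pideal G I \<Longrightarrow> R \<subseteq> I \<Longrightarrow> J \<subseteq> I"
  unfolding J_def by (rule ring.genideal_minimal[OF ring_free_algebra pideal_imp_ideal])

lemma J_trans: "x - y \<in> J \<Longrightarrow> y - z \<in> J \<Longrightarrow> x - z \<in> J"
  using J_add[of "x - y" "y - z"] by simp

lemma J_sym: "x - y \<in> J \<Longrightarrow> y - x \<in> J"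
  using J_uminus[of "x - y"] by simp

lemma cls_eq_iff: "p \<in> FA G \<Longrightarrow> q \<in> FA G \<Longrightarrow> cls p = cls q \<longleftrightarrow> p - q \<in> J"
proof -
  assume pq: "p \<in> FA G" "q \<in> FA G"
  have cls: "cls x = {j + x | j. j \<in> J}" for x
    by (auto simp: cls_def a_r_coset_def r_coset_def free_algebra_simps)
  show ?thesis
  proof
    assume "cls p = cls q"
    moreover have "p \<in> cls p"
      unfolding cls by (auto intro!: exI[of _ 0])
    ultimately show "p - q \<in> J"
      unfolding cls by auto
  next
    assume *: "p - q \<in> J"
    show "cls p = cls q"
      unfolding cls
    proof safe
      fix j assume j: "j \<in> J"
      show "\<exists>j'. j + p = j' + q \<and> j' \<in> J"
        using J_add[OF j *] by (intro exI[of _ "j + (p - q)"]) simp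
      show "\<exists>j'. j + q = j' + p \<and> j' \<in> J"
        using J_diff[OF j *] by (intro exI[of _ "j - (p - q)"]) simp
    qed
  qed
qed

lemma mem_cls: "q \<in> cls p \<longleftrightarrow> q - p \<in> J"
  by (auto simp: cls_def a_r_coset_def r_coset_def free_algebra_simps intro!: bexI[of _ "q - p"])

lemma carrier_Q: "carrier Q = cls ` FA G"
  by (auto simp: Q_def quotient_algebra_def ring.defs FactRing_def A_RCOSETS_defs cls_def
      free_algebra_simps a_r_coset_def)

lemma Q_mult: "p \<in> FA G \<Longrightarrow> q \<in> FA G \<Longrightarrow> cls p \<otimes>\<^bsub>Q\<^esub> cls q = cls (p * q)"
  using ideal.rcoset_mult_add[OF ideal_J, of p q]
  by (simp add: Q_def quotient_algebra_def ring.defs FactRing_def cls_def free_algebra_simps)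

lemma Q_add: "p \<in> FA G \<Longrightarrow> q \<in> FA G \<Longrightarrow> cls p \<oplus>\<^bsub>Q\<^esub> cls q = cls (p + q)"
proof -
  interpret ideal J "free_algebra G" by (rule ideal_J)
  show "p \<in> FA G \<Longrightarrow> q \<in> FA G \<Longrightarrow> cls p \<oplus>\<^bsub>Q\<^esub> cls q = cls (p + q)"
    using a_rcos_sum[of p q]
    by (simp add: Q_def quotient_algebra_def ring.defs FactRing_def cls_def free_algebra_simps)
qed

lemma Q_zero: "\<zero>\<^bsub>Q\<^esub> = cls 0"
proof -
  have "cls 0 = J"
    by (auto simp: mem_cls)
  then show ?thesis
    by (simp add: Q_def quotient_algebra_def ring.defs FactRing_def)
qed

lemma Q_one: "\<one>\<^bsub>Q\<^esub> = cls 1"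
  by (simp add: Q_def quotient_algebra_def ring.defs FactRing_def cls_def free_algebra_simps)

text \<open>Scalar multiplication of a class is a union of cosets over its members; the union
  collapses because scalar multiples of elements of \<open>J\<close> stay in
  \<open>J\<close>.\<close>

lemma Q_smult: "p \<in> FA G \<Longrightarrow> c \<odot>\<^bsub>Q\<^esub> cls p = cls (scl c p)"
proof -
  assume p: "p \<in> FA G"
  have "c \<odot>\<^bsub>Q\<^esub> cls p = (\<Union>x\<in>cls p. cls (scl c x))"
    by (simp add: Q_def quotient_algebra_def ring.defs cls_def free_algebra_simps)
  also have "\<dots> = (\<Union>x\<in>cls p. cls (scl c p))"
  proof (rule SUP_cong[OF refl])
    fix x assume "x \<in> cls p"
    then have x: "x - p \<in> J"
      by (simp add: mem_cls)
    then have "x \<in> FA G"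
      using FA_add[OF J_FA[OF x] p] by simp
    with x p show "cls (scl c x) = cls (scl c p)"
      using J_scl[OF x, of c] by (subst cls_eq_iff) (auto intro: FA_scl simp: pm.scale_right_diff_distrib)
  qed
  also have "\<dots> = cls (scl c p)"
    using mem_cls[of p p] by auto
  finally show ?thesis .
qed

lemmas Q_simps = Q_mult Q_add Q_zero Q_one Q_smult

lemma cls_carrier [simp]: "p \<in> FA G \<Longrightarrow> cls p \<in> carrier Q"
  by (simp add: carrier_Q)

lemma ring_Q: "ring Q"
proof (rule ringI)
  show "abelian_group Q"
  proof (rule abelian_groupI)
    fix x assume "x \<in> carrier Q"
    then obtain p where "p \<in> FA G" "x = cls p"
      by (auto simp: carrier_Q)
    then show "\<exists>y\<in>carrier Q. y \<oplus>\<^bsub>Q\<^esub> x = \<zero>\<^bsub>Q\<^esub>"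
      by (intro bexI[of _ "cls (- p)"]) (auto simp: Q_simps FA_intros)
  qed (auto simp: carrier_Q Q_simps FA_intros algebra_simps)
  show "Group.monoid Q"
    by (rule monoidI) (auto simp: carrier_Q Q_simps FA_intros algebra_simps)
qed (auto simp: carrier_Q Q_simps FA_intros algebra_simps)

lemma Q_uminus: "p \<in> FA G \<Longrightarrow> \<ominus>\<^bsub>Q\<^esub> cls p = cls (- p)"
proof -
  interpret ring Q by (rule ring_Q)
  show "p \<in> FA G \<Longrightarrow> \<ominus>\<^bsub>Q\<^esub> cls p = cls (- p)"
    by (rule minus_equality) (simp_all add: Q_simps FA_intros)
qed

lemma Q_minus: "p \<in> FA G \<Longrightarrow> q \<in> FA G \<Longrightarrow> cls p \<ominus>\<^bsub>Q\<^esub> cls q = cls (p - q)"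
  by (simp add: a_minus_def Q_uminus Q_add FA_uminus)

lemma Q_pow: "p \<in> FA G \<Longrightarrow> cls p [^]\<^bsub>Q\<^esub> (n::nat) = cls (p ^ n)"
  by (induction n) (simp_all add: Q_simps FA_power power_commutes)

lemma Q_divpow: "p \<in> FA G \<Longrightarrow> divpow Q q (cls p) m = cls (scl (inverse (q_fact q m)) (p ^ m))"
  by (simp add: divpow_def Q_pow Q_smult FA_power)

lemma Q_finsum:
  assumes "finite A" "\<And>a. a \<in> A \<Longrightarrow> f a \<in> FA G"
  shows "finsum Q (\<lambda>a. cls (f a)) A = cls (\<Sum>a\<in>A. f a)"
proof -
  interpret ring Q by (rule ring_Q)
  from assms show ?thesis
    by (induction A) (auto simp: Q_simps FA_intros finsum_insert)
qed

lemma word_eval_Q: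
  assumes "\<And>g. g \<in> set (letters w) \<Longrightarrow> \<psi> g \<in> FA G"
  shows "word_eval Q (\<lambda>g. cls (\<psi> g)) w = cls (prod_list (map \<psi> (letters w)))"
proof -
  have "set gs \<subseteq> set (letters w) \<Longrightarrow>
      foldr (\<lambda>g x. cls (\<psi> g) \<otimes>\<^bsub>Q\<^esub> x) gs \<one>\<^bsub>Q\<^esub> = cls (prod_list (map \<psi> gs))" for gs
  proof (induction gs)
    case (Cons g gs)
    have "prod_list (map \<psi> gs) \<in> FA G"
      using Cons.prems assms by (intro FA_prod_list) auto
    then show ?case
      using Cons assms by (simp add: Q_mult)
  qed (simp add: Q_one)
  then show ?thesis
    by (simp add: word_eval_def)
qed

lemma free_eval_Q:
  assumes "p \<in> FA H" "\<And>g. g \<in> H \<Longrightarrow> \<phi> g = cls (\<psi> g)" "\<And>g. g \<in> H \<Longrightarrow> \<psi> g \<in> FA G"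
  shows "free_eval Q \<phi> p = cls (subst \<psi> p)"
proof -
  have w: "word_eval Q \<phi> w = cls (prod_list (map \<psi> (letters w)))" "prod_list (map \<psi> (letters w)) \<in> FA G"
    if "w \<in> Poly_Mapping.keys p" for w
  proof -
    have sub: "set (letters w) \<subseteq> H"
      using assms(1) that by (simp add: FA_iff)
    have "word_eval Q \<phi> w = word_eval Q (\<lambda>g. cls (\<psi> g)) w"
      unfolding word_eval_def using sub assms(2) by (intro foldr_cong) auto
    then show "word_eval Q \<phi> w = cls (prod_list (map \<psi> (letters w)))"
      using sub assms(3) by (simp add: word_eval_Q subset_iff)
    show "prod_list (map \<psi> (letters w)) \<in> FA G"
      using sub assms(3) by (intro FA_prod_list) auto
  qed
  interpret ring Q by (rule ring_Q)
  have "free_eval Q \<phi> p = finsum Q (\<lambda>w. cls (scl (Poly_Mapping.lookup p w) (prod_list (map \<psi> (letters w))))) (Poly_Mapping.keys p)"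
    unfolding free_eval_def by (intro finsum_cong') (auto simp: w Q_smult FA_scl)
  also have "\<dots> = cls (\<Sum>w\<in>Poly_Mapping.keys p. scl (Poly_Mapping.lookup p w) (prod_list (map \<psi> (letters w))))"
    by (rule Q_finsum) (auto simp: w FA_scl)
  finally show ?thesis
    by (simp add: subst_def lext_def)
qed

end

text \<open>\<open>\<phi>\<close> gives the values in the quotient that enter
  \<open>induced_map\<close>, \<open>\<psi>\<close> gives representatives of them. With
  representatives the induced map is a substitution on polynomials, and its being well defined is a
  membership check for each relation.\<close>

locale presentation_map =
  dom: presentation H S + cod: presentation G R
  for H :: "'h set" and S and G :: "'g set" and R +
  fixes \<phi> :: "'h \<Rightarrow> ('g word \<Rightarrow>\<^sub>0 qv) set" and \<psi> :: "'h \<Rightarrow> 'g word \<Rightarrow>\<^sub>0 qv"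
  assumes phi: "\<And>h. h \<in> H \<Longrightarrow> \<phi> h = cod.cls (\<psi> h)"
    and psi_FA: "\<And>h. h \<in> H \<Longrightarrow> \<psi> h \<in> FA G"
    and psi_rels: "\<And>r. r \<in> S \<Longrightarrow> subst \<psi> r \<in> cod.J"
begin

lemma psi_J: "x \<in> dom.J \<Longrightarrow> subst \<psi> x \<in> cod.J"
proof -
  have "pideal H {x \<in> FA H. subst \<psi> x \<in> cod.J}"
    unfolding pideal_def
    by (auto simp: subst_simps subst_mult intro!: FA_intros cod.J_add)
       (blast intro: cod.J_left cod.J_right FA_subst psi_FA)+
  then have "dom.J \<subseteq> {x \<in> FA H. subst \<psi> x \<in> cod.J}"
    using dom.rels psi_rels by (intro dom.J_minimal) auto
  then show "x \<in> dom.J \<Longrightarrow> subst \<psi> x \<in> cod.J"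
    by auto
qed

text \<open>All members of a coset have the same value under \<open>free_eval\<close>, so the image
  of the coset is a singleton and \<open>the_elem\<close> returns that value.\<close>

lemma induced_map_cls:
  assumes "p \<in> FA H"
  shows "induced_map cod.Q \<phi> (dom.cls p) = cod.cls (subst \<psi> p)"
proof -
  have "free_eval cod.Q \<phi> q = cod.cls (subst \<psi> p)" if "q \<in> dom.cls p" for q
  proof -
    from that have q: "q - p \<in> dom.J"
      by (simp add: dom.mem_cls)
    then have qF: "q \<in> FA H"
      using FA_add[OF dom.J_FA assms] by fastforce
    have "free_eval cod.Q \<phi> q = cod.cls (subst \<psi> q)"
      by (rule cod.free_eval_Q[OF qF phi psi_FA])
    also have "\<dots> = cod.cls (subst \<psi> p)"
      using psi_J[OF q] qF assms
      by (subst cod.cls_eq_iff) (auto simp: subst_simps intro: FA_subst psi_FA)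
    finally show ?thesis .
  qed
  moreover have "p \<in> dom.cls p"
    by (simp add: dom.mem_cls)
  ultimately have "free_eval cod.Q \<phi> ` dom.cls p = {cod.cls (subst \<psi> p)}"
    by (auto simp: image_iff)
  then show ?thesis
    by (simp add: induced_map_def)
qed

end

section \<open>Positive definite forms and finite root data\<close>

text \<open>Completing the square in the new variable; the matrix that remains on \<open>I\<close>
  is the Schur complement.\<close>

lemma quadratic_form_insert:
  fixes A :: "'i \<Rightarrow> 'i \<Rightarrow> real"
  assumes "finite I" "i \<notin> I" "\<And>j. j \<in> I \<Longrightarrow> A i j = A j i" "A i i > 0"
  shows "(\<Sum>j\<in>insert i I. \<Sum>k\<in>insert i I. x j * A j k * x k) =
    A i i * (x i + (\<Sum>j\<in>I. A i j / A i i * x j))\<^sup>2 +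
    (\<Sum>j\<in>I. \<Sum>k\<in>I. x j * (A j k - A i j * A i k / A i i) * x k)"
proof -
  define S where "S = (\<Sum>j\<in>I. A i j * x j)"
  have 1: "(\<Sum>j\<in>I. A i j / A i i * x j) = S / A i i"
    by (simp add: S_def sum_divide_distrib)
  have 2: "(\<Sum>j\<in>I. \<Sum>k\<in>I. x j * (A j k - A i j * A i k / A i i) * x k) =
      (\<Sum>j\<in>I. \<Sum>k\<in>I. x j * A j k * x k) - S * S / A i i"
    unfolding S_def sum_product sum_divide_distrib sum_subtractf[symmetric]
    by (intro sum.cong) (simp_all add: algebra_simps)
  have 3: "(\<Sum>k\<in>I. x i * A i k * x k) = x i * S" "(\<Sum>j\<in>I. x j * A j i * x i) = x i * S"
    unfolding S_def sum_distrib_left using assms(3) by (auto intro!: sum.cong)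
  have "(\<Sum>j\<in>insert i I. \<Sum>k\<in>insert i I. x j * A j k * x k) =
      x i * A i i * x i + x i * S + (x i * S + (\<Sum>j\<in>I. \<Sum>k\<in>I. x j * A j k * x k))"
    using assms(1,2) by (simp add: sum.distrib 3)
  then show ?thesis
    unfolding 1 2 using assms(4) by (simp add: field_simps power2_eq_square)
qed

lemma Cauchy_Schwarz_sum:
  fixes a b :: "'i \<Rightarrow> real"
  shows "(\<Sum>i\<in>I. a i * b i)\<^sup>2 \<le> (\<Sum>i\<in>I. (a i)\<^sup>2) * (\<Sum>i\<in>I. (b i)\<^sup>2)"
proof -
  have "0 \<le> (\<Sum>i\<in>I. \<Sum>j\<in>I. (a i * b j - a j * b i)\<^sup>2)"
    by (intro sum_nonneg) auto
  also have "\<dots> = (\<Sum>i\<in>I. \<Sum>j\<in>I. (a i)\<^sup>2 * (b j)\<^sup>2) + (\<Sum>i\<in>I. \<Sum>j\<in>I. (b i)\<^sup>2 * (a j)\<^sup>2)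
      - 2 * (\<Sum>i\<in>I. \<Sum>j\<in>I. (a i * b i) * (a j * b j))"
    unfolding sum_distrib_left sum.distrib[symmetric] sum_subtractf[symmetric]
    by (intro sum.cong) (simp_all add: power2_diff power_mult_distrib algebra_simps)
  also have "\<dots> = 2 * ((\<Sum>i\<in>I. (a i)\<^sup>2) * (\<Sum>i\<in>I. (b i)\<^sup>2)) - 2 * (\<Sum>i\<in>I. a i * b i)\<^sup>2"
    unfolding sum_product[symmetric] by (simp add: power2_eq_square mult_ac)
  finally show ?thesis by simp
qed

text \<open>Elimination of one variable at a time replaces a compactness argument on the unit
  sphere. The constant only has to exist, so crude estimates suffice.\<close>

lemma posdef_coercive:
  fixes A :: "'i \<Rightarrow> 'i \<Rightarrow> real"
  assumes "finite I" "\<And>i j. i \<in> I \<Longrightarrow> j \<in> I \<Longrightarrow> A i j = A j i"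
    and "\<And>x. \<exists>i\<in>I. x i \<noteq> 0 \<Longrightarrow> (\<Sum>i\<in>I. \<Sum>j\<in>I. x i * A i j * x j) > 0"
  shows "\<exists>c>0. \<forall>x. (\<Sum>i\<in>I. \<Sum>j\<in>I. x i * A i j * x j) \<ge> c * (\<Sum>i\<in>I. (x i)\<^sup>2)"
  using assms
proof (induction I arbitrary: A rule: finite_induct)
  case empty
  then show ?case by (auto intro: exI[of _ 1])
next
  case (insert i I)
  define a where "a = A i i"
  have a: "a > 0"
  proof -
    have "(\<Sum>j\<in>insert i I. \<Sum>k\<in>insert i I. (if j = i then 1 else 0) * A j k * (if k = i then 1 else 0)) > 0"
      by (rule insert.prems(2)) auto
    moreover have "(\<Sum>j\<in>I. \<Sum>k\<in>I. (if j = i then 1 else 0) * A j k * (if k = i then 1 else (0::real))) = 0"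
      "(\<Sum>k\<in>I. A i k * (if k = i then 1 else 0)) = 0"
      using insert.hyps by (auto intro!: sum.neutral)
    ultimately show ?thesis
      using insert.hyps by (simp add: a_def sum.neutral if_distrib cong: if_cong)
  qed
  define A' where "A' = (\<lambda>j k. A j k - A i j * A i k / a)"
  define l where "l = (\<lambda>x. \<Sum>j\<in>I. A i j / a * x j)"
  define Q' where "Q' = (\<lambda>x. \<Sum>j\<in>I. \<Sum>k\<in>I. x j * A' j k * x k)"
  have Q: "(\<Sum>j\<in>insert i I. \<Sum>k\<in>insert i I. x j * A j k * x k) = a * (x i + l x)\<^sup>2 + Q' x" for x
    unfolding a_def l_def Q'_def A'_def using insert a
    by (intro quadratic_form_insert) (auto simp: a_def)
  have "\<exists>c>0. \<forall>x. Q' x \<ge> c * (\<Sum>j\<in>I. (x j)\<^sup>2)"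
    unfolding Q'_def
  proof (rule insert.IH)
    show "A' j k = A' k j" if "j \<in> I" "k \<in> I" for j k
      using that insert.prems(1)[of j k] by (simp add: A'_def)
    fix x :: "'i \<Rightarrow> real" assume x: "\<exists>i\<in>I. x i \<noteq> 0"
    \<comment> \<open>This value of the new variable annihilates the completed square, so positivity
      of the full form at \<open>y\<close> is positivity of the Schur complement at
      \<open>x\<close>.\<close>
    define y where "y = x(i := - l x)"
    have eq: "l y = l x" "Q' y = Q' x"
      unfolding l_def Q'_def y_def using insert.hyps by (auto intro!: sum.cong)
    have "\<exists>j\<in>insert i I. y j \<noteq> 0"
      using x insert.hyps unfolding y_def by force
    from insert.prems(2)[OF this] show "(\<Sum>j\<in>I. \<Sum>k\<in>I. x j * A' j k * x k) > 0"
      unfolding Q eq by (simp add: y_def Q'_def)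
  qed
  then obtain c where c: "c > 0" "\<And>x. Q' x \<ge> c * (\<Sum>j\<in>I. (x j)\<^sup>2)" by blast
  define L where "L = (\<Sum>j\<in>I. (A i j / a)\<^sup>2)"
  have L: "(l x)\<^sup>2 \<le> L * (\<Sum>j\<in>I. (x j)\<^sup>2)" for x
    unfolding l_def L_def by (rule Cauchy_Schwarz_sum)
  have L0: "L \<ge> 0"
    unfolding L_def by (intro sum_nonneg) auto
  \<comment> \<open>Estimating the square of \<open>x i\<close> by twice the squares of
    \<open>x i + l x\<close> and \<open>l x\<close> produces the coefficients \<open>2 * e\<close>
    and \<open>e * (2 * L + 1)\<close>; they have to stay below \<open>a\<close> and
    \<open>c\<close>.\<close>
  define e where "e = min (a / 2) (c / (2 * L + 1))"
  have e: "e > 0" "2 * e \<le> a" "e * (2 * L + 1) \<le> c"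
    using a c L0 by (auto simp: e_def min_def field_simps add_pos_nonneg add_nonneg_pos)
  show ?case
  proof (intro exI[of _ e] conjI allI e)
    fix x :: "'i \<Rightarrow> real"
    define s where "s = (\<Sum>j\<in>I. (x j)\<^sup>2)"
    have s0: "s \<ge> 0" unfolding s_def by (intro sum_nonneg) auto
    have "(x i)\<^sup>2 \<le> 2 * (x i + l x)\<^sup>2 + 2 * (l x)\<^sup>2"
      using zero_le_power2[of "x i + 2 * l x"] by (simp add: power2_eq_square algebra_simps)
    then have "e * ((x i)\<^sup>2 + s) \<le> e * (2 * (x i + l x)\<^sup>2 + 2 * (L * s) + s)"
      using L[of x] e(1) unfolding s_def[symmetric] by (intro mult_left_mono) auto
    also have "\<dots> = (2 * e) * (x i + l x)\<^sup>2 + (e * (2 * L + 1)) * s"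
      by (simp add: algebra_simps)
    also have "\<dots> \<le> a * (x i + l x)\<^sup>2 + c * s"
      using e s0 by (intro add_mono mult_right_mono) auto
    also have "\<dots> \<le> a * (x i + l x)\<^sup>2 + Q' x"
      using c(2)[of x] unfolding s_def by simp
    finally show "e * (\<Sum>j\<in>insert i I. (x j)\<^sup>2) \<le> (\<Sum>j\<in>insert i I. \<Sum>k\<in>insert i I. x j * A j k * x k)"
      unfolding Q s_def using insert.hyps by simp
  qed
qed

section \<open>Integer multiples in abelian groups\<close>

lemma zmul_0 [simp]: "zmul 0 x = 0"
  by (simp add: zmul_def)

lemma zmul_Suc: "zmul (n + 1) x = zmul n x + x"
proof (cases "n \<ge> 0")
  case True
  then have "nat (n + 1) = Suc (nat n)" by simp
  with True show ?thesis by (simp add: zmul_def)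
next
  case False
  then have "nat (- n) = Suc (nat (- (n + 1)))" by simp
  with False show ?thesis by (simp add: zmul_def)
qed

lemma zmul_add: "zmul (m + n) x = zmul m x + zmul n x"
proof (induction n rule: int_induct[of _ 0])
  case (step1 i)
  then show ?case
    using zmul_Suc[of "m + i" x] zmul_Suc[of i x] by (simp add: add.assoc)
next
  case (step2 i)
  then show ?case
    using zmul_Suc[of "m + (i - 1)" x] zmul_Suc[of "i - 1" x] by (simp add: algebra_simps)
qed auto

lemma zmul_1 [simp]: "zmul 1 x = x"
  using zmul_Suc[of 0 x] by simp

lemma zmul_minus: "zmul (- n) x = - zmul n x"
  using zmul_add[of n "- n" x] by (simp add: eq_neg_iff_add_eq_0 add.commute)

lemma zmul_diff: "zmul (m - n) x = zmul m x - zmul n x"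
  using zmul_add[of m "- n" x] by (simp add: zmul_minus)

lemma zmul_minus_one [simp]: "zmul (- 1) x = - x"
  by (simp add: zmul_minus)

lemma additive_zmul: "additive f \<Longrightarrow> f (zmul n x) = n * f x" for f :: "'a::ab_group_add \<Rightarrow> int"
proof -
  assume f: "additive f"
  show ?thesis
  proof (induction n rule: int_induct[of _ 0])
    case base
    show ?case by (simp add: additive.zero[OF f])
  next
    case (step1 i)
    then show ?case by (simp add: zmul_add additive.add[OF f] algebra_simps)
  next
    case (step2 i)
    then show ?case by (simp add: zmul_diff additive.diff[OF f] algebra_simps)
  qed
qed

section \<open>Consequences of the axioms of a root datum of finite type\<close>

locale finite_root_datum =
  fixes D :: "('i, 'x :: ab_group_add, 'y :: ab_group_add) root_data"
  assumes rd: "root_datum D" and ft: "finite_type D"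
begin

abbreviation I where "I \<equiv> index D"
abbreviation al where "al \<equiv> simple_root D"
abbreviation pr where "pr i \<equiv> pairing D (simple_coroot D i)"
abbreviation cart where "cart i j \<equiv> pr i (al j)"

lemma cartan: "cartan_datum D"
  using rd unfolding root_datum_def by (elim conjE)

lemma fin_I [simp]: "finite I"
  using cartan unfolding cartan_datum_def by (elim conjE)

lemma cart_eq_form: "i \<in> I \<Longrightarrow> j \<in> I \<Longrightarrow>
    rat_of_int (cart i j) = 2 * rat_of_int (form D i j) / rat_of_int (form D i i)"
  using rd unfolding root_datum_def by (elim conjE) blast

lemma additive_pairing: "additive (pairing D h)" "additive (\<lambda>h. pairing D h \<kappa>)"
proof -
  have "\<forall>h. additive (pairing D h)" "\<forall>\<kappa>. additive (\<lambda>h. pairing D h \<kappa>)"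
    using rd unfolding root_datum_def by - (elim conjE, assumption)+
  then show "additive (pairing D h)" "additive (\<lambda>h. pairing D h \<kappa>)"
    by - (erule spec)+
qed

lemma pairing_simps [simp]:
  "pairing D h (x + y) = pairing D h x + pairing D h y"
  "pairing D h (x - y) = pairing D h x - pairing D h y"
  "pairing D h (- x) = - pairing D h x"
  "pairing D h 0 = 0"
  "pairing D h (zmul n x) = n * pairing D h x"
  "pairing D h (sum f A) = (\<Sum>a\<in>A. pairing D h (f a))"
proof -
  interpret additive "pairing D h" by (rule additive_pairing(1))
  show "pairing D h (x + y) = pairing D h x + pairing D h y" by (rule add)
  show "pairing D h (x - y) = pairing D h x - pairing D h y" by (rule diff)
  show "pairing D h (- x) = - pairing D h x" by (rule minus)
  show "pairing D h 0 = 0" by (rule zero)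
  show "pairing D h (zmul n x) = n * pairing D h x" by (rule additive_zmul) (rule additive_pairing(1))
  show "pairing D h (sum f A) = (\<Sum>a\<in>A. pairing D h (f a))" by (rule sum)
qed

lemma pairing_left_simps [simp]:
  "pairing D (h + h') x = pairing D h x + pairing D h' x"
  "pairing D (- h) x = - pairing D h x"
  "pairing D 0 x = 0"
  "pairing D (zmul n h) x = n * pairing D h x"
proof -
  interpret additive "\<lambda>h. pairing D h x" by (rule additive_pairing(2))
  show "pairing D (h + h') x = pairing D h x + pairing D h' x" by (rule add)
  show "pairing D (- h) x = - pairing D h x" by (rule minus)
  show "pairing D 0 x = 0" by (rule zero)
  show "pairing D (zmul n h) x = n * pairing D h x"
    using additive_zmul[OF additive_pairing(2)[of x], of n h] .
qed

text \<open>Uniqueness in the perfectness of the pairing: both weights represent the same functional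
  on the coweight lattice.\<close>

lemma pairing_separates:
  assumes "\<And>h. pairing D h x = pairing D h y"
  shows "x = y"
proof -
  have "\<forall>f. additive f \<longrightarrow> (\<exists>!\<kappa>. f = (\<lambda>h. pairing D h \<kappa>))"
    using rd unfolding root_datum_def by (elim conjE)
  from this[rule_format, OF additive_pairing(2)]
  have "\<exists>!\<kappa>. (\<lambda>h. pairing D h x) = (\<lambda>h. pairing D h \<kappa>)" .
  then obtain k where k: "\<And>z. (\<lambda>h. pairing D h x) = (\<lambda>h. pairing D h z) \<Longrightarrow> z = k"
    by (elim ex1E) blast
  have "x = k"
    by (rule k) (rule refl)
  moreover have "y = k"
    by (rule k) (rule ext, rule assms)
  ultimately show ?thesis by simp
qed

lemma form_sym: "i \<in> I \<Longrightarrow> j \<in> I \<Longrightarrow> form D i j = form D j i"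
  using cartan unfolding cartan_datum_def by (elim conjE) blast

lemma form_diag: "i \<in> I \<Longrightarrow> form D i i = 2 * int (dd D i)" and dd_pos: "i \<in> I \<Longrightarrow> dd D i > 0"
proof -
  have "i \<in> I \<Longrightarrow> form D i i > 0 \<and> even (form D i i)"
    using cartan unfolding cartan_datum_def by (elim conjE) blast
  then show "i \<in> I \<Longrightarrow> form D i i = 2 * int (dd D i)" "i \<in> I \<Longrightarrow> dd D i > 0"
    by (auto simp: dd_def elim!: evenE)
qed

lemma form_eq: "i \<in> I \<Longrightarrow> j \<in> I \<Longrightarrow> form D i j = int (dd D i) * cart i j"
proof -
  assume ij: "i \<in> I" "j \<in> I"
  have "rat_of_int (cart i j) = 2 * rat_of_int (form D i j) / rat_of_int (form D i i)"
    using ij by (rule cart_eq_form)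
  then have "rat_of_int (int (dd D i) * cart i j) = rat_of_int (form D i j)"
    using form_diag[OF ij(1)] dd_pos[OF ij(1)] by (simp add: field_simps)
  then show ?thesis by (simp only: of_int_eq_iff)
qed

lemma cart_diag: "i \<in> I \<Longrightarrow> cart i i = 2"
  using form_eq[of i i] form_diag[of i] dd_pos[of i] by simp

lemma cart_le_0: "i \<in> I \<Longrightarrow> j \<in> I \<Longrightarrow> i \<noteq> j \<Longrightarrow> cart i j \<le> 0"
proof -
  assume ij: "i \<in> I" "j \<in> I" "i \<noteq> j"
  then obtain n :: nat where "2 * rat_of_int (form D i j) / rat_of_int (form D i i) = - of_nat n"
    using cartan unfolding cartan_datum_def by (elim conjE) blast
  moreover have "rat_of_int (cart i j) = 2 * rat_of_int (form D i j) / rat_of_int (form D i i)"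
    using ij(1,2) by (rule cart_eq_form)
  ultimately have "rat_of_int (cart i j) = rat_of_int (- int n)" by simp
  then have "cart i j = - int n" by (simp only: of_int_eq_iff)
  then show ?thesis by simp
qed

lemma cart_sym: "i \<in> I \<Longrightarrow> j \<in> I \<Longrightarrow> int (dd D i) * cart i j = int (dd D j) * cart j i"
  using form_eq form_sym by metis

section \<open>The form on the root lattice and finiteness\<close>

definition rb :: "('i \<Rightarrow> int) \<Rightarrow> 'x" where
  "rb \<beta> = (\<Sum>i\<in>I. zmul (\<beta> i) (al i))"

definition frm :: "('i \<Rightarrow> int) \<Rightarrow> ('i \<Rightarrow> int) \<Rightarrow> int" where
  "frm \<beta> \<gamma> = (\<Sum>i\<in>I. \<Sum>j\<in>I. \<beta> i * form D i j * \<gamma> j)"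

definition lin :: "'x \<Rightarrow> ('i \<Rightarrow> int) \<Rightarrow> int" where
  "lin \<kappa> \<beta> = (\<Sum>i\<in>I. int (dd D i) * pr i \<kappa> * \<beta> i)"

lemma rb_add: "rb (\<lambda>i. \<beta> i + \<gamma> i) = rb \<beta> + rb \<gamma>"
  by (simp add: rb_def zmul_add sum.distrib)

lemma lin_rb: "lin (rb \<gamma>) \<beta> = frm \<beta> \<gamma>"
  unfolding lin_def frm_def rb_def
  by (auto simp: sum_distrib_left sum_distrib_right form_eq intro!: sum.cong)

lemma lin_diff: "lin (\<kappa> - \<mu>) \<beta> = lin \<kappa> \<beta> - lin \<mu> \<beta>"
  by (simp add: lin_def sum_subtractf algebra_simps)

lemma lin_add: "lin \<kappa> (\<lambda>i. \<beta> i + \<gamma> i) = lin \<kappa> \<beta> + lin \<kappa> \<gamma>"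
  by (simp add: lin_def sum.distrib algebra_simps)

lemma frm_sym: "frm \<beta> \<gamma> = frm \<gamma> \<beta>"
  unfolding frm_def by (subst sum.swap) (auto simp: form_sym mult_ac intro!: sum.cong)

lemma frm_add: "frm (\<lambda>i. \<beta> i + \<gamma> i) (\<lambda>i. \<beta> i + \<gamma> i) = frm \<beta> \<beta> + 2 * frm \<beta> \<gamma> + frm \<gamma> \<gamma>"
proof -
  have "frm (\<lambda>i. \<beta> i + \<gamma> i) (\<lambda>i. \<beta> i + \<gamma> i) = frm \<beta> \<beta> + frm \<beta> \<gamma> + (frm \<gamma> \<beta> + frm \<gamma> \<gamma>)"
    unfolding frm_def sum.distrib[symmetric] by (intro sum.cong) (simp_all add: algebra_simps)
  then show ?thesis by (simp add: frm_sym)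
qed

lemma frm_coercive: "\<exists>c>0. \<forall>\<beta>. real_of_int (frm \<beta> \<beta>) \<ge> c * (\<Sum>i\<in>I. (real_of_int (\<beta> i))\<^sup>2)"
proof -
  have "\<exists>c>0. \<forall>x. (\<Sum>i\<in>I. \<Sum>j\<in>I. x i * real_of_int (form D i j) * x j) \<ge> c * (\<Sum>i\<in>I. (x i)\<^sup>2)"
    using ft by (intro posdef_coercive) (auto simp: finite_type_def form_sym)
  then obtain c where "c > 0" "\<And>x. (\<Sum>i\<in>I. \<Sum>j\<in>I. x i * real_of_int (form D i j) * x j) \<ge> c * (\<Sum>i\<in>I. (x i)\<^sup>2)"
    by blast
  then show ?thesis
    unfolding frm_def by (intro exI[of _ c]) simp
qed

text \<open>A coercive quadratic form dominates any linear functional, so the solutions are lattice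
  points in a ball. Finiteness of orbits and of sets of dominant weights is reduced to sets of this
  shape.\<close>

lemma finite_frm_le:
  "finite {\<beta>. (\<forall>i. i \<notin> I \<longrightarrow> \<beta> i = 0) \<and> frm \<beta> \<beta> \<le> (\<Sum>i\<in>I. l i * \<beta> i)}" (is "finite ?S")
proof -
  obtain c where c: "c > 0" "\<And>\<beta>. real_of_int (frm \<beta> \<beta>) \<ge> c * (\<Sum>i\<in>I. (real_of_int (\<beta> i))\<^sup>2)"
    using frm_coercive by blast
  \<comment> \<open>Splitting each product \<open>l i * \<beta> i\<close> by the inequality 2 x y
    \<le> x^2 + y^2 costs half of \<open>c * s\<close> and a constant; absorbing that half on the
    left leaves \<open>s \<le> K\<close>.\<close>
  define K where "K = (\<Sum>i\<in>I. (real_of_int (l i))\<^sup>2) / c\<^sup>2"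
  have bound: "\<bar>\<beta> i\<bar> \<le> \<lceil>K\<rceil>" if "\<beta> \<in> ?S" "i \<in> I" for \<beta> i
  proof -
    define s where "s = (\<Sum>i\<in>I. (real_of_int (\<beta> i))\<^sup>2)"
    have "c * s \<le> real_of_int (\<Sum>i\<in>I. l i * \<beta> i)"
      using that(1) order_trans[OF c(2)[of \<beta>], of "real_of_int (\<Sum>i\<in>I. l i * \<beta> i)"]
      unfolding s_def by (simp del: of_int_sum)
    also have "\<dots> \<le> (\<Sum>i\<in>I. (real_of_int (l i))\<^sup>2 / (2 * c) + c / 2 * (real_of_int (\<beta> i))\<^sup>2)"
      unfolding of_int_sum
    proof (rule sum_mono)
      fix i
      have "0 \<le> (real_of_int (l i) - c * real_of_int (\<beta> i))\<^sup>2 / (2 * c)"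
        using c by simp
      also have "\<dots> = (real_of_int (l i))\<^sup>2 / (2 * c) + c / 2 * (real_of_int (\<beta> i))\<^sup>2 - real_of_int (l i * \<beta> i)"
        using c by (simp add: power2_diff power_mult_distrib field_simps power2_eq_square)
      finally show "real_of_int (l i * \<beta> i) \<le> (real_of_int (l i))\<^sup>2 / (2 * c) + c / 2 * (real_of_int (\<beta> i))\<^sup>2"
        by simp
    qed
    also have "\<dots> = c / 2 * K + c / 2 * s"
      unfolding K_def s_def using c
      by (simp add: sum.distrib sum_distrib_left sum_divide_distrib power2_eq_square)
    finally have sK: "s \<le> K"
      using c by (simp add: field_simps)
    have "real_of_int \<bar>\<beta> i\<bar> \<le> real_of_int (\<bar>\<beta> i\<bar> * \<bar>\<beta> i\<bar>)"
      unfolding of_int_le_iff using mult_left_mono[of 1 "\<bar>\<beta> i\<bar>" "\<bar>\<beta> i\<bar>"] by (cases "\<beta> i = 0") simp_all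
    also have "\<dots> = (real_of_int (\<beta> i))\<^sup>2"
      by (simp add: power2_eq_square)
    also have "\<dots> \<le> s"
      unfolding s_def using that by (intro member_le_sum) auto
    finally show ?thesis
      using sK by linarith
  qed
  have "?S \<subseteq> {\<beta>. \<forall>i. (i \<in> I \<longrightarrow> \<beta> i \<in> {-\<lceil>K\<rceil>..\<lceil>K\<rceil>}) \<and> (i \<notin> I \<longrightarrow> \<beta> i = 0)}"
  proof (rule subsetI, intro CollectI allI conjI impI)
    fix \<beta> i assume \<beta>: "\<beta> \<in> ?S"
    show "\<beta> i \<in> {-\<lceil>K\<rceil>..\<lceil>K\<rceil>}" if "i \<in> I"
      using bound[OF \<beta> that] unfolding abs_le_iff by auto
    show "\<beta> i = 0" if "i \<notin> I"
      using \<beta> that by blast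
  qed
  then show ?thesis
    by (rule finite_subset) (intro finite_set_of_finite_funs; simp)
qed

text \<open>A linear relation among the simple roots would be a nonzero vector of norm zero. The
  root datum itself only says that the simple roots are distinct.\<close>

lemma rb_inj:
  assumes "rb \<beta> = rb \<gamma>" "\<forall>i. i \<notin> I \<longrightarrow> \<beta> i = 0" "\<forall>i. i \<notin> I \<longrightarrow> \<gamma> i = 0"
  shows "\<beta> = \<gamma>"
proof (rule ccontr)
  define \<delta> where "\<delta> i = \<beta> i + - \<gamma> i" for i
  assume "\<beta> \<noteq> \<gamma>"
  then obtain i where i: "\<beta> i \<noteq> \<gamma> i"
    by (auto simp: fun_eq_iff)
  then have "i \<in> I" "\<delta> i \<noteq> 0"
    using assms(2,3) unfolding \<delta>_def by (metis, simp)
  then have "0 < (\<Sum>i\<in>I. \<Sum>j\<in>I. real_of_int (\<delta> i) * of_int (form D i j) * real_of_int (\<delta> j))"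
    using ft[unfolded finite_type_def, rule_format, of "\<lambda>i. real_of_int (\<delta> i)"] by auto
  also have "\<dots> = real_of_int (frm \<delta> \<delta>)"
    by (simp add: frm_def)
  also have "rb \<delta> = 0"
    using assms(1) by (simp add: rb_def \<delta>_def zmul_diff sum_subtractf)
  then have "frm \<delta> \<delta> = 0"
    using lin_rb[of \<delta> \<delta>] by (simp add: lin_def)
  finally show False by simp
qed

lemma exists_rho: "\<exists>\<rho>. \<forall>i\<in>I. pr i \<rho> > 0"
proof -
  define \<phi> where "\<phi> \<beta> = frm \<beta> \<beta> - (\<Sum>i\<in>I. 2 * form D i i * \<beta> i)" for \<beta>
  define S where "S = {\<beta>. (\<forall>i. i \<notin> I \<longrightarrow> \<beta> i = 0) \<and> \<phi> \<beta> \<le> 0}"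
  have "finite S"
    using finite_frm_le[of "\<lambda>i. 2 * form D i i"] by (simp add: S_def \<phi>_def)
  moreover have S0: "(\<lambda>i. 0) \<in> S"
    by (simp add: S_def \<phi>_def frm_def)
  ultimately have "arg_min_on \<phi> S \<in> S" "\<not> (\<exists>\<gamma>\<in>S. \<phi> \<gamma> < \<phi> (arg_min_on \<phi> S))"
    using arg_min_if_finite[of S \<phi>] by blast+
  then obtain \<beta> where \<beta>: "\<beta> \<in> S" "\<And>\<gamma>. \<gamma> \<in> S \<Longrightarrow> \<phi> \<beta> \<le> \<phi> \<gamma>"
    by (meson not_le)
  have "pr i (rb \<beta>) > 0" if i: "i \<in> I" for i
  proof -
    define \<epsilon> :: "'i \<Rightarrow> int" where "\<epsilon> j = (if j = i then 1 else 0)" for j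
    define \<gamma> where "\<gamma> j = \<beta> j + \<epsilon> j" for j
    have "\<phi> \<beta> \<le> \<phi> \<gamma>"
    proof (cases "\<phi> \<gamma> \<le> 0")
      case True
      then have "\<gamma> \<in> S"
        using \<beta>(1) i by (auto simp: S_def \<gamma>_def \<epsilon>_def)
      then show ?thesis by (rule \<beta>(2))
    next
      case False
      then show ?thesis using \<beta>(1) by (simp add: S_def)
    qed
    also have "\<phi> \<gamma> = \<phi> \<beta> + (2 * frm \<epsilon> \<beta> + frm \<epsilon> \<epsilon> - 2 * form D i i)"
    proof -
      have "(\<Sum>j\<in>I. 2 * form D j j * \<epsilon> j) = 2 * form D i i"
        using i by (simp add: \<epsilon>_def if_distrib cong: if_cong)
      then show ?thesis
        unfolding \<phi>_def \<gamma>_def frm_add by (simp add: frm_sym[of \<beta> \<epsilon>] distrib_left sum.distrib)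
    qed
    also have frm_\<epsilon>: "frm \<epsilon> \<delta> = int (dd D i) * pr i (rb \<delta>)" for \<delta>
      using i unfolding lin_rb[symmetric] lin_def \<epsilon>_def by (simp add: if_distrib cong: if_cong)
    also have "rb \<epsilon> = al i"
      using i by (simp add: rb_def \<epsilon>_def if_distrib[of "\<lambda>n. zmul n _"] cong: if_cong)
    finally have "int (dd D i) * pr i (rb \<beta>) \<ge> int (dd D i)"
      using form_diag[OF i] cart_diag[OF i] frm_\<epsilon>[of \<beta>] by simp
    then show ?thesis
      using dd_pos[OF i] by (simp add: mult_le_cancel_left1)
  qed
  then show ?thesis by blast
qed

subsection \<open>The Weyl group\<close>

lemma reflection_reflection: "i \<in> I \<Longrightarrow> reflection D i (reflection D i \<kappa>) = \<kappa>"
  by (simp add: reflection_def cart_diag flip: zmul_minus)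

lemma reflection_Bij: "i \<in> I \<Longrightarrow> reflection D i \<in> carrier (BijGroup UNIV)"
  by (auto simp: BijGroup_def Bij_def intro!: o_bij[of "reflection D i"] simp: reflection_reflection fun_eq_iff)

lemma mult_Bij: "f \<in> carrier (BijGroup UNIV) \<Longrightarrow> g \<in> carrier (BijGroup UNIV) \<Longrightarrow>
    f \<otimes>\<^bsub>BijGroup UNIV\<^esub> g = (\<lambda>x. f (g x))"
  by (auto simp: BijGroup_def compose_def)

lemma one_Bij: "\<one>\<^bsub>BijGroup UNIV\<^esub> = (\<lambda>x. x)"
  by (simp add: BijGroup_def restrict_UNIV)

lemma weyl_subgroup: "subgroup (weyl_group D) (BijGroup UNIV)"
  unfolding weyl_group_def using reflection_Bij
  by (intro group.generate_is_subgroup group_BijGroup) auto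

lemma weyl_Bij: "w \<in> weyl_group D \<Longrightarrow> w \<in> carrier (BijGroup UNIV)"
  using subgroup.subset[OF weyl_subgroup] by auto

lemma weyl_reflection: "i \<in> I \<Longrightarrow> reflection D i \<in> weyl_group D"
  unfolding weyl_group_def by (intro generate.incl) auto

lemma weyl_comp: "w \<in> weyl_group D \<Longrightarrow> w' \<in> weyl_group D \<Longrightarrow> (\<lambda>x. w (w' x)) \<in> weyl_group D"
  using subgroup.m_closed[OF weyl_subgroup, of w w'] by (simp add: mult_Bij weyl_Bij)

lemma weyl_id: "(\<lambda>x. x) \<in> weyl_group D"
  using subgroup.one_closed[OF weyl_subgroup] by (simp add: BijGroup_def restrict_UNIV)

lemma weyl_inv: "w \<in> weyl_group D \<Longrightarrow> \<exists>w'\<in>weyl_group D. \<forall>x. w' (w x) = x"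
proof (intro bexI[of _ "inv\<^bsub>BijGroup UNIV\<^esub> w"] allI)
  assume w: "w \<in> weyl_group D"
  show inv: "inv\<^bsub>BijGroup UNIV\<^esub> w \<in> weyl_group D"
    using w by (rule subgroup.m_inv_closed[OF weyl_subgroup])
  have "inv\<^bsub>BijGroup UNIV\<^esub> w \<otimes>\<^bsub>BijGroup UNIV\<^esub> w = \<one>\<^bsub>BijGroup UNIV\<^esub>"
    using weyl_Bij[OF w] by (rule group.l_inv[OF group_BijGroup])
  then have "(\<lambda>x. (inv\<^bsub>BijGroup UNIV\<^esub> w) (w x)) = (\<lambda>x. x)"
    using inv w by (simp add: mult_Bij weyl_Bij one_Bij)
  then show "(inv\<^bsub>BijGroup UNIV\<^esub> w) (w x) = x" for x
    by (rule fun_cong)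
qed

text \<open>\<open>generate\<close> forms arbitrary products of the reflections and their inverses.
  Reflections are involutions, so left multiplication by one reflection at a time reaches
  everything.\<close>

lemma weyl_induct [consumes 1, case_names id step]:
  assumes "w \<in> weyl_group D" "P (\<lambda>x. x)"
    and "\<And>i w. i \<in> I \<Longrightarrow> w \<in> weyl_group D \<Longrightarrow> P w \<Longrightarrow> P (\<lambda>x. reflection D i (w x))"
  shows "P w"
proof -
  have refl_inv: "inv\<^bsub>BijGroup UNIV\<^esub> reflection D i = reflection D i" if "i \<in> I" for i
  proof (rule group.inv_equality[OF group_BijGroup])
    show "reflection D i \<otimes>\<^bsub>BijGroup UNIV\<^esub> reflection D i = \<one>\<^bsub>BijGroup UNIV\<^esub>"
      using that by (simp add: mult_Bij reflection_Bij reflection_reflection one_Bij)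
  qed (simp_all add: reflection_Bij that)
  \<comment> \<open>The claim is about left multiplication on every \<open>w'\<close> with
    \<open>P w'\<close>; in this form it passes to products.\<close>
  have "w \<in> generate (BijGroup UNIV) (reflection D ` I) \<Longrightarrow>
      (\<forall>w'\<in>weyl_group D. P w' \<longrightarrow> P (\<lambda>x. w (w' x)))"
  proof (induction rule: generate.induct)
    case one
    then show ?case by (simp add: one_Bij)
  next
    case (eng h1 h2)
    then have W: "h1 \<in> weyl_group D" "h2 \<in> weyl_group D"
      by (simp_all add: weyl_group_def)
    have "h1 \<otimes>\<^bsub>BijGroup UNIV\<^esub> h2 = (\<lambda>x. h1 (h2 x))"
      using W by (simp add: mult_Bij weyl_Bij)
    then show ?case
      using eng.IH W weyl_comp by simp
  qed (use assms(3) refl_inv in auto)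
  then show ?thesis
    using assms(1,2) weyl_id by (auto simp: weyl_group_def)
qed

text \<open>Invariance of the norm, written for the difference \<beta> = \<kappa> - w \<kappa>:
  expanding the norm of \<kappa> - \<beta> leaves (\<beta>, \<beta>) = 2 (\<kappa>, \<beta>), which
  makes sense without a norm for \<kappa> itself.\<close>

lemma weyl_orbit_norm:
  "w \<in> weyl_group D \<Longrightarrow> \<exists>\<beta>. (\<forall>i. i \<notin> I \<longrightarrow> \<beta> i = 0) \<and> w \<kappa> = \<kappa> - rb \<beta> \<and> frm \<beta> \<beta> = 2 * lin \<kappa> \<beta>"
proof (induction rule: weyl_induct)
  case id
  show ?case
    by (intro exI[of _ "\<lambda>i. 0"]) (simp add: rb_def frm_def lin_def)
next
  case (step i w)
  then obtain \<beta> where \<beta>: "\<forall>i. i \<notin> I \<longrightarrow> \<beta> i = 0" "w \<kappa> = \<kappa> - rb \<beta>" "frm \<beta> \<beta> = 2 * lin \<kappa> \<beta>"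
    by blast
  define n where "n = pr i (w \<kappa>)"
  define \<epsilon> :: "'i \<Rightarrow> int" where "\<epsilon> j = (if j = i then n else 0)" for j
  have rbe: "rb \<epsilon> = zmul n (al i)"
    using step(1) by (simp add: rb_def \<epsilon>_def if_distrib[of "\<lambda>n. zmul n _"] cong: if_cong)
  have line: "lin \<mu> \<epsilon> = int (dd D i) * pr i \<mu> * n" for \<mu>
    using step(1) by (simp add: lin_def \<epsilon>_def if_distrib cong: if_cong)
  have "frm \<epsilon> \<epsilon> = 2 * lin (w \<kappa>) \<epsilon>"
    using step(1) by (simp add: lin_rb[symmetric] rbe line cart_diag n_def)
  also have "lin (w \<kappa>) \<epsilon> = lin \<kappa> \<epsilon> - frm \<epsilon> \<beta>"
    by (simp add: \<beta>(2) lin_diff lin_rb)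
  finally have "frm (\<lambda>i. \<beta> i + \<epsilon> i) (\<lambda>i. \<beta> i + \<epsilon> i) = 2 * lin \<kappa> (\<lambda>i. \<beta> i + \<epsilon> i)"
    by (simp add: frm_add lin_add \<beta>(3) frm_sym)
  moreover have "reflection D i (w \<kappa>) = \<kappa> - rb (\<lambda>i. \<beta> i + \<epsilon> i)"
    unfolding reflection_def rb_add rbe n_def[symmetric] by (simp add: \<beta>(2) algebra_simps)
  ultimately show ?case
    using \<beta>(1) step(1) by (intro exI[of _ "\<lambda>i. \<beta> i + \<epsilon> i"]) (auto simp: \<epsilon>_def)
qed

lemma finite_orbit_coords:
  "finite {\<beta>. (\<forall>i. i \<notin> I \<longrightarrow> \<beta> i = 0) \<and> frm \<beta> \<beta> = 2 * lin \<kappa> \<beta>}"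
  by (rule finite_subset[OF _ finite_frm_le[of "\<lambda>i. 2 * (int (dd D i) * pr i \<kappa>)"]])
     (auto simp: lin_def sum_distrib_left mult_ac)

lemma finite_weyl_orbit: "finite P \<Longrightarrow> finite (weyl_orbit D P)"
proof -
  assume "finite P"
  moreover have "weyl_orbit D P \<subseteq> (\<Union>\<kappa>\<in>P. (\<lambda>\<beta>. \<kappa> - rb \<beta>) ` {\<beta>. (\<forall>i. i \<notin> I \<longrightarrow> \<beta> i = 0) \<and> frm \<beta> \<beta> = 2 * lin \<kappa> \<beta>})"
  proof
    fix \<mu> assume "\<mu> \<in> weyl_orbit D P"
    then obtain w \<kappa> where w: "w \<in> weyl_group D" "\<kappa> \<in> P" "\<mu> = w \<kappa>"
      by (auto simp: weyl_orbit_def)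
    with weyl_orbit_norm[OF w(1), of \<kappa>]
    show "\<mu> \<in> (\<Union>\<kappa>\<in>P. (\<lambda>\<beta>. \<kappa> - rb \<beta>) ` {\<beta>. (\<forall>i. i \<notin> I \<longrightarrow> \<beta> i = 0) \<and> frm \<beta> \<beta> = 2 * lin \<kappa> \<beta>})"
      by blast
  qed
  ultimately show ?thesis
    by (elim finite_subset) (auto intro: finite_orbit_coords)
qed

lemma weyl_orbit_mono: "P \<subseteq> P' \<Longrightarrow> weyl_orbit D P \<subseteq> weyl_orbit D P'"
  by (auto simp: weyl_orbit_def)

text \<open>Among the finitely many orbit points \<open>\<kappa> - rb \<beta>\<close> take one with
  \<beta> of least height: if coordinate i were negative, the reflection in i would lower the height
  further. Comparing heights uses that the coordinates \<beta> are unique.\<close>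

lemma exists_dominant_conjugate: "\<exists>w\<in>weyl_group D. w \<kappa> \<in> dominant D"
proof -
  define B where "B = {\<beta>. (\<forall>i. i \<notin> I \<longrightarrow> \<beta> i = 0) \<and> frm \<beta> \<beta> = 2 * lin \<kappa> \<beta> \<and> (\<exists>w\<in>weyl_group D. w \<kappa> = \<kappa> - rb \<beta>)}"
  define ht where "ht \<beta> = (\<Sum>i\<in>I. \<beta> i)" for \<beta> :: "'i \<Rightarrow> int"
  have "finite B"
    by (rule finite_subset[OF _ finite_orbit_coords[of \<kappa>]]) (auto simp: B_def)
  moreover have "B \<noteq> {}"
    using weyl_orbit_norm[OF weyl_id, of \<kappa>] weyl_id by (fastforce simp: B_def)
  ultimately obtain \<beta> where \<beta>: "\<beta> \<in> B" "\<And>\<gamma>. \<gamma> \<in> B \<Longrightarrow> ht \<beta> \<le> ht \<gamma>"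
    using arg_min_if_finite[of B ht] by (meson not_le)
  then obtain w where w: "w \<in> weyl_group D" "w \<kappa> = \<kappa> - rb \<beta>"
    by (auto simp: B_def)
  have "pr i (w \<kappa>) \<ge> 0" if i: "i \<in> I" for i
  proof (rule ccontr)
    assume neg: "\<not> pr i (w \<kappa>) \<ge> 0"
    have w': "(\<lambda>x. reflection D i (w x)) \<in> weyl_group D"
      using weyl_comp[OF weyl_reflection[OF i] w(1)] .
    from weyl_orbit_norm[OF w', of \<kappa>]
    obtain \<gamma> where \<gamma>: "\<forall>i. i \<notin> I \<longrightarrow> \<gamma> i = 0" "reflection D i (w \<kappa>) = \<kappa> - rb \<gamma>" "frm \<gamma> \<gamma> = 2 * lin \<kappa> \<gamma>"
      by blast
    then have "\<gamma> \<in> B"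
      using w' by (auto simp: B_def)
    define \<epsilon> :: "'i \<Rightarrow> int" where "\<epsilon> j = (if j = i then pr i (w \<kappa>) else 0)" for j
    have "rb \<epsilon> = zmul (pr i (w \<kappa>)) (al i)"
      using i by (simp add: rb_def \<epsilon>_def if_distrib[of "\<lambda>n. zmul n _"] cong: if_cong)
    then have "rb \<gamma> = rb (\<lambda>j. \<beta> j + \<epsilon> j)"
      using \<gamma>(2) unfolding reflection_def rb_add by (simp add: w(2) algebra_simps)
    then have "\<gamma> = (\<lambda>j. \<beta> j + \<epsilon> j)"
      using \<gamma>(1) \<beta>(1) i by (intro rb_inj) (auto simp: B_def \<epsilon>_def)
    then have "ht \<gamma> = ht \<beta> + pr i (w \<kappa>)"
      using i by (simp add: ht_def sum.distrib \<epsilon>_def)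
    with neg \<beta>(2)[OF \<open>\<gamma> \<in> B\<close>] show False by simp
  qed
  with w(1) show ?thesis unfolding dominant_def by blast
qed

text \<open>For \<kappa> = \<mu> - \<beta> dominant and \<beta> a nonnegative combination of simple
  roots, (\<kappa>, \<beta>) \<ge> 0 reads (\<beta>, \<beta>) \<le> (\<mu>, \<beta>).\<close>

lemma finite_dominant_below: "finite {\<kappa> \<in> dominant D. dom_le D \<kappa> \<mu>}"
proof -
  have "{\<kappa> \<in> dominant D. dom_le D \<kappa> \<mu>} \<subseteq> (\<lambda>\<beta>. \<mu> - rb \<beta>) ` {\<beta>. (\<forall>i. i \<notin> I \<longrightarrow> \<beta> i = 0) \<and> frm \<beta> \<beta> \<le> (\<Sum>i\<in>I. (int (dd D i) * pr i \<mu>) * \<beta> i)}"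
  proof safe
    fix \<kappa> assume \<kappa>: "\<kappa> \<in> dominant D" "dom_le D \<kappa> \<mu>"
    then obtain c :: "'i \<Rightarrow> nat" where c: "\<mu> - \<kappa> = (\<Sum>i\<in>I. zmul (int (c i)) (al i))"
      by (auto simp: dom_le_def)
    define \<beta> where "\<beta> i = (if i \<in> I then int (c i) else 0)" for i
    have rb: "\<mu> - \<kappa> = rb \<beta>"
      unfolding c rb_def \<beta>_def by (intro sum.cong) auto
    have "0 \<le> lin \<kappa> \<beta>"
      unfolding lin_def using \<kappa>(1) by (intro sum_nonneg) (auto simp: \<beta>_def dominant_def)
    also have "\<kappa> = \<mu> - rb \<beta>"
      by (simp flip: rb)
    finally have "frm \<beta> \<beta> \<le> lin \<mu> \<beta>"
      by (simp add: lin_diff lin_rb)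
    with rb show "\<kappa> \<in> (\<lambda>\<beta>. \<mu> - rb \<beta>) ` {\<beta>. (\<forall>i. i \<notin> I \<longrightarrow> \<beta> i = 0) \<and> frm \<beta> \<beta> \<le> (\<Sum>i\<in>I. (int (dd D i) * pr i \<mu>) * \<beta> i)}"
      by (intro image_eqI[of _ _ \<beta>]) (auto simp: lin_def \<beta>_def algebra_simps)
  qed
  then show ?thesis
    by (rule finite_subset) (intro finite_imageI finite_frm_le)
qed

lemma dom_le_refl: "dom_le D \<kappa> \<kappa>"
  unfolding dom_le_def by (intro exI[of _ "\<lambda>i. 0"]) simp

lemma dom_le_trans: "dom_le D \<kappa> \<mu> \<Longrightarrow> dom_le D \<mu> \<nu> \<Longrightarrow> dom_le D \<kappa> \<nu>"
proof -
  assume "dom_le D \<kappa> \<mu>" "dom_le D \<mu> \<nu>"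
  then obtain c c' :: "'i \<Rightarrow> nat" where
    "\<mu> - \<kappa> = (\<Sum>i\<in>I. zmul (int (c i)) (al i))" "\<nu> - \<mu> = (\<Sum>i\<in>I. zmul (int (c' i)) (al i))"
    by (auto simp: dom_le_def)
  then have "\<nu> - \<kappa> = (\<Sum>i\<in>I. zmul (int (c i + c' i)) (al i))"
    by (simp add: zmul_add sum.distrib flip: \<open>\<mu> - \<kappa> = _\<close> \<open>\<nu> - \<mu> = _\<close>)
  then show ?thesis unfolding dom_le_def by (intro exI[of _ "\<lambda>i. c i + c' i"])
qed

lemma exists_finite_saturated:
  assumes "finite \<Omega>"
  shows "\<exists>P\<in>finite_saturated D. \<Omega> \<subseteq> weyl_orbit D P"
proof -
  obtain w where w: "\<And>\<kappa>. w \<kappa> \<in> weyl_group D" "\<And>\<kappa>. w \<kappa> \<kappa> \<in> dominant D"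
    using exists_dominant_conjugate by metis
  \<comment> \<open>All dominant weights below the dominant conjugates of \<open>\<Omega>\<close>;
    the weight 0 is included so that \<open>P\<close> is nonempty even for empty
    \<open>\<Omega>\<close>.\<close>
  define P where "P = (\<Union>\<kappa>\<in>insert 0 \<Omega>. {\<nu> \<in> dominant D. dom_le D \<nu> (w \<kappa> \<kappa>)})"
  have "saturated D P"
    unfolding saturated_def
  proof (intro conjI ballI impI)
    show "P \<noteq> {}"
      using w(2)[of 0] dom_le_refl by (auto simp: P_def)
  qed (auto simp: P_def intro: dom_le_trans)
  moreover have "finite P"
    using assms by (auto simp: P_def finite_dominant_below)
  moreover have "\<Omega> \<subseteq> weyl_orbit D P"
  proof
    fix \<kappa> assume "\<kappa> \<in> \<Omega>"
    then have "w \<kappa> \<kappa> \<in> P"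
      using w(2) dom_le_refl by (auto simp: P_def)
    moreover obtain w' where "w' \<in> weyl_group D" "w' (w \<kappa> \<kappa>) = \<kappa>"
      using weyl_inv[OF w(1)] by blast
    ultimately show "\<kappa> \<in> weyl_orbit D P"
      unfolding weyl_orbit_def by (intro CollectI exI[of _ w'] exI[of _ "w \<kappa> \<kappa>"]) auto
  qed
  ultimately show ?thesis by (auto simp: finite_saturated_def)
qed

text \<open>Stability moves each element to its dominant conjugate inside \<open>\<Omega>\<close>,
  hence below \<open>b\<close>; what is left are the finite orbits of finitely many dominant
  weights.\<close>

lemma finite_reflection_stable:
  assumes "\<And>\<kappa>. \<kappa> \<in> \<Omega> \<Longrightarrow> dom_le D \<kappa> b"
    and "\<And>i \<kappa>. i \<in> I \<Longrightarrow> \<kappa> \<in> \<Omega> \<Longrightarrow> reflection D i \<kappa> \<in> \<Omega>"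
  shows "finite \<Omega>"
proof -
  have W: "w \<in> weyl_group D \<Longrightarrow> \<forall>\<kappa>\<in>\<Omega>. w \<kappa> \<in> \<Omega>" for w
    by (induction rule: weyl_induct) (use assms(2) in auto)
  have "\<Omega> \<subseteq> weyl_orbit D {\<kappa> \<in> dominant D. dom_le D \<kappa> b}"
  proof
    fix \<kappa> assume \<kappa>: "\<kappa> \<in> \<Omega>"
    obtain w where w: "w \<in> weyl_group D" "w \<kappa> \<in> dominant D"
      using exists_dominant_conjugate by blast
    moreover obtain w' where "w' \<in> weyl_group D" "w' (w \<kappa>) = \<kappa>"
      using weyl_inv[OF w(1)] by blast
    moreover have "dom_le D (w \<kappa>) b"
      using W[OF w(1)] \<kappa> by (intro assms(1)) blast
    ultimately show "\<kappa> \<in> weyl_orbit D {\<kappa> \<in> dominant D. dom_le D \<kappa> b}"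
      unfolding weyl_orbit_def by (intro CollectI exI[of _ w'] exI[of _ "w \<kappa>"]) auto
  qed
  then show ?thesis
    by (rule finite_subset) (intro finite_weyl_orbit finite_dominant_below)
qed

end

section \<open>Quantum numbers\<close>

lemma vv_power: "vv ^ n = Fract (monom 1 n) 1"
proof (induction n)
  case 0
  then show ?case by (simp add: One_fract_def[symmetric])
next
  case (Suc n)
  have "[:0, 1:] * monom 1 n = (monom 1 (Suc n) :: rat poly)"
    by (simp add: monom_Suc)
  then show ?case
    using Suc by (simp add: vv_def)
qed

lemma vv_power_eq_1: "vv ^ n = 1 \<Longrightarrow> n = 0"
proof -
  assume "vv ^ n = 1"
  then have "monom 1 n = (1 :: rat poly)"
    by (simp add: vv_power One_fract_def eq_fract)
  then have "degree (monom 1 n :: rat poly) = 0"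
    by simp
  then show "n = 0"
    by (simp add: degree_monom_eq)
qed

lemma vv_nonzero [simp]: "vv \<noteq> 0"
  by (simp add: vv_def Zero_fract_def eq_fract)

text \<open>Any nonzero base that is not a root of unity, so that the identities are proved once for
  all \<open>vi D i\<close>.\<close>

locale quantum_base =
  fixes q :: qv
  assumes q_nonzero [simp]: "q \<noteq> 0"
    and q_generic: "\<And>n :: int. q powi n = 1 \<Longrightarrow> n = 0"
begin

lemma q_add: "q powi (m + n) = q powi m * q powi n"
  by (simp add: power_int_add)

lemma q_diff: "q powi (m - n) = q powi m / q powi n"
  by (simp add: power_int_diff)

lemma q_minus_inverse: "q - inverse q \<noteq> 0"
proof
  assume "q - inverse q = 0"
  then have "q * q = 1"
    by (simp add: field_simps)
  then have "q powi 2 = 1"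
    by (simp add: power2_eq_square)
  from q_generic[OF this] show False by simp
qed

lemma q_int_zero [simp]: "q_int q 0 = 0"
  by (simp add: q_int_def)

lemma q_int_1 [simp]: "q_int q 1 = 1"
  using q_minus_inverse by (simp add: q_int_def power_int_minus)

lemma q_int_minus: "q_int q (- n) = - q_int q n"
  by (simp add: q_int_def minus_divide_left)

lemma q_int_eq_0: "q_int q n = 0 \<longleftrightarrow> n = 0"
proof
  assume "q_int q n = 0"
  then have "q powi n = q powi (- n)"
    using q_minus_inverse by (simp add: q_int_def)
  then have "q powi (n + n) = q powi n * q powi (- n)"
    unfolding q_add by simp
  also have "\<dots> = 1"
    by (simp flip: q_add)
  finally have "q powi (n + n) = 1" .
  from q_generic[OF this] show "n = 0" by simp
qed simp

lemma q_fact_nonzero [simp]: "q_fact q n \<noteq> 0"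
  by (simp add: q_fact_def q_int_eq_0)

lemma q_fact_0 [simp]: "q_fact q 0 = 1"
  by (simp add: q_fact_def)

lemma q_fact_Suc: "q_fact q (Suc n) = q_int q (int (Suc n)) * q_fact q n"
  by (simp add: q_fact_def)

text \<open>The scalar identity behind \<open>[E, F\<^bsup>j+1\<^esup>] = [j+1] F\<^sup>j [H - j]\<close>.\<close>
lemma q_int_string: "q_int q j * q_int q (M - j + 1) + q_int q (M - 2 * j) = q_int q (j + 1) * q_int q (M - j)"
proof -
  define x y where "x = q powi j" and "y = q powi M"
  have nz: "x \<noteq> 0" "y \<noteq> 0" by (simp_all add: x_def y_def)
  have e: "q powi j = x" "q powi (- j) = 1 / x" "q powi (M - j + 1) = y / x * q"
    "q powi (- (M - j + 1)) = x / y / q" "q powi (M - 2 * j) = y / (x * x)" "q powi (- (M - 2 * j)) = x * x / y"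
    "q powi (j + 1) = x * q" "q powi (- (j + 1)) = 1 / x / q" "q powi (M - j) = y / x" "q powi (- (M - j)) = x / y"
    unfolding minus_diff_eq minus_add_distrib mult_2 power_int_minus q_add q_diff x_def[symmetric] y_def[symmetric]
    by (simp_all add: power_int_minus q_add q_diff x_def y_def field_simps)
  define d where "d = q - inverse q"
  have d: "d \<noteq> 0" using q_minus_inverse by (simp add: d_def)
  have "(x - 1 / x) * (y / x * q - x / y / q) + (y / (x * x) - x * x / y) * d = (x * q - 1 / x / q) * (y / x - x / y)"
    using nz unfolding d_def by (simp add: field_simps)
  then have "((x - 1 / x) * (y / x * q - x / y / q) + (y / (x * x) - x * x / y) * d) / (d * d) = (x * q - 1 / x / q) * (y / x - x / y) / (d * d)"
    by simp
  then show ?thesis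
    unfolding q_int_def e d_def[symmetric] using d by (simp add: add_divide_distrib)
qed

text \<open>The identity by which one-sided factors of \<open>K\<close> recombine: it serves the
  twisted commutators of \<open>yop\<close>, the coproduct and the q-Pascal rule.\<close>

lemma q_int_shift: "q_int q (m + n) - q powi n * q_int q m = q powi (- m) * q_int q n"
  unfolding q_int_def q_add minus_add_distrib right_diff_distrib
  by (simp add: power_int_add diff_divide_distrib right_diff_distrib mult_ac)

definition q_binom :: "nat \<Rightarrow> nat \<Rightarrow> qv" where
  "q_binom n k = (if k \<le> n then q_fact q n / (q_fact q k * q_fact q (n - k)) else 0)"

lemma q_binom_0 [simp]: "q_binom n 0 = 1"
  by (simp add: q_binom_def)

text \<open>The q-Pascal rule with the asymmetric powers that the recursion of \<open>yop\<close>
  produces. It also holds on and beyond the diagonal, where \<open>q_binom\<close> takes the value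
  0.\<close>

lemma q_binom_Suc:
  "q_binom (Suc n) (Suc k) = q powi (int k + 1) * q_binom n (Suc k) + q powi (int k - int n) * q_binom n k"
proof -
  consider "k < n" | "k = n" | "k > n" by linarith
  then show ?thesis
  proof cases
    case 1
    then obtain r where r: "n = k + Suc r"
      using less_imp_Suc_add by fastforce
    have "q_int q (int (k + Suc r) + 1) =
        q powi (int k + 1) * q_int q (int r + 1) + q powi (int k - int n) * q_int q (int k + 1)"
      using q_int_shift[of "int r + 1" "int k + 1"] unfolding r
      by (simp add: algebra_simps)
    then show ?thesis
      unfolding q_binom_def r using q_int_eq_0[of "1 + int r"] q_int_eq_0[of "1 + int k"]
      by (simp add: q_fact_Suc field_simps)
  next
    case 2
    then show ?thesis by (simp add: q_binom_def)
  next
    case 3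
    then show ?thesis by (simp add: q_binom_def)
  qed
qed

end

section \<open>Modules over the algebra without the Serre relations\<close>

context finite_root_datum
begin

lemma quantum_base_vi: "i \<in> I \<Longrightarrow> quantum_base (vi D i)"
proof
  assume i: "i \<in> I"
  show "vi D i \<noteq> 0" by (simp add: vi_def)
  fix n :: int assume "vi D i powi n = 1"
  then have "vi D i ^ nat \<bar>n\<bar> = 1"
    by (cases "n \<ge> 0") (auto simp: power_int_def power_inverse)
  then have "vv ^ (dd D i * nat \<bar>n\<bar>) = 1"
    by (simp add: vi_def power_mult)
  then show "n = 0"
    using vv_power_eq_1 dd_pos[OF i] by fastforce
qed

lemma vi_powi: "vi D i powi n = vv powi (int (dd D i) * n)"
  by (simp add: vi_def power_int_mult)

end

lemma homog_neg: "homog (\<lambda>b. - wt b) \<mu> t \<longleftrightarrow> homog wt (- \<mu>) t" for wt :: "'b \<Rightarrow> 'x::ab_group_add"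
  by (auto simp: homog_def)

text \<open>Weight modules over the algebra with all defining relations except the Serre relations.
  The elements \<open>K\<close> do not appear: they act through the weight, so the commutator is
  stated on weight vectors with the quantum integer of the weight.\<close>

locale umod = finite_root_datum D
  for D :: "('i, 'x :: ab_group_add, 'y :: ab_group_add) root_data" +
  fixes wt :: "'b \<Rightarrow> 'x" and e f :: "'i \<Rightarrow> ('b \<Rightarrow>\<^sub>0 qv) \<Rightarrow> ('b \<Rightarrow>\<^sub>0 qv)"
  assumes lmap_e: "lmap (e i)" and lmap_f: "lmap (f i)"
    and wt_e: "i \<in> I \<Longrightarrow> homog wt \<mu> t \<Longrightarrow> homog wt (\<mu> + al i) (e i t)"
    and wt_f: "i \<in> I \<Longrightarrow> homog wt \<mu> t \<Longrightarrow> homog wt (\<mu> - al i) (f i t)"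
    and comm: "i \<in> I \<Longrightarrow> j \<in> I \<Longrightarrow> homog wt \<mu> t \<Longrightarrow>
      e i (f j t) = f j (e i t) + (if i = j then scl (q_int (vi D i) (pr i \<mu>)) t else 0)"
begin

text \<open>Twisting by the involution that exchanges raising and lowering operators and negates
  weights; statements on \<open>f\<close> thereby have counterparts for \<open>e\<close>.\<close>

lemma umod_swap: "umod D (\<lambda>b. - wt b) f e"
proof
  fix i j \<mu> t
  assume ij: "i \<in> I" "j \<in> I" and t: "homog (\<lambda>b. - wt b) \<mu> t"
  interpret q: quantum_base "vi D j" using ij(2) by (rule quantum_base_vi)
  from t have "homog wt (- \<mu>) t" by (simp add: homog_neg)
  from comm[OF ij(2,1) this] show "f i (e j t) = e j (f i t) + (if i = j then scl (q_int (vi D i) (pr i \<mu>)) t else 0)"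
    by (auto simp: q.q_int_minus pm.scale_minus_left)
next
  fix i \<mu> t assume "i \<in> I" "homog (\<lambda>b. - wt b) \<mu> t"
  then show "homog (\<lambda>b. - wt b) (\<mu> + al i) (f i t)" "homog (\<lambda>b. - wt b) (\<mu> - al i) (e i t)"
    using wt_e[of i "- \<mu>" t] wt_f[of i "- \<mu>" t] by (simp_all add: homog_neg algebra_simps)
qed (rule lmap_e lmap_f)+

lemmas e_simps = lmap_simps[OF lmap_e]
lemmas f_simps = lmap_simps[OF lmap_f]

lemma wt_f_pow: "i \<in> I \<Longrightarrow> homog wt \<mu> t \<Longrightarrow> homog wt (\<mu> - zmul (int k) (al i)) ((f i ^^ k) t)"
proof (induction k)
  case (Suc k)
  from wt_f[OF Suc.prems(1) Suc.IH[OF Suc.prems]] show ?case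
    by (simp add: zmul_add algebra_simps)
qed simp

text \<open>The iterated quantum adjoint action of \<open>f\<^sub>i\<close> on \<open>f\<^sub>j\<close>; step \<open>1 - \<langle>h\<^sub>i, \<alpha>\<^sub>j\<rangle>\<close> is the Serre element.\<close>
primrec yop :: "'i \<Rightarrow> 'i \<Rightarrow> nat \<Rightarrow> ('b \<Rightarrow>\<^sub>0 qv) \<Rightarrow> ('b \<Rightarrow>\<^sub>0 qv)" where
  "yop i j 0 t = f j t"
| "yop i j (Suc k) t = f i (yop i j k t) - scl (vi D i powi (- cart i j - 2 * int k)) (yop i j k (f i t))"

lemma lmap_yop: "lmap (yop i j k)"
proof (induction k)
  case (Suc k)
  show ?case
    unfolding yop.simps by (intro lmap_minus lmap_scale lmap_comp[OF lmap_f] lmap_comp[OF Suc] Suc lmap_f)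
qed (simp add: lmap_f)

lemmas yop_simps = lmap_simps[OF lmap_yop]

lemma wt_yop:
  "i \<in> I \<Longrightarrow> j \<in> I \<Longrightarrow> homog wt \<mu> t \<Longrightarrow> homog wt (\<mu> - al j - zmul (int k) (al i)) (yop i j k t)"
proof (induction k arbitrary: \<mu> t)
  case 0
  then show ?case by (simp add: wt_f)
next
  case (Suc k)
  have "homog wt (\<mu> - al j - zmul (int k) (al i) - al i) (f i (yop i j k t))"
    using Suc by (intro wt_f) auto
  moreover have "homog wt (\<mu> - al i - al j - zmul (int k) (al i)) (yop i j k (f i t))"
    using Suc by (intro Suc.IH wt_f) auto
  moreover have "\<mu> - al j - zmul (int k) (al i) - al i = \<mu> - al j - zmul (int (Suc k)) (al i)"
    "\<mu> - al i - al j - zmul (int k) (al i) = \<mu> - al j - zmul (int (Suc k)) (al i)"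
    by (simp_all add: zmul_add algebra_simps)
  ultimately show ?case by (simp add: homog_diff homog_scl)
qed

text \<open>The scalar vanishes exactly for k = 0 and k = 1 - \<open>cart i j\<close>. The second
  zero is the Serre element; nonvanishing at all other k permits the descent from large k when there
  are finitely many weights.\<close>

lemma e_yop_same:
  assumes "i \<in> I" "j \<in> I" "i \<noteq> j"
  shows "homog wt \<mu> t \<Longrightarrow> e i (yop i j k t) = yop i j k (e i t) +
    scl (vi D i powi (- pr i \<mu>) * q_int (vi D i) (int k) * q_int (vi D i) (1 - cart i j - int k)) (yop i j (k - 1) t)"
proof (induction k arbitrary: \<mu> t)
  case 0
  interpret q: quantum_base "vi D i" using assms(1) by (rule quantum_base_vi)
  from 0 show ?case using assms comm[of i j \<mu> t] by simp
next
  case (Suc k)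
  interpret q: quantum_base "vi D i" using assms(1) by (rule quantum_base_vi)
  define q where "q = vi D i"
  define m c where "m = pr i \<mu>" and "c = - cart i j"
  define y where "y = yop i j k t"
  define G where "G = q powi (- m) * q_int q (int k) * q_int q (c + 1 - int k)"
  have cart: "cart i i = 2" using assms(1) by (rule cart_diag)
  have ft: "homog wt (\<mu> - al i) (f i t)" using assms(1) Suc.prems by (rule wt_f)
  have eft: "e i (f i t) = f i (e i t) + scl (q_int q m) t"
    using comm[OF assms(1,1) Suc.prems] by (simp add: q_def m_def)
  have 1: "e i y = yop i j k (e i t) + scl G (yop i j (k - 1) t)"
    using Suc.IH[OF Suc.prems] by (simp add: y_def G_def q_def m_def c_def)
  have 2: "e i (yop i j k (f i t)) = yop i j k (f i (e i t)) + scl (q_int q m) y + scl (q powi 2 * G) (yop i j (k - 1) (f i t))"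
    using Suc.IH[OF ft] unfolding eft yop_simps
    by (simp add: y_def G_def q_def m_def c_def cart q.q_add q.q_diff power_int_minus field_simps)
  have "homog wt (\<mu> - al j - zmul (int k) (al i)) y"
    unfolding y_def using assms Suc.prems by (intro wt_yop)
  from comm[OF assms(1,1) this]
  have 3: "e i (f i y) = f i (e i y) + scl (q_int q (m + (c - 2 * int k))) y"
    by (simp add: q_def m_def c_def cart algebra_simps)
  \<comment> \<open>For positive k this is the recursion that defines \<open>y\<close> from the
    previous iterate. For k = 0, where \<open>k - 1\<close> is again 0, both sides vanish with the
    factor [k] in \<open>G\<close>.\<close>
  have 4: "scl G (f i (yop i j (k - 1) t)) - scl (q powi (c - 2 * int k)) (scl (q powi 2 * G) (yop i j (k - 1) (f i t))) = scl G y"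
  proof (cases k)
    case 0
    then show ?thesis by (simp add: G_def q_def)
  next
    case (Suc l)
    have "q powi (c - 2 * int k) * (q powi 2 * G) = G * q powi (c - 2 * int l)"
      unfolding Suc using q.q_nonzero by (simp add: q_def power_int_add power_int_diff power_int_mult_distrib field_simps)
    then show ?thesis
      unfolding y_def Suc by (simp add: pm.scale_right_diff_distrib q_def c_def)
  qed
  \<comment> \<open>\<open>q_int_shift\<close> merges the two twisted commutators into one quantum
    integer, and \<open>q_int_string\<close> adds it to the scalar of the previous step.\<close>
  have 5: "G + q_int q (m + (c - 2 * int k)) - q powi (c - 2 * int k) * q_int q m =
      q powi (- m) * q_int q (int k + 1) * q_int q (c - int k)"
    using q.q_int_shift[of m "c - 2 * int k"] q.q_int_string[of "int k" c]
    unfolding q_def[symmetric] G_def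
    by (simp add: algebra_simps) (metis distrib_left mult.left_commute)
  have "e i (yop i j (Suc k) t) = e i (f i y) - scl (q powi (c - 2 * int k)) (e i (yop i j k (f i t)))"
    by (simp add: e_simps y_def q_def c_def)
  also have "\<dots> = (f i (yop i j k (e i t)) - scl (q powi (c - 2 * int k)) (yop i j k (f i (e i t)))) +
     (scl G (f i (yop i j (k - 1) t)) - scl (q powi (c - 2 * int k)) (scl (q powi 2 * G) (yop i j (k - 1) (f i t)))) +
     scl (q_int q (m + (c - 2 * int k)) - q powi (c - 2 * int k) * q_int q m) y"
    unfolding 3 2 1 by (simp add: f_simps algebra_simps pm.scale_right_diff_distrib pm.scale_right_distrib pm.scale_left_diff_distrib)
  also have "\<dots> = yop i j (Suc k) (e i t) + scl (G + q_int q (m + (c - 2 * int k)) - q powi (c - 2 * int k) * q_int q m) y"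
    unfolding 4 by (simp add: q_def c_def pm.scale_left_distrib pm.scale_left_diff_distrib)
  finally have final: "e i (yop i j (Suc k) t) = yop i j (Suc k) (e i t) + scl (G + q_int q (m + (c - 2 * int k)) - q powi (c - 2 * int k) * q_int q m) y" .
  have idx: "c - int k = 1 - cart i j - int (Suc k)" "int k + 1 = int (Suc k)"
    by (simp_all add: c_def)
  from final show ?case
    unfolding 5 idx by (simp only: y_def q_def m_def diff_Suc_1)
qed

text \<open>The two products come from the two powers of \<open>K\<close> in the commutator of
  \<open>e j\<close> and \<open>f j\<close>. The first acquires a zero factor once k exceeds
  \<open>- cart i j\<close>, the second for every positive k.\<close>

lemma e_yop_second:
  assumes "i \<in> I" "j \<in> I" "i \<noteq> j"
  shows "homog wt \<mu> t \<Longrightarrow> e j (yop i j k t) = yop i j k (e j t) +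
    scl (((\<Prod>l<k. 1 - vi D i powi (- 2 * cart i j - 2 * int l)) * vi D j powi (pr j \<mu>) -
      (\<Prod>l<k. 1 - vi D i powi (- 2 * int l)) * vi D j powi (- pr j \<mu>)) / (vi D j - inverse (vi D j)))
      ((f i ^^ k) t)"
proof (induction k arbitrary: \<mu> t)
  case 0
  then show ?case using assms comm[of j j \<mu> t] by (simp add: q_int_def)
next
  case (Suc k)
  interpret q: quantum_base "vi D i" using assms(1) by (rule quantum_base_vi)
  interpret qj: quantum_base "vi D j" using assms(2) by (rule quantum_base_vi)
  define c where "c = - cart i j"
  define A B where "A k = (\<Prod>l<k. 1 - vi D i powi (- 2 * cart i j - 2 * int l))"
    and "B k = (\<Prod>l<k. 1 - vi D i powi (- 2 * int l))" for k
  define x where "x = vi D j powi (pr j \<mu>)"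
  define H where "H x k = (A k * x - B k / x) / (vi D j - inverse (vi D j))" for x k
  have x: "vi D j powi (- pr j \<mu>) = 1 / x" "x \<noteq> 0"
    by (simp_all add: x_def power_int_minus field_simps)
  have "vi D j powi (pr j (\<mu> - al i)) = x * vi D j powi (- cart j i)"
    by (simp add: x_def power_int_diff power_int_minus field_simps)
  \<comment> \<open>Symmetrizability of the Cartan matrix converts the base \<open>vi D j\<close>
    into \<open>vi D i\<close>.\<close>
  also have "vi D j powi (- cart j i) = vi D i powi c"
    using cart_sym[OF assms(1,2)] by (simp add: vi_powi c_def)
  finally have x': "vi D j powi (pr j (\<mu> - al i)) = x * vi D i powi c" .
  have ft: "homog wt (\<mu> - al i) (f i t)" using assms(1) Suc.prems by (rule wt_f)
  have ejfi: "homog wt \<nu> s \<Longrightarrow> e j (f i s) = f i (e j s)" for \<nu> s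
    using comm[of j i \<nu> s] assms by auto
  have 1: "e j (yop i j k t) = yop i j k (e j t) + scl (H x k) ((f i ^^ k) t)"
    using Suc.IH[OF Suc.prems] x by (simp add: H_def A_def B_def x_def)
  have "vi D j powi (- pr j (\<mu> - al i)) = 1 / (x * vi D i powi c)"
    unfolding power_int_minus x' by (simp add: field_simps)
  then have 2: "e j (yop i j k (f i t)) = yop i j k (f i (e j t)) + scl (H (x * vi D i powi c) k) ((f i ^^ Suc k) t)"
    using Suc.IH[OF ft] ejfi[OF Suc.prems] x' by (simp add: H_def A_def B_def funpow_swap1)
  have 3: "e j (f i (yop i j k t)) = f i (e j (yop i j k t))"
    by (rule ejfi) (rule wt_yop[OF assms(1,2) Suc.prems])
  have 4: "H x k - vi D i powi (c - 2 * int k) * H (x * vi D i powi c) k = H x (Suc k)"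
  proof -
    have AS: "A (Suc k) = A k * (1 - vi D i powi (c - 2 * int k) * vi D i powi c)"
      by (simp add: A_def c_def flip: q.q_add)
    have BS: "B (Suc k) = B k * (1 - vi D i powi (c - 2 * int k) / vi D i powi c)"
      by (simp add: B_def flip: q.q_diff)
    have "A k * x - B k / x - vi D i powi (c - 2 * int k) * (A k * (x * vi D i powi c) - B k / (x * vi D i powi c))
        = A (Suc k) * x - B (Suc k) / x"
      unfolding AS BS using x(2) by (simp add: field_simps)
    then show ?thesis
      unfolding H_def by (simp flip: diff_divide_distrib)
  qed
  have "e j (yop i j (Suc k) t) = f i (yop i j k (e j t)) + scl (H x k) ((f i ^^ Suc k) t)
      - scl (vi D i powi (c - 2 * int k)) (yop i j k (f i (e j t)) + scl (H (x * vi D i powi c) k) ((f i ^^ Suc k) t))"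
    by (simp add: e_simps c_def 3 1 2[unfolded c_def] f_simps)
  also have "\<dots> = yop i j (Suc k) (e j t) + scl (H x (Suc k)) ((f i ^^ Suc k) t)"
    unfolding 4[symmetric] by (simp add: c_def pm.scale_right_distrib pm.scale_left_diff_distrib)
  finally show ?case
    by (simp add: H_def x A_def B_def) (simp add: x_def)
qed

lemma e_yop_other:
  assumes "i \<in> I" "j \<in> I" "l \<in> I" "l \<noteq> i" "l \<noteq> j"
  shows "homog wt \<mu> t \<Longrightarrow> e l (yop i j k t) = yop i j k (e l t)"
proof (induction k arbitrary: \<mu> t)
  case 0
  then show ?case using assms comm[of l j \<mu> t] by simp
next
  case (Suc k)
  have "e l (f i (yop i j k t)) = f i (e l (yop i j k t))"
    using comm[OF assms(3,1) wt_yop[OF assms(1,2) Suc.prems]] assms(4) by simp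
  moreover have "e l (f i t) = f i (e l t)"
    using comm[OF assms(3,1) Suc.prems] assms(4) by simp
  ultimately show ?case
    using Suc.IH[OF Suc.prems] Suc.IH[OF wt_f[OF assms(1) Suc.prems]] by (simp add: e_simps)
qed

definition ser_len :: "'i \<Rightarrow> 'i \<Rightarrow> nat" where
  "ser_len i j = nat (1 - cart i j)"

text \<open>At the Serre index every correction term carries a vanishing scalar. Serre elements thus
  commute with all raising operators, so dividing a free module by them is compatible with the
  raising action.\<close>

lemma e_yop_serre:
  assumes "i \<in> I" "j \<in> I" "l \<in> I" "i \<noteq> j"
  shows "e l (yop i j (ser_len i j) t) = yop i j (ser_len i j) (e l t)"
proof (rule lmap_eqI[OF lmap_comp[OF lmap_e lmap_yop] lmap_comp[OF lmap_yop lmap_e]])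
  fix b
  have h: "homog wt (wt b) (mon b)" by simp
  have n: "int (ser_len i j) = 1 - cart i j"
    using cart_le_0[OF assms(1,2,4)] by (simp add: ser_len_def)
  interpret q: quantum_base "vi D i" using assms(1) by (rule quantum_base_vi)
  consider "l = i" | "l = j" | "l \<noteq> i" "l \<noteq> j" by blast
  then show "e l (yop i j (ser_len i j) (mon b)) = yop i j (ser_len i j) (e l (mon b))"
  proof cases
    case 1
    then show ?thesis using e_yop_same[OF assms(1,2,4) h] n by simp
  next
    case 2
    have "nat (- cart i j) < ser_len i j" "0 < ser_len i j"
      using cart_le_0[OF assms(1,2,4)] by (auto simp: ser_len_def)
    then have "\<exists>l\<in>{..<ser_len i j}. 1 - vi D i powi (- 2 * cart i j - 2 * int l) = 0"
      "\<exists>l\<in>{..<ser_len i j}. 1 - vi D i powi (- 2 * int l) = 0"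
      using cart_le_0[OF assms(1,2,4)] by (force intro!: bexI[of _ "nat (- cart i j)"], force intro!: bexI[of _ 0])
    then have prods: "(\<Prod>l<ser_len i j. 1 - vi D i powi (- 2 * cart i j - 2 * int l)) = 0"
      "(\<Prod>l<ser_len i j. 1 - vi D i powi (- 2 * int l)) = 0"
      by (simp_all add: prod_zero_iff)
    show ?thesis using e_yop_second[OF assms(1,2,4) h, of "ser_len i j", unfolded prods] 2 by simp
  next
    case 3
    then show ?thesis using e_yop_other[OF assms(1,2,3) _ _ h] by simp
  qed
qed

text \<open>The q-binomial expansion of an iterated twisted commutator. At k = 1 -
  \<open>cart i j\<close> the power of \<open>vi D i\<close> disappears, and the sum becomes the
  Serre element up to a q-factorial.\<close>

lemma yop_expand:
  assumes "i \<in> I"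
  shows "yop i j k t = (\<Sum>s\<le>k. scl ((- 1) ^ s * vi D i powi (int s * (1 - cart i j - int k)) * quantum_base.q_binom (vi D i) k s)
    ((f i ^^ (k - s)) (f j ((f i ^^ s) t))))"
proof (induction k arbitrary: t)
  case 0
  interpret q: quantum_base "vi D i" using assms(1) by (rule quantum_base_vi)
  show ?case by simp
next
  case (Suc k)
  interpret q: quantum_base "vi D i" using assms(1) by (rule quantum_base_vi)
  define q n where "q = vi D i" and "n = 1 - cart i j"
  define z where "z s = (f i ^^ (Suc k - s)) (f j ((f i ^^ s) t))" for s
  define C where "C k s = (- 1) ^ s * q powi (int s * (n - int k)) * q.q_binom k s" for k s
  have IH: "yop i j k t = (\<Sum>s\<le>k. scl (C k s) ((f i ^^ (k - s)) (f j ((f i ^^ s) t))))" for t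
    using Suc by (simp add: C_def q_def n_def)
  have 1: "f i (yop i j k t) = (\<Sum>s\<le>k. scl (C k s) (z s))"
    unfolding IH f_simps z_def by (intro sum.cong) (simp_all add: Suc_diff_le)
  also have "\<dots> = (\<Sum>s\<le>Suc k. scl (C k s) (z s))"
    by (simp add: C_def q.q_binom_def)
  also have "\<dots> = scl (C k 0) (z 0) + (\<Sum>s\<le>k. scl (C k (Suc s)) (z (Suc s)))"
    by (rule sum.atMost_Suc_shift)
  finally have 1: "f i (yop i j k t) = \<dots>" .
  have 2: "yop i j k (f i t) = (\<Sum>s\<le>k. scl (C k s) (z (Suc s)))"
    unfolding IH z_def by (intro sum.cong) (simp_all add: funpow_swap1)
  have 3: "C k (Suc s) - q powi (n - 1 - 2 * int k) * C k s = C (Suc k) (Suc s)" for s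
  proof -
    define x where "x = q powi (int s * (n - int k))"
    have e: "q powi (int (Suc s) * (n - int k)) = x * q powi (n - int k)"
      "q powi (int (Suc s) * (n - int (Suc k))) = x * q powi (n - int k) / q powi (int s + 1)"
      "q powi (n - 1 - 2 * int k) = q powi (n - int k) / q powi (int s + 1) * q powi (int s - int k)"
      unfolding x_def q_def q.q_add[symmetric] q.q_diff[symmetric]
      by (rule arg_cong[of _ _ "(powi) (vi D i)"]; simp add: algebra_simps)+
    have nz: "q powi (int s + 1) \<noteq> 0" by (simp add: q_def)
    show ?thesis
      unfolding C_def e q.q_binom_Suc unfolding q_def[symmetric] x_def[symmetric] using nz by (simp add: field_simps)
  qed
  have "yop i j (Suc k) t = f i (yop i j k t) - scl (q powi (n - 1 - 2 * int k)) (yop i j k (f i t))"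
    by (simp add: q_def n_def)
  also have "\<dots> = scl (C k 0) (z 0) + (\<Sum>s\<le>k. scl (C k (Suc s) - q powi (n - 1 - 2 * int k) * C k s) (z (Suc s)))"
    unfolding 1 2 by (simp add: pm.scale_sum_right pm.scale_left_diff_distrib sum_subtractf)
  also have "\<dots> = scl (C (Suc k) 0) (z 0) + (\<Sum>s\<le>k. scl (C (Suc k) (Suc s)) (z (Suc s)))"
    unfolding 3 by (simp add: C_def)
  also have "\<dots> = (\<Sum>s\<le>Suc k. scl (C (Suc k) s) (z s))"
    by (rule sum.atMost_Suc_shift[symmetric])
  finally show ?case
    by (simp only: C_def z_def q_def n_def)
qed

lemma act_gen_pow: "act f (gen i ^ n) t = (f i ^^ n) t"
  by (induction n) (simp_all add: act_mult[OF lmap_f])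

lemma act_serre:
  assumes "i \<in> I" "j \<in> I" "i \<noteq> j"
  shows "act f (serre D i j (gen i) (gen j)) t = scl (inverse (q_fact (vi D i) (ser_len i j))) (yop i j (ser_len i j) t)"
proof -
  interpret q: quantum_base "vi D i" using assms(1) by (rule quantum_base_vi)
  define n where "n = ser_len i j"
  have n: "int n = 1 - cart i j"
    using cart_le_0[OF assms] by (simp add: ser_len_def n_def)
  have set: "{(s, s'). int s + int s' = 1 - cart i j} = (\<lambda>s. (n - s, s)) ` {..n}"
    using n by force
  have m1: "act f (((- 1) :: 'i word \<Rightarrow>\<^sub>0 qv) ^ s) t = scl ((- 1) ^ s) t" for s t
    by (induction s) (simp_all add: act_mult[OF lmap_f] lmap_uminus[OF lmap_act1])
  have "act f (serre D i j (gen i) (gen j)) t =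
      (\<Sum>s\<le>n. act f ((- 1) ^ s * scl (inverse (q_fact (vi D i) (n - s))) (gen i ^ (n - s)) * gen j * scl (inverse (q_fact (vi D i) s)) (gen i ^ s)) t)"
    unfolding serre_def set divpow_free_algebra
    by (subst sum.reindex) (auto simp: inj_on_def lmap_sum[OF lmap_act1])
  also have "\<dots> = (\<Sum>s\<le>n. scl (inverse (q_fact (vi D i) n)) (scl ((- 1) ^ s * q.q_binom n s) ((f i ^^ (n - s)) (f j ((f i ^^ s) t)))))"
    by (intro sum.cong)
       (simp_all add: act_mult[OF lmap_f] m1 lmap_scl[OF lmap_act1] lmap_scl[OF lmap_act2[of f, OF lmap_f]] act_gen_pow
         f_simps lmap_scl[OF lmap_funpow[OF lmap_f]] q.q_binom_def field_simps)
  also have "\<dots> = scl (inverse (q_fact (vi D i) n)) (yop i j n t)"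
    unfolding yop_expand[OF assms(1)] by (simp add: pm.scale_sum_right flip: n)
  finally show ?thesis by (simp add: n_def)
qed

end

text \<open>The module that is meant is the quotient by \<open>N\<close>; membership in
  \<open>N\<close> plays the role of being zero. \<open>N_filt\<close> makes \<open>N\<close> a
  graded subspace, so that the quotient decomposes into weight spaces.\<close>

locale umod_sub = umod D wt e f
  for D :: "('i, 'x :: ab_group_add, 'y :: ab_group_add) root_data" and wt :: "'b \<Rightarrow> 'x" and e f +
  fixes N :: "('b \<Rightarrow>\<^sub>0 qv) set"
  assumes N_subspace: "pm.subspace N"
    and N_e: "i \<in> I \<Longrightarrow> t \<in> N \<Longrightarrow> e i t \<in> N"
    and N_f: "i \<in> I \<Longrightarrow> t \<in> N \<Longrightarrow> f i t \<in> N"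
    and N_filt: "t \<in> N \<Longrightarrow> filt (\<lambda>b. wt b = \<mu>) t \<in> N"
begin

lemmas N_simps = pm.subspace_0[OF N_subspace] pm.subspace_add[OF N_subspace]
  pm.subspace_diff[OF N_subspace] pm.subspace_scale[OF N_subspace]

lemma N_scl_iff: "c \<noteq> 0 \<Longrightarrow> scl c t \<in> N \<longleftrightarrow> t \<in> N"
  using N_simps(4)[of "scl c t" "inverse c"] N_simps(4)[of t c] by auto

lemma umod_sub_swap: "umod_sub D (\<lambda>b. - wt b) f e N"
proof -
  interpret sw: umod D "\<lambda>b. - wt b" f e by (rule umod_swap)
  show ?thesis
  proof
    fix t \<mu> assume "t \<in> N"
    have "(\<lambda>b. wt b = - \<mu>) = (\<lambda>b. - wt b = \<mu>)"
      by (auto simp: fun_eq_iff)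
    with N_filt[OF \<open>t \<in> N\<close>, of "- \<mu>"] show "filt (\<lambda>b. - wt b = \<mu>) t \<in> N"
      by (simp only:)
  qed (rule N_subspace N_e N_f; assumption)+
qed

lemma N_yop: "i \<in> I \<Longrightarrow> j \<in> I \<Longrightarrow> t \<in> N \<Longrightarrow> yop i j k t \<in> N"
  by (induction k arbitrary: t) (auto intro!: N_f N_simps)

lemma N_f_pow: "i \<in> I \<Longrightarrow> t \<in> N \<Longrightarrow> (f i ^^ k) t \<in> N"
  by (induction k) (auto intro: N_f)

definition weights :: "'x set" where
  "weights = {\<mu>. \<exists>t. homog wt \<mu> t \<and> t \<notin> N}"

text \<open>Finitely many weights force the Serre relations: a large iterate of the adjoint action vanishes,
  and commutators with \<open>e\<^sub>i\<close> lead back to the Serre element by nonzero scalars.\<close>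
lemma yop_serre_mem:
  assumes "finite weights" "i \<in> I" "j \<in> I" "i \<noteq> j"
  shows "yop i j (ser_len i j) t \<in> N"
proof -
  interpret q: quantum_base "vi D i" using assms(2) by (rule quantum_base_vi)
  define c where "c = - cart i j"
  have c: "c \<ge> 0" using cart_le_0[OF assms(2-4)] by (simp add: c_def)
  obtain C where C: "\<And>\<mu>. \<mu> \<in> weights \<Longrightarrow> \<bar>pr i \<mu>\<bar> \<le> C"
  proof -
    have "\<bar>pr i \<mu>\<bar> \<le> Max ((\<lambda>\<mu>. \<bar>pr i \<mu>\<bar>) ` weights)" if "\<mu> \<in> weights" for \<mu>
      using assms(1) that by (intro Max_ge) auto
    then show ?thesis by (rule that)
  qed
  \<comment> \<open>The operator \<open>yop i j k\<close> lowers the i-th coordinate of a weight by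
    2 k - c; beyond the width 2 C of the range of weights it must vanish on the quotient.\<close>
  have large: "yop i j k t \<in> N" if t: "homog wt \<mu> t" and k: "2 * int k > 2 * \<bar>C\<bar> + c" for k \<mu> t
  proof (rule ccontr)
    assume *: "yop i j k t \<notin> N"
    then have "t \<notin> N" using N_yop assms by blast
    then have "\<mu> \<in> weights" using t by (auto simp: weights_def)
    moreover have "\<mu> - al j - zmul (int k) (al i) \<in> weights"
      using * wt_yop[OF assms(2,3) t, of k] by (auto simp: weights_def)
    ultimately have "\<bar>pr i \<mu>\<bar> \<le> C" "\<bar>pr i \<mu> + c - 2 * int k\<bar> \<le> C"
      using C[of \<mu>] C[of "\<mu> - al j - zmul (int k) (al i)"] cart_diag[OF assms(2)] by (auto simp: c_def algebra_simps)
    with k c show False by linarith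
  qed
  define n where "n = ser_len i j"
  have n: "int n = c + 1" using c by (simp add: n_def ser_len_def c_def)
  have "\<forall>\<mu> t. homog wt \<mu> t \<longrightarrow> yop i j k t \<in> N" if "n \<le> k" "k \<le> K" "2 * int K > 2 * \<bar>C\<bar> + c" for k K
    using that(2,1)
  proof (induction k rule: inc_induct)
    case base
    show ?case using large that(3) by blast
  next
    case (step k)
    show ?case
    proof (intro allI impI)
      fix \<mu> t assume t: "homog wt \<mu> t"
      define a where "a = vi D i powi (- pr i \<mu>) * q_int (vi D i) (int (Suc k)) * q_int (vi D i) (1 - cart i j - int (Suc k))"
      \<comment> \<open>Here k is at least n = c + 1, so neither k + 1 nor c - k is zero.\<close>
      have "a \<noteq> 0"
        using n step.prems unfolding a_def by (simp add: q.q_int_eq_0 c_def)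
      have IH: "homog wt \<nu> u \<Longrightarrow> yop i j (Suc k) u \<in> N" for \<nu> u
        using step.IH step.prems by simp
      have "e i (yop i j (Suc k) t) \<in> N"
        by (rule N_e[OF assms(2) IH[OF t]])
      moreover have "yop i j (Suc k) (e i t) \<in> N"
        by (rule IH[OF wt_e[OF assms(2) t]])
      ultimately have "e i (yop i j (Suc k) t) - yop i j (Suc k) (e i t) \<in> N"
        by (rule N_simps)
      also have "e i (yop i j (Suc k) t) - yop i j (Suc k) (e i t) = scl a (yop i j k t)"
        using e_yop_same[OF assms(2-4) t, of "Suc k"] unfolding a_def[symmetric] by simp
      finally have "scl a (yop i j k t) \<in> N" .
      with \<open>a \<noteq> 0\<close> show "yop i j k t \<in> N" by (simp add: N_scl_iff)
    qed
  qed
  from this[of n "n + nat (\<bar>C\<bar> + c + 1)"] c have "\<forall>\<mu> t. homog wt \<mu> t \<longrightarrow> yop i j n t \<in> N"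
    by simp
  then have "yop i j n (mon b) \<in> N" for b
    using homog_mon[of wt "wt b" b] by blast
  then show ?thesis
    unfolding n_def[symmetric] by (rule lmap_mem[OF lmap_yop N_subspace])
qed

text \<open>A factor \<open>f i\<close> in front of \<open>yop i j k\<close> either raises k or
  moves on to the argument. After n - k raises the iterate vanishes, after M moves the argument
  does; this bounds the exponent. It is how the Serre relations let nilpotency propagate along
  words.\<close>

lemma f_pow_nilpotent_step:
  assumes "i \<in> I" "j \<in> I" "\<And>t. yop i j n t \<in> N"
  shows "(f i ^^ M) t \<in> N \<Longrightarrow> k \<le> n \<Longrightarrow> (n - k) + M \<le> m \<Longrightarrow> (f i ^^ m) (yop i j k t) \<in> N"
proof (induction m arbitrary: k M t)
  case 0
  then have "k = n" by simp
  then show ?case using assms(3) by simp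
next
  case (Suc m)
  show ?case
  proof (cases "M = 0 \<or> k = n")
    case True
    then have "yop i j k t \<in> N"
      using Suc.prems assms N_yop by auto
    then show ?thesis using assms(1) by (rule N_f_pow[rotated])
  next
    case False
    define c where "c = vi D i powi (- cart i j - 2 * int k)"
    have "f i (yop i j k t) = yop i j (Suc k) t + scl c (yop i j k (f i t))"
      by (simp add: c_def)
    then have "(f i ^^ Suc m) (yop i j k t) = (f i ^^ m) (yop i j (Suc k) t) + scl c ((f i ^^ m) (yop i j k (f i t)))"
      by (simp only: funpow_Suc_right comp_def lmap_simps[OF lmap_funpow[OF lmap_f]])
    moreover have "(f i ^^ m) (yop i j (Suc k) t) \<in> N"
      using Suc.prems False by (intro Suc.IH[of M]) auto
    moreover have "(f i ^^ m) (yop i j k (f i t)) \<in> N"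
    proof (rule Suc.IH[of "M - 1"])
      have "(f i ^^ (M - 1)) (f i t) = (f i ^^ Suc (M - 1)) t"
        by (simp only: funpow_Suc_right comp_def)
      moreover have "Suc (M - 1) = M"
        using False by simp
      ultimately show "(f i ^^ (M - 1)) (f i t) \<in> N"
        using Suc.prems(1) by (simp only:)
    qed (use Suc.prems False in auto)
    ultimately show ?thesis
      by (auto intro!: N_simps)
  qed
qed

text \<open>The string formula of rank one, with an error term because \<open>e i z\<close> is zero
  only modulo \<open>N\<close>.\<close>

lemma f_string:
  assumes "i \<in> I" "homog wt \<mu> z" "e i z \<in> N"
  shows "\<exists>r\<in>N. e i ((f i ^^ Suc k) z) = scl (q_int (vi D i) (int k + 1) * q_int (vi D i) (pr i \<mu> - int k)) ((f i ^^ k) z) + r"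
proof (induction k)
  case 0
  interpret q: quantum_base "vi D i" using assms(1) by (rule quantum_base_vi)
  show ?case
    using comm[OF assms(1,1,2)] N_f[OF assms(1,3)] by (auto simp: add.commute intro!: bexI[of _ "f i (e i z)"])
next
  case (Suc k)
  interpret q: quantum_base "vi D i" using assms(1) by (rule quantum_base_vi)
  from Suc obtain r where r: "r \<in> N" "e i ((f i ^^ Suc k) z) =
      scl (q_int (vi D i) (int k + 1) * q_int (vi D i) (pr i \<mu> - int k)) ((f i ^^ k) z) + r"
    by blast
  have "e i ((f i ^^ Suc (Suc k)) z) = f i (e i ((f i ^^ Suc k) z)) +
      scl (q_int (vi D i) (pr i \<mu> - 2 * int (Suc k))) ((f i ^^ Suc k) z)"
    using comm[OF assms(1,1) wt_f_pow[OF assms(1,2), of "Suc k"]] cart_diag[OF assms(1)] by (simp add: mult.commute)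
  also have "\<dots> = scl (q_int (vi D i) (int (Suc k)) * q_int (vi D i) (pr i \<mu> - int (Suc k) + 1) +
       q_int (vi D i) (pr i \<mu> - 2 * int (Suc k))) ((f i ^^ Suc k) z) + f i r"
    unfolding r(2) f_simps pm.scale_left_distrib by (simp add: add.commute)
  finally show ?case
    unfolding q.q_int_string using N_f[OF assms(1) r(1)] by blast
qed

text \<open>Below a vector killed by \<open>e i\<close>, the operator \<open>e i\<close> leads each
  string vector back to the previous one with the scalar of \<open>f_string\<close>, which is
  nonzero while k is below the coordinate of the weight.\<close>

lemma f_string_not_mem:
  assumes "i \<in> I" "homog wt \<mu> z" "e i z \<in> N" "z \<notin> N"
  shows "int k \<le> pr i \<mu> \<Longrightarrow> (f i ^^ k) z \<notin> N"
proof (induction k)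
  case 0
  then show ?case using assms(4) by simp
next
  case (Suc k)
  interpret q: quantum_base "vi D i" using assms(1) by (rule quantum_base_vi)
  from f_string[OF assms(1-3), of k] obtain r where r: "r \<in> N"
    "e i ((f i ^^ Suc k) z) = scl (q_int (vi D i) (int k + 1) * q_int (vi D i) (pr i \<mu> - int k)) ((f i ^^ k) z) + r"
    by blast
  show ?case
  proof
    assume "(f i ^^ Suc k) z \<in> N"
    then have "e i ((f i ^^ Suc k) z) - r \<in> N"
      using r(1) assms(1) by (intro N_simps N_e)
    then show False
      using Suc r by (simp add: N_scl_iff q.q_int_eq_0)
  qed
qed

text \<open>Climb with \<open>e i\<close> to the top z of the string, k steps up, and come down k +
  \<open>pr i \<mu>\<close> steps. The weight of z has i-th coordinate \<open>pr i \<mu>\<close> + 2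
  k, so the string below z is long enough.\<close>

lemma reflection_weight_nonneg:
  assumes "i \<in> I" "\<And>t. \<exists>M. (e i ^^ M) t \<in> N" "\<mu> \<in> weights" "pr i \<mu> \<ge> 0"
  shows "reflection D i \<mu> \<in> weights"
proof -
  obtain t where t: "homog wt \<mu> t" "t \<notin> N"
    using assms(3) by (auto simp: weights_def)
  define M where "M = (LEAST M. (e i ^^ M) t \<in> N)"
  have M: "(e i ^^ M) t \<in> N"
    unfolding M_def using assms(2) by (rule LeastI_ex)
  then have "M \<noteq> 0" using t(2) by (intro notI) simp
  then obtain k where k: "M = Suc k" by (cases M) auto
  define z where "z = (e i ^^ k) t"
  have "z \<notin> N"
    unfolding z_def using not_less_Least[of k "\<lambda>M. (e i ^^ M) t \<in> N"] k by (simp add: M_def)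
  have ez: "e i z \<in> N" using M by (simp add: k z_def)
  have hz: "homog wt (\<mu> + zmul (int l) (al i)) ((e i ^^ l) t)" for l
  proof (induction l)
    case (Suc l)
    from wt_e[OF assms(1) this] show ?case by (simp add: zmul_add algebra_simps)
  qed (simp add: t)
  have "pr i (\<mu> + zmul (int k) (al i)) = pr i \<mu> + 2 * int k"
    using cart_diag[OF assms(1)] by simp
  then have "int (k + nat (pr i \<mu>)) \<le> pr i (\<mu> + zmul (int k) (al i))"
    using assms(4) by linarith
  then have "(f i ^^ (k + nat (pr i \<mu>))) z \<notin> N"
    by (rule f_string_not_mem[OF assms(1) hz[of k, folded z_def] ez \<open>z \<notin> N\<close>])
  moreover have "homog wt (\<mu> + zmul (int k) (al i) - zmul (int (k + nat (pr i \<mu>))) (al i)) ((f i ^^ (k + nat (pr i \<mu>))) z)"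
    using hz[of k] unfolding z_def[symmetric] by (rule wt_f_pow[OF assms(1)])
  moreover have "\<mu> + zmul (int k) (al i) - zmul (int (k + nat (pr i \<mu>))) (al i) = reflection D i \<mu>"
    using assms(4) by (simp add: reflection_def zmul_add)
  ultimately show ?thesis
    by (auto simp: weights_def)
qed

lemma reflection_weight:
  assumes "i \<in> I" "\<And>t. \<exists>M. (e i ^^ M) t \<in> N" "\<And>t. \<exists>M. (f i ^^ M) t \<in> N" "\<mu> \<in> weights"
  shows "reflection D i \<mu> \<in> weights"
proof (cases "pr i \<mu> \<ge> 0")
  case True
  then show ?thesis using reflection_weight_nonneg assms by blast
next
  case False
  interpret sw: umod_sub D "\<lambda>b. - wt b" f e N by (rule umod_sub_swap)
  have sw_weights: "sw.weights = uminus ` weights"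
    unfolding sw.weights_def weights_def homog_neg by (auto simp: image_iff) (metis minus_minus)+
  have "reflection D i (- \<mu>) \<in> sw.weights"
    using assms False by (intro sw.reflection_weight_nonneg) (auto simp: sw_weights)
  moreover have "reflection D i (- \<mu>) = - reflection D i \<mu>"
    by (simp add: reflection_def zmul_minus)
  ultimately show ?thesis
    by (auto simp: sw_weights)
qed

end

section \<open>Integrable highest weight modules\<close>

lemma act_left_mult: "act (\<lambda>i t. gen i * t) p t = p * t"
proof (rule lmap_eqI[OF lmap_act1 lmap_mult_right])
  have "foldr (\<lambda>i t. gen i * t) w t = mon (Word w) * t" for w
    by (induction w) (simp_all add: gen_mult_mon[symmetric] mult.assoc)
  then show "act (\<lambda>i t. gen i * t) (mon k) t = mon k * t" for k
    by (cases k) simp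
qed

context finite_root_datum
begin

definition wsum :: "'i word \<Rightarrow> 'x" where
  "wsum w = sum_list (map al (letters w))"

lemma wsum_simps [simp]: "wsum (Word []) = 0" "wsum (Word (i # w)) = al i + wsum (Word w)"
  by (simp_all add: wsum_def)

definition vwt :: "'x \<Rightarrow> 'i word \<Rightarrow> 'x" where
  "vwt b w = b - wsum w"

lemma vwt_Cons: "vwt b (Word (j # w)) = vwt b (Word w) - al j"
  by (simp add: vwt_def algebra_simps)

text \<open>The raising operator on a Verma module whose basis consists of all words in the lowering
  letters: it is commuted past the first letter and kills the empty word. The weight in the
  commutator is that of the remaining word.\<close>

primrec eword :: "'x \<Rightarrow> 'i \<Rightarrow> 'i list \<Rightarrow> 'i word \<Rightarrow>\<^sub>0 qv" where
  "eword b l [] = 0"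
| "eword b l (j # w) = gen j * eword b l w +
    (if l = j then scl (q_int (vi D l) (pr l (vwt b (Word w)))) (mon (Word w)) else 0)"

definition ve :: "'x \<Rightarrow> 'i \<Rightarrow> ('i word \<Rightarrow>\<^sub>0 qv) \<Rightarrow> ('i word \<Rightarrow>\<^sub>0 qv)" where
  "ve b l = lext (\<lambda>w. eword b l (letters w))"

abbreviation vf :: "'i \<Rightarrow> ('i word \<Rightarrow>\<^sub>0 qv) \<Rightarrow> ('i word \<Rightarrow>\<^sub>0 qv)" where
  "vf \<equiv> \<lambda>i t. gen i * t"

lemma lmap_ve: "lmap (ve b l)"
  by (simp add: ve_def lmap_lext)

lemma ve_mon [simp]: "ve b l (mon w) = eword b l (letters w)"
  by (simp add: ve_def)

lemma ve_one [simp]: "ve b l 1 = 0"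
  using ve_mon[of b l 0] by (simp del: ve_mon)

lemma gen_mult_mon': "gen j * mon w = mon (Word (j # letters w))"
  by (cases w) (simp add: gen_mult_mon)

lemma homog_vf: "homog (vwt b) \<mu> t \<Longrightarrow> homog (vwt b) (\<mu> - al j) (gen j * t)"
  by (rule homog_lmap[OF lmap_mult_left]) (auto simp: gen_mult_mon' vwt_def wsum_def)

lemma ve_gen: "homog (vwt b) \<mu> t \<Longrightarrow>
    ve b l (gen j * t) = gen j * ve b l t + (if l = j then scl (q_int (vi D l) (pr l \<mu>)) t else 0)"
proof (rule lmap_eqI[of "\<lambda>t. ve b l (gen j * t)" "\<lambda>t. gen j * ve b l t + (if l = j then scl (q_int (vi D l) (pr l \<mu>)) t else 0)"])
  show "lmap (\<lambda>t. ve b l (gen j * t))"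
    by (rule lmap_comp[OF lmap_ve lmap_mult_left])
  show "lmap (\<lambda>t. gen j * ve b l t + (if l = j then scl (q_int (vi D l) (pr l \<mu>)) t else 0))"
    by (cases "l = j") (auto intro!: lmap_plus lmap_scale lmap_id lmap_const0 lmap_comp[OF lmap_mult_left lmap_ve])
  fix w assume "homog (vwt b) \<mu> t" "w \<in> Poly_Mapping.keys t"
  then have "vwt b (Word (letters w)) = \<mu>" by (simp add: homog_def)
  then show "ve b l (gen j * mon w) = gen j * ve b l (mon w) + (if l = j then scl (q_int (vi D l) (pr l \<mu>)) (mon w) else 0)"
    by (simp add: gen_mult_mon')
qed

lemma homog_ve: "homog (vwt b) \<mu> t \<Longrightarrow> homog (vwt b) (\<mu> + al l) (ve b l t)"
proof (rule homog_lmap[OF lmap_ve])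
  have "homog (vwt b) (vwt b (Word w) + al l) (eword b l w)" for w
  proof (induction w)
    case (Cons j w)
    have "homog (vwt b) (vwt b (Word (j # w)) + al l) (gen j * eword b l w)"
      using homog_vf[OF Cons, of j] by (simp add: vwt_Cons algebra_simps)
    then show ?case
      by (auto intro!: homog_add homog_scl simp: vwt_Cons)
  qed simp
  then show "homog (vwt b) (\<mu> + al l) (ve b l (mon k))" if "vwt b k = \<mu>" for k
    using that by (cases k) auto
qed

lemma umod_verma: "umod D (vwt b) (ve b) vf"
proof
  fix i j \<mu> t assume "homog (vwt b) \<mu> t"
  then show "ve b i (gen j * t) = gen j * ve b i t + (if i = j then scl (q_int (vi D i) (pr i \<mu>)) t else 0)"
    by (rule ve_gen)
qed (auto intro: lmap_ve lmap_mult_left homog_ve homog_vf)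

section \<open>Serre elements and the integrable quotient\<close>

definition ser :: "'i \<Rightarrow> 'i \<Rightarrow> 'i word \<Rightarrow>\<^sub>0 qv" where
  "ser i j = serre D i j (gen i) (gen j)"

definition ser_gens :: "('i word \<Rightarrow>\<^sub>0 qv) set" where
  "ser_gens = {mon u * ser i j * mon w | u w i j. i \<in> I \<and> j \<in> I \<and> i \<noteq> j}"

definition bad :: "'i word \<Rightarrow> bool" where
  "bad w \<longleftrightarrow> \<not> set (letters w) \<subseteq> I"

text \<open>Words with letters outside the index set are killed as well, so that no index restriction on words is needed.\<close>
definition vgens :: "'x \<Rightarrow> ('i word \<Rightarrow>\<^sub>0 qv) set" where
  "vgens b = ser_gens \<union> {mon u * gen i ^ Suc (nat (pr i b)) | u i. i \<in> I} \<union> {mon w | w. bad w}"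

definition vN :: "'x \<Rightarrow> ('i word \<Rightarrow>\<^sub>0 qv) set" where
  "vN b = pm.span (vgens b)"

lemma vN_subspace: "pm.subspace (vN b)"
  by (simp add: vN_def)

lemma vgens_vN: "x \<in> vgens b \<Longrightarrow> x \<in> vN b"
  by (simp add: vN_def pm.span_base)

lemma bad_vgens: "bad w \<Longrightarrow> mon w \<in> vgens b"
  unfolding vgens_def by blast

lemma vgens_left: "x \<in> vgens b \<Longrightarrow> gen j * x \<in> vgens b"
proof -
  assume "x \<in> vgens b"
  then consider u i' j' w where "x = mon u * ser i' j' * mon w" "i' \<in> I" "j' \<in> I" "i' \<noteq> j'"
    | u i where "x = mon u * gen i ^ Suc (nat (pr i b))" "i \<in> I"
    | w where "x = mon w" "bad w"
    by (auto simp: vgens_def ser_gens_def)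
  then show ?thesis
  proof cases
    case 1
    then have "gen j * x = mon (Word (j # letters u)) * ser i' j' * mon w"
      by (simp add: gen_mult_mon'[symmetric] mult.assoc)
    with 1 show ?thesis unfolding vgens_def ser_gens_def by blast
  next
    case 2
    then have "gen j * x = mon (Word (j # letters u)) * gen i ^ Suc (nat (pr i b))"
      by (simp add: gen_mult_mon'[symmetric] mult.assoc)
    with 2 show ?thesis unfolding vgens_def by blast
  next
    case 3
    then show ?thesis using bad_vgens[of "Word (j # letters w)" b] by (auto simp: gen_mult_mon' bad_def)
  qed
qed

lemma vN_left: "x \<in> vN b \<Longrightarrow> gen j * x \<in> vN b"
  unfolding vN_def by (rule lmap_span[OF lmap_mult_left]) (auto intro: pm.span_base vgens_left)

lemma ser_mult_eq:
  assumes "i \<in> I" "j \<in> I" "i \<noteq> j"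
  shows "ser i j * t = scl (inverse (q_fact (vi D i) (umod.ser_len D i j))) (umod.yop D vf i j (umod.ser_len D i j) t)"
proof -
  interpret v: umod D "vwt b" "ve b" vf for b by (rule umod_verma)
  show ?thesis
    using v.act_serre[OF assms, of t] by (simp add: act_left_mult ser_def)
qed

lemma ve_ser:
  assumes "i \<in> I" "j \<in> I" "l \<in> I" "i \<noteq> j"
  shows "ve b l (ser i j * t) = ser i j * ve b l t"
proof -
  interpret v: umod D "vwt b" "ve b" vf by (rule umod_verma)
  show ?thesis
    unfolding ser_mult_eq[OF assms(1,2,4)] v.e_simps v.e_yop_serre[OF assms] ..
qed

lemma homog_ser:
  assumes "i \<in> I" "j \<in> I" "i \<noteq> j" "homog (vwt b) \<mu> t"
  shows "\<exists>\<nu>. homog (vwt b) \<nu> (ser i j * t)"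
proof -
  interpret v: umod D "vwt b" "ve b" vf by (rule umod_verma)
  show ?thesis
    unfolding ser_mult_eq[OF assms(1-3)] by (rule exI) (rule homog_scl[OF v.wt_yop[OF assms(1,2,4)]])
qed

lemma homog_mon_mult: "homog (vwt b) \<mu> t \<Longrightarrow> \<exists>\<nu>. homog (vwt b) \<nu> (mon u * t)"
proof -
  assume t: "homog (vwt b) \<mu> t"
  have "\<exists>\<nu>. homog (vwt b) \<nu> (mon (Word u) * t)" for u
  proof (induction u)
    case (Cons j u)
    then show ?case
      using homog_vf by (fastforce simp: gen_mult_mon[symmetric] mult.assoc)
  qed (use t in auto)
  then show ?thesis by (cases u) auto
qed

lemma ve_gen_pow:
  "l \<in> I \<Longrightarrow> i \<in> I \<Longrightarrow> ve b l (gen i ^ k) = (if l = i then scl (q_int (vi D i) (int k) * q_int (vi D i) (pr i b - int k + 1)) (gen i ^ (k - 1)) else 0)"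
proof (induction k)
  case (Suc k)
  interpret q: quantum_base "vi D i" using Suc.prems(2) by (rule quantum_base_vi)
  have h: "homog (vwt b) (b - zmul (int k) (al i)) (gen i ^ k)" for k
  proof (induction k)
    case (Suc k)
    from homog_vf[OF this, of i] show ?case by (simp add: zmul_add algebra_simps)
  next
    case 0
    have "homog (vwt b) b (mon (Word []) )" by (simp add: vwt_def del: mon_Nil)
    then show ?case by simp
  qed
  show ?case
  proof (cases "l = i")
    case True
    have "gen i * scl (q_int (vi D i) (int k) * q_int (vi D i) (pr i b - int k + 1)) (gen i ^ (k - 1)) =
       scl (q_int (vi D i) (int k) * q_int (vi D i) (pr i b - int k + 1)) (gen i ^ k)"
      by (cases k) (simp_all add: scl_mult_right)
    then have "ve b i (gen i ^ Suc k) = scl (q_int (vi D i) (int k) * q_int (vi D i) (pr i b - int k + 1) + q_int (vi D i) (pr i b - 2 * int k)) (gen i ^ k)"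
      using ve_gen[OF h, of i i k] Suc True cart_diag[OF Suc.prems(2)] by (simp add: pm.scale_left_distrib mult.commute)
    then show ?thesis
      unfolding q.q_int_string using True by (simp add: algebra_simps)
  next
    case False
    then show ?thesis
      using ve_gen[OF h, of l i k] Suc by simp
  qed
next
  case 0
  interpret q: quantum_base "vi D i" using 0(2) by (rule quantum_base_vi)
  show ?case by simp
qed

lemma ve_bad: "l \<in> I \<Longrightarrow> bad w \<Longrightarrow> ve b l (mon w) \<in> vN b"
proof -
  assume l: "l \<in> I"
  have all_bad: "gen j * t \<in> vN b" if "j \<notin> I" for j t
    by (rule lmap_mem[OF lmap_mult_left vN_subspace])
       (use that in \<open>auto intro!: vgens_vN bad_vgens simp: gen_mult_mon' bad_def\<close>)
  have "bad (Word w) \<Longrightarrow> eword b l w \<in> vN b" for w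
  proof (induction w)
    case (Cons j w)
    show ?case
    proof (cases "j \<in> I")
      case True
      then have "bad (Word w)" using Cons.prems by (simp add: bad_def)
      moreover from this have "mon (Word w) \<in> vN b"
        by (intro vgens_vN bad_vgens)
      ultimately show ?thesis
        using Cons.IH vN_left[of _ b j] pm.subspace_scale[OF vN_subspace] pm.subspace_0[OF vN_subspace]
        by (auto intro!: pm.subspace_add[OF vN_subspace])
    next
      case False
      then show ?thesis using l all_bad by auto
    qed
  qed (simp add: bad_def)
  then show "bad w \<Longrightarrow> ve b l (mon w) \<in> vN b"
    by (cases w) simp
qed

text \<open>Moving the raising operator through \<open>u\<close> produces commutators that are word
  multiples of \<open>z\<close>, all of them relations; only the value on \<open>z\<close> itself
  has to be known.\<close>

lemma ve_mon_mult:
  assumes "homog (vwt b) \<mu> z" "\<And>u. mon u * z \<in> vN b" "ve b l z \<in> vN b"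
  shows "ve b l (mon u * z) \<in> vN b"
proof -
  have "ve b l (mon (Word u) * z) \<in> vN b" for u
  proof (induction u)
    case (Cons j u)
    obtain \<nu> where "homog (vwt b) \<nu> (mon (Word u) * z)"
      using homog_mon_mult[OF assms(1)] by blast
    from ve_gen[OF this, of l j] show ?case
      using Cons vN_left[of _ b j] pm.subspace_scale[OF vN_subspace] pm.subspace_0[OF vN_subspace] assms(2)
      by (auto simp: gen_mult_mon[symmetric] mult.assoc intro!: pm.subspace_add[OF vN_subspace])
  qed (simp add: assms)
  then show ?thesis by (cases u) simp
qed

lemma ser_vN: "i \<in> I \<Longrightarrow> j \<in> I \<Longrightarrow> i \<noteq> j \<Longrightarrow> ser i j * t \<in> vN b"
proof (rule lmap_mem[OF lmap_mult_left vN_subspace])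
  fix w assume "i \<in> I" "j \<in> I" "i \<noteq> j"
  then have "mon 0 * ser i j * mon w \<in> vgens b"
    unfolding vgens_def ser_gens_def by blast
  then show "ser i j * mon w \<in> vN b"
    by (simp add: vgens_vN)
qed

text \<open>Serre elements commute with raising operators, and the powers are singular vectors
  because the quantum integer of \<open>pr i b - k + 1\<close> vanishes at their exponent. Dominance
  makes \<open>nat (pr i b)\<close> the true coordinate.\<close>

lemma ve_vN:
  assumes "b \<in> dominant D" "l \<in> I"
  shows "x \<in> vN b \<Longrightarrow> ve b l x \<in> vN b"
  unfolding vN_def
proof (rule lmap_span[OF lmap_ve])
  fix x assume "x \<in> vgens b"
  then consider u i j w where "x = mon u * ser i j * mon w" "i \<in> I" "j \<in> I" "i \<noteq> j"
    | u i where "x = mon u * gen i ^ Suc (nat (pr i b))" "i \<in> I"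
    | w where "x = mon w" "bad w"
    by (auto simp: vgens_def ser_gens_def)
  then have "ve b l x \<in> vN b"
  proof cases
    case 1
    have "homog (vwt b) (vwt b w) (mon w)" by simp
    then obtain \<nu> where \<nu>: "homog (vwt b) \<nu> (ser i j * mon w)"
      using homog_ser[OF 1(2-4)] by blast
    have "ve b l (mon u * (ser i j * mon w)) \<in> vN b"
    proof (rule ve_mon_mult[OF \<nu>])
      show "mon u * (ser i j * mon w) \<in> vN b" for u
        by (rule vgens_vN) (use 1 in \<open>auto simp: vgens_def ser_gens_def mult.assoc\<close>)
      show "ve b l (ser i j * mon w) \<in> vN b"
        unfolding ve_ser[OF 1(2,3) assms(2) 1(4)] by (rule ser_vN[OF 1(2-4)])
    qed
    then show ?thesis by (simp add: 1 mult.assoc)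
  next
    case 2
    interpret q: quantum_base "vi D i" using 2(2) by (rule quantum_base_vi)
    have "homog (vwt b) (vwt b 0) (mon 0)" unfolding homog_mon ..
    have "mon (Word (replicate k i)) = gen i ^ k" for k
      by (induction k) (simp_all add: gen_mult_mon[symmetric])
    then have "homog (vwt b) (vwt b (Word (replicate k i))) (gen i ^ k)" for k
      using homog_mon[of "vwt b" _ "Word (replicate k i)"] by simp
    then have "ve b l (mon u * gen i ^ Suc (nat (pr i b))) \<in> vN b"
    proof (rule ve_mon_mult)
      show "mon u * gen i ^ Suc (nat (pr i b)) \<in> vN b" for u
        by (rule vgens_vN) (use 2 in \<open>auto simp: vgens_def\<close>)
      have "ve b l (gen i ^ Suc (nat (pr i b))) = 0"
        unfolding ve_gen_pow[OF assms(2) 2(2)] using assms(1) 2(2) by (auto simp: dominant_def)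
      then show "ve b l (gen i ^ Suc (nat (pr i b))) \<in> vN b"
        using pm.subspace_0[OF vN_subspace] by (simp del: power_Suc)
    qed
    then show ?thesis by (simp add: 2)
  next
    case 3
    then show ?thesis using ve_bad assms(2) by blast
  qed
  then show "ve b l x \<in> pm.span (vgens b)" by (simp add: vN_def)
qed simp_all

lemma filt_homog: "homog d \<nu> x \<Longrightarrow> filt (\<lambda>k. d k = \<mu>) x = (if \<nu> = \<mu> then x else 0)"
  by (auto simp: homog_def intro!: filt_id filt_0)

lemma vgens_homog: "x \<in> vgens b \<Longrightarrow> \<exists>\<nu>. homog (vwt b) \<nu> x"
proof -
  assume "x \<in> vgens b"
  then consider u i j w where "x = mon u * (ser i j * mon w)" "i \<in> I" "j \<in> I" "i \<noteq> j"
    | u i where "x = mon u * gen i ^ Suc (nat (pr i b))" "i \<in> I"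
    | w where "x = mon w" "bad w"
    by (auto simp: vgens_def ser_gens_def mult.assoc)
  then show ?thesis
  proof cases
    case 1
    have "homog (vwt b) (vwt b w) (mon w)" by simp
    then show ?thesis
      using homog_ser[OF 1(2-4)] homog_mon_mult 1(1) by blast
  next
    case 2
    have "mon (Word (replicate k i)) = gen i ^ k" for k
      by (induction k) (simp_all add: gen_mult_mon[symmetric])
    then have "homog (vwt b) (vwt b (Word (replicate k i))) (gen i ^ k)" for k
      using homog_mon[of "vwt b" _ "Word (replicate k i)"] by simp
    then show ?thesis
      using homog_mon_mult 2(1) by blast
  next
    case 3
    then show ?thesis by (auto intro: exI[of _ "vwt b w"])
  qed
qed

lemma umod_sub_verma:
  assumes "b \<in> dominant D"
  shows "umod_sub D (vwt b) (ve b) vf (vN b)"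
proof -
  interpret v: umod D "vwt b" "ve b" vf by (rule umod_verma)
  show ?thesis
  proof
    fix t \<mu> assume "t \<in> vN b"
    then show "filt (\<lambda>w. vwt b w = \<mu>) t \<in> vN b"
      unfolding vN_def
    proof (rule lmap_span[OF lmap_filt, rotated 2])
      fix x assume x: "x \<in> vgens b"
      then obtain \<nu> where "homog (vwt b) \<nu> x" using vgens_homog by blast
      then show "filt (\<lambda>w. vwt b w = \<mu>) x \<in> pm.span (vgens b)"
        using x by (auto simp: filt_homog pm.span_base pm.span_zero)
    qed simp
  qed (auto intro: vN_subspace ve_vN[OF assms] vN_left)
qed

text \<open>The empty word is killed by the imposed power of the letter i. In front of a different
  letter j the Serre element bounds the number of adjoint iterates, so nilpotency passes from a word
  to its extension by j.\<close>

lemma vf_nilpotent: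
  assumes "b \<in> dominant D" "i \<in> I"
  shows "\<exists>M. (vf i ^^ M) t \<in> vN b"
proof -
  interpret v: umod_sub D "vwt b" "ve b" vf "vN b" by (rule umod_sub_verma[OF assms(1)])
  have word: "\<exists>M. (vf i ^^ M) (mon (Word w)) \<in> vN b" for w
  proof (induction w)
    case Nil
    have "(vf i ^^ k) 1 = gen i ^ k" for k
      by (induction k) simp_all
    moreover have "mon 0 * gen i ^ Suc (nat (pr i b)) \<in> vN b"
      using assms(2) unfolding vN_def vgens_def by (intro pm.span_base) blast
    ultimately show ?case
      by (intro exI[of _ "Suc (nat (pr i b))"]) (simp del: power_Suc funpow.simps)
  next
    case (Cons j w)
    then obtain M where M: "(vf i ^^ M) (mon (Word w)) \<in> vN b" by blast
    consider "j \<notin> I" | "j = i" | "j \<in> I" "i \<noteq> j" by blast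
    then show ?case
    proof cases
      case 1
      then have "mon (Word (j # w)) \<in> vN b"
        by (intro vgens_vN bad_vgens) (auto simp: bad_def)
      then show ?thesis by (intro exI[of _ 0]) simp
    next
      case 2
      have "(vf i ^^ M) (mon (Word (j # w))) = (vf i ^^ Suc M) (mon (Word w))"
        by (simp only: 2 funpow_Suc_right comp_def gen_mult_mon)
      also have "\<dots> \<in> vN b" using M vN_left by simp
      finally show ?thesis by blast
    next
      case 3
      interpret q: quantum_base "vi D i" using assms(2) by (rule quantum_base_vi)
      have "v.yop i j (v.ser_len i j) t \<in> vN b" for t
        using ser_vN[OF assms(2) 3, of t b] unfolding ser_mult_eq[OF assms(2) 3]
        by (subst (asm) v.N_scl_iff) auto
      from v.f_pow_nilpotent_step[OF assms(2) 3(1) this M, of 0 "v.ser_len i j + M"]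
      have "(vf i ^^ (v.ser_len i j + M)) (gen j * mon (Word w)) \<in> vN b" by simp
      then show ?thesis by (auto simp: gen_mult_mon)
    qed
  qed
  define M where "M w = (SOME M. (vf i ^^ M) (mon w) \<in> vN b)" for w
  have M: "(vf i ^^ M w) (mon w) \<in> vN b" for w
    unfolding M_def by (rule someI_ex) (use word[of "letters w"] in simp)
  have stable: "(vf i ^^ m) x \<in> vN b" if "(vf i ^^ n) x \<in> vN b" "n \<le> m" for m n x
  proof -
    have "(vf i ^^ (m - n + n)) x = (vf i ^^ (m - n)) ((vf i ^^ n) x)"
      by (simp only: funpow_add comp_apply)
    then have "(vf i ^^ m) x = (vf i ^^ (m - n)) ((vf i ^^ n) x)"
      using that(2) by (simp only: le_add_diff_inverse2)
    then show ?thesis using v.N_f_pow[OF assms(2) that(1)] by simp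
  qed
  \<comment> \<open>Larger exponents also work for each word, so the sum of the exponents over the
    support works for the whole vector.\<close>
  define K where "K = (\<Sum>w\<in>Poly_Mapping.keys t. M w)"
  have "(vf i ^^ K) t \<in> vN b"
  proof (rule lmap_mem[OF lmap_funpow[OF lmap_mult_left] vN_subspace])
    fix w assume "w \<in> Poly_Mapping.keys t"
    then have "M w \<le> K" unfolding K_def by (intro member_le_sum) auto
    with M[of w] show "(vf i ^^ K) (mon w) \<in> vN b" by (rule stable)
  qed
  then show ?thesis ..
qed

section \<open>Word length and finiteness of the weights\<close>

definition len :: "'i word \<Rightarrow> nat" where
  "len w = length (letters w)"

lemma len_Word [simp]: "len (Word w) = length w"
  by (simp add: len_def)

lemma homog_len_gen: "homog len n t \<Longrightarrow> homog len (Suc n) (gen j * t)"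
  by (rule homog_lmap[OF lmap_mult_left]) (auto simp: gen_mult_mon' len_def)

lemma homog_len_ve: "homog len n t \<Longrightarrow> homog len (n - 1) (ve b i t)"
proof (rule homog_lmap[OF lmap_ve])
  have "homog len (length w - 1) (eword b i w)" for w
  proof (induction w)
    case (Cons j w)
    have "homog len (length w) (gen j * eword b i w)"
      using homog_len_gen[OF Cons, of j] by (cases w) auto
    then show ?case by (auto intro!: homog_add homog_scl)
  qed simp
  then show "len k = n \<Longrightarrow> homog len (n - 1) (ve b i (mon k))" for k
    by (auto simp: len_def)
qed

lemma ve_len_0: "homog len 0 t \<Longrightarrow> ve b i t = 0"
  by (rule lmap_eqI[OF lmap_ve lmap_const0]) (auto simp: homog_def len_def)

text \<open>Raising operators shorten words by one, so they are nilpotent on every vector before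
  dividing by any relations.\<close>

lemma ve_nilpotent: "\<exists>M. (ve b i ^^ M) t = 0"
proof -
  have pow: "homog len n t \<Longrightarrow> (ve b i ^^ Suc n) t = 0" for n t
  proof (induction n arbitrary: t)
    case (Suc n)
    have "(ve b i ^^ Suc n) (ve b i t) = 0"
      using homog_len_ve[OF Suc.prems] by (intro Suc.IH) simp
    then show ?case by (simp only: funpow_Suc_right comp_def)
  qed (simp add: ve_len_0)
  have pow': "(ve b i ^^ K) (mon w) = 0" if "len w < K" for w K
  proof -
    have "(ve b i ^^ (K - Suc (len w) + Suc (len w))) (mon w) = (ve b i ^^ (K - Suc (len w))) ((ve b i ^^ Suc (len w)) (mon w))"
      by (simp only: funpow_add comp_apply)
    also have "(ve b i ^^ Suc (len w)) (mon w) = 0"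
      by (rule pow) simp
    also have "(ve b i ^^ (K - Suc (len w))) 0 = 0"
      by (rule lmap_zero[OF lmap_funpow[OF lmap_ve]])
    finally show ?thesis using that by (simp only: le_add_diff_inverse2 Suc_leI)
  qed
  define K where "K = Suc (\<Sum>w\<in>Poly_Mapping.keys t. len w)"
  have "(ve b i ^^ K) t = 0"
  proof (rule lmap_eqI[OF lmap_funpow[OF lmap_ve] lmap_const0])
    fix w assume "w \<in> Poly_Mapping.keys t"
    then have "len w < K" unfolding K_def less_Suc_eq_le by (intro member_le_sum) auto
    then show "(ve b i ^^ K) (mon w) = 0" by (rule pow')
  qed
  then show ?thesis ..
qed

lemma wsum_eq: "set w \<subseteq> I \<Longrightarrow> wsum (Word w) = (\<Sum>i\<in>I. zmul (int (count_list w i)) (al i))"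
proof (induction w)
  case (Cons j w)
  have "(\<Sum>i\<in>I. zmul (int (count_list (j # w) i)) (al i)) =
      (\<Sum>i\<in>I. (if i = j then al i else 0) + zmul (int (count_list w i)) (al i))"
    by (intro sum.cong) (auto simp: zmul_add)
  then show ?case
    using Cons by (simp add: sum.distrib)
qed simp

text \<open>All weights lie below \<open>b\<close>, and local nilpotency in both directions makes
  the set of weights stable under reflections. Words with letters outside the index set, whose
  weights could escape the bound, vanish in the quotient.\<close>

lemma finite_vweights:
  assumes "b \<in> dominant D"
  shows "finite {\<mu>. \<exists>t. homog (vwt b) \<mu> t \<and> t \<notin> vN b}"
proof -
  interpret v: umod_sub D "vwt b" "ve b" vf "vN b" by (rule umod_sub_verma[OF assms])
  have "finite v.weights"
  proof (rule finite_reflection_stable)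
    fix \<mu> assume "\<mu> \<in> v.weights"
    then obtain t where t: "homog (vwt b) \<mu> t" "t \<notin> vN b"
      by (auto simp: v.weights_def)
    have "\<exists>w\<in>Poly_Mapping.keys t. \<not> bad w"
    proof (rule ccontr)
      assume "\<not> ?thesis"
      then have "t \<in> vN b"
        by - (rule lmap_mem[OF lmap_id vN_subspace], auto intro!: vgens_vN bad_vgens)
      with t(2) show False ..
    qed
    then obtain w where w: "w \<in> Poly_Mapping.keys t" "set (letters w) \<subseteq> I"
      by (auto simp: bad_def)
    then have "b - \<mu> = wsum (Word (letters w))"
      using t(1) by (auto simp: homog_def vwt_def)
    then show "dom_le D \<mu> b"
      unfolding dom_le_def wsum_eq[OF w(2)] by (intro exI[of _ "count_list (letters w)"])
  next
    fix i \<mu> assume i: "i \<in> I" and \<mu>: "\<mu> \<in> v.weights"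
    have "\<exists>M. (ve b i ^^ M) t \<in> vN b" for t
      using ve_nilpotent[of b i t] pm.subspace_0[OF vN_subspace] by metis
    then show "reflection D i \<mu> \<in> v.weights"
      using v.reflection_weight[OF i _ vf_nilpotent[OF assms i] \<mu>] by blast
  qed
  then show ?thesis by (simp add: v.weights_def)
qed

end

section \<open>Tensor products of a lowest and a highest weight module\<close>

definition tens :: "('a \<Rightarrow>\<^sub>0 qv) \<Rightarrow> ('b \<Rightarrow>\<^sub>0 qv) \<Rightarrow> ('a \<times> 'b \<Rightarrow>\<^sub>0 qv)" where
  "tens p r = lext (\<lambda>B. lext (\<lambda>A. mon (B, A)) r) p"

lemma tens_mon [simp]: "tens (mon B) (mon A) = mon (B, A)"
  by (simp add: tens_def)

lemma lmap_tens_left: "lmap (\<lambda>p. tens p r)"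
  by (simp add: tens_def lmap_lext)

lemma lmap_tens_right: "lmap (\<lambda>r. tens p r)"
  unfolding tens_def lext_def[of _ p] by (intro lmap_big_sum lmap_scale lmap_lext)

lemma tens_mem:
  assumes "lmap f" "pm.subspace N" "\<And>B A. B \<in> Poly_Mapping.keys p \<Longrightarrow> A \<in> Poly_Mapping.keys r \<Longrightarrow> f (mon (B, A)) \<in> N"
  shows "f (tens p r) \<in> N"
proof (rule lmap_mem[OF lmap_comp[OF assms(1) lmap_tens_left] assms(2)])
  fix B assume B: "B \<in> Poly_Mapping.keys p"
  show "f (tens (mon B) r) \<in> N"
    by (rule lmap_mem[OF lmap_comp[OF assms(1) lmap_tens_right] assms(2)])
       (simp add: assms(3) B)
qed

lemma keys_tens: "Poly_Mapping.keys (tens p r) \<subseteq> Poly_Mapping.keys p \<times> Poly_Mapping.keys r"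
proof -
  have "pm.subspace {t. Poly_Mapping.keys t \<subseteq> Poly_Mapping.keys p \<times> Poly_Mapping.keys r}"
    by (auto simp: pm.subspace_def dest!: subsetD[OF keys_add] subsetD[OF keys_scl])
  from tens_mem[OF lmap_id this] show ?thesis by auto
qed

context finite_root_datum
begin

text \<open>In a pair \<open>(B, A)\<close> the word \<open>B\<close> stands for raising operators
  on the lowest weight vector, hence the sign, and \<open>A\<close> for lowering operators on the
  highest weight vector.\<close>

definition twt :: "'x \<Rightarrow> 'x \<Rightarrow> 'i word \<times> 'i word \<Rightarrow> 'x" where
  "twt a b = (\<lambda>(B, A). - vwt a B + vwt b A)"

text \<open>The module is the tensor product of the lowest weight module of lowest weight \<open>- a\<close> (the highest
  weight module of weight \<open>a\<close> twisted by the involution exchanging \<open>E\<close> and \<open>F\<close>) and the highest weight module of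
  weight \<open>b\<close>, with coproduct \<open>E \<mapsto> E \<otimes> 1 + K \<otimes> E\<close> and \<open>F \<mapsto> F \<otimes> K\<^sup>-\<^sup>1 + 1 \<otimes> F\<close>.\<close>
definition te :: "'x \<Rightarrow> 'x \<Rightarrow> 'i \<Rightarrow> ('i word \<times> 'i word \<Rightarrow>\<^sub>0 qv) \<Rightarrow> ('i word \<times> 'i word \<Rightarrow>\<^sub>0 qv)" where
  "te a b i = lext (\<lambda>(B, A). tens (gen i * mon B) (mon A) +
    scl (vi D i powi (- pr i (vwt a B))) (tens (mon B) (ve b i (mon A))))"

definition tf :: "'x \<Rightarrow> 'x \<Rightarrow> 'i \<Rightarrow> ('i word \<times> 'i word \<Rightarrow>\<^sub>0 qv) \<Rightarrow> ('i word \<times> 'i word \<Rightarrow>\<^sub>0 qv)" where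
  "tf a b i = lext (\<lambda>(B, A). tens (mon B) (gen i * mon A) +
    scl (vi D i powi (- pr i (vwt b A))) (tens (ve a i (mon B)) (mon A)))"

lemma lmap_te: "lmap (te a b i)"
  by (simp add: te_def lmap_lext)

lemma lmap_tf: "lmap (tf a b i)"
  by (simp add: tf_def lmap_lext)

lemma te_tens:
  assumes "homog (vwt a) \<alpha> p"
  shows "te a b i (tens p r) = tens (gen i * p) r + scl (vi D i powi (- pr i \<alpha>)) (tens p (ve b i r))"
proof -
  have B: "te a b i (tens (mon B) r) = tens (gen i * mon B) r + scl (vi D i powi (- pr i (vwt a B))) (tens (mon B) (ve b i r))" for B
    by (rule lmap_eqI[OF lmap_comp[OF lmap_te lmap_tens_right]
          lmap_plus[OF lmap_tens_right lmap_scale[OF lmap_comp[OF lmap_tens_right lmap_ve]]]])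
       (simp add: te_def del: ve_mon)
  show ?thesis
    by (rule lmap_eqI[OF lmap_comp[OF lmap_te lmap_tens_left]
          lmap_plus[OF lmap_comp[OF lmap_tens_left lmap_mult_left] lmap_scale[OF lmap_tens_left]]])
       (use assms in \<open>auto simp: B homog_def\<close>)
qed

lemma tf_tens:
  assumes "homog (vwt b) \<beta> r"
  shows "tf a b i (tens p r) = tens p (gen i * r) + scl (vi D i powi (- pr i \<beta>)) (tens (ve a i p) r)"
proof -
  have B: "tf a b i (tens (mon B) r) = tens (mon B) (gen i * r) + scl (vi D i powi (- pr i \<beta>)) (tens (ve a i (mon B)) r)" for B
    by (rule lmap_eqI[OF lmap_comp[OF lmap_tf lmap_tens_right]
          lmap_plus[OF lmap_comp[OF lmap_tens_right lmap_mult_left] lmap_scale[OF lmap_tens_right]]])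
       (use assms in \<open>simp add: tf_def homog_def del: ve_mon\<close>)
  show ?thesis
    by (rule lmap_eqI[OF lmap_comp[OF lmap_tf lmap_tens_left]
          lmap_plus[OF lmap_tens_left lmap_scale[OF lmap_comp[OF lmap_tens_left lmap_ve]]]])
       (simp add: B del: ve_mon)
qed

lemma homog_tens: "homog (vwt a) \<alpha> p \<Longrightarrow> homog (vwt b) \<beta> r \<Longrightarrow> homog (twt a b) (- \<alpha> + \<beta>) (tens p r)"
  using keys_tens[of p r] by (force simp: homog_def twt_def)

text \<open>The mixed terms agree because both twists pick up the same factor \<open>C\<close>, by
  symmetrizability. For i = j the commutators in the two slots combine, by
  \<open>q_int_shift\<close>, to the quantum integer of the total weight.\<close>

lemma te_tf_comm:
  assumes "i \<in> I" "j \<in> I" and p: "homog (vwt a) \<alpha> p" and r: "homog (vwt b) \<beta> r"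
  shows "te a b i (tf a b j (tens p r)) = tf a b j (te a b i (tens p r)) +
    (if i = j then scl (q_int (vi D i) (pr i (- \<alpha> + \<beta>))) (tens p r) else 0)"
proof -
  interpret q: quantum_base "vi D i" using assms(1) by (rule quantum_base_vi)
  interpret qj: quantum_base "vi D j" using assms(2) by (rule quantum_base_vi)
  define A B where "A = vi D i powi (- pr i \<alpha>)" and "B = vi D j powi (- pr j \<beta>)"
  define C where "C = vi D i powi (- cart i j)"
  have C': "vi D j powi (- cart j i) = C"
    using cart_sym[OF assms(1,2)] by (simp add: C_def vi_powi)
  have powi: "vi D i powi (- pr i (\<alpha> + al j)) = A * C" "vi D j powi (- pr j (\<beta> + al i)) = B * C"
    by (simp add: A_def C_def flip: q.q_add) (simp add: B_def C'[symmetric] flip: qj.q_add)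
  have 1: "te a b i (tf a b j (tens p r)) =
      tens (gen i * p) (gen j * r) + scl A (tens p (ve b i (gen j * r))) +
      scl B (tens (gen i * ve a j p) r + scl (A * C) (tens (ve a j p) (ve b i r)))"
    unfolding tf_tens[OF r] lmap_simps[OF lmap_te] te_tens[OF p] te_tens[OF homog_ve[OF p]] powi
    by (simp add: A_def B_def)
  have 2: "tf a b j (te a b i (tens p r)) =
      tens (gen i * p) (gen j * r) + scl B (tens (ve a j (gen i * p)) r) +
      scl A (tens p (gen j * ve b i r) + scl (B * C) (tens (ve a j p) (ve b i r)))"
    unfolding te_tens[OF p] lmap_simps[OF lmap_tf] tf_tens[OF r] tf_tens[OF homog_ve[OF r]] powi
    by (simp add: A_def B_def)
  show ?thesis
  proof (cases "i = j")
    case True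
    have "A * q_int (vi D i) (pr i \<beta>) = B * q_int (vi D i) (pr i \<alpha>) + q_int (vi D i) (pr i \<beta> - pr i \<alpha>)"
      using q.q_int_shift[of "pr i \<beta>" "- pr i \<alpha>"] True unfolding A_def B_def q.q_int_minus
      by (simp add: algebra_simps)
    then have "scl (A * q_int (vi D i) (pr i \<beta>)) (tens p r) = scl (B * q_int (vi D i) (pr i \<alpha>)) (tens p r) + scl (q_int (vi D i) (pr i (- \<alpha> + \<beta>))) (tens p r)"
      by (simp add: pm.scale_left_distrib[symmetric])
    then show ?thesis
      unfolding 1 2 ve_gen[OF r] ve_gen[OF p] using True
      by (simp add: lmap_simps[OF lmap_tens_left] lmap_simps[OF lmap_tens_right] pm.scale_right_distrib mult_ac)
  next
    case False
    then show ?thesis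
      unfolding 1 2 ve_gen[OF r] ve_gen[OF p]
      by (simp add: lmap_simps[OF lmap_tens_left] lmap_simps[OF lmap_tens_right] pm.scale_right_distrib mult_ac)
  qed
qed

lemma umod_tensor: "umod D (twt a b) (te a b) (tf a b)"
proof
  show "lmap (te a b i)" "lmap (tf a b i)" for i
    by (rule lmap_te lmap_tf)+
  fix i j \<mu> t
  have h: "homog (vwt c) (vwt c w) (mon w)" for c w
    by simp
  show "homog (twt a b) \<mu> t \<Longrightarrow> homog (twt a b) (\<mu> + al i) (te a b i t)"
  proof (rule homog_lmap[OF lmap_te])
    fix k assume "twt a b k = \<mu>"
    then obtain B A where k: "k = (B, A)" "\<mu> = - vwt a B + vwt b A" by (cases k) (auto simp: twt_def)
    show "homog (twt a b) (\<mu> + al i) (te a b i (mon k))"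
      unfolding k tens_mon[symmetric] te_tens[OF h]
      using homog_tens[OF homog_vf[OF h[of a B], of i] h[of b A]] homog_tens[OF h[of a B] homog_ve[OF h[of b A], of i]]
      by (intro homog_add homog_scl) (simp_all add: algebra_simps)
  qed
  show "homog (twt a b) \<mu> t \<Longrightarrow> homog (twt a b) (\<mu> - al i) (tf a b i t)"
  proof (rule homog_lmap[OF lmap_tf])
    fix k assume "twt a b k = \<mu>"
    then obtain B A where k: "k = (B, A)" "\<mu> = - vwt a B + vwt b A" by (cases k) (auto simp: twt_def)
    show "homog (twt a b) (\<mu> - al i) (tf a b i (mon k))"
      unfolding k tens_mon[symmetric] tf_tens[OF h]
      using homog_tens[OF h[of a B] homog_vf[OF h[of b A], of i]] homog_tens[OF homog_ve[OF h[of a B], of i] h[of b A]]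
      by (intro homog_add homog_scl) (simp_all add: algebra_simps)
  qed
  assume ij: "i \<in> I" "j \<in> I"
  show "homog (twt a b) \<mu> t \<Longrightarrow> te a b i (tf a b j t) = tf a b j (te a b i t) + (if i = j then scl (q_int (vi D i) (pr i \<mu>)) t else 0)"
  proof (rule lmap_eqI[of "\<lambda>t. te a b i (tf a b j t)" "\<lambda>t. tf a b j (te a b i t) + (if i = j then scl (q_int (vi D i) (pr i \<mu>)) t else 0)"])
    show "lmap (\<lambda>t. te a b i (tf a b j t))"
      by (rule lmap_comp[OF lmap_te lmap_tf])
    show "lmap (\<lambda>t. tf a b j (te a b i t) + (if i = j then scl (q_int (vi D i) (pr i \<mu>)) t else 0))"
    proof (cases "i = j")
      case True
      then show ?thesis
        using lmap_plus[OF lmap_comp[OF lmap_tf lmap_te] lmap_scale[OF lmap_id]] by simp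
    next
      case False
      then show ?thesis
        using lmap_comp[OF lmap_tf lmap_te] by simp
    qed
    fix k assume "homog (twt a b) \<mu> t" "k \<in> Poly_Mapping.keys t"
    then have "twt a b k = \<mu>" by (simp add: homog_def)
    then obtain B A where k: "k = (B, A)" "\<mu> = - vwt a B + vwt b A" by (cases k) (auto simp: twt_def)
    show "te a b i (tf a b j (mon k)) = tf a b j (te a b i (mon k)) + (if i = j then scl (q_int (vi D i) (pr i \<mu>)) (mon k) else 0)"
      unfolding k tens_mon[symmetric] by (rule te_tf_comm[OF ij h h])
  qed
qed

text \<open>The kernel of the map onto the tensor product of the two quotients. A generating
  relation in one slot and a single word in the other keep all spanning vectors homogeneous.\<close>

definition tN :: "'x \<Rightarrow> 'x \<Rightarrow> ('i word \<times> 'i word \<Rightarrow>\<^sub>0 qv) set" where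
  "tN a b = pm.span ({tens x (mon A) | x A. x \<in> vgens a} \<union> {tens (mon B) x | x B. x \<in> vgens b})"

lemma tN_subspace: "pm.subspace (tN a b)"
  by (simp add: tN_def)

lemma tN_left: "x \<in> vN a \<Longrightarrow> tens x r \<in> tN a b"
  unfolding vN_def
proof (rule lmap_span[OF lmap_tens_left tN_subspace])
  fix x assume "x \<in> vgens a"
  then show "tens x r \<in> tN a b"
    by - (rule lmap_mem[OF lmap_tens_right tN_subspace], auto simp: tN_def intro!: pm.span_base)
qed

lemma tN_right: "x \<in> vN b \<Longrightarrow> tens p x \<in> tN a b"
  unfolding vN_def
proof (rule lmap_span[OF lmap_tens_right tN_subspace])
  fix x assume "x \<in> vgens b"
  then show "tens p x \<in> tN a b"
    by - (rule lmap_mem[OF lmap_tens_left tN_subspace], auto simp: tN_def intro!: pm.span_base)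
qed

lemma tN_induct:
  assumes "lmap g" "pm.subspace M"
    and "\<And>x A \<alpha>. x \<in> vgens a \<Longrightarrow> homog (vwt a) \<alpha> x \<Longrightarrow> g (tens x (mon A)) \<in> M"
    and "\<And>x B \<beta>. x \<in> vgens b \<Longrightarrow> homog (vwt b) \<beta> x \<Longrightarrow> g (tens (mon B) x) \<in> M"
    and "t \<in> tN a b"
  shows "g t \<in> M"
  using assms(5) unfolding tN_def
proof (rule lmap_span[OF assms(1,2), rotated])
  fix z assume "z \<in> {tens x (mon A) |x A. x \<in> vgens a} \<union> {tens (mon B) x |x B. x \<in> vgens b}"
  then show "g z \<in> M"
    using assms(3,4) vgens_homog by blast
qed

lemma umod_sub_tensor:
  assumes "a \<in> dominant D" "b \<in> dominant D"
  shows "umod_sub D (twt a b) (te a b) (tf a b) (tN a b)"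
proof -
  interpret t: umod D "twt a b" "te a b" "tf a b" by (rule umod_tensor)
  have h: "homog (vwt c) (vwt c w) (mon w)" for c w
    by simp
  note sub = pm.subspace_add[OF tN_subspace] pm.subspace_scale[OF tN_subspace] tN_left tN_right vN_left vgens_vN
  show ?thesis
  proof
    show "pm.subspace (tN a b)" by (rule tN_subspace)
    fix i t assume i: "i \<in> I"
    show "t \<in> tN a b \<Longrightarrow> te a b i t \<in> tN a b"
    proof (rule tN_induct[OF lmap_te tN_subspace])
      show "x \<in> vgens a \<Longrightarrow> homog (vwt a) \<alpha> x \<Longrightarrow> te a b i (tens x (mon A)) \<in> tN a b" for x A \<alpha>
        unfolding te_tens by (intro sub)
      show "x \<in> vgens b \<Longrightarrow> te a b i (tens (mon B) x) \<in> tN a b" for x B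
        unfolding te_tens[OF h] by (intro pm.subspace_add[OF tN_subspace] pm.subspace_scale[OF tN_subspace] tN_right ve_vN[OF assms(2) i] vgens_vN)
    qed
    show "t \<in> tN a b \<Longrightarrow> tf a b i t \<in> tN a b"
    proof (rule tN_induct[OF lmap_tf tN_subspace])
      show "x \<in> vgens b \<Longrightarrow> homog (vwt b) \<beta> x \<Longrightarrow> tf a b i (tens (mon B) x) \<in> tN a b" for x B \<beta>
        unfolding tf_tens by (intro sub)
      show "x \<in> vgens a \<Longrightarrow> tf a b i (tens x (mon A)) \<in> tN a b" for x A
        unfolding tf_tens[OF h] by (intro pm.subspace_add[OF tN_subspace] pm.subspace_scale[OF tN_subspace] tN_left ve_vN[OF assms(1) i] vgens_vN)
    qed
  next
    fix t \<mu>
    show "t \<in> tN a b \<Longrightarrow> filt (\<lambda>k. twt a b k = \<mu>) t \<in> tN a b"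
    proof (rule tN_induct[OF lmap_filt tN_subspace])
      show "x \<in> vgens a \<Longrightarrow> homog (vwt a) \<alpha> x \<Longrightarrow> filt (\<lambda>k. twt a b k = \<mu>) (tens x (mon A)) \<in> tN a b" for x A \<alpha>
        using tN_left[OF vgens_vN] pm.subspace_0[OF tN_subspace] by (simp add: filt_homog[OF homog_tens[OF _ h]])
      show "x \<in> vgens b \<Longrightarrow> homog (vwt b) \<beta> x \<Longrightarrow> filt (\<lambda>k. twt a b k = \<mu>) (tens (mon B) x) \<in> tN a b" for x B \<beta>
        using tN_right[OF vgens_vN] pm.subspace_0[OF tN_subspace] by (simp add: filt_homog[OF homog_tens[OF h]])
    qed
  qed
qed

lemma finite_tweights:
  assumes "a \<in> dominant D" "b \<in> dominant D"
  shows "finite (umod_sub.weights (twt a b) (tN a b))"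
proof -
  interpret t: umod_sub D "twt a b" "te a b" "tf a b" "tN a b" by (rule umod_sub_tensor[OF assms])
  let ?W = "\<lambda>c. {\<mu>. \<exists>t. homog (vwt c) \<mu> t \<and> t \<notin> vN c}"
  have "t.weights \<subseteq> (\<lambda>(\<alpha>, \<beta>). - \<alpha> + \<beta>) ` (?W a \<times> ?W b)"
  proof
    fix \<mu> assume "\<mu> \<in> t.weights"
    then obtain t where t: "homog (twt a b) \<mu> t" "t \<notin> tN a b"
      by (auto simp: t.weights_def)
    then obtain B A where BA: "(B, A) \<in> Poly_Mapping.keys t" "mon (B, A) \<notin> tN a b"
      using lmap_mem[OF lmap_id tN_subspace] by (metis surj_pair)
    have "mon B \<notin> vN a" "mon A \<notin> vN b"
      using BA(2) tN_left[of "mon B" a "mon A" b] tN_right[of "mon A" b "mon B" a] by auto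
    then have W: "\<exists>t. homog (vwt a) (vwt a B) t \<and> t \<notin> vN a" "\<exists>t. homog (vwt b) (vwt b A) t \<and> t \<notin> vN b"
      by (auto intro: exI[of _ "mon B"] exI[of _ "mon A"])
    have "\<mu> = - vwt a B + vwt b A"
      using t(1) BA(1) by (auto simp: homog_def twt_def)
    then show "\<mu> \<in> (\<lambda>(\<alpha>, \<beta>). - \<alpha> + \<beta>) ` (?W a \<times> ?W b)"
      by (intro image_eqI[of _ _ "(vwt a B, vwt b A)"]) (simp_all add: W)
  qed
  then show ?thesis
    by (rule finite_subset) (intro finite_imageI finite_cartesian_product finite_vweights assms)
qed

subsection \<open>Leading terms\<close>

definition ser_good :: "('i word \<Rightarrow>\<^sub>0 qv) set" where
  "ser_good = {mon u * ser i j * mon w | u w i j. i \<in> I \<and> j \<in> I \<and> i \<noteq> j \<and> \<not> bad u \<and> \<not> bad w}"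

text \<open>The relations that are to remain in low degree. Unlike in \<open>tN\<close>, all words
  have their letters in the index set, so that these tensors translate into products inside the
  quantized enveloping algebra.\<close>

definition serT :: "('i word \<times> 'i word \<Rightarrow>\<^sub>0 qv) set" where
  "serT = pm.span ({tens x (mon A) | x A. x \<in> ser_good \<and> \<not> bad A} \<union> {tens (mon B) x | x B. x \<in> ser_good \<and> \<not> bad B})"

lemma serT_subspace: "pm.subspace serT"
  by (simp add: serT_def)

lemma homog_len_mult: "homog len m p \<Longrightarrow> homog len n r \<Longrightarrow> homog len (m + n) (p * r)"
  unfolding homog_def using keys_mult[of p r] by (fastforce simp: len_def)

lemma homog_len_one: "homog len 0 1"
  by (simp add: homog_def len_def)

lemma homog_len_pow: "homog len m p \<Longrightarrow> homog len (n * m) (p ^ n)"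
  by (induction n) (auto intro: homog_len_mult homog_len_one)

lemma homog_len_ser:
  assumes "i \<in> I" "j \<in> I" "i \<noteq> j"
  shows "homog len (nat (1 - cart i j) + 1) (ser i j)"
proof -
  have g: "homog len 1 (gen i)" for i
    by (simp add: gen_eq_mon)
  have m1: "homog len 0 (- 1)"
    using homog_scl[OF homog_len_one, of "- 1"] by simp
  have summand: "homog len (nat (1 - cart i j) + 1)
      ((- 1) ^ s' * scl c (gen i ^ s) * gen j * scl c' (gen i ^ s'))" if "int s + int s' = 1 - cart i j" for s s' c c'
  proof -
    have "homog len (s' * 0 + s * 1 + 1 + s' * 1) ((- 1) ^ s' * scl c (gen i ^ s) * gen j * scl c' (gen i ^ s'))"
      by (intro homog_len_mult homog_scl homog_len_pow g m1)
    moreover have "s' * 0 + s * 1 + 1 + s' * 1 = nat (1 - cart i j) + 1"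
      using that by simp
    ultimately show ?thesis by simp
  qed
  have "homog len n (\<Sum>k\<in>S. f k)" if "\<And>k. k \<in> S \<Longrightarrow> homog len n (f k)" for S n and f :: "nat \<times> nat \<Rightarrow> 'i word \<Rightarrow>\<^sub>0 qv"
    using pm.subspace_sum[OF homog_subspace, of S f len n] that by simp
  note sum = this
  show ?thesis
    unfolding ser_def serre_def divpow_free_algebra by (rule sum) (auto dest!: summand)
qed

text \<open>A multiple of a Serre element has all its words of one length and either all bad or none
  bad; a filter by length and badness keeps it whole or kills it.\<close>

lemma ser_gens_uniform:
  assumes "x \<in> ser_gens"
  obtains n c where "homog len n x" "homog bad c x" "\<not> c \<longrightarrow> x \<in> ser_good"
proof -
  from assms obtain u w i j where x: "x = mon u * ser i j * mon w" "i \<in> I" "j \<in> I" "i \<noteq> j"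
    by (auto simp: ser_gens_def)
  have "homog len (len u + (nat (1 - cart i j) + 1) + len w) x"
    unfolding x(1) by (intro homog_len_mult homog_len_ser x(2-)) auto
  moreover have "homog bad (bad u \<or> bad w) x"
  proof -
    have "ser i j \<in> FA I"
      unfolding ser_def using x by (intro FA_serre) auto
    then have "set (letters k) \<subseteq> I" if "k \<in> Poly_Mapping.keys (ser i j)" for k
      using that by (simp add: FA_iff)
    then show ?thesis
      unfolding homog_def x(1)
      using keys_mult[of "mon u * ser i j" "mon w"] keys_mult[of "mon u" "ser i j"]
      by (fastforce simp: bad_def)
  qed
  moreover have "\<not> (bad u \<or> bad w) \<longrightarrow> x \<in> ser_good"
    using x unfolding ser_good_def by blast
  ultimately show thesis by (rule that)
qed

text \<open>The relation in a generator of \<open>tN\<close> is homogeneous for length or consists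
  of bad words only, so the filter treats the generator as a whole. Multiples of the powers are
  longer than \<open>d\<close> and bad words are excluded; only Serre elements survive.\<close>

lemma low_part:
  assumes "t \<in> tN a b" "m \<le> d" and "\<And>i. i \<in> I \<Longrightarrow> int d \<le> pr i a \<and> int d \<le> pr i b"
  shows "filt (\<lambda>(B, A). len B = m \<and> len A \<le> d \<and> \<not> bad B \<and> \<not> bad A) t \<in> serT"
  using assms(1)
proof (rule tN_induct[OF lmap_filt serT_subspace, rotated 2])
  let ?P = "\<lambda>(B, A). len B = m \<and> len A \<le> d \<and> \<not> bad B \<and> \<not> bad A"
  have pow: "homog len (len u + Suc (nat (pr i c))) (mon u * gen i ^ Suc (nat (pr i c)))" for u i c
    using homog_len_mult[OF _ homog_len_pow[of 1 "gen i"], of "len u" "mon u" "Suc (nat (pr i c))"]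
    by (simp add: gen_eq_mon del: power_Suc)
  have zero: "0 \<in> serT" by (rule pm.subspace_0[OF serT_subspace])
  have cases: "x \<in> ser_gens \<or> (\<exists>n>d. homog len n x) \<or> homog bad True x"
    if "x \<in> vgens c" "\<And>i. i \<in> I \<Longrightarrow> int d \<le> pr i c" for x c
  proof -
    from that(1) consider "x \<in> ser_gens" | u i where "x = mon u * gen i ^ Suc (nat (pr i c))" "i \<in> I"
      | w where "x = mon w" "bad w"
      by (auto simp: vgens_def)
    then show ?thesis
    proof cases
      case 2
      have "d < len u + Suc (nat (pr i c))"
        using that(2)[OF 2(2)] by simp
      with pow[of u i c] 2(1) show ?thesis by blast
    qed auto
  qed
  fix x C \<alpha>
  {
    assume "x \<in> vgens a"
    then consider "x \<in> ser_gens" | n where "n > d" "homog len n x" | "homog bad True x"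
      using cases assms(3) by blast
    then show "filt ?P (tens x (mon C)) \<in> serT"
    proof cases
      case 1
      then obtain n c where h: "homog len n x" "homog bad c x" "\<not> c \<longrightarrow> x \<in> ser_good" by (rule ser_gens_uniform)
      have "tens x (mon C) \<in> serT" if "\<not> c" "\<not> bad C"
        unfolding serT_def using h(3) that by (intro pm.span_base) blast
      moreover have "filt ?P (tens x (mon C)) = (if n = m \<and> \<not> c \<and> len C \<le> d \<and> \<not> bad C then tens x (mon C) else 0)"
        using keys_tens[of x "mon C"] h(1,2) by (auto simp: homog_def intro!: filt_id filt_0)
      ultimately show ?thesis using zero by simp
    next
      case 2
      then have "filt ?P (tens x (mon C)) = 0"
        using keys_tens[of x "mon C"] assms(2) by (fastforce simp: homog_def intro!: filt_0)
      then show ?thesis using zero by simp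
    next
      case 3
      then have "filt ?P (tens x (mon C)) = 0"
        using keys_tens[of x "mon C"] by (fastforce simp: homog_def intro!: filt_0)
      then show ?thesis using zero by simp
    qed
  next
    assume "x \<in> vgens b"
    then consider "x \<in> ser_gens" | n where "n > d" "homog len n x" | "homog bad True x"
      using cases assms(3) by blast
    then show "filt ?P (tens (mon C) x) \<in> serT"
    proof cases
      case 1
      then obtain n c where h: "homog len n x" "homog bad c x" "\<not> c \<longrightarrow> x \<in> ser_good" by (rule ser_gens_uniform)
      have "tens (mon C) x \<in> serT" if "\<not> c" "\<not> bad C"
        unfolding serT_def using h(3) that by (intro pm.span_base) blast
      moreover have "filt ?P (tens (mon C) x) = (if n \<le> d \<and> \<not> c \<and> len C = m \<and> \<not> bad C then tens (mon C) x else 0)"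
        using keys_tens[of "mon C" x] h(1,2) by (auto simp: homog_def intro!: filt_id filt_0)
      ultimately show ?thesis using zero by simp
    next
      case 2
      then have "filt ?P (tens (mon C) x) = 0"
        using keys_tens[of "mon C" x] by (fastforce simp: homog_def intro!: filt_0)
      then show ?thesis using zero by simp
    next
      case 3
      then have "filt ?P (tens (mon C) x) = 0"
        using keys_tens[of "mon C" x] by (fastforce simp: homog_def intro!: filt_0)
      then show ?thesis using zero by simp
    qed
  }
qed

text \<open>The highest weight vector is killed by raising operators, so only the first summand of
  the coproduct acts, without lower terms or scalars.\<close>

lemma foldr_te: "foldr (te a b) B (mon (Word [], Word [])) = mon (Word B, Word [])"
proof (induction B)
  case (Cons i B)
  have h: "homog (vwt a) (vwt a (Word B)) (mon (Word B))" by simp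
  have "te a b i (mon (Word B, Word [])) = te a b i (tens (mon (Word B)) (mon (Word [])))"
    by (simp only: tens_mon)
  also have "\<dots> = tens (mon (Word (i # B))) (mon (Word []))"
    unfolding te_tens[OF h] gen_mult_mon by (simp add: lmap_zero[OF lmap_tens_right] del: mon_Nil)
  finally show ?case
    using Cons by (simp del: mon_Nil)
qed simp

definition lower :: "nat \<Rightarrow> ('i word \<times> 'i word \<Rightarrow>\<^sub>0 qv) set" where
  "lower n = {t. \<forall>k\<in>Poly_Mapping.keys t. len (fst k) < n}"

lemma lower_subspace: "pm.subspace (lower n)"
  by (auto simp: pm.subspace_def lower_def dest!: subsetD[OF keys_add] subsetD[OF keys_scl])

lemma ve_lower: "tens (ve a i (mon B)) r \<in> lower (len B)"
proof (cases "len B")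
  case 0
  then have "ve a i (mon B) = 0" by (intro ve_len_0) simp
  then show ?thesis
    by (simp add: lower_def lmap_zero[OF lmap_tens_left])
next
  case (Suc n)
  have "homog len n (ve a i (mon B))"
    using homog_len_ve[of "Suc n" "mon B" a i] Suc by simp
  then show ?thesis
    using keys_tens[of "ve a i (mon B)" r] Suc by (fastforce simp: lower_def homog_def)
qed

lemma lower_mono: "m \<le> n \<Longrightarrow> t \<in> lower m \<Longrightarrow> t \<in> lower n"
  by (force simp: lower_def)

text \<open>One summand of the coproduct extends the word \<open>A\<close> with coefficient 1; the
  other acts on the lowest weight factor, where a lowering operator shortens the word
  \<open>B\<close>.\<close>

lemma tf_lead: "tf a b i (mon (B, A)) - mon (B, Word (i # letters A)) \<in> lower (len B)"
proof -
  have h: "homog (vwt b) (vwt b A) (mon A)" by simp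
  have "tf a b i (mon (B, A)) = tf a b i (tens (mon B) (mon A))"
    by simp
  also have "\<dots> = mon (B, Word (i # letters A)) + scl (vi D i powi (- pr i (vwt b A))) (tens (ve a i (mon B)) (mon A))"
    by (subst tf_tens[OF h]) (simp add: gen_mult_mon' del: ve_mon)
  finally show ?thesis
    using pm.subspace_scale[OF lower_subspace ve_lower] by (simp del: ve_mon)
qed

lemma tf_lower: "t \<in> lower n \<Longrightarrow> tf a b i t \<in> lower n"
proof (rule lmap_mem[OF lmap_tf lower_subspace])
  fix k assume t: "t \<in> lower n" "k \<in> Poly_Mapping.keys t"
  obtain B A where k: "k = (B, A)" by (cases k)
  have n: "len B < n" using t by (auto simp: lower_def k)
  have "mon (B, Word (i # letters A)) + (tf a b i (mon (B, A)) - mon (B, Word (i # letters A))) \<in> lower n"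
  proof (rule pm.subspace_add[OF lower_subspace])
    show "mon (B, Word (i # letters A)) \<in> lower n" using n by (simp add: lower_def)
    show "tf a b i (mon (B, A)) - mon (B, Word (i # letters A)) \<in> lower n"
      using n tf_lead by (intro lower_mono[OF less_imp_le[OF n]])
  qed
  then show "tf a b i (mon k) \<in> lower n" by (simp add: k)
qed

lemma foldr_tf: "foldr (tf a b) A (mon (B, Word [])) - mon (B, Word A) \<in> lower (len B)"
proof (induction A)
  case Nil
  then show ?case using pm.subspace_0[OF lower_subspace] by simp
next
  case (Cons i A)
  have "tf a b i (foldr (tf a b) A (mon (B, Word [])) - mon (B, Word A)) + (tf a b i (mon (B, Word A)) - mon (B, Word (i # A))) \<in> lower (len B)"
    using tf_lower[OF Cons] tf_lead[of a b i B "Word A"] by (intro pm.subspace_add[OF lower_subspace]) auto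
  then show ?case
    by (simp add: lmap_diff[OF lmap_tf])
qed

text \<open>The value on the tensor of lowest and highest weight vectors of the operator that
  \<open>sig t\<close> will represent.\<close>

definition lead :: "'x \<Rightarrow> 'x \<Rightarrow> ('i word \<times> 'i word \<Rightarrow>\<^sub>0 qv) \<Rightarrow> ('i word \<times> 'i word \<Rightarrow>\<^sub>0 qv)" where
  "lead a b = lext (\<lambda>(B, A). foldr (tf a b) (letters A) (foldr (te a b) (letters B) (mon (Word [], Word []))))"

lemma lmap_lead: "lmap (lead a b)"
  by (simp add: lead_def lmap_lext)

lemma lead_mon: "lead a b (mon (B, A)) - mon (B, A) \<in> lower (len B)"
  using foldr_tf[of a b "letters A" B] foldr_te[of a b "letters B"] by (simp add: lead_def del: mon_Nil)

text \<open>\<open>lead a b\<close> is unitriangular with respect to the length of the raising word,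
  so it acts as the identity on the part of maximal length.\<close>

lemma filt_lead:
  assumes "\<And>B A. (B, A) \<in> Poly_Mapping.keys t \<Longrightarrow> len B \<le> m \<and> len A \<le> d \<and> \<not> bad B \<and> \<not> bad A"
  shows "filt (\<lambda>(B, A). len B = m \<and> len A \<le> d \<and> \<not> bad B \<and> \<not> bad A) (lead a b t) = filt (\<lambda>(B, A). len B = m) t"
proof (rule lmap_eqI[OF lmap_comp[OF lmap_filt lmap_lead] lmap_filt])
  let ?P = "\<lambda>(B, A). len B = m \<and> len A \<le> d \<and> \<not> bad B \<and> \<not> bad A"
  fix k assume k: "k \<in> Poly_Mapping.keys t"
  obtain B A where BA: "k = (B, A)" by (cases k)
  have *: "len B \<le> m" "len A \<le> d" "\<not> bad B" "\<not> bad A"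
    using assms k BA by auto
  have "filt ?P (lead a b (mon k) - mon k) = 0"
    using lead_mon[of a b B A] * BA by (fastforce simp: lower_def intro!: filt_0)
  then have "filt ?P (lead a b (mon k)) = filt ?P (mon k)"
    by (simp add: lmap_diff[OF lmap_filt])
  then show "filt ?P (lead a b (mon k)) = filt (\<lambda>(B, A). len B = m) (mon k)"
    using * BA by simp
qed

lemma exists_large_weights: "\<exists>a b. a \<in> dominant D \<and> b \<in> dominant D \<and> b - a = \<kappa> \<and> (\<forall>i\<in>I. int d \<le> pr i a \<and> int d \<le> pr i b)"
proof -
  obtain \<rho> where \<rho>: "\<And>i. i \<in> I \<Longrightarrow> pr i \<rho> > 0"
    using exists_rho by blast
  \<comment> \<open>The absolute values of the coordinates of \<open>\<kappa>\<close> are added so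
    that \<open>\<kappa> + zmul n \<rho>\<close> stays at least \<open>d\<close> even where
    \<open>\<kappa>\<close> is negative.\<close>
  define n where "n = int d + (\<Sum>i\<in>I. \<bar>pr i \<kappa>\<bar>)"
  have n0: "n \<ge> int d" unfolding n_def by (simp add: sum_nonneg)
  have *: "int d \<le> n * pr i \<rho>" "int d \<le> pr i \<kappa> + n * pr i \<rho>" if "i \<in> I" for i
  proof -
    have "\<bar>pr i \<kappa>\<bar> \<le> (\<Sum>i\<in>I. \<bar>pr i \<kappa>\<bar>)"
      using that by (intro member_le_sum) auto
    then have "n \<ge> int d + \<bar>pr i \<kappa>\<bar>" by (simp add: n_def)
    moreover have "n * 1 \<le> n * pr i \<rho>"
      using \<rho>[OF that] n0 by (intro mult_left_mono) auto
    ultimately show "int d \<le> n * pr i \<rho>" "int d \<le> pr i \<kappa> + n * pr i \<rho>"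
      by linarith+
  qed
  show ?thesis
    using * by (intro exI[of _ "zmul n \<rho>"] exI[of _ "\<kappa> + zmul n \<rho>"])
       (auto simp: dominant_def intro: order_trans[of 0 "int d"])
qed

end

section \<open>Congruence calculus\<close>

context presentation
begin

definition eqv :: "('g word \<Rightarrow>\<^sub>0 qv) \<Rightarrow> ('g word \<Rightarrow>\<^sub>0 qv) \<Rightarrow> bool" (infix "\<cong>\<^sub>J" 50) where
  "x \<cong>\<^sub>J y \<longleftrightarrow> x - y \<in> J"

lemma eqv_refl [simp]: "x \<cong>\<^sub>J x"
  by (simp add: eqv_def)

lemma eqv_sym: "x \<cong>\<^sub>J y \<Longrightarrow> y \<cong>\<^sub>J x"
  by (simp add: eqv_def J_sym)

lemma eqv_trans [trans]: "x \<cong>\<^sub>J y \<Longrightarrow> y \<cong>\<^sub>J z \<Longrightarrow> x \<cong>\<^sub>J z"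
  unfolding eqv_def by (rule J_trans)

lemma eqv_add: "x \<cong>\<^sub>J y \<Longrightarrow> x' \<cong>\<^sub>J y' \<Longrightarrow> x + x' \<cong>\<^sub>J y + y'"
  unfolding eqv_def using J_add[of "x - y" "x' - y'"] by (simp add: algebra_simps)

lemma eqv_scl: "x \<cong>\<^sub>J y \<Longrightarrow> scl c x \<cong>\<^sub>J scl c y"
  unfolding eqv_def using J_scl[of "x - y" c] by (simp add: pm.scale_right_diff_distrib)

lemma eqv_left: "a \<in> FA G \<Longrightarrow> x \<cong>\<^sub>J y \<Longrightarrow> a * x \<cong>\<^sub>J a * y"
  unfolding eqv_def using J_left[of a "x - y"] by (simp add: algebra_simps)

lemma eqv_right: "a \<in> FA G \<Longrightarrow> x \<cong>\<^sub>J y \<Longrightarrow> x * a \<cong>\<^sub>J y * a"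
  unfolding eqv_def using J_right[of a "x - y"] by (simp add: algebra_simps)

lemma eqv_sum: "(\<And>i. i \<in> A \<Longrightarrow> f i \<cong>\<^sub>J g i) \<Longrightarrow> sum f A \<cong>\<^sub>J sum g A"
  by (induction A rule: infinite_finite_induct) (auto intro: eqv_add)

lemma eqv_rel: "x - y \<in> R \<Longrightarrow> x \<cong>\<^sub>J y"
  by (simp add: eqv_def J_rel)

lemma eqv_J: "x \<cong>\<^sub>J y \<Longrightarrow> y \<in> J \<Longrightarrow> x \<in> J"
  unfolding eqv_def using J_add[of "x - y" y] by simp

lemma eqv_0: "x \<cong>\<^sub>J 0 \<longleftrightarrow> x \<in> J"
  by (simp add: eqv_def)

end

section \<open>The presentations of the algebras\<close>

context finite_root_datum
begin

lemma U_gens_iff [simp]: "UE s i \<in> U_gens D \<longleftrightarrow> i \<in> I" "UK h \<in> U_gens D"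
  by (auto simp: U_gens_def)

lemma S_gens_iff [simp]: "SE s i \<in> S_gens D P \<longleftrightarrow> i \<in> I" "SI \<kappa> \<in> S_gens D P \<longleftrightarrow> \<kappa> \<in> weyl_orbit D P"
  by (auto simp: S_gens_def)

lemma S_idem_FA [simp]: "S_idem D P \<kappa> \<in> FA (S_gens D P)"
  by (simp add: S_idem_def)

lemma presentation_U: "presentation (U_gens D) (U_rels D)"
  by standard (auto simp: U_rels_def intro!: FA_intros FA_serre)

lemma presentation_S: "presentation (S_gens D P) (S_rels D P)"
  by standard (auto simp: S_rels_def intro!: FA_intros FA_serre)

sublocale U: presentation "U_gens D" "U_rels D"
  by (rule presentation_U)

sublocale S: presentation "S_gens D P" "S_rels D P" for P
  by (rule presentation_S)

lemma U_folds: "U.J = U_ideal D" "U.Q = U_alg D" "U.cls = U_class D"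
  by (simp_all add: U.J_def U.Q_def U.cls_def[abs_def] U_ideal_def U_alg_def U_class_def[abs_def])

lemma S_folds: "S.J P = S_ideal D P" "S.Q P = S_alg D P" "S.cls P = S_class D P"
  by (simp_all add: S.J_def S.Q_def S.cls_def[abs_def] S_ideal_def S_alg_def S_class_def[abs_def])

definition sK :: "'x set \<Rightarrow> 'y \<Rightarrow> ('i, 'x) S_gen word \<Rightarrow>\<^sub>0 qv" where
  "sK P h = (\<Sum>\<kappa>\<in>weyl_orbit D P. scl (vv powi (pairing D h \<kappa>)) (S_idem D P \<kappa>))"

fun psi :: "'x set \<Rightarrow> ('i, 'y) U_gen \<Rightarrow> ('i, 'x) S_gen word \<Rightarrow>\<^sub>0 qv" where
  "psi P (UE s i) = gen (SE s i)"
| "psi P (UK h) = sK P h"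

text \<open>Idempotents of the larger orbit that lie outside the smaller one go to 0; this is built
  into \<open>S_idem\<close>.\<close>

fun tau :: "'x set \<Rightarrow> ('i, 'x) S_gen \<Rightarrow> ('i, 'x) S_gen word \<Rightarrow>\<^sub>0 qv" where
  "tau P (SE s i) = gen (SE s i)"
| "tau P (SI \<kappa>) = S_idem D P \<kappa>"

lemma sK_FA [simp]: "sK P h \<in> FA (S_gens D P)"
  by (auto simp: sK_def intro!: FA_intros)

lemma psi_FA: "g \<in> U_gens D \<Longrightarrow> psi P g \<in> FA (S_gens D P)"
  by (cases g) auto

lemma tau_FA: "g \<in> S_gens D P' \<Longrightarrow> tau P g \<in> FA (S_gens D P)"
  by (cases g) auto

abbreviation sidem where "sidem \<equiv> S_idem D"
abbreviation sub where "sub P \<equiv> subst (psi P)"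

lemma sub_FA: "p \<in> FA (U_gens D) \<Longrightarrow> sub P p \<in> FA (S_gens D P)"
  by (rule FA_subst) (auto intro: psi_FA)

lemma S_K_cls: "finite P \<Longrightarrow> S_K D P h = S.cls P (sK P h)"
proof -
  assume "finite P"
  then have "finite (weyl_orbit D P)" by (rule finite_weyl_orbit)
  then show ?thesis
    unfolding S_K_def S_one_def S_folds[symmetric] sK_def
    by (simp add: S.Q_smult S.Q_finsum FA_scl)
qed

lemma idem_mult: "S.eqv P (sidem P \<kappa> * sidem P \<kappa>') (if \<kappa> = \<kappa>' then sidem P \<kappa> else 0)"
  by (rule S.eqv_rel) (auto simp: S_rels_def)

lemma idem_sum: "S.eqv P (\<Sum>\<kappa>\<in>weyl_orbit D P. sidem P \<kappa>) 1"
  by (rule S.eqv_rel) (auto simp: S_rels_def)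

lemma E_idem: "i \<in> I \<Longrightarrow> S.eqv P (gen (SE s i) * sidem P \<kappa>) (sidem P (\<kappa> + zmul (sg s) (al i)) * gen (SE s i))"
  by (rule S.eqv_rel) (unfold S_rels_def, blast)

lemma S_comm: "i \<in> I \<Longrightarrow> j \<in> I \<Longrightarrow> S.eqv P (gen (SE Plus i) * gen (SE Minus j) - gen (SE Minus j) * gen (SE Plus i))
   (if i = j then (\<Sum>\<kappa>\<in>weyl_orbit D P. scalar (q_int (vi D i) (pr i \<kappa>)) * sidem P \<kappa>) else 0)"
  by (rule S.eqv_rel) (unfold S_rels_def, blast)

lemma S_serre: "i \<in> I \<Longrightarrow> j \<in> I \<Longrightarrow> i \<noteq> j \<Longrightarrow> serre D i j (gen (SE s i)) (gen (SE s j)) \<in> S.J P"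
  by (rule S.J_rel) (unfold S_rels_def, blast)

text \<open>The idempotents sum to 1 modulo the ideal, so a relation may be checked after
  multiplication by each of them; there the \<open>K\<close> act as scalars.\<close>

lemma J_by_idem:
  assumes "x \<in> FA (S_gens D P)" "\<And>\<kappa>. x * sidem P \<kappa> \<in> S.J P"
  shows "x \<in> S.J P"
proof -
  have "S.eqv P (x * (\<Sum>\<kappa>\<in>weyl_orbit D P. sidem P \<kappa>)) (x * 1)"
    using idem_sum assms(1) by (rule S.eqv_left[rotated])
  then have "S.eqv P x (x * (\<Sum>\<kappa>\<in>weyl_orbit D P. sidem P \<kappa>))"
    by (simp add: S.eqv_sym)
  moreover have "x * (\<Sum>\<kappa>\<in>weyl_orbit D P. sidem P \<kappa>) \<in> S.J P"
    unfolding sum_distrib_left by (intro pm.subspace_sum[OF S.J_subspace] assms)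
  ultimately show ?thesis by (rule S.eqv_J)
qed

lemma K_idem:
  assumes "finite P"
  shows "S.eqv P (sK P h * sidem P \<kappa>) (scl (vv powi (pairing D h \<kappa>)) (sidem P \<kappa>))"
proof -
  have fin: "finite (weyl_orbit D P)" by (rule finite_weyl_orbit[OF assms])
  have "S.eqv P (sK P h * sidem P \<kappa>) (\<Sum>\<mu>\<in>weyl_orbit D P. scl (vv powi (pairing D h \<mu>)) (if \<mu> = \<kappa> then sidem P \<mu> else 0))"
    unfolding sK_def sum_distrib_right scl_mult_left by (intro S.eqv_sum S.eqv_scl idem_mult)
  also have "(\<Sum>\<mu>\<in>weyl_orbit D P. scl (vv powi (pairing D h \<mu>)) (if \<mu> = \<kappa> then sidem P \<mu> else 0)) =
      (\<Sum>\<mu>\<in>weyl_orbit D P. if \<mu> = \<kappa> then scl (vv powi (pairing D h \<kappa>)) (sidem P \<kappa>) else 0)"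
    by (intro sum.cong) auto
  also have "\<dots> = scl (vv powi (pairing D h \<kappa>)) (sidem P \<kappa>)"
    using fin by (auto simp: S_idem_def)
  finally show ?thesis .
qed

lemma idem_K:
  assumes "finite P"
  shows "S.eqv P (sidem P \<kappa> * sK P h) (scl (vv powi (pairing D h \<kappa>)) (sidem P \<kappa>))"
proof -
  have fin: "finite (weyl_orbit D P)" by (rule finite_weyl_orbit[OF assms])
  have "S.eqv P (sidem P \<kappa> * sK P h) (\<Sum>\<mu>\<in>weyl_orbit D P. scl (vv powi (pairing D h \<mu>)) (if \<kappa> = \<mu> then sidem P \<kappa> else 0))"
    unfolding sK_def sum_distrib_left scl_mult_right by (intro S.eqv_sum S.eqv_scl idem_mult)
  also have "(\<Sum>\<mu>\<in>weyl_orbit D P. scl (vv powi (pairing D h \<mu>)) (if \<kappa> = \<mu> then sidem P \<kappa> else 0)) =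
      (\<Sum>\<mu>\<in>weyl_orbit D P. if \<kappa> = \<mu> then scl (vv powi (pairing D h \<kappa>)) (sidem P \<kappa>) else 0)"
    by (intro sum.cong) auto
  also have "\<dots> = scl (vv powi (pairing D h \<kappa>)) (sidem P \<kappa>)"
    using fin by (auto simp: S_idem_def)
  finally show ?thesis .
qed

definition uwt :: "('i, 'y) U_gen word \<Rightarrow> 'x" where
  "uwt w = sum_list (map (U_gen_weight D) (letters w))"

lemma sub_mon_idem:
  assumes "finite P" "set w \<subseteq> U_gens D"
  shows "S.eqv P (sub P (mon (Word w)) * sidem P \<kappa>) (sidem P (\<kappa> + uwt (Word w)) * sub P (mon (Word w)))"
  using assms(2)
proof (induction w)
  case (Cons g w)
  have m: "sub P (mon (Word (g # w))) = psi P g * sub P (mon (Word w))"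
    by (simp add: gen_mult_mon[symmetric] subst_mult)
  have wF: "sub P (mon (Word w)) \<in> FA (S_gens D P)"
    using Cons.prems by (intro sub_FA) auto
  have gF: "psi P g \<in> FA (S_gens D P)"
    using Cons.prems by (intro psi_FA) auto
  define \<mu> where "\<mu> = \<kappa> + uwt (Word w)"
  have "S.eqv P (psi P g * (sub P (mon (Word w)) * sidem P \<kappa>)) (psi P g * (sidem P \<mu> * sub P (mon (Word w))))"
    unfolding \<mu>_def using Cons by (intro S.eqv_left gF) auto
  also have "psi P g * (sidem P \<mu> * sub P (mon (Word w))) = (psi P g * sidem P \<mu>) * sub P (mon (Word w))"
    by (simp add: mult.assoc)
  also have "S.eqv P \<dots> ((sidem P (\<mu> + U_gen_weight D g) * psi P g) * sub P (mon (Word w)))"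
  proof (rule S.eqv_right[OF wF])
    show "S.eqv P (psi P g * sidem P \<mu>) (sidem P (\<mu> + U_gen_weight D g) * psi P g)"
    proof (cases g)
      case (UE s i)
      then show ?thesis using Cons.prems E_idem by simp
    next
      case (UK h)
      then show ?thesis
        using S.eqv_trans[OF K_idem[OF assms(1)] S.eqv_sym[OF idem_K[OF assms(1)]]] by simp
    qed
  qed
  finally show ?case
    by (simp add: m \<mu>_def uwt_def algebra_simps)
qed (simp add: uwt_def)

lemma sub_idem:
  assumes "finite P" "p \<in> FA (U_gens D)" "homog uwt \<nu> p"
  shows "S.eqv P (sub P p * sidem P \<kappa>) (sidem P (\<kappa> + \<nu>) * sub P p)"
  unfolding S.eqv_def
proof (rule lmap_mem[of "\<lambda>p. sub P p * sidem P \<kappa> - sidem P (\<kappa> + \<nu>) * sub P p", OF _ S.J_subspace])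
  show "lmap (\<lambda>p. sub P p * sidem P \<kappa> - sidem P (\<kappa> + \<nu>) * sub P p)"
    by (rule lmap_minus[OF lmap_comp[OF lmap_mult_right lmap_subst] lmap_comp[OF lmap_mult_left lmap_subst]])
  fix k assume k: "k \<in> Poly_Mapping.keys p"
  then have "set (letters k) \<subseteq> U_gens D" "uwt k = \<nu>"
    using assms by (auto simp: FA_iff homog_def)
  then show "sub P (mon k) * sidem P \<kappa> - sidem P (\<kappa> + \<nu>) * sub P (mon k) \<in> S.J P"
    using sub_mon_idem[OF assms(1), of "letters k" \<kappa>] by (simp add: S.eqv_def)
qed

text \<open>The relations with \<open>K\<close> alone or with \<open>K\<close> and one generator are
  tested on idempotents. In the commutator relation the two sums over the orbit agree term by
  term.\<close>

lemma sub_U_rels: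
  assumes "finite P" "r \<in> U_rels D"
  shows "sub P r \<in> S.J P"
proof -
  have rF: "r \<in> FA (U_gens D)" using assms(2) U.rels by auto
  have K: "S.eqv P (sK P h * sidem P \<kappa>) (scl (vv powi (pairing D h \<kappa>)) (sidem P \<kappa>))" for h \<kappa>
    by (rule K_idem[OF assms(1)])
  from assms(2) consider
    h h' where "r = gen (UK h) * gen (UK h') - gen (UK (h + h'))"
  | "r = gen (UK 0) - 1"
  | h s i where "r = gen (UK h) * gen (UE s i) - scalar (vv powi (sg s * pairing D h (al i))) * gen (UE s i) * gen (UK h)" "i \<in> I"
  | i j where "r = gen (UE Plus i) * gen (UE Minus j) - gen (UE Minus j) * gen (UE Plus i) -
       (if i = j then scalar (1 / (vi D i - inverse (vi D i))) *
          (gen (UK (zmul (int (dd D i)) (simple_coroot D i))) - gen (UK (- zmul (int (dd D i)) (simple_coroot D i)))) else 0)" "i \<in> I" "j \<in> I"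
  | s i j where "r = serre D i j (gen (UE s i)) (gen (UE s j))" "i \<in> I" "j \<in> I" "i \<noteq> j"
    unfolding U_rels_def by blast
  then show ?thesis
  proof cases
    case 1
    show ?thesis
    proof (rule J_by_idem[OF sub_FA[OF rF]])
      fix \<kappa>
      have "S.eqv P (sK P h * (sK P h' * sidem P \<kappa>)) (sK P h * scl (vv powi (pairing D h' \<kappa>)) (sidem P \<kappa>))"
        by (rule S.eqv_left[OF sK_FA K])
      also have "sK P h * scl (vv powi (pairing D h' \<kappa>)) (sidem P \<kappa>) = scl (vv powi (pairing D h' \<kappa>)) (sK P h * sidem P \<kappa>)"
        by (rule scl_mult_right)
      also have "S.eqv P \<dots> (scl (vv powi (pairing D h' \<kappa>)) (scl (vv powi (pairing D h \<kappa>)) (sidem P \<kappa>)))"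
        by (rule S.eqv_scl[OF K])
      also have "\<dots> = scl (vv powi (pairing D (h + h') \<kappa>)) (sidem P \<kappa>)"
        by (simp add: power_int_add mult.commute)
      also have "S.eqv P \<dots> (sK P (h + h') * sidem P \<kappa>)"
        by (rule S.eqv_sym[OF K])
      finally show "sub P r * sidem P \<kappa> \<in> S.J P"
        by (simp add: 1 subst_simps subst_mult S.eqv_def algebra_simps)
    qed
  next
    case 2
    show ?thesis
      by (rule J_by_idem[OF sub_FA[OF rF]]) (use K[of 0] in \<open>simp add: 2 subst_simps S.eqv_def algebra_simps\<close>)
  next
    case 3
    show ?thesis
    proof (rule J_by_idem[OF sub_FA[OF rF]])
      fix \<kappa>
      define \<mu> where "\<mu> = \<kappa> + zmul (sg s) (al i)"
      define E :: "('i, 'x) S_gen word \<Rightarrow>\<^sub>0 qv" where "E = gen (SE s i)"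
      have E: "E \<in> FA (S_gens D P)" using 3 by (simp add: E_def)
      have Ei: "S.eqv P (E * sidem P \<kappa>) (sidem P \<mu> * E)"
        unfolding E_def \<mu>_def by (rule E_idem[OF 3(2)])
      have "S.eqv P (sK P h * (E * sidem P \<kappa>)) (sK P h * (sidem P \<mu> * E))"
        by (rule S.eqv_left[OF sK_FA Ei])
      also have "sK P h * (sidem P \<mu> * E) = (sK P h * sidem P \<mu>) * E"
        by (simp add: mult.assoc)
      also have "S.eqv P \<dots> (scl (vv powi (pairing D h \<mu>)) (sidem P \<mu>) * E)"
        by (rule S.eqv_right[OF E K])
      also have "\<dots> = scl (vv powi (pairing D h \<mu>)) (sidem P \<mu> * E)"
        by (rule scl_mult_left)
      also have "S.eqv P \<dots> (scl (vv powi (pairing D h \<mu>)) (E * sidem P \<kappa>))"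
        by (rule S.eqv_scl[OF S.eqv_sym[OF Ei]])
      also have "scl (vv powi (pairing D h \<mu>)) (E * sidem P \<kappa>) =
          scl (vv powi (sg s * pairing D h (al i))) (E * scl (vv powi (pairing D h \<kappa>)) (sidem P \<kappa>))"
        by (simp add: \<mu>_def power_int_add scl_mult_right mult.commute)
      also have "S.eqv P \<dots> (scl (vv powi (sg s * pairing D h (al i))) (E * (sK P h * sidem P \<kappa>)))"
        by (rule S.eqv_scl[OF S.eqv_left[OF E S.eqv_sym[OF K]]])
      finally show "sub P r * sidem P \<kappa> \<in> S.J P"
        by (simp add: 3 subst_simps subst_mult S.eqv_def algebra_simps E_def scalar_mult scl_mult_left)
    qed
  next
    case 4
    have "scl (1 / (vi D i - inverse (vi D i))) (sK P (zmul (int (dd D i)) (simple_coroot D i)) - sK P (- zmul (int (dd D i)) (simple_coroot D i))) =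
       (\<Sum>\<kappa>\<in>weyl_orbit D P. scalar (q_int (vi D i) (pr i \<kappa>)) * sidem P \<kappa>)"
      unfolding sK_def sum_subtractf[symmetric] pm.scale_sum_right scalar_mult
      by (intro sum.cong refl) (simp add: q_int_def vi_powi pm.scale_left_diff_distrib[symmetric] diff_divide_distrib)
    then show ?thesis
      using S_comm[OF 4(2,3), of P] by (auto simp: 4(1) subst_simps subst_mult S.eqv_def scalar_mult)
  next
    case 5
    then show ?thesis
      by (simp add: subst_serre S_serre)
  qed
qed

lemma presentation_map_psi:
  assumes "finite P"
  shows "presentation_map (U_gens D) (U_rels D) (S_gens D P) (S_rels D P)
    (\<lambda>g. case g of UE s i \<Rightarrow> S_E D P s i | UK h \<Rightarrow> S_K D P h) (psi P)"
proof
  show "(case g of UE s i \<Rightarrow> S_E D P s i | UK h \<Rightarrow> S_K D P h) = S.cls P (psi P g)" for g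
    by (cases g) (simp_all add: S_E_def S_K_cls[OF assms] S_folds)
qed (auto intro: psi_FA sub_U_rels[OF assms])

lemma sub_J: "finite P \<Longrightarrow> x \<in> U.J \<Longrightarrow> sub P x \<in> S.J P"
  using presentation_map.psi_J[OF presentation_map_psi] .

lemma p_map_cls: "finite P \<Longrightarrow> p \<in> FA (U_gens D) \<Longrightarrow> p_map D P (U_class D p) = S_class D P (sub P p)"
  using presentation_map.induced_map_cls[OF presentation_map_psi, of P p]
  by (simp add: p_map_def U_folds S_folds)

lemma tau_S_rels:
  assumes "finite P'" "P \<subseteq> P'" "r \<in> S_rels D P'"
  shows "subst (tau P) r \<in> S.J P"
proof -
  have sub: "weyl_orbit D P \<subseteq> weyl_orbit D P'" by (rule weyl_orbit_mono[OF assms(2)])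
  have fin: "finite (weyl_orbit D P')" by (rule finite_weyl_orbit[OF assms(1)])
  have idem: "subst (tau P) (sidem P' \<kappa>) = sidem P \<kappa>" for \<kappa>
    using sub by (auto simp: S_idem_def subst_simps)
  \<comment> \<open>Summands outside the smaller orbit vanish because \<open>S_idem\<close> is 0
    there.\<close>
  have sums: "(\<Sum>\<kappa>\<in>weyl_orbit D P'. scl (c \<kappa>) (sidem P \<kappa>)) = (\<Sum>\<kappa>\<in>weyl_orbit D P. scl (c \<kappa>) (sidem P \<kappa>))" for c
    using fin sub by (intro sum.mono_neutral_right) (auto simp: S_idem_def)
  from assms(3) consider
    \<kappa> \<kappa>' where "r = sidem P' \<kappa> * sidem P' \<kappa>' - (if \<kappa> = \<kappa>' then sidem P' \<kappa> else 0)"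
  | "r = (\<Sum>\<kappa>\<in>weyl_orbit D P'. sidem P' \<kappa>) - 1"
  | s i \<kappa> where "r = gen (SE s i) * sidem P' \<kappa> - sidem P' (\<kappa> + zmul (sg s) (al i)) * gen (SE s i)" "i \<in> I"
  | i j where "r = gen (SE Plus i) * gen (SE Minus j) - gen (SE Minus j) * gen (SE Plus i) -
       (if i = j then (\<Sum>\<kappa>\<in>weyl_orbit D P'. scalar (q_int (vi D i) (pr i \<kappa>)) * sidem P' \<kappa>) else 0)" "i \<in> I" "j \<in> I"
  | s i j where "r = serre D i j (gen (SE s i)) (gen (SE s j))" "i \<in> I" "j \<in> I" "i \<noteq> j"
    unfolding S_rels_def by blast
  then show ?thesis
  proof cases
    case 1
    then show ?thesis
      using idem_mult[of P \<kappa> \<kappa>'] by (auto simp: subst_simps subst_mult idem S.eqv_def)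
  next
    case 2
    then show ?thesis
      using idem_sum[of P] sums[of "\<lambda>_. 1"] by (simp add: subst_simps idem S.eqv_def)
  next
    case 3
    then show ?thesis
      using E_idem[OF 3(2), of P s \<kappa>] by (simp add: subst_simps subst_mult idem S.eqv_def)
  next
    case 4
    then show ?thesis
      using S_comm[OF 4(2,3), of P] by (auto simp: subst_simps subst_mult idem S.eqv_def scalar_mult sums)
  next
    case 5
    then show ?thesis
      by (simp add: subst_serre S_serre)
  qed
qed

lemma presentation_map_tau:
  assumes "finite P'" "P \<subseteq> P'"
  shows "presentation_map (S_gens D P') (S_rels D P') (S_gens D P) (S_rels D P)
    (\<lambda>g. case g of SE s i \<Rightarrow> S_E D P s i | SI \<kappa> \<Rightarrow> S_one D P \<kappa>) (tau P)"
proof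
  show "(case g of SE s i \<Rightarrow> S_E D P s i | SI \<kappa> \<Rightarrow> S_one D P \<kappa>) = S.cls P (tau P g)" for g
    by (cases g) (simp_all add: S_E_def S_one_def S_folds)
qed (auto intro: tau_FA tau_S_rels[OF assms])

lemma S_trans_cls: "finite P' \<Longrightarrow> P \<subseteq> P' \<Longrightarrow> p \<in> FA (S_gens D P') \<Longrightarrow>
    S_trans D P (S_class D P' p) = S_class D P (subst (tau P) p)"
  using presentation_map.induced_map_cls[OF presentation_map_tau, of P' P p]
  by (simp add: S_trans_def S_folds)

lemma tau_idem: "P \<subseteq> P' \<Longrightarrow> subst (tau P) (sidem P' \<kappa>) = sidem P \<kappa>"
  using weyl_orbit_mono[of P P'] by (auto simp: S_idem_def subst_simps)

lemma tau_sub: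
  assumes "finite P'" "P \<subseteq> P'"
  shows "subst (tau P) (sub P' p) = sub P p"
proof (rule lmap_eqI[OF lmap_comp[OF lmap_subst lmap_subst] lmap_subst])
  fix w
  have sums: "(\<Sum>\<kappa>\<in>weyl_orbit D P'. scl (c \<kappa>) (sidem P \<kappa>)) = (\<Sum>\<kappa>\<in>weyl_orbit D P. scl (c \<kappa>) (sidem P \<kappa>))" for c
    using finite_weyl_orbit[OF assms(1)] weyl_orbit_mono[OF assms(2)]
    by (intro sum.mono_neutral_right) (auto simp: S_idem_def)
  have g: "subst (tau P) (psi P' g) = psi P g" for g
    by (cases g) (simp_all add: sK_def subst_simps tau_idem[OF assms(2)] sums)
  have "subst (tau P) (prod_list (map (psi P') ws)) = prod_list (map (psi P) ws)" for ws
    by (induction ws) (simp_all add: subst_mult g)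
  then show "subst (tau P) (sub P' (mon w)) = sub P (mon w)"
    by (simp add: subst_mon)
qed

end

context finite_root_datum
begin

section \<open>The components of the modified form\<close>

text \<open>The defining subspace of a component, pulled back to the free algebra: elements of the
  component become polynomials modulo \<open>MS\<close>, which contains the ideal of the enveloping
  algebra.\<close>

definition MS :: "'x \<Rightarrow> 'x \<Rightarrow> (('i, 'y) U_gen word \<Rightarrow>\<^sub>0 qv) set" where
  "MS \<kappa> \<kappa>' = {p \<in> FA (U_gens D). U_class D p \<in> mod_sub D \<kappa> \<kappa>'}"

abbreviation UF where "UF \<equiv> FA (U_gens D)"
abbreviation gK where "gK h \<equiv> gen (UK h) :: ('i, 'y) U_gen word \<Rightarrow>\<^sub>0 qv"

definition Kd :: "'y \<Rightarrow> 'x \<Rightarrow> ('i, 'y) U_gen word \<Rightarrow>\<^sub>0 qv" where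
  "Kd h \<kappa> = gK h - scl (vv powi (pairing D h \<kappa>)) 1"

lemma Kd_FA [simp]: "Kd h \<kappa> \<in> UF"
  by (auto simp: Kd_def intro!: FA_intros)

lemma mod_sub_eq: "mod_sub D \<kappa> \<kappa>' = generate (add_monoid (U_alg D))
    ({U_class D (Kd h \<kappa> * u) | h u. u \<in> UF} \<union> {U_class D (u * Kd h \<kappa>') | h u. u \<in> UF})"
proof -
  have K: "U_K D h \<ominus>\<^bsub>U_alg D\<^esub> vv powi (pairing D h \<kappa>) \<odot>\<^bsub>U_alg D\<^esub> \<one>\<^bsub>U_alg D\<^esub> = U.cls (Kd h \<kappa>)" for h \<kappa>
    unfolding U_K_def U_folds[symmetric] Kd_def
    by (simp add: U.Q_one U.Q_smult U.Q_minus FA_scl)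
  have "{(U_K D h \<ominus>\<^bsub>U_alg D\<^esub> vv powi (pairing D h \<kappa>) \<odot>\<^bsub>U_alg D\<^esub> \<one>\<^bsub>U_alg D\<^esub>) \<otimes>\<^bsub>U_alg D\<^esub> u | h u. u \<in> carrier (U_alg D)}
      = {U_class D (Kd h \<kappa> * u) | h u. u \<in> UF}"
    (is "?A = ?B")
  proof (intro equalityI subsetI)
    show "x \<in> ?A \<Longrightarrow> x \<in> ?B" for x
      unfolding K unfolding U_folds[symmetric] U.carrier_Q by (auto simp: U.Q_mult; blast)
    fix x assume "x \<in> ?B"
    then obtain h u where "x = U.cls (Kd h \<kappa> * u)" "u \<in> UF"
      by (auto simp: U_folds[symmetric])
    then have "x = U.cls (Kd h \<kappa>) \<otimes>\<^bsub>U.Q\<^esub> U.cls u" "U.cls u \<in> carrier U.Q"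
      by (simp_all add: U.Q_mult)
    then show "x \<in> ?A"
      unfolding K unfolding U_folds[symmetric] by blast
  qed
  moreover have "{u \<otimes>\<^bsub>U_alg D\<^esub> (U_K D h \<ominus>\<^bsub>U_alg D\<^esub> vv powi (pairing D h \<kappa>') \<odot>\<^bsub>U_alg D\<^esub> \<one>\<^bsub>U_alg D\<^esub>) | h u. u \<in> carrier (U_alg D)}
      = {U_class D (u * Kd h \<kappa>') | h u. u \<in> UF}"
    (is "?A = ?B")
  proof (intro equalityI subsetI)
    show "x \<in> ?A \<Longrightarrow> x \<in> ?B" for x
      unfolding K unfolding U_folds[symmetric] U.carrier_Q by (auto simp: U.Q_mult; blast)
    fix x assume "x \<in> ?B"
    then obtain h u where "x = U.cls (u * Kd h \<kappa>')" "u \<in> UF"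
      by (auto simp: U_folds[symmetric])
    then have "x = U.cls u \<otimes>\<^bsub>U.Q\<^esub> U.cls (Kd h \<kappa>')" "U.cls u \<in> carrier U.Q"
      by (simp_all add: U.Q_mult)
    then show "x \<in> ?A"
      unfolding K unfolding U_folds[symmetric] by blast
  qed
  ultimately show ?thesis
    unfolding mod_sub_def by simp
qed

lemma U_add_group: "group (add_monoid (U_alg D))"
  using abelian_group.a_group[OF ring.is_abelian_group[OF U.ring_Q]] by (simp add: U_folds)

lemma mod_sub_subgroup: "subgroup (mod_sub D \<kappa> \<kappa>') (add_monoid (U_alg D))"
  unfolding mod_sub_eq
  by (rule group.generate_is_subgroup[OF U_add_group])
     (auto simp: U.carrier_Q[unfolded U_folds] intro!: imageI FA_mult)

lemma mod_sub_carrier: "x \<in> mod_sub D \<kappa> \<kappa>' \<Longrightarrow> \<exists>p\<in>MS \<kappa> \<kappa>'. x = U_class D p"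
  using subgroup.subset[OF mod_sub_subgroup, of \<kappa> \<kappa>'] by (auto simp: MS_def U.carrier_Q[unfolded U_folds])

lemma MS_FA: "p \<in> MS \<kappa> \<kappa>' \<Longrightarrow> p \<in> UF"
  by (simp add: MS_def)

lemma MS_add: "p \<in> MS \<kappa> \<kappa>' \<Longrightarrow> r \<in> MS \<kappa> \<kappa>' \<Longrightarrow> p + r \<in> MS \<kappa> \<kappa>'"
  using subgroup.m_closed[OF mod_sub_subgroup, of "U_class D p" \<kappa> \<kappa>' "U_class D r"]
  by (auto simp: MS_def U.Q_add[unfolded U_folds] intro: FA_add)

lemma MS_J: "p \<in> U.J \<Longrightarrow> p \<in> MS \<kappa> \<kappa>'"
proof -
  assume p: "p \<in> U.J"
  then have "U_class D p = U_class D 0"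
    using U.cls_eq_iff[of p 0] U.J_FA[OF p] by (simp add: U_folds)
  also have "\<dots> = \<zero>\<^bsub>U_alg D\<^esub>"
    using U.Q_zero by (simp add: U_folds)
  finally show ?thesis
    using subgroup.one_closed[OF mod_sub_subgroup, of \<kappa> \<kappa>'] U.J_FA[OF p] by (simp add: MS_def)
qed

lemma MS_left: "u \<in> UF \<Longrightarrow> Kd h \<kappa> * u \<in> MS \<kappa> \<kappa>'"
  unfolding MS_def mod_sub_eq by (auto intro!: generate.incl FA_mult)

lemma MS_right: "u \<in> UF \<Longrightarrow> u * Kd h \<kappa>' \<in> MS \<kappa> \<kappa>'"
  unfolding MS_def mod_sub_eq by (auto intro!: generate.incl FA_mult)

text \<open>Induction over \<open>generate\<close>, transferred from classes to polynomials. That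
  \<open>M\<close> contains the ideal makes membership in it independent of the representative of a
  class.\<close>

lemma MS_induct:
  assumes "p \<in> MS \<kappa> \<kappa>'" "pm.subspace M" "U.J \<subseteq> M"
    and "\<And>h u. u \<in> UF \<Longrightarrow> Kd h \<kappa> * u \<in> M" "\<And>h u. u \<in> UF \<Longrightarrow> u * Kd h \<kappa>' \<in> M"
  shows "p \<in> M"
proof -
  have inM: "r \<in> M" if "U_class D p = U_class D r" "p \<in> UF" "r \<in> UF" "p \<in> M" for p r
  proof -
    have "p - r \<in> U.J" using that U.cls_eq_iff[of p r] by (simp add: U_folds)
    then have "p - r \<in> M" using assms(3) by blast
    from pm.subspace_diff[OF assms(2) that(4) this] show ?thesis by simp
  qed
  have "x \<in> mod_sub D \<kappa> \<kappa>' \<Longrightarrow> \<exists>p\<in>UF \<inter> M. x = U_class D p" for x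
    unfolding mod_sub_eq
  proof (induction rule: generate.induct)
    case one
    then show ?case
      using U.Q_zero subsetD[OF assms(3) U.J_zero] by (auto simp: U_folds intro!: bexI[of _ 0])
  next
    case (incl x)
    then show ?case
      using assms(4,5) FA_mult[OF Kd_FA] FA_mult[OF _ Kd_FA] by blast
  next
    case (inv x)
    then obtain p where p: "p \<in> UF" "p \<in> M" "x = U_class D p"
      using assms(4,5) FA_mult[OF Kd_FA] FA_mult[OF _ Kd_FA] by blast
    have "inv\<^bsub>add_monoid (U_alg D)\<^esub> x = U_class D (- p)"
      using U.Q_uminus[OF p(1)] p(3) by (simp add: a_inv_def U_folds)
    then show ?case
      using p pm.subspace_neg[OF assms(2)] by (auto intro!: bexI[of _ "- p"] FA_uminus)
  next
    case (eng x y)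
    then obtain p r where pr: "p \<in> UF" "p \<in> M" "x = U_class D p" "r \<in> UF" "r \<in> M" "y = U_class D r"
      by blast
    then have "x \<otimes>\<^bsub>add_monoid (U_alg D)\<^esub> y = U_class D (p + r)"
      using U.Q_add by (simp add: U_folds)
    then show ?case
      using pr pm.subspace_add[OF assms(2)] by (auto intro!: bexI[of _ "p + r"] FA_add)
  qed
  with assms(1) inM show ?thesis
    unfolding MS_def by (metis (no_types, lifting) IntD1 IntD2 mem_Collect_eq)
qed

lemma MS_uminus: "p \<in> MS \<kappa> \<kappa>' \<Longrightarrow> - p \<in> MS \<kappa> \<kappa>'"
  using subgroup.m_inv_closed[OF mod_sub_subgroup, of "U_class D p" \<kappa> \<kappa>'] U.Q_uminus[of p]
  by (auto simp: MS_def a_inv_def U_folds intro: FA_uminus)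

lemma Kd_central: "Kd h \<kappa> * scl c u = scl c (Kd h \<kappa> * u)" "scl c u * Kd h \<kappa> = scl c (u * Kd h \<kappa>)"
  by (simp_all add: scl_mult_right scl_mult_left)

lemma MS_scl: "p \<in> MS \<kappa> \<kappa>' \<Longrightarrow> scl c p \<in> MS \<kappa> \<kappa>'"
proof -
  assume p: "p \<in> MS \<kappa> \<kappa>'"
  have "p \<in> {p. \<forall>c. scl c p \<in> MS \<kappa> \<kappa>'}"
  proof (rule MS_induct[OF p])
    show "pm.subspace {p. \<forall>c. scl c p \<in> MS \<kappa> \<kappa>'}"
      using MS_J[OF U.J_zero] by (auto simp: pm.subspace_def pm.scale_right_distrib intro: MS_add)
    show "U.J \<subseteq> {p. \<forall>c. scl c p \<in> MS \<kappa> \<kappa>'}"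
      using MS_J U.J_scl by blast
  qed (auto simp: Kd_central[symmetric] intro!: MS_left MS_right FA_scl)
  then show ?thesis by blast
qed

lemma MS_subspace: "pm.subspace (MS \<kappa> \<kappa>')"
  using MS_J[OF U.J_zero] by (auto simp: pm.subspace_def intro: MS_add MS_scl)

lemmas MS_diff = pm.subspace_diff[OF MS_subspace]

lemma uwt_simps [simp]: "uwt (Word []) = 0" "uwt (Word (g # w)) = U_gen_weight D g + uwt (Word w)"
  by (simp_all add: uwt_def)

lemma K_mon_commute:
  "set w \<subseteq> U_gens D \<Longrightarrow> U.eqv (gK h * mon (Word w)) (scl (vv powi (pairing D h (uwt (Word w)))) (mon (Word w) * gK h))"
proof (induction w)
  case (Cons g w)
  define x where "x = mon (Word w)"
  define c where "c = vv powi (pairing D h (uwt (Word w)))"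
  have gF: "gen g \<in> UF" and xF: "x \<in> UF"
    using Cons.prems by (auto simp: x_def)
  have "U.eqv (gK h * gen g) (scl (vv powi (pairing D h (U_gen_weight D g))) (gen g * gK h))"
  proof (cases g)
    case (UE s i)
    then have "i \<in> I" using Cons.prems by simp
    then have "gK h * gen g - scalar (vv powi (sg s * pairing D h (al i))) * gen g * gK h \<in> U_rels D"
      unfolding U_rels_def UE by blast
    then show ?thesis
      using UE by (intro U.eqv_rel) (simp add: scalar_mult scl_mult_left)
  next
    case (UK h')
    have "gK h * gK h' - gK (h + h') \<in> U_rels D" "gK h' * gK h - gK (h' + h) \<in> U_rels D"
      unfolding U_rels_def by blast+
    then have "U.eqv (gK h * gK h') (gK (h + h'))" "U.eqv (gK h' * gK h) (gK (h + h'))"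
      by (auto intro!: U.eqv_rel simp: add.commute)
    then have "U.eqv (gK h * gK h') (gK h' * gK h)"
      by (blast intro: U.eqv_trans U.eqv_sym)
    then show ?thesis
      using UK by simp
  qed
  then have "U.eqv ((gK h * gen g) * x) (scl (vv powi (pairing D h (U_gen_weight D g))) (gen g * gK h) * x)"
    by (rule U.eqv_right[OF xF])
  also have "scl (vv powi (pairing D h (U_gen_weight D g))) (gen g * gK h) * x =
      scl (vv powi (pairing D h (U_gen_weight D g))) (gen g * (gK h * x))"
    by (simp add: scl_mult_left mult.assoc)
  also have "U.eqv \<dots> (scl (vv powi (pairing D h (U_gen_weight D g))) (gen g * scl c (x * gK h)))"
    unfolding x_def c_def using Cons by (intro U.eqv_scl U.eqv_left gF) auto
  finally show ?case
    by (simp add: gen_mult_mon[symmetric] x_def c_def scl_mult_right mult.assoc power_int_add)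
qed simp

text \<open>\<open>K\<close> acts on the left by one scalar, on the right by another, and passes the
  monomial up to a third. Unless the weight of the monomial is \<kappa> - \<kappa>', these are
  incompatible for some h, since the pairing separates weights, and a nonzero multiple of the
  monomial lies in \<open>MS\<close>. Hence homogeneous polynomials suffice to represent a
  component.\<close>

lemma mon_MS:
  assumes "set (letters w) \<subseteq> U_gens D" "uwt w \<noteq> \<kappa> - \<kappa>'"
  shows "mon w \<in> MS \<kappa> \<kappa>'"
proof -
  obtain u where w: "w = Word u" by (cases w)
  have wF: "mon w \<in> UF" using assms by simp
  obtain h where h: "pairing D h (uwt w) \<noteq> pairing D h (\<kappa> - \<kappa>')"
    using assms(2) pairing_separates by blast
  define c where "c = vv powi (pairing D h (uwt w))"
  have "gK h * mon w - scl c (mon w * gK h) \<in> MS \<kappa> \<kappa>'"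
    using K_mon_commute[of u h] assms(1) by (intro MS_J) (simp add: w c_def U.eqv_def)
  moreover have "Kd h \<kappa> * mon w \<in> MS \<kappa> \<kappa>'" "scl c (mon w * Kd h \<kappa>') \<in> MS \<kappa> \<kappa>'"
    by (intro MS_left MS_right MS_scl wF)+
  ultimately have "(gK h * mon w - scl c (mon w * gK h)) - Kd h \<kappa> * mon w + scl c (mon w * Kd h \<kappa>') \<in> MS \<kappa> \<kappa>'"
    by (rule MS_add[OF MS_diff])
  also have "(gK h * mon w - scl c (mon w * gK h)) - Kd h \<kappa> * mon w + scl c (mon w * Kd h \<kappa>') =
      scl (vv powi (pairing D h \<kappa>) - c * vv powi (pairing D h \<kappa>')) (mon w)"
    by (simp add: Kd_def algebra_simps scl_mult_left scl_mult_right pm.scale_right_diff_distrib pm.scale_left_diff_distrib)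
  finally have "scl (vv powi (pairing D h \<kappa>) - c * vv powi (pairing D h \<kappa>')) (mon w) \<in> MS \<kappa> \<kappa>'" .
  moreover have "vv powi (pairing D h \<kappa>) - c * vv powi (pairing D h \<kappa>') \<noteq> 0"
  proof
    assume "vv powi (pairing D h \<kappa>) - c * vv powi (pairing D h \<kappa>') = 0"
    then have "vv powi (pairing D h \<kappa>) = vv powi (pairing D h (uwt w) + pairing D h \<kappa>')"
      by (simp add: c_def power_int_add)
    then have "vv powi (pairing D h \<kappa> - (pairing D h (uwt w) + pairing D h \<kappa>')) = 1"
      by (simp add: power_int_diff)
    then have "vv ^ nat \<bar>pairing D h \<kappa> - (pairing D h (uwt w) + pairing D h \<kappa>')\<bar> = 1"
      by (auto simp: power_int_def abs_if power_inverse split: if_splits)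
    then show False
      using vv_power_eq_1 h by fastforce
  qed
  ultimately show ?thesis
    using MS_scl[of "scl (vv powi (pairing D h \<kappa>) - c * vv powi (pairing D h \<kappa>')) (mon w)" \<kappa> \<kappa>' "inverse (vv powi (pairing D h \<kappa>) - c * vv powi (pairing D h \<kappa>'))"]
    by simp
qed

lemma filt_MS: "p \<in> UF \<Longrightarrow> p - filt (\<lambda>w. uwt w = \<kappa> - \<kappa>') p \<in> MS \<kappa> \<kappa>'"
proof (rule lmap_mem[OF lmap_minus[OF lmap_id lmap_filt] MS_subspace])
  fix w assume "p \<in> UF" "w \<in> Poly_Mapping.keys p"
  then have "set (letters w) \<subseteq> U_gens D" by (simp add: FA_iff)
  then show "mon w - filt (\<lambda>w. uwt w = \<kappa> - \<kappa>') (mon w) \<in> MS \<kappa> \<kappa>'"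
    using mon_MS pm.subspace_0[OF MS_subspace] by auto
qed

definition ker :: "'x \<Rightarrow> 'x \<Rightarrow> 'x set \<Rightarrow> (('i, 'y) U_gen word \<Rightarrow>\<^sub>0 qv) set" where
  "ker \<kappa> \<kappa>' P = {p. sidem P \<kappa> * sub P p * sidem P \<kappa>' \<in> S.J P}"

lemma ker_subspace: "pm.subspace (ker \<kappa> \<kappa>' P)"
  using S.J_subspace
  by (auto simp: ker_def pm.subspace_def subst_simps distrib_left distrib_right scl_mult_left scl_mult_right S.J_scl S.J_add)

text \<open>The reason why \<open>pdot_map\<close> is well defined on cosets: next to the matching
  idempotent the image of \<open>Kd\<close> becomes 0.\<close>

lemma MS_ker:
  assumes "finite P" "p \<in> MS \<kappa> \<kappa>'"
  shows "p \<in> ker \<kappa> \<kappa>' P"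
proof (rule MS_induct[OF assms(2) ker_subspace])
  note F = FA_mult[OF FA_mult] S_idem_FA sub_FA
  show "U.J \<subseteq> ker \<kappa> \<kappa>' P"
    unfolding ker_def using S.J_right[OF S_idem_FA S.J_left[OF S_idem_FA sub_J[OF assms(1)]]] by blast
  fix h u assume u: "u \<in> UF"
  have "S.eqv P (sidem P \<kappa> * sub P (Kd h \<kappa>)) 0"
    using idem_K[OF assms(1), of \<kappa> h] by (simp add: Kd_def subst_simps algebra_simps scl_mult_right S.eqv_def)
  then have "sidem P \<kappa> * sub P (Kd h \<kappa>) * (sub P u * sidem P \<kappa>') \<in> S.J P"
    by - (rule S.J_right, intro FA_mult S_idem_FA sub_FA u, simp add: S.eqv_0)
  then show "Kd h \<kappa> * u \<in> ker \<kappa> \<kappa>' P"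
    by (simp add: ker_def subst_mult mult.assoc)
  have "S.eqv P (sub P (Kd h \<kappa>') * sidem P \<kappa>') 0"
    using K_idem[OF assms(1), of h \<kappa>'] by (simp add: Kd_def subst_simps algebra_simps scl_mult_left S.eqv_def)
  then have "(sidem P \<kappa> * sub P u) * (sub P (Kd h \<kappa>') * sidem P \<kappa>') \<in> S.J P"
    by - (rule S.J_left, intro FA_mult S_idem_FA sub_FA u, simp add: S.eqv_0)
  then show "u * Kd h \<kappa>' \<in> ker \<kappa> \<kappa>' P"
    by (simp add: ker_def subst_mult mult.assoc)
qed

section \<open>Triangular spanning set\<close>

text \<open>Lowering letters stand on the left, so the raising letters act first, while the second
  tensor factor is still the highest weight vector.\<close>

definition few :: "'i word \<times> 'i word \<Rightarrow> ('i, 'y) U_gen word" where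
  "few = (\<lambda>(B, A). Word (map (UE Minus) (letters A) @ map (UE Plus) (letters B)))"

definition sig :: "('i word \<times> 'i word \<Rightarrow>\<^sub>0 qv) \<Rightarrow> ('i, 'y) U_gen word \<Rightarrow>\<^sub>0 qv" where
  "sig = lext (\<lambda>k. mon (few k))"

lemma lmap_sig: "lmap sig"
  by (simp add: sig_def lmap_lext)

lemma sig_mon [simp]: "sig (mon k) = mon (few k)"
  by (simp add: sig_def)

definition good :: "('i word \<times> 'i word \<Rightarrow>\<^sub>0 qv) set" where
  "good = {t. \<forall>(B, A)\<in>Poly_Mapping.keys t. \<not> bad B \<and> \<not> bad A}"

lemma good_subspace: "pm.subspace good"
  by (auto simp: pm.subspace_def good_def dest!: subsetD[OF keys_add] subsetD[OF keys_scl])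

lemma few_FA: "\<not> bad B \<Longrightarrow> \<not> bad A \<Longrightarrow> set (letters (few (B, A))) \<subseteq> U_gens D"
  by (auto simp: few_def bad_def)

lemma sig_FA: "t \<in> good \<Longrightarrow> sig t \<in> UF"
proof (rule lmap_mem[OF lmap_sig FA_subspace])
  fix k assume "t \<in> good" "k \<in> Poly_Mapping.keys t"
  then have "\<not> bad (fst k)" "\<not> bad (snd k)"
    by (auto simp: good_def)
  then show "sig (mon k) \<in> UF"
    using few_FA[of "fst k" "snd k"] by simp
qed

text \<open>The largest left ideal contained in all the subspaces attached to the right weight.\<close>
definition LS :: "'x \<Rightarrow> (('i, 'y) U_gen word \<Rightarrow>\<^sub>0 qv) set" where
  "LS \<kappa>' = {p \<in> UF. \<forall>u\<in>UF. \<forall>\<kappa>. u * p \<in> MS \<kappa> \<kappa>'}"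

lemma LS_subspace: "pm.subspace (LS \<kappa>')"
  using pm.subspace_0[OF MS_subspace]
  by (auto simp: pm.subspace_def LS_def distrib_left scl_mult_right intro: MS_add MS_scl FA_add FA_scl)

lemma LS_MS: "p \<in> LS \<kappa>' \<Longrightarrow> p \<in> MS \<kappa> \<kappa>'"
  unfolding LS_def using FA_one by fastforce

lemma LS_left: "u \<in> UF \<Longrightarrow> p \<in> LS \<kappa>' \<Longrightarrow> u * p \<in> LS \<kappa>'"
  by (auto simp: LS_def mult.assoc[symmetric] intro: FA_mult)

lemma LS_J: "p \<in> U.J \<Longrightarrow> p \<in> LS \<kappa>'"
  by (auto simp: LS_def intro: MS_J U.J_left U.J_FA)

lemma LS_Kd: "u \<in> UF \<Longrightarrow> u * Kd h \<kappa>' \<in> LS \<kappa>'"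
  by (auto simp: LS_def mult.assoc[symmetric] intro: MS_right FA_mult)

text \<open>The congruence is modulo the left ideal \<open>LS\<close>, not modulo \<open>MS\<close>,
  because spanning is proved by multiplying with generators from the left.\<close>

definition spanned :: "'x \<Rightarrow> (('i, 'y) U_gen word \<Rightarrow>\<^sub>0 qv) set" where
  "spanned \<kappa>' = {p. \<exists>t\<in>good. p - sig t \<in> LS \<kappa>'}"

lemma spanned_subspace: "pm.subspace (spanned \<kappa>')"
proof -
  note LS = pm.subspace_add[OF LS_subspace] pm.subspace_scale[OF LS_subspace] pm.subspace_0[OF LS_subspace]
  note g = pm.subspace_add[OF good_subspace] pm.subspace_scale[OF good_subspace] pm.subspace_0[OF good_subspace]
  show ?thesis
    unfolding pm.subspace_def
  proof (intro conjI ballI allI)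
    show "0 \<in> spanned \<kappa>'"
      unfolding spanned_def using g(3) LS(3) by (auto intro!: bexI[of _ 0] simp: lmap_zero[OF lmap_sig])
    fix x assume "x \<in> spanned \<kappa>'"
    then obtain t where t: "t \<in> good" "x - sig t \<in> LS \<kappa>'" by (auto simp: spanned_def)
    show "scl c x \<in> spanned \<kappa>'" for c
      unfolding spanned_def using g(2)[OF t(1), of c] LS(2)[OF t(2), of c]
      by (auto intro!: bexI[of _ "scl c t"] simp: lmap_scl[OF lmap_sig] pm.scale_right_diff_distrib)
    fix y assume "y \<in> spanned \<kappa>'"
    then obtain s where s: "s \<in> good" "y - sig s \<in> LS \<kappa>'" by (auto simp: spanned_def)
    show "x + y \<in> spanned \<kappa>'"
      unfolding spanned_def using g(1)[OF t(1) s(1)] LS(1)[OF t(2) s(2)]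
      by (auto intro!: bexI[of _ "t + s"] simp: lmap_add[OF lmap_sig] algebra_simps)
  qed
qed

lemma spanned_cong: "p - r \<in> LS \<kappa>' \<Longrightarrow> r \<in> spanned \<kappa>' \<Longrightarrow> p \<in> spanned \<kappa>'"
  unfolding spanned_def using pm.subspace_add[OF LS_subspace, of "p - r" \<kappa>'] by fastforce

lemma spanned_few: "\<not> bad B \<Longrightarrow> \<not> bad A \<Longrightarrow> mon (few (B, A)) \<in> spanned \<kappa>'"
proof -
  assume "\<not> bad B" "\<not> bad A"
  then have "mon (B, A) \<in> good" by (simp add: good_def)
  then show ?thesis
    unfolding spanned_def using pm.subspace_0[OF LS_subspace] by (auto intro!: bexI[of _ "mon (B, A)"])
qed

lemma spanned_extend:
  assumes "u \<in> UF" "\<And>B A. \<not> bad B \<Longrightarrow> \<not> bad A \<Longrightarrow> u * mon (few (B, A)) \<in> spanned \<kappa>'" "p \<in> spanned \<kappa>'"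
  shows "u * p \<in> spanned \<kappa>'"
proof -
  obtain t where t: "t \<in> good" "p - sig t \<in> LS \<kappa>'" using assms(3) by (auto simp: spanned_def)
  have "u * sig t \<in> spanned \<kappa>'"
  proof (rule lmap_mem[of "\<lambda>t. u * sig t", OF lmap_comp[OF lmap_mult_left lmap_sig] spanned_subspace])
    fix k assume "k \<in> Poly_Mapping.keys t"
    then show "u * sig (mon k) \<in> spanned \<kappa>'"
      using t(1) assms(2)[of "fst k" "snd k"] by (auto simp: good_def)
  qed
  moreover have "u * p - u * sig t \<in> LS \<kappa>'"
    using LS_left[OF assms(1) t(2)] by (simp add: algebra_simps)
  ultimately show ?thesis by (rule spanned_cong[rotated])
qed

text \<open>A \<open>K\<close> on the left is moved to the right end of the monomial, where it is a
  scalar modulo \<open>LS\<close>.\<close>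

lemma spanned_K: "p \<in> spanned \<kappa>' \<Longrightarrow> gK h * p \<in> spanned \<kappa>'"
proof (rule spanned_extend)
  fix B A assume BA: "\<not> bad B" "\<not> bad A"
  define w where "w = few (B, A)"
  have wF: "mon w \<in> UF" using few_FA[OF BA] by (simp add: w_def)
  define c where "c = vv powi (pairing D h (uwt w))"
  have "gK h * mon w - scl c (mon w * gK h) \<in> LS \<kappa>'"
    using K_mon_commute[of "letters w" h] few_FA[OF BA] by (intro LS_J) (simp add: w_def c_def U.eqv_def)
  moreover have "scl c (mon w * Kd h \<kappa>') \<in> LS \<kappa>'"
    by (intro pm.subspace_scale[OF LS_subspace] LS_Kd wF)
  ultimately have "(gK h * mon w - scl c (mon w * gK h)) + scl c (mon w * Kd h \<kappa>') \<in> LS \<kappa>'"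
    by (rule pm.subspace_add[OF LS_subspace])
  then have "gK h * mon w - scl (c * vv powi (pairing D h \<kappa>')) (mon w) \<in> LS \<kappa>'"
    by (simp add: Kd_def algebra_simps scl_mult_right pm.scale_right_diff_distrib)
  then show "gK h * mon (few (B, A)) \<in> spanned \<kappa>'"
    unfolding w_def[symmetric]
    by (rule spanned_cong) (use spanned_few[OF BA] pm.subspace_scale[OF spanned_subspace] in \<open>auto simp: w_def\<close>)
qed simp

lemma few_minus: "gen (UE Minus i) * mon (few (B, A)) = mon (few (B, Word (i # letters A)))"
  by (simp add: few_def gen_mult_mon)

lemma spanned_minus: "i \<in> I \<Longrightarrow> p \<in> spanned \<kappa>' \<Longrightarrow> gen (UE Minus i) * p \<in> spanned \<kappa>'"
proof (rule spanned_extend)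
  show "i \<in> I \<Longrightarrow> \<not> bad B \<Longrightarrow> \<not> bad A \<Longrightarrow> gen (UE Minus i) * mon (few (B, A)) \<in> spanned \<kappa>'" for B A
    unfolding few_minus by (intro spanned_few) (auto simp: bad_def)
qed simp

lemma U_comm:
  assumes "i \<in> I" "j \<in> I"
  shows "U.eqv (gen (UE Plus i) * gen (UE Minus j)) (gen (UE Minus j) * gen (UE Plus i) +
    (if i = j then scl (1 / (vi D i - inverse (vi D i)))
      (gK (zmul (int (dd D i)) (simple_coroot D i)) - gK (- zmul (int (dd D i)) (simple_coroot D i))) else 0))"
proof -
  have "gen (UE Plus i) * gen (UE Minus j) - gen (UE Minus j) * gen (UE Plus i) -
       (if i = j then scalar (1 / (vi D i - inverse (vi D i))) *
          (gK (zmul (int (dd D i)) (simple_coroot D i)) - gK (- zmul (int (dd D i)) (simple_coroot D i))) else 0) \<in> U_rels D"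
    unfolding U_rels_def using assms by blast
  from U.J_rel[OF this] show ?thesis
    by (cases "i = j") (simp_all add: U.eqv_def scalar_mult diff_diff_add)
qed

text \<open>Passing an equal lowering letter leaves a difference of two \<open>K\<close> in front of
  a shorter monomial, which \<open>spanned_K\<close> absorbs; past the last lowering letter the new
  letter joins the raising word.\<close>

lemma spanned_plus: "i \<in> I \<Longrightarrow> p \<in> spanned \<kappa>' \<Longrightarrow> gen (UE Plus i) * p \<in> spanned \<kappa>'"
proof (rule spanned_extend)
  assume i: "i \<in> I"
  have "\<not> bad B \<Longrightarrow> \<not> bad (Word A) \<Longrightarrow> gen (UE Plus i) * mon (few (B, Word A)) \<in> spanned \<kappa>'" for B A
  proof (induction A)
    case Nil
    have "gen (UE Plus i) * mon (few (B, Word [])) = mon (few (Word (i # letters B), Word []))"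
      by (simp add: few_def gen_mult_mon)
    then show ?case
      using Nil i by (auto intro!: spanned_few simp: bad_def)
  next
    case (Cons j A)
    then have j: "j \<in> I" "\<not> bad (Word A)" by (auto simp: bad_def)
    define x where "x = mon (few (B, Word A))"
    have xF: "x \<in> UF" using few_FA[OF Cons.prems(1) j(2)] by (simp add: x_def)
    have xs: "x \<in> spanned \<kappa>'" unfolding x_def by (rule spanned_few[OF Cons.prems(1) j(2)])
    have "gen (UE Plus i) * mon (few (B, Word (j # A))) = (gen (UE Plus i) * gen (UE Minus j)) * x"
      using few_minus[of j B "Word A"] by (simp add: x_def mult.assoc)
    moreover have "(gen (UE Plus i) * gen (UE Minus j)) * x - (gen (UE Minus j) * gen (UE Plus i) +
       (if i = j then scl (1 / (vi D i - inverse (vi D i)))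
      (gK (zmul (int (dd D i)) (simple_coroot D i)) - gK (- zmul (int (dd D i)) (simple_coroot D i))) else 0)) * x \<in> LS \<kappa>'"
      using U.eqv_right[OF xF U_comm[OF i j(1)]] by (intro LS_J) (simp add: U.eqv_def)
    moreover have "(gen (UE Minus j) * gen (UE Plus i) +
       (if i = j then scl (1 / (vi D i - inverse (vi D i)))
      (gK (zmul (int (dd D i)) (simple_coroot D i)) - gK (- zmul (int (dd D i)) (simple_coroot D i))) else 0)) * x \<in> spanned \<kappa>'"
    proof -
      have 1: "gen (UE Minus j) * (gen (UE Plus i) * x) \<in> spanned \<kappa>'"
        unfolding x_def by (intro spanned_minus j(1) Cons.IH Cons.prems(1) j(2))
      have 2: "scl c (gK h * x - gK h' * x) \<in> spanned \<kappa>'" for c h h'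
        by (intro pm.subspace_scale[OF spanned_subspace] pm.subspace_diff[OF spanned_subspace] spanned_K xs)
      show ?thesis
        using pm.subspace_add[OF spanned_subspace 1 2] 1
        by (auto simp: distrib_right left_diff_distrib scl_mult_left mult.assoc)
    qed
    ultimately show ?case
      using spanned_cong by simp
  qed
  from this[of _ "letters A" for A]
  show "\<not> bad B \<Longrightarrow> \<not> bad A \<Longrightarrow> gen (UE Plus i) * mon (few (B, A)) \<in> spanned \<kappa>'" for B A
    by simp
qed simp

lemma spanned_all: "p \<in> UF \<Longrightarrow> p \<in> spanned \<kappa>'"
proof (rule lmap_mem[OF lmap_id spanned_subspace])
  fix w assume "p \<in> UF" "w \<in> Poly_Mapping.keys p"
  then have "set (letters w) \<subseteq> U_gens D" by (simp add: FA_iff)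
  moreover have "set u \<subseteq> U_gens D \<Longrightarrow> mon (Word u) \<in> spanned \<kappa>'" for u
  proof (induction u)
    case Nil
    then show ?case
      using spanned_few[of "Word []" "Word []" \<kappa>'] by (simp add: few_def bad_def)
  next
    case (Cons g u)
    then show ?case
      unfolding gen_mult_mon[symmetric]
      by (cases g; cases "case g of UE s i \<Rightarrow> s | UK h \<Rightarrow> Plus") (auto intro: spanned_K spanned_plus spanned_minus)
  qed
  ultimately show "mon w \<in> spanned \<kappa>'" by (cases w) simp
qed

lemma triangular: "p \<in> UF \<Longrightarrow> \<exists>t\<in>good. p - sig t \<in> MS \<kappa> \<kappa>'"
  using spanned_all[of p \<kappa>'] LS_MS unfolding spanned_def by blast

end

context finite_root_datum
begin

section \<open>Separation by the finite-dimensional quotients\<close>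

text \<open>The candidate action of a generalized Schur algebra on the tensor product: idempotents
  act as projections to weight spaces.\<close>

fun sact :: "'x \<Rightarrow> 'x \<Rightarrow> ('i, 'x) S_gen \<Rightarrow> ('i word \<times> 'i word \<Rightarrow>\<^sub>0 qv) \<Rightarrow> ('i word \<times> 'i word \<Rightarrow>\<^sub>0 qv)" where
  "sact a b (SE Plus i) = te a b i"
| "sact a b (SE Minus i) = tf a b i"
| "sact a b (SI \<kappa>) = filt (\<lambda>k. twt a b k = \<kappa>)"

lemma lmap_sact: "lmap (sact a b g)"
  by (cases "(a, b, g)" rule: sact.cases) (auto intro: lmap_te lmap_tf lmap_filt)

lemmas act_sact_mult = act_mult[of "sact a b" for a b, OF lmap_sact]
lemmas act_sact_simps = lmap_simps[OF lmap_act1[of "sact a b" for a b]]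

lemma act_sub_few: "act (sact a b) (sub P (mon (few (B, A)))) t = foldr (tf a b) (letters A) (foldr (te a b) (letters B) t)"
proof -
  have "foldr (\<lambda>g. act (sact a b) (psi P g)) (map (UE s) w) t = foldr (\<lambda>i. sact a b (SE s i)) w t" for s w t
    by (induction w) auto
  then show ?thesis
    by (simp add: act_subst[OF lmap_sact] few_def)
qed

lemma act_sub_sig: "act (sact a b) (sub P (sig t)) (mon (Word [], Word [])) = lead a b t"
proof (rule lmap_eqI[of "\<lambda>t. act (sact a b) (sub P (sig t)) (mon (Word [], Word []))", OF _ lmap_lead])
  show "lmap (\<lambda>t. act (sact a b) (sub P (sig t)) (mon (Word [], Word [])))"
    by (rule lmap_comp[OF lmap_act1 lmap_comp[OF lmap_subst lmap_sig]])
  fix k show "act (sact a b) (sub P (sig (mon k))) (mon (Word [], Word [])) = lead a b (mon k)"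
    by (cases k) (simp add: act_sub_few lead_def del: mon_Nil)
qed

context
  fixes a b :: 'x and P :: "'x set"
  assumes dom: "a \<in> dominant D" "b \<in> dominant D" and finP: "finite P"
    and wts: "umod_sub.weights (twt a b) (tN a b) \<subseteq> weyl_orbit D P"
begin

interpretation t: umod_sub D "twt a b" "te a b" "tf a b" "tN a b"
  by (rule umod_sub_tensor[OF dom])

lemma homog_outside: "homog (twt a b) \<mu> t \<Longrightarrow> \<mu> \<notin> weyl_orbit D P \<Longrightarrow> t \<in> tN a b"
  using wts by (auto simp: t.weights_def)

lemma sact_tN: "g \<in> S_gens D P \<Longrightarrow> t \<in> tN a b \<Longrightarrow> sact a b g t \<in> tN a b"
  by (cases "(a, b, g)" rule: sact.cases) (auto intro: t.N_e t.N_f t.N_filt)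

lemma act_tN: "x \<in> FA (S_gens D P) \<Longrightarrow> t \<in> tN a b \<Longrightarrow> act (sact a b) x t \<in> tN a b"
proof (rule lmap_mem[OF lmap_act1 tN_subspace])
  fix w assume "x \<in> FA (S_gens D P)" "w \<in> Poly_Mapping.keys x" and t: "t \<in> tN a b"
  then have "set (letters w) \<subseteq> S_gens D P" by (simp add: FA_iff)
  moreover have "set u \<subseteq> S_gens D P \<Longrightarrow> foldr (sact a b) u t \<in> tN a b" for u
    by (induction u) (use t in \<open>auto intro: sact_tN\<close>)
  ultimately show "act (sact a b) (mon w) t \<in> tN a b" by simp
qed

lemma act_idem: "act (sact a b) (sidem P \<kappa>) t - filt (\<lambda>k. twt a b k = \<kappa>) t \<in> tN a b"
proof (cases "\<kappa> \<in> weyl_orbit D P")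
  case True
  then show ?thesis using pm.subspace_0[OF tN_subspace] by (simp add: S_idem_def)
next
  case False
  then show ?thesis
    using homog_outside[OF homog_filt False] pm.subspace_neg[OF tN_subspace]
    by (simp add: S_idem_def act_sact_simps)
qed

lemma act_idem_homog:
  assumes "homog (twt a b) \<mu> t"
  shows "act (sact a b) (sidem P \<kappa>) t - (if \<mu> = \<kappa> then t else 0) \<in> tN a b"
  using act_idem[of \<kappa> t] by (simp add: filt_homog[OF assms])

lemma act_idem_exact:
  assumes "homog (twt a b) \<mu> t" "\<kappa> \<in> weyl_orbit D P"
  shows "act (sact a b) (sidem P \<kappa>) t = (if \<mu> = \<kappa> then t else 0)"
  using assms(2) by (simp add: S_idem_def filt_homog[OF assms(1)])

text \<open>The relations with idempotents can fail on the free space only through weights outside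
  the orbit, and vectors of such weights lie in \<open>tN\<close>. The Serre relations hold modulo
  \<open>tN\<close> because there are finitely many weights.\<close>

lemma act_rels:
  assumes r: "r \<in> S_rels D P"
  shows "act (sact a b) r t \<in> tN a b"
proof (rule lmap_mem[of "\<lambda>t. act (sact a b) r t", OF lmap_act2[OF lmap_sact] tN_subspace])
  fix k
  define t where "t = (mon k :: 'i word \<times> 'i word \<Rightarrow>\<^sub>0 qv)"
  define \<mu> where "\<mu> = twt a b k"
  have t: "homog (twt a b) \<mu> t" by (simp add: t_def \<mu>_def)
  have zero: "0 \<in> tN a b" by (rule pm.subspace_0[OF tN_subspace])
  have fin: "finite (weyl_orbit D P)" by (rule finite_weyl_orbit[OF finP])
  have idem: "act (sact a b) (sidem P \<kappa>) s = (if \<kappa> \<in> weyl_orbit D P \<and> \<nu> = \<kappa> then s else 0)"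
    if "homog (twt a b) \<nu> s" for \<kappa> \<nu> s
    using act_idem_exact[OF that, of \<kappa>] by (auto simp: S_idem_def act_sact_simps)
  from r consider
    \<kappa> \<kappa>' where "r = sidem P \<kappa> * sidem P \<kappa>' - (if \<kappa> = \<kappa>' then sidem P \<kappa> else 0)"
  | "r = (\<Sum>\<kappa>\<in>weyl_orbit D P. sidem P \<kappa>) - 1"
  | s i \<kappa> where "r = gen (SE s i) * sidem P \<kappa> - sidem P (\<kappa> + zmul (sg s) (al i)) * gen (SE s i)" "i \<in> I"
  | i j where "r = gen (SE Plus i) * gen (SE Minus j) - gen (SE Minus j) * gen (SE Plus i) -
       (if i = j then (\<Sum>\<kappa>\<in>weyl_orbit D P. scalar (q_int (vi D i) (pr i \<kappa>)) * sidem P \<kappa>) else 0)" "i \<in> I" "j \<in> I"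
  | s i j where "r = serre D i j (gen (SE s i)) (gen (SE s j))" "i \<in> I" "j \<in> I" "i \<noteq> j"
    unfolding S_rels_def by blast
  then have "act (sact a b) r t \<in> tN a b"
  proof cases
    case 1
    have "act (sact a b) (sidem P \<kappa>) (act (sact a b) (sidem P \<kappa>') t) = act (sact a b) (if \<kappa> = \<kappa>' then sidem P \<kappa> else 0) t"
      unfolding idem[OF t] by (auto simp: idem[OF t] act_sact_simps lmap_zero[OF lmap_act2[OF lmap_sact]])
    then show ?thesis
      using zero by (simp add: 1 act_sact_simps act_sact_mult)
  next
    case 2
    have "act (sact a b) (\<Sum>\<kappa>\<in>weyl_orbit D P. sidem P \<kappa>) t = (\<Sum>\<kappa>\<in>weyl_orbit D P. if \<mu> = \<kappa> then t else 0)"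
      unfolding act_sact_simps by (intro sum.cong) (simp_all add: idem[OF t])
    also have "\<dots> = (if \<mu> \<in> weyl_orbit D P then t else 0)"
      using fin by simp
    finally show ?thesis
      using zero homog_outside[OF t] pm.subspace_neg[OF tN_subspace] by (auto simp: 2 act_sact_simps)
  next
    case 3
    define g :: "('i word \<times> 'i word \<Rightarrow>\<^sub>0 qv) \<Rightarrow> ('i word \<times> 'i word \<Rightarrow>\<^sub>0 qv)" where "g = sact a b (SE s i)"
    have lg: "lmap g" unfolding g_def by (rule lmap_sact)
    have wg: "homog (twt a b) (\<mu> + zmul (sg s) (al i)) (g t)"
      unfolding g_def using t.wt_e[OF 3(2) t] t.wt_f[OF 3(2) t] by (cases s) simp_all
    have "act (sact a b) (sidem P (\<kappa> + zmul (sg s) (al i))) (g t) - (if \<mu> = \<kappa> then g t else 0) \<in> tN a b"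
      using act_idem_homog[OF wg, of "\<kappa> + zmul (sg s) (al i)"] by simp
    moreover have "g (act (sact a b) (sidem P \<kappa>) t - (if \<mu> = \<kappa> then t else 0)) \<in> tN a b"
      unfolding g_def using 3(2) by (intro sact_tN act_idem_homog t) simp
    then have "g (act (sact a b) (sidem P \<kappa>) t) - (if \<mu> = \<kappa> then g t else 0) \<in> tN a b"
      by (cases "\<mu> = \<kappa>") (simp_all add: lmap_diff[OF lg])
    ultimately have "(g (act (sact a b) (sidem P \<kappa>) t) - (if \<mu> = \<kappa> then g t else 0)) -
        (act (sact a b) (sidem P (\<kappa> + zmul (sg s) (al i))) (g t) - (if \<mu> = \<kappa> then g t else 0)) \<in> tN a b"
      by - (rule pm.subspace_diff[OF tN_subspace])
    then show ?thesis
      by (simp add: 3 act_sact_simps act_sact_mult g_def)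
  next
    case 4
    have "act (sact a b) (\<Sum>\<kappa>\<in>weyl_orbit D P. scalar (q_int (vi D i) (pr i \<kappa>)) * sidem P \<kappa>) t =
       (\<Sum>\<kappa>\<in>weyl_orbit D P. if \<mu> = \<kappa> then scl (q_int (vi D i) (pr i \<mu>)) t else 0)"
      unfolding act_sact_simps scalar_mult by (intro sum.cong) (simp_all add: idem[OF t])
    also have "\<dots> = (if \<mu> \<in> weyl_orbit D P then scl (q_int (vi D i) (pr i \<mu>)) t else 0)"
      using fin by simp
    finally have sum: "act (sact a b) (\<Sum>\<kappa>\<in>weyl_orbit D P. scalar (q_int (vi D i) (pr i \<kappa>)) * sidem P \<kappa>) t = \<dots>" .
    have "act (sact a b) r t = (if i = j then scl (q_int (vi D i) (pr i \<mu>)) t else 0) -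
        (if i = j then (if \<mu> \<in> weyl_orbit D P then scl (q_int (vi D i) (pr i \<mu>)) t else 0) else 0)"
      using t.comm[OF 4(2,3) t] sum by (auto simp: 4 act_sact_simps act_sact_mult)
    then show ?thesis
      using zero homog_outside[OF t] pm.subspace_scale[OF tN_subspace] by auto
  next
    case 5
    have ser: "act (sact a b) (serre D i j (gen (SE s i)) (gen (SE s j))) t =
        act (\<lambda>i. sact a b (SE s i)) (serre D i j (gen i) (gen j)) t"
      using act_subst[of "sact a b" "\<lambda>i. gen (SE s i)" "serre D i j (gen i) (gen j)" t, OF lmap_sact]
      by (simp add: subst_serre act_gen[abs_def])
    have w: "finite t.weights" by (rule finite_tweights[OF dom])
    show ?thesis
    proof (cases s)
      case Minus
      then show ?thesis
        using t.act_serre[OF 5(2-4), of t] t.yop_serre_mem[OF w 5(2-4), of t] pm.subspace_scale[OF tN_subspace]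
        unfolding 5(1) ser by simp
    next
      case Plus
      \<comment> \<open>For raising letters the argument is applied to the twisted module, whose
        weights are the negatives.\<close>
      interpret sw: umod_sub D "\<lambda>k. - twt a b k" "tf a b" "te a b" "tN a b" by (rule t.umod_sub_swap)
      have "sw.weights = uminus ` t.weights"
        unfolding sw.weights_def t.weights_def homog_neg by (auto simp: image_iff) (metis minus_minus)+
      then have "finite sw.weights" using w by simp
      then show ?thesis
        using Plus sw.act_serre[OF 5(2-4), of t] sw.yop_serre_mem[OF _ 5(2-4), of t] pm.subspace_scale[OF tN_subspace]
        unfolding 5(1) ser by simp
    qed
  qed
  then show "act (sact a b) r (mon k) \<in> tN a b" by (simp add: t_def)
qed

lemma act_J: "x \<in> S.J P \<Longrightarrow> act (sact a b) x t \<in> tN a b"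
proof -
  have "pideal (S_gens D P) {x \<in> FA (S_gens D P). \<forall>t. act (sact a b) x t \<in> tN a b}"
    unfolding pideal_def using pm.subspace_0[OF tN_subspace] pm.subspace_add[OF tN_subspace]
    by (auto simp: act_sact_simps act_sact_mult intro: FA_add FA_mult act_tN)
  then have "S.J P \<subseteq> {x \<in> FA (S_gens D P). \<forall>t. act (sact a b) x t \<in> tN a b}"
    using act_rels S.rels by (intro S.J_minimal) auto
  then show "x \<in> S.J P \<Longrightarrow> act (sact a b) x t \<in> tN a b" by blast
qed

text \<open>The compressed element is applied to the tensor of lowest and highest weight vectors, of
  weight b - a: modulo \<open>tN\<close> the right idempotent fixes it and the left one cuts out the
  component of weight \<kappa>.\<close>

lemma ker_lead:
  assumes "sig t \<in> ker \<kappa> (b - a) P" "t \<in> good"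
  shows "filt (\<lambda>k. twt a b k = \<kappa>) (lead a b t) \<in> tN a b"
proof -
  define v where "v = (mon (Word [], Word []) :: 'i word \<times> 'i word \<Rightarrow>\<^sub>0 qv)"
  define x where "x = sub P (sig t)"
  have xF: "x \<in> FA (S_gens D P)" unfolding x_def by (intro sub_FA sig_FA assms(2))
  have v: "homog (twt a b) (b - a) v"
    by (simp add: v_def twt_def vwt_def)
  note l2 = lmap_diff[OF lmap_act2[OF lmap_sact]]
  have "act (sact a b) (sidem P \<kappa> * x * sidem P (b - a)) v \<in> tN a b"
    using assms(1) by (intro act_J) (simp add: ker_def x_def)
  then have 1: "act (sact a b) (sidem P \<kappa>) (act (sact a b) x (act (sact a b) (sidem P (b - a)) v)) \<in> tN a b"
    by (simp add: act_sact_mult)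
  have "act (sact a b) (sidem P (b - a)) v - v \<in> tN a b"
    using act_idem_homog[OF v, of "b - a"] by simp
  then have 3: "act (sact a b) (sidem P \<kappa>) (act (sact a b) x (act (sact a b) (sidem P (b - a)) v - v)) \<in> tN a b"
    by (intro act_tN xF S_idem_FA)
  then have 2: "act (sact a b) (sidem P \<kappa>) (act (sact a b) x v) \<in> tN a b"
    using pm.subspace_diff[OF tN_subspace 1 3] by (simp add: l2)
  have "act (sact a b) x v = lead a b t"
    unfolding x_def v_def by (rule act_sub_sig)
  then show ?thesis
    using pm.subspace_diff[OF tN_subspace 2 act_idem[of \<kappa> "act (sact a b) x v"]] by simp
qed

end

lemma sig_tens: "sig (tens p r) = subst (\<lambda>i. gen (UE Minus i)) r * subst (\<lambda>i. gen (UE Plus i)) p"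
proof (rule lmap_eqI[of "\<lambda>p. sig (tens p r)" "\<lambda>p. subst (\<lambda>i. gen (UE Minus i)) r * subst (\<lambda>i. gen (UE Plus i)) p"])
  show "lmap (\<lambda>p. sig (tens p r))"
    by (rule lmap_comp[OF lmap_sig lmap_tens_left])
  show "lmap (\<lambda>p. subst (\<lambda>i. gen (UE Minus i)) r * subst (\<lambda>i. gen (UE Plus i)) p)"
    by (rule lmap_comp[OF lmap_mult_left lmap_subst])
  fix B
  have w: "prod_list (map (\<lambda>i. gen (UE s i)) u) = mon (Word (map (UE s) u))" for s u
    by (induction u) (simp_all add: gen_mult_mon)
  show "sig (tens (mon B) r) = subst (\<lambda>i. gen (UE Minus i)) r * subst (\<lambda>i. gen (UE Plus i)) (mon B)"
    by (rule lmap_eqI[of "\<lambda>r. sig (tens (mon B) r)" "\<lambda>r. subst (\<lambda>i. gen (UE Minus i)) r * subst (\<lambda>i. gen (UE Plus i)) (mon B)"])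
       (auto intro!: lmap_comp[OF lmap_sig lmap_tens_right] lmap_comp[OF lmap_mult_right lmap_subst]
         simp: subst_mon w few_def mon_mult plus_word_def)
qed

lemma subst_ser_good: "x \<in> ser_good \<Longrightarrow> subst (\<lambda>i. gen (UE s i)) x \<in> U.J"
proof -
  assume "x \<in> ser_good"
  then obtain u w i j where x: "x = mon u * ser i j * mon w" "i \<in> I" "j \<in> I" "i \<noteq> j" "\<not> bad u" "\<not> bad w"
    by (auto simp: ser_good_def)
  have F: "\<not> bad u \<Longrightarrow> subst (\<lambda>i. gen (UE s i)) (mon u) \<in> UF" for u
    by (rule FA_subst[of _ I]) (auto simp: bad_def)
  have "serre D i j (gen (UE s i)) (gen (UE s j)) \<in> U.J"
    using x(2-4) by (intro U.J_rel) (unfold U_rels_def, blast)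
  then show ?thesis
    unfolding x(1) subst_mult ser_def subst_serre subst_gen
    by (intro U.J_right U.J_left F x)
qed

text \<open>By \<open>sig_tens\<close> a Serre element in either slot becomes a factor of a product
  in the enveloping algebra.\<close>

lemma sig_serT: "t \<in> serT \<Longrightarrow> sig t \<in> U.J"
  unfolding serT_def
proof (rule lmap_span[OF lmap_sig U.J_subspace])
  have F: "\<not> bad u \<Longrightarrow> subst (\<lambda>i. gen (UE s i)) (mon u) \<in> UF" for u s
    by (rule FA_subst[of _ I]) (auto simp: bad_def)
  fix z assume "z \<in> {tens x (mon A) |x A. x \<in> ser_good \<and> \<not> bad A} \<union> {tens (mon B) x |x B. x \<in> ser_good \<and> \<not> bad B}"
  then show "sig z \<in> U.J"
    by (auto simp: sig_tens intro: U.J_left[OF F subst_ser_good] U.J_right[OF F subst_ser_good])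
qed

lemma uwt_few: "uwt (few (B, A)) = wsum B - wsum A"
proof -
  have "sum_list (map (U_gen_weight D) (map (UE Minus) w)) = - wsum (Word w)"
    "sum_list (map (U_gen_weight D) (map (UE Plus) w)) = wsum (Word w)" for w
    by (induction w) (simp_all add: algebra_simps)
  from this(1)[of "letters A"] this(2)[of "letters B"] show ?thesis
    by (simp add: few_def uwt_def)
qed

text \<open>Induction on the largest degree of a raising monomial: the leading part is a combination of Serre elements.\<close>
lemma ker_sig_MS:
  assumes "\<And>B A. (B, A) \<in> Poly_Mapping.keys t \<Longrightarrow> len B < n" "t \<in> good"
    and "\<And>k. k \<in> Poly_Mapping.keys t \<Longrightarrow> uwt (few k) = \<kappa> - \<kappa>'"
    and "\<And>P. P \<in> finite_saturated D \<Longrightarrow> sig t \<in> ker \<kappa> \<kappa>' P"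
  shows "sig t \<in> MS \<kappa> \<kappa>'"
  using assms
proof (induction n arbitrary: t)
  case 0
  then have "Poly_Mapping.keys t = {}" by fastforce
  then have "t = 0" by simp
  then show ?case
    using MS_J[OF U.J_zero] by (simp add: lmap_zero[OF lmap_sig])
next
  case (Suc m)
  \<comment> \<open>\<open>d\<close> bounds the raising words, of length at most m, and every
    lowering word in the support.\<close>
  define d where "d = m + (\<Sum>k\<in>Poly_Mapping.keys t. len (snd k))"
  have d: "len A \<le> d" if "(B, A) \<in> Poly_Mapping.keys t" for B A
    using member_le_sum[OF that, of "\<lambda>k. len (snd k)"] by (simp add: d_def)
  obtain a b where ab: "a \<in> dominant D" "b \<in> dominant D" "b - a = \<kappa>'" "\<And>i. i \<in> I \<Longrightarrow> int d \<le> pr i a \<and> int d \<le> pr i b"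
    using exists_large_weights[of \<kappa>' d] by blast
  obtain P where P: "P \<in> finite_saturated D" "umod_sub.weights (twt a b) (tN a b) \<subseteq> weyl_orbit D P"
    using exists_finite_saturated[OF finite_tweights[OF ab(1,2)]] by blast
  have finP: "finite P" using P(1) by (simp add: finite_saturated_def)
  have twt: "twt a b k = \<kappa>" if "k \<in> Poly_Mapping.keys t" for k
    using Suc.prems(3)[OF that] ab(3) by (cases k) (simp add: uwt_few twt_def vwt_def algebra_simps)
  let ?Q = "\<lambda>(B, A). len B = m \<and> len A \<le> d \<and> \<not> bad B \<and> \<not> bad A"
  define top where "top = filt (\<lambda>(B, A). len B = m) t"
  have "filt (\<lambda>k. twt a b k = \<kappa>) (lead a b t) \<in> tN a b"
    using ker_lead[OF ab(1,2) finP P(2)] Suc.prems(2) Suc.prems(4)[OF P(1)] ab(3) by blast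
  then have "filt ?Q (filt (\<lambda>k. twt a b k = \<kappa>) (lead a b t)) \<in> serT"
    using ab(4) by (intro low_part) (auto simp: d_def)
  \<comment> \<open>The two filters commute; on the top part the weight filter is then the
    identity.\<close>
  also have "filt ?Q (filt (\<lambda>k. twt a b k = \<kappa>) (lead a b t)) = filt (\<lambda>k. twt a b k = \<kappa>) (filt ?Q (lead a b t))"
    by (rule poly_mapping_eqI) (simp add: lookup_filt)
  also have "filt ?Q (lead a b t) = top"
    unfolding top_def using Suc.prems(1,2) d by (intro filt_lead) (auto simp: good_def less_Suc_eq_le)
  also have "filt (\<lambda>k. twt a b k = \<kappa>) top = top"
    using twt by (intro filt_id) (auto simp: top_def keys_filt)
  finally have top: "sig top \<in> U.J" by (rule sig_serT)
  have rest: "t - top = filt (\<lambda>(B, A). len B \<noteq> m) t"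
    by (rule poly_mapping_eqI) (auto simp: top_def lookup_minus lookup_filt)
  have keys: "Poly_Mapping.keys (t - top) \<subseteq> Poly_Mapping.keys t"
    by (auto simp: rest keys_filt)
  have "sig (t - top) \<in> MS \<kappa> \<kappa>'"
  proof (rule Suc.IH)
    show "len B < m" if "(B, A) \<in> Poly_Mapping.keys (t - top)" for B A
      using that Suc.prems(1)[of B A] by (auto simp: rest keys_filt)
    show "t - top \<in> good"
      using keys Suc.prems(2) by (auto simp: good_def)
    show "uwt (few k) = \<kappa> - \<kappa>'" if "k \<in> Poly_Mapping.keys (t - top)" for k
      using that keys Suc.prems(3) by blast
    show "sig (t - top) \<in> ker \<kappa> \<kappa>' P" if "P \<in> finite_saturated D" for P
    proof -
      have "sig top \<in> ker \<kappa> \<kappa>' P"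
        using that by (intro MS_ker MS_J top) (simp add: finite_saturated_def)
      then show ?thesis
        using pm.subspace_diff[OF ker_subspace Suc.prems(4)[OF that]] by (simp add: lmap_diff[OF lmap_sig])
    qed
  qed
  from MS_add[OF this MS_J[OF top]] show ?case
    by (simp add: lmap_diff[OF lmap_sig])
qed

text \<open>A triangular expansion may contain monomials of the wrong weight. They lie in
  \<open>MS\<close>, hence in every \<open>ker\<close>, and are removed before the induction, which
  needs a combination of one weight.\<close>

theorem ker_MS:
  assumes "p \<in> UF" "\<And>P. P \<in> finite_saturated D \<Longrightarrow> p \<in> ker \<kappa> \<kappa>' P"
  shows "p \<in> MS \<kappa> \<kappa>'"
proof -
  obtain t where t: "t \<in> good" "p - sig t \<in> MS \<kappa> \<kappa>'"
    using triangular[OF assms(1)] by blast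
  define s where "s = filt (\<lambda>k. uwt (few k) = \<kappa> - \<kappa>') t"
  have ts: "t - s = filt (\<lambda>k. uwt (few k) \<noteq> \<kappa> - \<kappa>') t"
    by (rule poly_mapping_eqI) (auto simp: s_def lookup_minus lookup_filt)
  have "sig (t - s) \<in> MS \<kappa> \<kappa>'"
  proof (rule lmap_mem[OF lmap_sig MS_subspace])
    fix k assume "k \<in> Poly_Mapping.keys (t - s)"
    then have k: "k \<in> Poly_Mapping.keys t" "uwt (few k) \<noteq> \<kappa> - \<kappa>'" by (auto simp: ts keys_filt)
    then have "\<not> bad (fst k)" "\<not> bad (snd k)"
      using t(1) by (auto simp: good_def)
    from few_FA[OF this] show "sig (mon k) \<in> MS \<kappa> \<kappa>'"
      using k(2) by (auto intro!: mon_MS)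
  qed
  from MS_add[OF t(2) this] have ps: "p - sig s \<in> MS \<kappa> \<kappa>'"
    by (simp add: lmap_diff[OF lmap_sig])
  define n where "n = Suc (\<Sum>k\<in>Poly_Mapping.keys s. len (fst k))"
  have "sig s \<in> MS \<kappa> \<kappa>'"
  proof (rule ker_sig_MS[of s n])
    show "len B < n" if "(B, A) \<in> Poly_Mapping.keys s" for B A
      using member_le_sum[OF that, of "\<lambda>k. len (fst k)"] by (simp add: n_def)
    show "s \<in> good" using t(1) by (auto simp: s_def good_def keys_filt)
    show "uwt (few k) = \<kappa> - \<kappa>'" if "k \<in> Poly_Mapping.keys s" for k
      using that by (simp add: s_def keys_filt)
    show "sig s \<in> ker \<kappa> \<kappa>' P" if "P \<in> finite_saturated D" for P
    proof -
      have "p - sig s \<in> ker \<kappa> \<kappa>' P"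
        using that by (intro MS_ker ps) (simp add: finite_saturated_def)
      then show ?thesis
        using pm.subspace_diff[OF ker_subspace assms(2)[OF that], of "p - sig s"] by simp
    qed
  qed
  from MS_add[OF ps this] show ?thesis by simp
qed

end

context finite_root_datum
begin

section \<open>The modified form in terms of homogeneous representatives\<close>

definition cl :: "'x \<Rightarrow> 'x \<Rightarrow> (('i, 'y) U_gen word \<Rightarrow>\<^sub>0 qv) \<Rightarrow> ('i, 'y) U_elem set" where
  "cl \<kappa> \<kappa>' p = mod_proj D \<kappa> \<kappa>' (U_class D p)"

lemma mem_cl: "p \<in> UF \<Longrightarrow> x \<in> cl \<kappa> \<kappa>' p \<longleftrightarrow> (\<exists>m\<in>MS \<kappa> \<kappa>'. x = U_class D (m + p))"
proof -
  assume p: "p \<in> UF"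
  have add: "U_class D m \<oplus>\<^bsub>U_alg D\<^esub> U_class D p = U_class D (m + p)" if "m \<in> MS \<kappa> \<kappa>'" for m
    using U.Q_add[OF MS_FA[OF that] p] by (simp add: U_folds)
  have "x \<in> cl \<kappa> \<kappa>' p \<longleftrightarrow> (\<exists>h\<in>mod_sub D \<kappa> \<kappa>'. x = h \<oplus>\<^bsub>U_alg D\<^esub> U_class D p)"
    by (auto simp: cl_def mod_proj_def a_r_coset_def r_coset_def)
  also have "\<dots> \<longleftrightarrow> (\<exists>m\<in>MS \<kappa> \<kappa>'. x = U_class D m \<oplus>\<^bsub>U_alg D\<^esub> U_class D p)"
    using mod_sub_carrier by (fastforce simp: MS_def)
  finally show ?thesis
    using add by auto
qed

lemma cl_image: "p \<in> UF \<Longrightarrow> cl \<kappa> \<kappa>' p = (\<lambda>m. U_class D (m + p)) ` MS \<kappa> \<kappa>'"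
  using mem_cl by blast

lemma U_class_eq: "p \<in> UF \<Longrightarrow> r \<in> UF \<Longrightarrow> U_class D p = U_class D r \<longleftrightarrow> p - r \<in> U.J"
  using U.cls_eq_iff by (simp add: U_folds)

lemma U_class_mem_cl: "p \<in> UF \<Longrightarrow> r \<in> UF \<Longrightarrow> U_class D r \<in> cl \<kappa> \<kappa>' p \<longleftrightarrow> r - p \<in> MS \<kappa> \<kappa>'"
proof -
  assume p: "p \<in> UF" and r: "r \<in> UF"
  show ?thesis
  proof
    assume "U_class D r \<in> cl \<kappa> \<kappa>' p"
    then obtain m where m: "m \<in> MS \<kappa> \<kappa>'" "U_class D r = U_class D (m + p)"
      using mem_cl[OF p] by auto
    then have "r - (m + p) \<in> MS \<kappa> \<kappa>'"
      using U_class_eq[OF r FA_add[OF MS_FA[OF m(1)] p]] MS_J by simp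
    from MS_add[OF this m(1)] show "r - p \<in> MS \<kappa> \<kappa>'" by simp
  next
    assume "r - p \<in> MS \<kappa> \<kappa>'"
    then show "U_class D r \<in> cl \<kappa> \<kappa>' p"
      using mem_cl[OF p] by (auto intro!: bexI[of _ "r - p"])
  qed
qed

lemma cl_eq_iff: "p \<in> UF \<Longrightarrow> r \<in> UF \<Longrightarrow> cl \<kappa> \<kappa>' p = cl \<kappa> \<kappa>' r \<longleftrightarrow> p - r \<in> MS \<kappa> \<kappa>'"
proof -
  assume p: "p \<in> UF" and r: "r \<in> UF"
  show ?thesis
  proof
    assume "cl \<kappa> \<kappa>' p = cl \<kappa> \<kappa>' r"
    moreover have "U_class D p \<in> cl \<kappa> \<kappa>' p"
      using U_class_mem_cl[OF p p] MS_J[OF U.J_zero] by simp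
    ultimately show "p - r \<in> MS \<kappa> \<kappa>'"
      using U_class_mem_cl[OF r p] by simp
  next
    have *: "x \<in> cl \<kappa> \<kappa>' s" if "x \<in> cl \<kappa> \<kappa>' p" "p - s \<in> MS \<kappa> \<kappa>'" "p \<in> UF" "s \<in> UF" for x p s
    proof -
      from that obtain m where m: "m \<in> MS \<kappa> \<kappa>'" "x = U_class D (m + p)"
        using mem_cl by auto
      have "m + (p - s) \<in> MS \<kappa> \<kappa>'" using m(1) that(2) by (rule MS_add)
      moreover have "m + p = (m + (p - s)) + s" by simp
      ultimately show ?thesis
        unfolding mem_cl[OF that(4)] m(2) by metis
    qed
    assume "p - r \<in> MS \<kappa> \<kappa>'"
    moreover from MS_uminus[OF this] have "r - p \<in> MS \<kappa> \<kappa>'" by simp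
    ultimately show "cl \<kappa> \<kappa>' p = cl \<kappa> \<kappa>' r"
      using *[of _ p r] *[of _ r p] p r by blast
  qed
qed

lemma cl_carrier: "carrier (mod_comp D \<kappa> \<kappa>') = cl \<kappa> \<kappa>' ` UF"
  unfolding mod_comp_def A_FactGroup_def' A_RCOSETS_def'
  by (auto simp: U.carrier_Q[unfolded U_folds] cl_def mod_proj_def a_r_coset_def')

lemma cl_mult: "p \<in> UF \<Longrightarrow> r \<in> UF \<Longrightarrow> cl \<kappa> \<kappa>' p \<otimes>\<^bsub>mod_comp D \<kappa> \<kappa>'\<^esub> cl \<kappa> \<kappa>' r = cl \<kappa> \<kappa>' (p + r)"
proof -
  assume p: "p \<in> UF" and r: "r \<in> UF"
  have "x \<in> cl \<kappa> \<kappa>' p \<otimes>\<^bsub>mod_comp D \<kappa> \<kappa>'\<^esub> cl \<kappa> \<kappa>' r \<longleftrightarrow> x \<in> cl \<kappa> \<kappa>' (p + r)" for x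
  proof -
    have add: "U_class D (m + p) \<oplus>\<^bsub>U_alg D\<^esub> U_class D (m' + r) = U_class D ((m + m') + (p + r))"
      if "m \<in> MS \<kappa> \<kappa>'" "m' \<in> MS \<kappa> \<kappa>'" for m m'
      using U.Q_add[of "m + p" "m' + r"] that p r by (simp add: U_folds MS_FA FA_add algebra_simps)
    have "x \<in> cl \<kappa> \<kappa>' p \<otimes>\<^bsub>mod_comp D \<kappa> \<kappa>'\<^esub> cl \<kappa> \<kappa>' r \<longleftrightarrow>
        (\<exists>y\<in>cl \<kappa> \<kappa>' p. \<exists>z\<in>cl \<kappa> \<kappa>' r. x = y \<oplus>\<^bsub>U_alg D\<^esub> z)"
      by (auto simp: mod_comp_def A_FactGroup_def' set_add_def set_mult_def)
    also have "\<dots> \<longleftrightarrow> (\<exists>m\<in>MS \<kappa> \<kappa>'. \<exists>m'\<in>MS \<kappa> \<kappa>'. x = U_class D ((m + m') + (p + r)))"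
    proof -
      have "(\<exists>y\<in>cl \<kappa> \<kappa>' p. \<exists>z\<in>cl \<kappa> \<kappa>' r. x = y \<oplus>\<^bsub>U_alg D\<^esub> z) \<longleftrightarrow>
          (\<exists>m\<in>MS \<kappa> \<kappa>'. \<exists>m'\<in>MS \<kappa> \<kappa>'. x = U_class D (m + p) \<oplus>\<^bsub>U_alg D\<^esub> U_class D (m' + r))"
        unfolding cl_image[OF p] cl_image[OF r] by simp
      then show ?thesis by (simp add: add cong: bex_cong)
    qed
    also have "\<dots> \<longleftrightarrow> (\<exists>m\<in>MS \<kappa> \<kappa>'. x = U_class D (m + (p + r)))"
    proof
      assume "\<exists>m\<in>MS \<kappa> \<kappa>'. \<exists>m'\<in>MS \<kappa> \<kappa>'. x = U_class D ((m + m') + (p + r))"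
      then obtain m m' where "m \<in> MS \<kappa> \<kappa>'" "m' \<in> MS \<kappa> \<kappa>'" "x = U_class D ((m + m') + (p + r))" by blast
      then show "\<exists>m\<in>MS \<kappa> \<kappa>'. x = U_class D (m + (p + r))"
        by (intro bexI[of _ "m + m'"] MS_add)
    next
      assume "\<exists>m\<in>MS \<kappa> \<kappa>'. x = U_class D (m + (p + r))"
      then obtain m where "m \<in> MS \<kappa> \<kappa>'" "x = U_class D (m + (p + r))" by blast
      then show "\<exists>m\<in>MS \<kappa> \<kappa>'. \<exists>m'\<in>MS \<kappa> \<kappa>'. x = U_class D ((m + m') + (p + r))"
        using MS_J[OF U.J_zero] by (intro bexI[of _ m] bexI[of _ 0]) simp_all
    qed
    finally show ?thesis
      using mem_cl[OF FA_add[OF p r]] by simp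
  qed
  then show ?thesis by blast
qed

lemma cl_one: "\<one>\<^bsub>mod_comp D \<kappa> \<kappa>'\<^esub> = cl \<kappa> \<kappa>' 0"
proof -
  have "x \<in> mod_sub D \<kappa> \<kappa>' \<longleftrightarrow> x \<in> cl \<kappa> \<kappa>' 0" for x
    using mod_sub_carrier[of x \<kappa> \<kappa>'] by (auto simp: mem_cl MS_def)
  then show ?thesis
    by (auto simp: mod_comp_def A_FactGroup_def')
qed

lemma comm_group_comp: "comm_group (mod_comp D \<kappa> \<kappa>')"
proof (rule comm_groupI)
  fix x assume "x \<in> carrier (mod_comp D \<kappa> \<kappa>')"
  then obtain p where p: "p \<in> UF" "x = cl \<kappa> \<kappa>' p" by (auto simp: cl_carrier)
  then show "\<exists>y\<in>carrier (mod_comp D \<kappa> \<kappa>'). y \<otimes>\<^bsub>mod_comp D \<kappa> \<kappa>'\<^esub> x = \<one>\<^bsub>mod_comp D \<kappa> \<kappa>'\<^esub>"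
    by (intro bexI[of _ "cl \<kappa> \<kappa>' (- p)"]) (auto simp: cl_carrier cl_mult cl_one FA_uminus)
qed (auto simp: cl_carrier cl_mult cl_one FA_intros algebra_simps)

lemma cl_finprod:
  assumes "finite A" "\<And>a. a \<in> A \<Longrightarrow> f a \<in> UF"
  shows "finprod (mod_comp D \<kappa> \<kappa>') (\<lambda>a. cl \<kappa> \<kappa>' (f a)) A = cl \<kappa> \<kappa>' (\<Sum>a\<in>A. f a)"
proof -
  interpret comm_group "mod_comp D \<kappa> \<kappa>'" by (rule comm_group_comp)
  from assms show ?thesis
    by (induction A) (auto simp: cl_one cl_carrier cl_mult FA_sum)
qed

definition phom :: "'x \<Rightarrow> 'x \<Rightarrow> (('i, 'y) U_gen word \<Rightarrow>\<^sub>0 qv) \<Rightarrow> bool" where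
  "phom \<kappa> \<kappa>' p \<longleftrightarrow> p \<in> UF \<and> homog uwt (\<kappa> - \<kappa>') p"

lemma phom_FA: "phom \<kappa> \<kappa>' p \<Longrightarrow> p \<in> UF"
  by (simp add: phom_def)

lemma phom_subspace: "pm.subspace {p. phom \<kappa> \<kappa>' p}"
  by (auto simp: phom_def pm.subspace_def FA_intros intro: homog_add homog_scl)

lemma phom_add: "phom \<kappa> \<kappa>' p \<Longrightarrow> phom \<kappa> \<kappa>' r \<Longrightarrow> phom \<kappa> \<kappa>' (p + r)"
  and phom_scl: "phom \<kappa> \<kappa>' p \<Longrightarrow> phom \<kappa> \<kappa>' (scl c p)"
  and phom_zero [simp]: "phom \<kappa> \<kappa>' 0"
  using phom_subspace[of \<kappa> \<kappa>'] by (auto simp: pm.subspace_def)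

lemma homog_uwt_mult: "homog uwt \<mu> p \<Longrightarrow> homog uwt \<nu> r \<Longrightarrow> homog uwt (\<mu> + \<nu>) (p * r)"
  unfolding homog_def using keys_mult[of p r] by (fastforce simp: uwt_def)

lemma phom_mult: "phom \<kappa> \<mu> p \<Longrightarrow> phom \<mu> \<nu> r \<Longrightarrow> phom \<kappa> \<nu> (p * r)"
  using homog_uwt_mult[of "\<kappa> - \<mu>" p "\<mu> - \<nu>" r] by (auto simp: phom_def intro: FA_mult)

lemma U_homogeneous_eq: "U_homogeneous D (\<kappa> - \<kappa>') = U_class D ` {p. phom \<kappa> \<kappa>' p}"
  by (auto simp: U_homogeneous_def phom_def homog_def uwt_def FA_def)

lemma Kd_phom:
  assumes "phom \<kappa> \<mu> p"
  shows "U.eqv (Kd h \<kappa> * p) (scl (vv powi (pairing D h (\<kappa> - \<mu>))) (p * Kd h \<mu>))"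
proof -
  define c where "c = vv powi (pairing D h (\<kappa> - \<mu>))"
  have "gK h * p - scl c (p * gK h) \<in> U.J"
  proof (rule lmap_mem[of "\<lambda>p. gK h * p - scl c (p * gK h)", OF _ U.J_subspace])
    show "lmap (\<lambda>p. gK h * p - scl c (p * gK h))"
      by (rule lmap_minus[OF lmap_mult_left lmap_scale[OF lmap_mult_right]])
    fix w assume "w \<in> Poly_Mapping.keys p"
    then have "set (letters w) \<subseteq> U_gens D" "uwt w = \<kappa> - \<mu>"
      using assms by (auto simp: phom_def FA_iff homog_def)
    then show "gK h * mon w - scl c (mon w * gK h) \<in> U.J"
      using K_mon_commute[of "letters w" h] by (simp add: U.eqv_def c_def)
  qed
  moreover have "vv powi (pairing D h \<kappa>) = c * vv powi (pairing D h \<mu>)"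
    by (simp add: c_def power_int_diff)
  then have "Kd h \<kappa> * p - scl c (p * Kd h \<mu>) = gK h * p - scl c (p * gK h)"
    by (simp add: Kd_def algebra_simps scl_mult_left scl_mult_right pm.scale_right_diff_distrib)
  ultimately show ?thesis
    by (simp add: U.eqv_def c_def)
qed

text \<open>A homogeneous factor turns \<open>Kd h \<kappa>\<close> on its left into a nonzero
  multiple of \<open>Kd h \<mu>\<close> on its right, so left relations at \<mu> become left
  relations at \<kappa>. With its mirror image this makes the product of components independent of
  representatives.\<close>

lemma MS_phom_left:
  assumes "phom \<kappa> \<mu> p" "m \<in> MS \<mu> \<nu>"
  shows "p * m \<in> MS \<kappa> \<nu>"
proof -
  have p: "p \<in> UF" using assms(1) by (rule phom_FA)
  have "m \<in> {m. p * m \<in> MS \<kappa> \<nu>}"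
  proof (rule MS_induct[OF assms(2)])
    show "pm.subspace {m. p * m \<in> MS \<kappa> \<nu>}"
      using pm.subspace_0[OF MS_subspace] by (auto simp: pm.subspace_def distrib_left scl_mult_right intro: MS_add MS_scl)
    show "U.J \<subseteq> {m. p * m \<in> MS \<kappa> \<nu>}"
      using MS_J U.J_left[OF p] by blast
    fix h u assume u: "u \<in> UF"
    define c where "c = vv powi (pairing D h (\<kappa> - \<mu>))"
    have "U.eqv (Kd h \<kappa> * p * u) (scl c (p * Kd h \<mu>) * u)"
      unfolding c_def by (rule U.eqv_right[OF u Kd_phom[OF assms(1)]])
    then have "Kd h \<kappa> * (p * u) - scl c (p * (Kd h \<mu> * u)) \<in> MS \<kappa> \<nu>"
      by (intro MS_J) (simp add: U.eqv_def mult.assoc scl_mult_left)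
    from MS_diff[OF MS_left[OF FA_mult[OF p u], where h = h] this]
    have "scl c (p * (Kd h \<mu> * u)) \<in> MS \<kappa> \<nu>" by simp
    from MS_scl[OF this, of "inverse c"] show "Kd h \<mu> * u \<in> {m. p * m \<in> MS \<kappa> \<nu>}"
      by (simp add: c_def)
    show "u * Kd h \<nu> \<in> {m. p * m \<in> MS \<kappa> \<nu>}"
      using MS_right[OF FA_mult[OF p u]] by (simp add: mult.assoc)
  qed
  then show ?thesis by simp
qed

lemma MS_phom_right:
  assumes "m \<in> MS \<kappa> \<mu>" "phom \<mu> \<nu> p"
  shows "m * p \<in> MS \<kappa> \<nu>"
proof -
  have p: "p \<in> UF" using assms(2) by (rule phom_FA)
  have "m \<in> {m. m * p \<in> MS \<kappa> \<nu>}"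
  proof (rule MS_induct[OF assms(1)])
    show "pm.subspace {m. m * p \<in> MS \<kappa> \<nu>}"
      using pm.subspace_0[OF MS_subspace] by (auto simp: pm.subspace_def distrib_right scl_mult_left intro: MS_add MS_scl)
    show "U.J \<subseteq> {m. m * p \<in> MS \<kappa> \<nu>}"
      using MS_J U.J_right[OF p] by blast
    fix h u assume u: "u \<in> UF"
    define c where "c = vv powi (pairing D h (\<mu> - \<nu>))"
    have "U.eqv (u * (Kd h \<mu> * p)) (u * scl c (p * Kd h \<nu>))"
      unfolding c_def by (rule U.eqv_left[OF u Kd_phom[OF assms(2)]])
    then have "u * Kd h \<mu> * p - scl c (u * p * Kd h \<nu>) \<in> MS \<kappa> \<nu>"
      by (intro MS_J) (simp add: U.eqv_def mult.assoc scl_mult_right)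
    from MS_add[OF this MS_scl[OF MS_right[OF FA_mult[OF u p], where h = h], of c]]
    show "u * Kd h \<mu> \<in> {m. m * p \<in> MS \<kappa> \<nu>}" by simp
    show "Kd h \<kappa> * u \<in> {m. m * p \<in> MS \<kappa> \<nu>}"
      using MS_left[OF FA_mult[OF u p]] by (simp add: mult.assoc)
  qed
  then show ?thesis by simp
qed

lemma comp_mult_cl:
  assumes p: "phom \<kappa> \<mu> p" and r: "phom \<mu> \<nu> r"
  shows "comp_mult D \<kappa> \<mu> \<nu> (cl \<kappa> \<mu> p) (cl \<mu> \<nu> r) = cl \<kappa> \<nu> (p * r)"
proof -
  have all: "mod_proj D \<kappa> \<nu> (t \<otimes>\<^bsub>U_alg D\<^esub> s) = cl \<kappa> \<nu> (p * r)"
    if t: "t \<in> cl \<kappa> \<mu> p \<inter> U_homogeneous D (\<kappa> - \<mu>)" and s: "s \<in> cl \<mu> \<nu> r \<inter> U_homogeneous D (\<mu> - \<nu>)" for t s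
  proof -
    from t obtain p' where p': "phom \<kappa> \<mu> p'" "t = U_class D p'" by (auto simp: U_homogeneous_eq)
    from s obtain r' where r': "phom \<mu> \<nu> r'" "s = U_class D r'" by (auto simp: U_homogeneous_eq)
    note F = phom_FA[OF p] phom_FA[OF r] phom_FA[OF p'(1)] phom_FA[OF r'(1)]
    have "p' - p \<in> MS \<kappa> \<mu>" "r' - r \<in> MS \<mu> \<nu>"
      using t s F by (simp_all add: p' r' U_class_mem_cl)
    then have "p' * (r' - r) + (p' - p) * r \<in> MS \<kappa> \<nu>"
      by (intro MS_add MS_phom_left[OF p'(1)] MS_phom_right[OF _ r])
    then have "p' * r' - p * r \<in> MS \<kappa> \<nu>" by (simp add: algebra_simps)
    moreover have "t \<otimes>\<^bsub>U_alg D\<^esub> s = U_class D (p' * r')"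
      using U.Q_mult F by (simp add: p' r' U_folds)
    ultimately show ?thesis
      using F by (simp add: cl_def[symmetric] cl_eq_iff FA_mult)
  qed
  have "U_class D p \<in> cl \<kappa> \<mu> p \<inter> U_homogeneous D (\<kappa> - \<mu>)"
    "U_class D r \<in> cl \<mu> \<nu> r \<inter> U_homogeneous D (\<mu> - \<nu>)"
    using p r MS_J[OF U.J_zero] by (auto simp: U_homogeneous_eq U_class_mem_cl phom_FA)
  then show ?thesis
    unfolding comp_mult_def using all by auto
qed

section \<open>Matrices of homogeneous polynomials\<close>

type_synonym ('a, 'b, 'c) uf = "'b \<times> 'b \<Rightarrow> (('a, 'c) U_gen word \<Rightarrow>\<^sub>0 qv)"

text \<open>Families of polynomials in place of families of cosets: every element of the modified
  form comes from such a family through \<open>rep\<close>, though not from a unique one.\<close>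

definition FS :: "('i, 'x, 'y) uf set" where
  "FS = {F. (\<forall>\<kappa> \<kappa>'. phom \<kappa> \<kappa>' (F (\<kappa>, \<kappa>'))) \<and> finite {k. F k \<noteq> 0}}"

definition rep :: "('i, 'x, 'y) uf \<Rightarrow> ('i, 'x, 'y) Udot_elem" where
  "rep F = (\<lambda>(\<kappa>, \<kappa>'). cl \<kappa> \<kappa>' (F (\<kappa>, \<kappa>')))"

lemma FS_phom: "F \<in> FS \<Longrightarrow> phom \<kappa> \<kappa>' (F (\<kappa>, \<kappa>'))"
  by (simp add: FS_def)

lemma FS_FA: "F \<in> FS \<Longrightarrow> F k \<in> UF"
  using FS_phom[of F "fst k" "snd k"] by (simp add: phom_FA)

lemma FS_finite: "F \<in> FS \<Longrightarrow> finite {k. F k \<noteq> 0}"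
  by (simp add: FS_def)

lemma Udot_space_carrier:
  "carrier (Udot_space D) = {f. (\<forall>\<kappa> \<kappa>'. f (\<kappa>, \<kappa>') \<in> cl \<kappa> \<kappa>' ` UF) \<and> finite {(\<kappa>, \<kappa>'). f (\<kappa>, \<kappa>') \<noteq> cl \<kappa> \<kappa>' 0}}"
proof -
  have "group (case k of (\<kappa>, \<kappa>') \<Rightarrow> mod_comp D \<kappa> \<kappa>')" for k
    using comm_group.axioms(2)[OF comm_group_comp] by (cases k) simp
  then show ?thesis
    unfolding Udot_space_def by (subst carrier_sum_group) (simp_all add: PiE_iff cl_carrier cl_one case_prod_unfold)
qed

lemma Udot_one: "\<one>\<^bsub>Udot_space D\<^esub> = (\<lambda>(\<kappa>, \<kappa>'). cl \<kappa> \<kappa>' 0)"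
  by (auto simp: Udot_space_def cl_one fun_eq_iff)

lemma Udot_carrier: "carrier (Udot D) = rep ` FS"
proof (intro equalityI subsetI)
  fix f assume "f \<in> carrier (Udot D)"
  then have f: "\<And>\<kappa> \<kappa>'. f (\<kappa>, \<kappa>') \<in> cl \<kappa> \<kappa>' ` UF" "finite {(\<kappa>, \<kappa>'). f (\<kappa>, \<kappa>') \<noteq> cl \<kappa> \<kappa>' 0}"
    by (auto simp: Udot_def Udot_space_carrier)
  define r where "r \<kappa> \<kappa>' = (SOME p. p \<in> UF \<and> f (\<kappa>, \<kappa>') = cl \<kappa> \<kappa>' p)" for \<kappa> \<kappa>'
  have r: "r \<kappa> \<kappa>' \<in> UF" "f (\<kappa>, \<kappa>') = cl \<kappa> \<kappa>' (r \<kappa> \<kappa>')" for \<kappa> \<kappa>'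
    using someI_ex[of "\<lambda>p. p \<in> UF \<and> f (\<kappa>, \<kappa>') = cl \<kappa> \<kappa>' p"] f(1)[of \<kappa> \<kappa>'] unfolding r_def by auto
  \<comment> \<open>Zero cosets must get the polynomial 0, or the support of \<open>F\<close> could
    be infinite; elsewhere the component of the right weight represents the same coset.\<close>
  define F where "F = (\<lambda>(\<kappa>, \<kappa>'). if f (\<kappa>, \<kappa>') = cl \<kappa> \<kappa>' 0 then 0 else filt (\<lambda>w. uwt w = \<kappa> - \<kappa>') (r \<kappa> \<kappa>'))"
  have "F \<in> FS"
    unfolding FS_def
  proof (intro CollectI conjI allI)
    show "phom \<kappa> \<kappa>' (F (\<kappa>, \<kappa>'))" for \<kappa> \<kappa>'
      by (simp add: F_def phom_def FA_filt r homog_filt)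
    show "finite {k. F k \<noteq> 0}"
      by (rule finite_subset[OF _ f(2)]) (auto simp: F_def split: if_splits)
  qed
  moreover have "rep F = f"
  proof (rule ext, clarify)
    fix \<kappa> \<kappa>'
    have "cl \<kappa> \<kappa>' (r \<kappa> \<kappa>') = cl \<kappa> \<kappa>' (filt (\<lambda>w. uwt w = \<kappa> - \<kappa>') (r \<kappa> \<kappa>'))"
      using filt_MS[OF r(1)] by (subst cl_eq_iff) (auto simp: r FA_filt)
    then show "rep F (\<kappa>, \<kappa>') = f (\<kappa>, \<kappa>')"
      by (auto simp: rep_def F_def r(2)[symmetric])
  qed
  ultimately show "f \<in> rep ` FS" by blast
next
  fix f assume "f \<in> rep ` FS"
  then obtain F where F: "F \<in> FS" "f = rep F" by blast
  have "finite {(\<kappa>, \<kappa>'). rep F (\<kappa>, \<kappa>') \<noteq> cl \<kappa> \<kappa>' 0}"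
    by (rule finite_subset[OF _ FS_finite[OF F(1)]]) (auto simp: rep_def)
  then show "f \<in> carrier (Udot D)"
    using F by (auto simp: Udot_def Udot_space_carrier rep_def FS_FA)
qed

lemma FS_add: "F \<in> FS \<Longrightarrow> G \<in> FS \<Longrightarrow> (\<lambda>k. F k + G k) \<in> FS"
  unfolding FS_def by (auto intro: phom_add finite_subset[of _ "{k. F k \<noteq> 0} \<union> {k. G k \<noteq> 0}"])

lemma FS_scl: "F \<in> FS \<Longrightarrow> (\<lambda>k. scl c (F k)) \<in> FS"
  unfolding FS_def by (auto intro: phom_scl finite_subset[of _ "{k. F k \<noteq> 0}"])

lemma FS_zero: "(\<lambda>k. 0) \<in> FS"
  by (simp add: FS_def)

lemma Udot_zero: "\<zero>\<^bsub>Udot D\<^esub> = rep (\<lambda>k. 0)"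
  by (simp add: Udot_def Udot_one rep_def)

lemma Udot_add: "F \<in> FS \<Longrightarrow> G \<in> FS \<Longrightarrow> rep F \<oplus>\<^bsub>Udot D\<^esub> rep G = rep (\<lambda>k. F k + G k)"
  by (auto simp: Udot_def Udot_space_def rep_def fun_eq_iff cl_mult FS_FA)

lemma Udot_smult: "F \<in> FS \<Longrightarrow> c \<odot>\<^bsub>Udot D\<^esub> rep F = rep (\<lambda>k. scl c (F k))"
proof (rule ext, clarify)
  fix \<kappa> \<kappa>' assume F: "F \<in> FS"
  have all: "mod_proj D \<kappa> \<kappa>' (c \<odot>\<^bsub>U_alg D\<^esub> u) = cl \<kappa> \<kappa>' (scl c (F (\<kappa>, \<kappa>')))" if u: "u \<in> cl \<kappa> \<kappa>' (F (\<kappa>, \<kappa>'))" for u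
  proof -
    obtain m where m: "m \<in> MS \<kappa> \<kappa>'" "u = U_class D (m + F (\<kappa>, \<kappa>'))"
      using u mem_cl[OF FS_FA[OF F]] by auto
    have mF: "m + F (\<kappa>, \<kappa>') \<in> UF" using MS_FA[OF m(1)] FS_FA[OF F] by (rule FA_add)
    have "c \<odot>\<^bsub>U_alg D\<^esub> u = U_class D (scl c (m + F (\<kappa>, \<kappa>')))"
      using U.Q_smult[OF mF] by (simp add: m(2) U_folds)
    then have "mod_proj D \<kappa> \<kappa>' (c \<odot>\<^bsub>U_alg D\<^esub> u) = cl \<kappa> \<kappa>' (scl c (m + F (\<kappa>, \<kappa>')))"
      by (simp add: cl_def)
    also have "\<dots> = cl \<kappa> \<kappa>' (scl c (F (\<kappa>, \<kappa>')))"
      using MS_scl[OF m(1), of c] FS_FA[OF F] mF by (subst cl_eq_iff) (auto intro: FA_scl simp: lmap_diff[OF lmap_scale[OF lmap_id], symmetric] pm.scale_right_diff_distrib[symmetric])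
    finally show ?thesis .
  qed
  have "U_class D (F (\<kappa>, \<kappa>')) \<in> cl \<kappa> \<kappa>' (F (\<kappa>, \<kappa>'))"
    using MS_J[OF U.J_zero] by (simp add: U_class_mem_cl FS_FA[OF F])
  then show "(c \<odot>\<^bsub>Udot D\<^esub> rep F) (\<kappa>, \<kappa>') = rep (\<lambda>k. scl c (F k)) (\<kappa>, \<kappa>')"
    using all by (auto simp: Udot_def rep_def)
qed

text \<open>A finite range for the inner weights that depends on \<open>F\<close> alone. It can
  exceed the index set in \<open>Udot\<close>, where zero cosets and not just zero polynomials are
  left out.\<close>

definition mids :: "('i, 'x, 'y) uf \<Rightarrow> 'x set" where
  "mids F = snd ` {k. F k \<noteq> 0}"

definition Fmul :: "('i, 'x, 'y) uf \<Rightarrow> ('i, 'x, 'y) uf \<Rightarrow> ('i, 'x, 'y) uf" where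
  "Fmul F G = (\<lambda>(\<kappa>, \<nu>). \<Sum>\<mu>\<in>mids F. F (\<kappa>, \<mu>) * G (\<mu>, \<nu>))"

lemma finite_mids: "F \<in> FS \<Longrightarrow> finite (mids F)"
  by (simp add: mids_def FS_finite)

lemma FS_mul:
  assumes "F \<in> FS" "G \<in> FS"
  shows "Fmul F G \<in> FS"
  unfolding FS_def
proof (intro CollectI conjI allI)
  show "phom \<kappa> \<nu> (Fmul F G (\<kappa>, \<nu>))" for \<kappa> \<nu>
    using pm.subspace_sum[OF phom_subspace[of \<kappa> \<nu>], of "mids F" "\<lambda>\<mu>. F (\<kappa>, \<mu>) * G (\<mu>, \<nu>)"] phom_mult[OF FS_phom[OF assms(1)] FS_phom[OF assms(2)]]
    by (simp add: Fmul_def)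
  have "{k. Fmul F G k \<noteq> 0} \<subseteq> fst ` {k. F k \<noteq> 0} \<times> snd ` {k. G k \<noteq> 0}"
  proof
    fix k assume "k \<in> {k. Fmul F G k \<noteq> 0}"
    moreover obtain \<kappa> \<nu> where k: "k = (\<kappa>, \<nu>)" by (cases k)
    ultimately have "(\<Sum>\<mu>\<in>mids F. F (\<kappa>, \<mu>) * G (\<mu>, \<nu>)) \<noteq> 0"
      by (simp add: Fmul_def)
    then obtain \<mu> where "F (\<kappa>, \<mu>) * G (\<mu>, \<nu>) \<noteq> 0"
      by (rule sum.not_neutral_contains_not_neutral)
    then have "F (\<kappa>, \<mu>) \<noteq> 0" "G (\<mu>, \<nu>) \<noteq> 0" by auto
    then have "\<kappa> \<in> fst ` {k. F k \<noteq> 0}"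
      by (intro image_eqI[of _ _ "(\<kappa>, \<mu>)"]) simp_all
    moreover have "\<nu> \<in> snd ` {k. G k \<noteq> 0}"
      using \<open>G (\<mu>, \<nu>) \<noteq> 0\<close> by (intro image_eqI[of _ _ "(\<mu>, \<nu>)"]) simp_all
    ultimately show "k \<in> fst ` {k. F k \<noteq> 0} \<times> snd ` {k. G k \<noteq> 0}"
      by (simp add: k)
  qed
  then show "finite {k. Fmul F G k \<noteq> 0}"
    by (rule finite_subset) (intro finite_cartesian_product finite_imageI FS_finite assms)
qed

lemma Udot_mult:
  assumes "F \<in> FS" "G \<in> FS"
  shows "rep F \<otimes>\<^bsub>Udot D\<^esub> rep G = rep (Fmul F G)"
proof (rule ext, clarify)
  fix \<kappa> \<nu>
  interpret comm_group "mod_comp D \<kappa> \<nu>" by (rule comm_group_comp)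
  have FG: "F (\<kappa>, \<mu>) * G (\<mu>, \<nu>) \<in> UF" for \<mu>
    by (rule FA_mult[OF FS_FA[OF assms(1)] FS_FA[OF assms(2)]])
  let ?A = "{\<mu>. cl \<kappa> \<mu> (F (\<kappa>, \<mu>)) \<noteq> cl \<kappa> \<mu> 0 \<and> cl \<mu> \<nu> (G (\<mu>, \<nu>)) \<noteq> cl \<mu> \<nu> 0}"
  have "(rep F \<otimes>\<^bsub>Udot D\<^esub> rep G) (\<kappa>, \<nu>) =
      finprod (mod_comp D \<kappa> \<nu>) (\<lambda>\<mu>. comp_mult D \<kappa> \<mu> \<nu> (cl \<kappa> \<mu> (F (\<kappa>, \<mu>))) (cl \<mu> \<nu> (G (\<mu>, \<nu>)))) ?A"
    by (simp add: Udot_def rep_def cl_one)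
  also have "\<dots> = finprod (mod_comp D \<kappa> \<nu>) (\<lambda>\<mu>. cl \<kappa> \<nu> (F (\<kappa>, \<mu>) * G (\<mu>, \<nu>))) (mids F)"
  proof (rule finprod_mono_neutral_cong_left)
    show "finite (mids F)" by (rule finite_mids[OF assms(1)])
    show "?A \<subseteq> mids F"
    proof
      fix \<mu> assume "\<mu> \<in> ?A"
      then have "F (\<kappa>, \<mu>) \<noteq> 0" by auto
      then show "\<mu> \<in> mids F"
        unfolding mids_def by (intro image_eqI[of _ _ "(\<kappa>, \<mu>)"]) auto
    qed
    show "comp_mult D \<kappa> \<mu> \<nu> (cl \<kappa> \<mu> (F (\<kappa>, \<mu>))) (cl \<mu> \<nu> (G (\<mu>, \<nu>))) = cl \<kappa> \<nu> (F (\<kappa>, \<mu>) * G (\<mu>, \<nu>))" for \<mu>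
      by (intro comp_mult_cl FS_phom assms)
    show "(\<lambda>\<mu>. cl \<kappa> \<nu> (F (\<kappa>, \<mu>) * G (\<mu>, \<nu>))) \<in> mids F \<rightarrow> carrier (mod_comp D \<kappa> \<nu>)"
      using FG by (auto simp: cl_carrier)
    \<comment> \<open>An inner weight that is dropped has a zero coset in one factor, although both
      polynomials may be nonzero; the product then lies in \<open>MS\<close>.\<close>
    fix \<mu> assume "\<mu> \<in> mids F - ?A"
    then have "F (\<kappa>, \<mu>) \<in> MS \<kappa> \<mu> \<or> G (\<mu>, \<nu>) \<in> MS \<mu> \<nu>"
      using assms by (auto simp: cl_eq_iff FS_FA)
    then have "F (\<kappa>, \<mu>) * G (\<mu>, \<nu>) \<in> MS \<kappa> \<nu>"
      using MS_phom_left MS_phom_right FS_phom assms by blast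
    then show "cl \<kappa> \<nu> (F (\<kappa>, \<mu>) * G (\<mu>, \<nu>)) = \<one>\<^bsub>mod_comp D \<kappa> \<nu>\<^esub>"
      unfolding cl_one using FG by (subst cl_eq_iff) auto
  qed
  also have "\<dots> = rep (Fmul F G) (\<kappa>, \<nu>)"
    unfolding rep_def Fmul_def using assms FG by (simp add: cl_finprod finite_mids)
  finally show "(rep F \<otimes>\<^bsub>Udot D\<^esub> rep G) (\<kappa>, \<nu>) = rep (Fmul F G) (\<kappa>, \<nu>)" .
qed

end

context finite_root_datum
begin

section \<open>The homomorphisms to the generalized \<open>q\<close>-Schur algebras\<close>

definition tm :: "'x set \<Rightarrow> ('i, 'x, 'y) uf \<Rightarrow> 'x \<times> 'x \<Rightarrow> ('i, 'x) S_gen word \<Rightarrow>\<^sub>0 qv" where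
  "tm P F k = sidem P (fst k) * sub P (F k) * sidem P (snd k)"

definition Phi :: "'x set \<Rightarrow> ('i, 'x, 'y) uf \<Rightarrow> ('i, 'x) S_gen word \<Rightarrow>\<^sub>0 qv" where
  "Phi P F = (\<Sum>k | F k \<noteq> 0. tm P F k)"

lemma tm_FA: "F \<in> FS \<Longrightarrow> tm P F k \<in> FA (S_gens D P)"
  unfolding tm_def by (rule FA_mult[OF FA_mult[OF S_idem_FA sub_FA[OF FS_FA]] S_idem_FA])

lemma Phi_FA: "F \<in> FS \<Longrightarrow> Phi P F \<in> FA (S_gens D P)"
  unfolding Phi_def by (rule FA_sum[OF tm_FA])

lemma tm_zero: "F k = 0 \<Longrightarrow> tm P F k = 0"
  by (simp add: tm_def subst_simps)

lemma Phi_superset: "finite A \<Longrightarrow> {k. F k \<noteq> 0} \<subseteq> A \<Longrightarrow> Phi P F = (\<Sum>k\<in>A. tm P F k)"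
  unfolding Phi_def by (rule sum.mono_neutral_left) (auto intro: tm_zero)

lemma S_class_eq: "x \<in> FA (S_gens D P) \<Longrightarrow> y \<in> FA (S_gens D P) \<Longrightarrow> S_class D P x = S_class D P y \<longleftrightarrow> S.eqv P x y"
  using S.cls_eq_iff by (simp add: S_folds S.eqv_def)

lemma the_elem_cl:
  assumes P: "finite P" and p: "p \<in> UF"
  shows "the_elem ((\<lambda>u. S_one D P \<kappa> \<otimes>\<^bsub>S_alg D P\<^esub> p_map D P u \<otimes>\<^bsub>S_alg D P\<^esub> S_one D P \<kappa>') ` cl \<kappa> \<kappa>' p)
    = S_class D P (sidem P \<kappa> * sub P p * sidem P \<kappa>')"
proof -
  have all: "S_one D P \<kappa> \<otimes>\<^bsub>S_alg D P\<^esub> p_map D P u \<otimes>\<^bsub>S_alg D P\<^esub> S_one D P \<kappa>' = S_class D P (sidem P \<kappa> * sub P p * sidem P \<kappa>')"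
    if u: "u \<in> cl \<kappa> \<kappa>' p" for u
  proof -
    obtain m where m: "m \<in> MS \<kappa> \<kappa>'" "u = U_class D (m + p)"
      using u mem_cl[OF p] by blast
    have mp: "m + p \<in> UF" using MS_FA[OF m(1)] p by (rule FA_add)
    have "p_map D P u = S_class D P (sub P (m + p))"
      unfolding m(2) by (rule p_map_cls[OF P mp])
    then have "S_one D P \<kappa> \<otimes>\<^bsub>S_alg D P\<^esub> p_map D P u \<otimes>\<^bsub>S_alg D P\<^esub> S_one D P \<kappa>' = S_class D P (sidem P \<kappa> * sub P (m + p) * sidem P \<kappa>')"
      using S.Q_mult[of _ P] sub_FA[OF mp] by (simp add: S_one_def S_folds FA_mult)
    also have "\<dots> = S_class D P (sidem P \<kappa> * sub P p * sidem P \<kappa>')"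
    proof (subst S_class_eq)
      show "sidem P \<kappa> * sub P (m + p) * sidem P \<kappa>' \<in> FA (S_gens D P)" "sidem P \<kappa> * sub P p * sidem P \<kappa>' \<in> FA (S_gens D P)"
        by (intro FA_mult S_idem_FA sub_FA mp p)+
      show "S.eqv P (sidem P \<kappa> * sub P (m + p) * sidem P \<kappa>') (sidem P \<kappa> * sub P p * sidem P \<kappa>')"
        using MS_ker[OF P m(1)] by (simp add: ker_def S.eqv_def subst_simps algebra_simps)
    qed
    finally show ?thesis .
  qed
  moreover have "cl \<kappa> \<kappa>' p \<noteq> {}"
    using U_class_mem_cl[OF p p, of \<kappa> \<kappa>'] MS_J[OF U.J_zero] by auto
  ultimately have "(\<lambda>u. S_one D P \<kappa> \<otimes>\<^bsub>S_alg D P\<^esub> p_map D P u \<otimes>\<^bsub>S_alg D P\<^esub> S_one D P \<kappa>') ` cl \<kappa> \<kappa>' p = {S_class D P (sidem P \<kappa> * sub P p * sidem P \<kappa>')}"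
    by auto
  then show ?thesis by simp
qed

lemma pdot_rep:
  assumes P: "finite P" and F: "F \<in> FS"
  shows "pdot_map D P (rep F) = S_class D P (Phi P F)"
proof -
  interpret ring "S_alg D P" using S.ring_Q[of P] by (simp add: S_folds)
  define A where "A = {k. rep F k \<noteq> cl (fst k) (snd k) 0}"
  have A: "A \<subseteq> {k. F k \<noteq> 0}" by (auto simp: A_def rep_def)
  have finA: "finite A" by (rule finite_subset[OF A FS_finite[OF F]])
  have summand: "the_elem ((\<lambda>u. S_one D P (fst k) \<otimes>\<^bsub>S_alg D P\<^esub> p_map D P u \<otimes>\<^bsub>S_alg D P\<^esub> S_one D P (snd k)) ` rep F k) = S_class D P (tm P F k)" for k
    using the_elem_cl[OF P FS_FA[OF F], of "fst k" "snd k" k] by (simp add: rep_def tm_def case_prod_unfold)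
  have "pdot_map D P (rep F) = finsum (S_alg D P) (\<lambda>k. S_class D P (tm P F k)) A"
    unfolding pdot_map_def A_def cl_one case_prod_unfold prod.collapse summand ..
  also have "\<dots> = S_class D P (\<Sum>k\<in>A. tm P F k)"
    using S.Q_finsum[OF finA, of "tm P F" P] tm_FA[OF F] by (simp add: S_folds)
  also have "\<dots> = S_class D P (Phi P F)"
  proof (subst S_class_eq)
    show "(\<Sum>k\<in>A. tm P F k) \<in> FA (S_gens D P)" "Phi P F \<in> FA (S_gens D P)"
      by (rule FA_sum[OF tm_FA[OF F]]) (rule Phi_FA[OF F])
    have "Phi P F = (\<Sum>k\<in>{k. F k \<noteq> 0} - A. tm P F k) + (\<Sum>k\<in>A. tm P F k)"
      unfolding Phi_def using A FS_finite[OF F] by (rule sum.subset_diff)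
    \<comment> \<open>Entries with a nonzero polynomial but a zero coset are missing in
      \<open>pdot_map\<close>; they contribute elements of the ideal.\<close>
    moreover have "(\<Sum>k\<in>{k. F k \<noteq> 0} - A. tm P F k) \<in> S.J P"
    proof (rule pm.subspace_sum[OF S.J_subspace])
      fix k assume "k \<in> {k. F k \<noteq> 0} - A"
      then have "F k \<in> MS (fst k) (snd k)"
        using cl_eq_iff[OF FS_FA[OF F] FA_zero, of "fst k" "snd k" k] by (simp add: A_def rep_def case_prod_unfold)
      from MS_ker[OF P this] show "tm P F k \<in> S.J P"
        by (simp add: ker_def tm_def)
    qed
    ultimately have "S.eqv P (Phi P F) (\<Sum>k\<in>A. tm P F k)"
      by (simp add: S.eqv_def)
    then show "S.eqv P (\<Sum>k\<in>A. tm P F k) (Phi P F)" by (rule S.eqv_sym)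
  qed
  finally show ?thesis .
qed

lemma Phi_add: "F \<in> FS \<Longrightarrow> G \<in> FS \<Longrightarrow> Phi P (\<lambda>k. F k + G k) = Phi P F + Phi P G"
proof -
  assume F: "F \<in> FS" and G: "G \<in> FS"
  let ?A = "{k. F k \<noteq> 0} \<union> {k. G k \<noteq> 0}"
  have fin: "finite ?A" using FS_finite F G by simp
  have "Phi P (\<lambda>k. F k + G k) = (\<Sum>k\<in>?A. tm P (\<lambda>k. F k + G k) k)"
    using fin by (rule Phi_superset) auto
  also have "\<dots> = (\<Sum>k\<in>?A. tm P F k) + (\<Sum>k\<in>?A. tm P G k)"
    by (simp add: tm_def subst_simps distrib_left distrib_right sum.distrib)
  also have "\<dots> = Phi P F + Phi P G"
    using Phi_superset[OF fin, of F P] Phi_superset[OF fin, of G P] by simp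
  finally show ?thesis .
qed

lemma Phi_scl: "F \<in> FS \<Longrightarrow> Phi P (\<lambda>k. scl c (F k)) = scl c (Phi P F)"
proof -
  assume F: "F \<in> FS"
  have "Phi P (\<lambda>k. scl c (F k)) = (\<Sum>k\<in>{k. F k \<noteq> 0}. tm P (\<lambda>k. scl c (F k)) k)"
    using FS_finite[OF F] by (rule Phi_superset) auto
  then show ?thesis
    by (simp add: Phi_def tm_def subst_simps scl_mult_left scl_mult_right pm.scale_sum_right)
qed

text \<open>Distinct inner idempotents annihilate the product; an equal one is pushed through the
  homogeneous first factor and merges into the outer idempotent.\<close>

lemma tm_mult:
  assumes P: "finite P" and F: "F \<in> FS" and G: "G \<in> FS"
  shows "S.eqv P (tm P F (\<kappa>, \<mu>) * tm P G (\<mu>', \<nu>))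
    (if \<mu> = \<mu>' then sidem P \<kappa> * sub P (F (\<kappa>, \<mu>) * G (\<mu>, \<nu>)) * sidem P \<nu> else 0)"
proof -
  define f g where "f = sub P (F (\<kappa>, \<mu>))" and "g = sub P (G (\<mu>', \<nu>))"
  note fF = sub_FA[OF FS_FA[OF F, of "(\<kappa>, \<mu>)"], of P, folded f_def]
  note gF = sub_FA[OF FS_FA[OF G, of "(\<mu>', \<nu>)"], of P, folded g_def]
  have "tm P F (\<kappa>, \<mu>) * tm P G (\<mu>', \<nu>) = (sidem P \<kappa> * f) * (sidem P \<mu> * sidem P \<mu>') * (g * sidem P \<nu>)"
    by (simp add: tm_def f_def g_def mult.assoc)
  also have "S.eqv P \<dots> ((sidem P \<kappa> * f) * (if \<mu> = \<mu>' then sidem P \<mu> else 0) * (g * sidem P \<nu>))"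
    by (rule S.eqv_right[OF FA_mult[OF gF S_idem_FA] S.eqv_left[OF FA_mult[OF S_idem_FA fF] idem_mult]])
  also have "\<dots> = (if \<mu> = \<mu>' then sidem P \<kappa> * (f * sidem P \<mu>) * (g * sidem P \<nu>) else 0)"
    by (simp add: mult.assoc)
  also have "S.eqv P \<dots> (if \<mu> = \<mu>' then sidem P \<kappa> * f * (g * sidem P \<nu>) else 0)"
  proof -
    have "S.eqv P (f * sidem P \<mu>) (sidem P \<kappa> * f)"
      using sub_idem[OF P phom_FA[OF FS_phom[OF F]], of "\<kappa> - \<mu>" \<kappa> \<mu> \<mu>] FS_phom[OF F, of \<kappa> \<mu>]
      by (simp add: f_def phom_def)
    from S.eqv_left[OF S_idem_FA[of P \<kappa>] this]
    have "S.eqv P (sidem P \<kappa> * (f * sidem P \<mu>)) (sidem P \<kappa> * sidem P \<kappa> * f)"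
      by (simp add: mult.assoc)
    also have "S.eqv P (sidem P \<kappa> * sidem P \<kappa> * f) (sidem P \<kappa> * f)"
      using S.eqv_right[OF fF idem_mult[of P \<kappa> \<kappa>]] by simp
    finally have "S.eqv P (sidem P \<kappa> * (f * sidem P \<mu>)) (sidem P \<kappa> * f)" .
    from S.eqv_right[OF FA_mult[OF gF S_idem_FA[of P \<nu>]] this] show ?thesis
      by (cases "\<mu> = \<mu>'") simp_all
  qed
  finally show ?thesis
    by (auto simp: f_def g_def subst_mult mult.assoc)
qed

lemma Phi_mult:
  assumes P: "finite P" and F: "F \<in> FS" and G: "G \<in> FS"
  shows "S.eqv P (Phi P F * Phi P G) (Phi P (Fmul F G))"
proof -
  \<comment> \<open>\<open>M\<close> holds the inner weights of both families, so that both sums can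
    be written over rectangles.\<close>
  define A B M where "A = fst ` {k. F k \<noteq> 0}" and "B = snd ` {k. G k \<noteq> 0}" and "M = mids F \<union> fst ` {k. G k \<noteq> 0}"
  have fin: "finite A" "finite B" "finite M"
    using FS_finite F G finite_mids by (auto simp: A_def B_def M_def)
  have KF: "{k. F k \<noteq> 0} \<subseteq> A \<times> M" by (force simp: A_def M_def mids_def)
  have KG: "{k. G k \<noteq> 0} \<subseteq> M \<times> B" by (force simp: B_def M_def)
  have KM: "{k. Fmul F G k \<noteq> 0} \<subseteq> A \<times> B"
  proof
    fix k assume "k \<in> {k. Fmul F G k \<noteq> 0}"
    then obtain \<kappa> \<nu> where k: "k = (\<kappa>, \<nu>)" "(\<Sum>\<mu>\<in>mids F. F (\<kappa>, \<mu>) * G (\<mu>, \<nu>)) \<noteq> 0"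
      by (cases k) (auto simp: Fmul_def)
    from k(2) obtain \<mu> where "F (\<kappa>, \<mu>) * G (\<mu>, \<nu>) \<noteq> 0"
      by (rule sum.not_neutral_contains_not_neutral)
    then have "(\<kappa>, \<mu>) \<in> {k. F k \<noteq> 0}" "(\<mu>, \<nu>) \<in> {k. G k \<noteq> 0}" by auto
    then show "k \<in> A \<times> B" using KF KG by (auto simp: k(1))
  qed
  define X where "X \<kappa> \<mu> \<nu> = sidem P \<kappa> * sub P (F (\<kappa>, \<mu>) * G (\<mu>, \<nu>)) * sidem P \<nu>" for \<kappa> \<mu> \<nu>
  have "Phi P F * Phi P G = (\<Sum>\<kappa>\<in>A. \<Sum>\<mu>\<in>M. tm P F (\<kappa>, \<mu>)) * (\<Sum>\<mu>'\<in>M. \<Sum>\<nu>\<in>B. tm P G (\<mu>', \<nu>))"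
    using fin KF KG by (simp add: Phi_superset[of "A \<times> M"] Phi_superset[of "M \<times> B"] sum.cartesian_product)
  also have "\<dots> = (\<Sum>\<kappa>\<in>A. \<Sum>\<mu>\<in>M. \<Sum>\<mu>'\<in>M. \<Sum>\<nu>\<in>B. tm P F (\<kappa>, \<mu>) * tm P G (\<mu>', \<nu>))"
    unfolding sum_distrib_right unfolding sum_distrib_left ..
  also have "S.eqv P \<dots> (\<Sum>\<kappa>\<in>A. \<Sum>\<mu>\<in>M. \<Sum>\<mu>'\<in>M. \<Sum>\<nu>\<in>B. if \<mu> = \<mu>' then X \<kappa> \<mu> \<nu> else 0)"
    unfolding X_def by (intro S.eqv_sum tm_mult P F G)
  also have "\<dots> = (\<Sum>\<kappa>\<in>A. \<Sum>\<mu>\<in>M. \<Sum>\<mu>'\<in>M. if \<mu> = \<mu>' then (\<Sum>\<nu>\<in>B. X \<kappa> \<mu> \<nu>) else 0)"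
    by (intro sum.cong refl) auto
  also have "\<dots> = (\<Sum>\<kappa>\<in>A. \<Sum>\<mu>\<in>M. \<Sum>\<nu>\<in>B. X \<kappa> \<mu> \<nu>)"
    using fin by (simp add: sum.delta)
  also have "\<dots> = (\<Sum>\<kappa>\<in>A. \<Sum>\<nu>\<in>B. \<Sum>\<mu>\<in>M. X \<kappa> \<mu> \<nu>)"
    by (rule sum.cong[OF refl]) (rule sum.swap)
  also have "\<dots> = (\<Sum>\<kappa>\<in>A. \<Sum>\<nu>\<in>B. tm P (Fmul F G) (\<kappa>, \<nu>))"
  proof (intro sum.cong refl)
    fix \<kappa> \<nu>
    have "F (\<kappa>, \<mu>) = 0" if "\<mu> \<notin> mids F" for \<mu>
      using that by (force simp: mids_def)
    then have "Fmul F G (\<kappa>, \<nu>) = (\<Sum>\<mu>\<in>M. F (\<kappa>, \<mu>) * G (\<mu>, \<nu>))"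
      unfolding Fmul_def prod.case using fin by (intro sum.mono_neutral_left) (auto simp: M_def)
    then show "(\<Sum>\<mu>\<in>M. X \<kappa> \<mu> \<nu>) = tm P (Fmul F G) (\<kappa>, \<nu>)"
      by (simp add: tm_def X_def subst_simps sum_distrib_left sum_distrib_right)
  qed
  also have "\<dots> = Phi P (Fmul F G)"
    using fin KM by (simp add: Phi_superset[of "A \<times> B"] sum.cartesian_product)
  finally show ?thesis .
qed

lemma Phi_tau: "finite P' \<Longrightarrow> P \<subseteq> P' \<Longrightarrow> subst (tau P) (Phi P' F) = Phi P F"
  by (simp add: Phi_def tm_def subst_simps subst_mult tau_idem tau_sub)

lemma S_ops:
  fixes P :: "'x set" and x y :: "('i, 'x) S_gen word \<Rightarrow>\<^sub>0 qv"
  assumes "x \<in> FA (S_gens D P)" "y \<in> FA (S_gens D P)"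
  shows "S_class D P x \<oplus>\<^bsub>S_alg D P\<^esub> S_class D P y = S_class D P (x + y)"
    and "S_class D P x \<otimes>\<^bsub>S_alg D P\<^esub> S_class D P y = S_class D P (x * y)"
  using assms S.Q_add S.Q_mult by (simp_all add: S_folds)

lemma S_smult: "x \<in> FA (S_gens D P) \<Longrightarrow> c \<odot>\<^bsub>S_alg D P\<^esub> S_class D P x = S_class D P (scl c x)"
  using S.Q_smult by (simp add: S_folds)

lemma S_class_carrier: "x \<in> FA (S_gens D P) \<Longrightarrow> S_class D P x \<in> carrier (S_alg D P)"
  using S.cls_carrier by (simp add: S_folds)

lemma S_zero: "\<zero>\<^bsub>S_alg D P\<^esub> = S_class D P 0"
  using S.Q_zero by (simp add: S_folds)

lemma pdot_zero: "finite P \<Longrightarrow> pdot_map D P \<zero>\<^bsub>Udot D\<^esub> = \<zero>\<^bsub>S_alg D P\<^esub>"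
  by (simp add: Udot_zero pdot_rep FS_zero S_zero Phi_def)

lemma pdot_add: "finite P \<Longrightarrow> x \<in> carrier (Udot D) \<Longrightarrow> y \<in> carrier (Udot D) \<Longrightarrow>
    pdot_map D P (x \<oplus>\<^bsub>Udot D\<^esub> y) = pdot_map D P x \<oplus>\<^bsub>S_alg D P\<^esub> pdot_map D P y"
  by (auto simp: Udot_carrier Udot_add pdot_rep FS_add Phi_add S_ops Phi_FA)

lemma pdot_smult: "finite P \<Longrightarrow> x \<in> carrier (Udot D) \<Longrightarrow>
    pdot_map D P (c \<odot>\<^bsub>Udot D\<^esub> x) = c \<odot>\<^bsub>S_alg D P\<^esub> pdot_map D P x"
  by (auto simp: Udot_carrier Udot_smult pdot_rep FS_scl Phi_scl S_smult Phi_FA)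

lemma pdot_mult: "finite P \<Longrightarrow> x \<in> carrier (Udot D) \<Longrightarrow> y \<in> carrier (Udot D) \<Longrightarrow>
    pdot_map D P (x \<otimes>\<^bsub>Udot D\<^esub> y) = pdot_map D P x \<otimes>\<^bsub>S_alg D P\<^esub> pdot_map D P y"
proof -
  assume P: "finite P" and "x \<in> carrier (Udot D)" "y \<in> carrier (Udot D)"
  then obtain F G where FG: "F \<in> FS" "G \<in> FS" "x = rep F" "y = rep G" by (auto simp: Udot_carrier)
  have "S_class D P (Phi P (Fmul F G)) = S_class D P (Phi P F * Phi P G)"
    using S.eqv_sym[OF Phi_mult[OF P FG(1,2)]] FG by (subst S_class_eq) (auto intro: FA_mult Phi_FA FS_mul)
  then show ?thesis
    using P FG by (simp add: Udot_mult pdot_rep FS_mul S_ops Phi_FA)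
qed

lemma pdot_carrier: "finite P \<Longrightarrow> x \<in> carrier (Udot D) \<Longrightarrow> pdot_map D P x \<in> carrier (S_alg D P)"
  by (auto simp: Udot_carrier pdot_rep S_class_carrier Phi_FA)

lemma pdot_trans: "finite P' \<Longrightarrow> P \<subseteq> P' \<Longrightarrow> x \<in> carrier (Udot D) \<Longrightarrow> S_trans D P (pdot_map D P' x) = pdot_map D P x"
  by (auto simp: Udot_carrier pdot_rep finite_subset S_trans_cls Phi_FA Phi_tau)

text \<open>Compressing the difference by idempotents on both sides isolates one matrix entry, since
  the other entries are annihilated; that entry then lies in every \<open>ker\<close>.\<close>

lemma pdot_separates:
  assumes "x \<in> carrier (Udot D)" "y \<in> carrier (Udot D)"
    and "\<And>P. P \<in> finite_saturated D \<Longrightarrow> pdot_map D P x = pdot_map D P y"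
  shows "x = y"
proof -
  obtain F G where FG: "F \<in> FS" "G \<in> FS" "x = rep F" "y = rep G"
    using assms by (auto simp: Udot_carrier)
  define H where "H = (\<lambda>k. F k + scl (- 1) (G k))"
  have H: "H \<in> FS" unfolding H_def using FG by (intro FS_add FS_scl)
  have "H (\<kappa>, \<nu>) \<in> MS \<kappa> \<nu>" for \<kappa> \<nu>
  proof (rule ker_MS[OF FS_FA[OF H]])
    fix P assume PS: "P \<in> finite_saturated D"
    then have P: "finite P" by (simp add: finite_saturated_def)
    have "S.eqv P (Phi P F) (Phi P G)"
      using assms(3)[OF PS] P FG by (simp add: pdot_rep S_class_eq Phi_FA)
    then have PH: "Phi P H \<in> S.J P"
      unfolding H_def Phi_add[OF FG(1) FS_scl[OF FG(2)]] Phi_scl[OF FG(2)] by (simp add: S.eqv_def)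
    define e where "e = (\<lambda>k. if k = (\<kappa>, \<nu>) then tm P H (\<kappa>, \<nu>) else 0)"
    have "S.eqv P (sidem P \<kappa> * Phi P H * sidem P \<nu>) (\<Sum>k | H k \<noteq> 0. e k)"
      unfolding Phi_def sum_distrib_left sum_distrib_right
    proof (rule S.eqv_sum)
      fix k
      have mid: "sub P (H k) \<in> FA (S_gens D P)" by (rule sub_FA[OF FS_FA[OF H]])
      have "sidem P \<kappa> * tm P H k * sidem P \<nu> = (sidem P \<kappa> * sidem P (fst k)) * (sub P (H k) * (sidem P (snd k) * sidem P \<nu>))"
        by (simp add: tm_def mult.assoc)
      also have "S.eqv P \<dots> ((if \<kappa> = fst k then sidem P \<kappa> else 0) * (sub P (H k) * (sidem P (snd k) * sidem P \<nu>)))"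
        by (rule S.eqv_right[OF FA_mult[OF mid FA_mult[OF S_idem_FA S_idem_FA]] idem_mult])
      also have "S.eqv P \<dots> ((if \<kappa> = fst k then sidem P \<kappa> else 0) * (sub P (H k) * (if snd k = \<nu> then sidem P (snd k) else 0)))"
        by (intro S.eqv_left mid idem_mult) auto
      also have "\<dots> = e k"
        by (cases k) (auto simp: e_def tm_def mult.assoc)
      finally show "S.eqv P (sidem P \<kappa> * tm P H k * sidem P \<nu>) (e k)" .
    qed
    also have "(\<Sum>k | H k \<noteq> 0. e k) = tm P H (\<kappa>, \<nu>)"
      using FS_finite[OF H] by (simp add: e_def tm_zero)
    finally have "S.eqv P (tm P H (\<kappa>, \<nu>)) (sidem P \<kappa> * Phi P H * sidem P \<nu>)" by (rule S.eqv_sym)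
    moreover have "sidem P \<kappa> * Phi P H * sidem P \<nu> \<in> S.J P"
      by (rule S.J_right[OF S_idem_FA S.J_left[OF S_idem_FA PH]])
    ultimately have "tm P H (\<kappa>, \<nu>) \<in> S.J P" by (rule S.eqv_J)
    then show "H (\<kappa>, \<nu>) \<in> ker \<kappa> \<nu> P" by (simp add: ker_def tm_def)
  qed
  then have "cl \<kappa> \<nu> (F (\<kappa>, \<nu>)) = cl \<kappa> \<nu> (G (\<kappa>, \<nu>))" for \<kappa> \<nu>
    using FG by (subst cl_eq_iff) (simp_all add: FS_FA H_def)
  then show ?thesis
    unfolding FG(3,4) by (simp add: rep_def)
qed

lemma Udot_closed:
  "\<zero>\<^bsub>Udot D\<^esub> \<in> carrier (Udot D)"
  "x \<in> carrier (Udot D) \<Longrightarrow> y \<in> carrier (Udot D) \<Longrightarrow> x \<oplus>\<^bsub>Udot D\<^esub> y \<in> carrier (Udot D)"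
  "x \<in> carrier (Udot D) \<Longrightarrow> y \<in> carrier (Udot D) \<Longrightarrow> x \<otimes>\<^bsub>Udot D\<^esub> y \<in> carrier (Udot D)"
  "x \<in> carrier (Udot D) \<Longrightarrow> c \<odot>\<^bsub>Udot D\<^esub> x \<in> carrier (Udot D)"
  by (auto simp: Udot_carrier Udot_zero Udot_add Udot_mult Udot_smult intro!: imageI FS_zero FS_add FS_mul FS_scl)

definition Efam :: "sign \<Rightarrow> 'i \<Rightarrow> nat \<Rightarrow> 'x \<Rightarrow> ('i, 'x, 'y) uf" where
  "Efam s i m \<kappa> = (\<lambda>k. if k = (\<kappa> + zmul (sg s * int m) (al i), \<kappa>)
    then scl (inverse (q_fact (vi D i) m)) (gen (UE s i) ^ m) else 0)"

lemma phom_gen_pow: "i \<in> I \<Longrightarrow> phom (\<kappa> + zmul (sg s * int m) (al i)) \<kappa> (gen (UE s i) ^ m)"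
proof -
  assume i: "i \<in> I"
  have "homog uwt (zmul (sg s * int m) (al i)) (gen (UE s i) ^ m)"
  proof (induction m)
    case 0
    have "homog uwt 0 (mon (Word []))" unfolding homog_mon by simp
    then show ?case by simp
  next
    case (Suc m)
    have "homog uwt (zmul (sg s) (al i)) (gen (UE s i))"
      by (simp add: gen_eq_mon)
    from homog_uwt_mult[OF this Suc] show ?case
      by (simp add: distrib_left zmul_add)
  qed
  then show ?thesis using i by (simp add: phom_def FA_power)
qed

lemma Efam_FS: "i \<in> I \<Longrightarrow> Efam s i m \<kappa> \<in> FS"
  unfolding FS_def by (auto simp: Efam_def intro: phom_scl phom_gen_pow)

lemma Udot_E_rep: "i \<in> I \<Longrightarrow> Udot_E D s i m \<kappa> = rep (Efam s i m \<kappa>)"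
proof -
  assume i: "i \<in> I"
  have "divpow (U_alg D) (vi D i) (U_E D s i) m = U_class D (scl (inverse (q_fact (vi D i) m)) (gen (UE s i) ^ m))"
    using U.Q_divpow[of "gen (UE s i)"] i by (simp add: U_E_def U_folds)
  then show ?thesis
    unfolding Udot_E_def Udot_in_def Udot_one
    by (auto simp: rep_def Efam_def fun_eq_iff cl_def)
qed

lemma S_E_divpow: "i \<in> I \<Longrightarrow> divpow (S_alg D P) (vi D i) (S_E D P s i) m = S_class D P (scl (inverse (q_fact (vi D i) m)) (gen (SE s i) ^ m))"
  using S.Q_divpow[of "gen (SE s i)" P] by (simp add: S_E_def S_folds)

text \<open>\<open>pdot_map\<close> puts an idempotent on both sides; the left one is absorbed
  because the power of the generator carries one weight to the other.\<close>

lemma pdot_Udot_E: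
  assumes P: "finite P" and i: "i \<in> I"
  shows "pdot_map D P (Udot_E D s i m \<kappa>) = divpow (S_alg D P) (vi D i) (S_E D P s i) m \<otimes>\<^bsub>S_alg D P\<^esub> S_one D P \<kappa>"
proof -
  define F where "F = Efam s i m \<kappa>"
  define \<kappa>' where "\<kappa>' = \<kappa> + zmul (sg s * int m) (al i)"
  define x :: "('i, 'x) S_gen word \<Rightarrow>\<^sub>0 qv" where "x = scl (inverse (q_fact (vi D i) m)) (gen (SE s i) ^ m)"
  define p :: "('i, 'y) U_gen word \<Rightarrow>\<^sub>0 qv" where "p = scl (inverse (q_fact (vi D i) m)) (gen (UE s i) ^ m)"
  have F: "F \<in> FS" unfolding F_def by (rule Efam_FS[OF i])
  have xF: "x \<in> FA (S_gens D P)" using i by (simp add: x_def FA_scl FA_power)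
  have subp: "sub P p = x" by (simp add: p_def x_def subst_simps subst_power)
  have "Phi P F = (\<Sum>k\<in>{(\<kappa>', \<kappa>)}. tm P F k)"
    by (rule Phi_superset) (auto simp: F_def Efam_def \<kappa>'_def)
  then have Phi: "Phi P F = sidem P \<kappa>' * x * sidem P \<kappa>"
    using subp by (simp add: tm_def F_def Efam_def \<kappa>'_def p_def)
  have ph: "phom \<kappa>' \<kappa> p"
    unfolding p_def \<kappa>'_def by (rule phom_scl[OF phom_gen_pow[OF i]])
  then have comm: "S.eqv P (x * sidem P \<kappa>) (sidem P \<kappa>' * x)"
    using sub_idem[OF P, of p "\<kappa>' - \<kappa>" \<kappa>] by (simp add: subp phom_def)
  from S.eqv_left[OF S_idem_FA[of P \<kappa>'] this]
  have "S.eqv P (sidem P \<kappa>' * x * sidem P \<kappa>) (sidem P \<kappa>' * sidem P \<kappa>' * x)"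
    by (simp add: mult.assoc)
  also have "S.eqv P (sidem P \<kappa>' * sidem P \<kappa>' * x) (sidem P \<kappa>' * x)"
    using S.eqv_right[OF xF idem_mult[of P \<kappa>' \<kappa>']] by simp
  also have "S.eqv P (sidem P \<kappa>' * x) (x * sidem P \<kappa>)"
    by (rule S.eqv_sym[OF comm])
  finally have "S_class D P (Phi P F) = S_class D P (x * sidem P \<kappa>)"
    unfolding Phi using xF by (subst S_class_eq) (simp_all add: FA_mult)
  then show ?thesis
    using P F xF by (simp add: Udot_E_rep[OF i] F_def[symmetric] pdot_rep S_E_divpow[OF i] x_def[symmetric] S_one_def S_ops)
qed

section \<open>The homomorphism to the inverse limit\<close>

text \<open>Taken on the whole modified form over the field of rational functions: the homomorphism
  property and injectivity hold there, and the integral map is a restriction.\<close>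

definition th :: "('i, 'x, 'y) Udot_elem \<Rightarrow> ('i, 'x) Uhat_elem" where
  "th x = (\<lambda>P\<in>finite_saturated D. pdot_map D P x)"

lemma fs_finite: "P \<in> finite_saturated D \<Longrightarrow> finite P"
  by (simp add: finite_saturated_def)

lemma th_carrier: "x \<in> carrier (Udot D) \<Longrightarrow> th x \<in> carrier (Uhat D)"
  by (auto simp: Uhat_def th_def PiE_iff fs_finite pdot_carrier pdot_trans)

lemma th_hom:
  assumes "x \<in> carrier (Udot D)" "y \<in> carrier (Udot D)"
  shows "th (x \<oplus>\<^bsub>Udot D\<^esub> y) = th x \<oplus>\<^bsub>Uhat D\<^esub> th y"
    and "th (x \<otimes>\<^bsub>Udot D\<^esub> y) = th x \<otimes>\<^bsub>Uhat D\<^esub> th y"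
  using assms by (auto simp: th_def Uhat_def fun_eq_iff fs_finite pdot_add pdot_mult)

lemma th_smult: "x \<in> carrier (Udot D) \<Longrightarrow> th (c \<odot>\<^bsub>Udot D\<^esub> x) = c \<odot>\<^bsub>Uhat D\<^esub> th x"
  by (auto simp: th_def Uhat_def fun_eq_iff fs_finite pdot_smult)

lemma th_zero: "th \<zero>\<^bsub>Udot D\<^esub> = \<zero>\<^bsub>Uhat D\<^esub>"
  by (auto simp: th_def Uhat_def fun_eq_iff fs_finite pdot_zero)

lemma th_inj: "inj_on th (carrier (Udot D))"
proof (rule inj_onI)
  fix x y assume xy: "x \<in> carrier (Udot D)" "y \<in> carrier (Udot D)" "th x = th y"
  show "x = y"
  proof (rule pdot_separates[OF xy(1,2)])
    fix P assume "P \<in> finite_saturated D"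
    with fun_cong[OF xy(3), of P] show "pdot_map D P x = pdot_map D P y" by (simp add: th_def)
  qed
qed

lemma Uhat_divpow: "divpow (Uhat D) q (Uhat_E D s i) m = (\<lambda>P\<in>finite_saturated D. divpow (S_alg D P) q (S_E D P s i) m)"
proof -
  have "Uhat_E D s i [^]\<^bsub>Uhat D\<^esub> m = (\<lambda>P\<in>finite_saturated D. S_E D P s i [^]\<^bsub>S_alg D P\<^esub> m)" for m :: nat
  proof (induction m)
    case 0
    show ?case by (simp add: Uhat_def)
  next
    case (Suc m)
    have "Uhat_E D s i [^]\<^bsub>Uhat D\<^esub> Suc m = (\<lambda>P\<in>finite_saturated D. S_E D P s i [^]\<^bsub>S_alg D P\<^esub> m) \<otimes>\<^bsub>Uhat D\<^esub> Uhat_E D s i"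
      by (simp only: nat_pow_Suc Suc)
    also have "\<dots> = (\<lambda>P\<in>finite_saturated D. S_E D P s i [^]\<^bsub>S_alg D P\<^esub> Suc m)"
      by (auto simp: Uhat_def Uhat_E_def fun_eq_iff)
    finally show ?case .
  qed
  then show ?thesis
    unfolding divpow_def by (auto simp: Uhat_def fun_eq_iff)
qed

lemma th_Udot_E: "i \<in> I \<Longrightarrow> th (Udot_E D s i m \<kappa>) = Uhat_E1 D s i m \<kappa>"
  unfolding Uhat_E1_def Uhat_divpow
  by (auto simp: th_def Uhat_one_def Uhat_def fun_eq_iff fs_finite pdot_Udot_E)

subsection \<open>Integral forms\<close>

abbreviation Egens where "Egens \<equiv> {Udot_E D s i m \<kappa> | s i m \<kappa>. i \<in> I}"

lemma A_Udot_simps: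
  "carrier (A_Udot D) = subalgebra_gen laurent (Udot D) Egens"
  "add (A_Udot D) = add (Udot D)" "monoid.mult (A_Udot D) = monoid.mult (Udot D)"
  "module.smult (A_Udot D) = module.smult (Udot D)"
  by (simp_all add: A_Udot_def)

lemma A_Uhat_simps:
  "carrier (A_Uhat D) = {a \<in> carrier (Uhat D). \<forall>P\<in>finite_saturated D. a P \<in> carrier (A_S_alg D P)}"
  "add (A_Uhat D) = add (Uhat D)" "monoid.mult (A_Uhat D) = monoid.mult (Uhat D)"
  "module.smult (A_Uhat D) = module.smult (Uhat D)" "ring.zero (A_Uhat D) = ring.zero (Uhat D)"
  by (simp_all add: A_Uhat_def)

lemma A_Uhat_sub_simps:
  "carrier (A_Uhat_sub D) = subalgebra_gen laurent (A_Uhat D) {Uhat_E1 D s i m \<kappa> | s i m \<kappa>. i \<in> I}"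
  "add (A_Uhat_sub D) = add (Uhat D)" "monoid.mult (A_Uhat_sub D) = monoid.mult (Uhat D)"
  "module.smult (A_Uhat_sub D) = module.smult (Uhat D)"
  by (simp_all add: A_Uhat_sub_def A_Uhat_simps)

lemma A_Udot_Udot: "x \<in> subalgebra_gen laurent (Udot D) Egens \<Longrightarrow> x \<in> carrier (Udot D)"
proof (induction rule: subalgebra_gen.induct)
  case (gen x)
  then show ?case by (auto simp: Udot_E_rep Udot_carrier Efam_FS)
qed (rule Udot_closed; assumption)+

lemma pdot_integral:
  assumes P: "finite P"
  shows "x \<in> subalgebra_gen laurent (Udot D) Egens \<Longrightarrow> pdot_map D P x \<in> carrier (A_S_alg D P)"
proof (induction rule: subalgebra_gen.induct)
  case zero
  show ?case
    unfolding pdot_zero[OF P] A_S_alg_def by (simp add: subalgebra_gen.zero)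
next
  case (gen x)
  then obtain s i m \<kappa> where x: "x = Udot_E D s i m \<kappa>" "i \<in> I" by blast
  \<comment> \<open>For a weight outside the orbit \<open>S_one\<close> is not among the generators,
    but it is 0.\<close>
  have one: "S_one D P \<kappa> \<in> carrier (A_S_alg D P)"
  proof (cases "\<kappa> \<in> weyl_orbit D P")
    case True
    then show ?thesis by (auto simp: A_S_alg_def intro: subalgebra_gen.gen)
  next
    case False
    then have "S_one D P \<kappa> = \<zero>\<^bsub>S_alg D P\<^esub>"
      by (simp add: S_one_def S_idem_def S_zero)
    then show ?thesis by (simp add: A_S_alg_def subalgebra_gen.zero)
  qed
  have "divpow (S_alg D P) (vi D i) (S_E D P s i) m \<in> carrier (A_S_alg D P)"
    using x(2) by (auto simp: A_S_alg_def intro!: subalgebra_gen.gen)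
  with one show ?case
    unfolding x(1) pdot_Udot_E[OF P x(2)] by (simp add: A_S_alg_def subalgebra_gen.mult)
next
  case (add x y)
  then show ?case
    using pdot_add[OF P A_Udot_Udot[OF add.hyps(1)] A_Udot_Udot[OF add.hyps(2)]]
    by (simp add: A_S_alg_def subalgebra_gen.add)
next
  case (mult x y)
  then show ?case
    using pdot_mult[OF P A_Udot_Udot[OF mult.hyps(1)] A_Udot_Udot[OF mult.hyps(2)]]
    by (simp add: A_S_alg_def subalgebra_gen.mult)
next
  case (smult c x)
  then show ?case
    using pdot_smult[OF P A_Udot_Udot[OF smult.hyps(2)]]
    by (simp add: A_S_alg_def subalgebra_gen.smult)
qed

lemma th_A_Uhat: "x \<in> carrier (A_Udot D) \<Longrightarrow> th x \<in> carrier (A_Uhat D)"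
  by (simp add: A_Udot_simps A_Uhat_simps th_carrier A_Udot_Udot) (simp add: th_def fs_finite pdot_integral)

lemma A_Udot_closed:
  "x \<in> carrier (A_Udot D) \<Longrightarrow> y \<in> carrier (A_Udot D) \<Longrightarrow> x \<oplus>\<^bsub>Udot D\<^esub> y \<in> carrier (A_Udot D)"
  "x \<in> carrier (A_Udot D) \<Longrightarrow> y \<in> carrier (A_Udot D) \<Longrightarrow> x \<otimes>\<^bsub>Udot D\<^esub> y \<in> carrier (A_Udot D)"
  "c \<in> laurent \<Longrightarrow> x \<in> carrier (A_Udot D) \<Longrightarrow> c \<odot>\<^bsub>Udot D\<^esub> x \<in> carrier (A_Udot D)"
  by (simp_all add: A_Udot_simps subalgebra_gen.intros)

definition theta :: "('i, 'x, 'y) Udot_elem \<Rightarrow> ('i, 'x) Uhat_elem" where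
  "theta = restrict th (carrier (A_Udot D))"

lemma theta_th: "x \<in> carrier (A_Udot D) \<Longrightarrow> theta x = th x"
  by (simp add: theta_def)

lemma theta_alg_hom:
  assumes "\<And>x. x \<in> carrier (A_Udot D) \<Longrightarrow> th x \<in> carrier B" "add B = add (Uhat D)"
    "monoid.mult B = monoid.mult (Uhat D)" "module.smult B = module.smult (Uhat D)"
  shows "theta \<in> alg_hom laurent (A_Udot D) B"
proof -
  have U: "x \<in> carrier (A_Udot D) \<Longrightarrow> x \<in> carrier (Udot D)" for x
    by (simp add: A_Udot_simps A_Udot_Udot)
  show ?thesis
    unfolding alg_hom_def A_Udot_simps(2-4) assms(2-4)
    by (auto simp: theta_th A_Udot_closed assms(1) th_hom th_smult U)
qed

lemma is_dot_theta_theta: "is_dot_theta D theta"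
  unfolding is_dot_theta_def
proof (intro conjI ballI)
  show "theta \<in> alg_hom laurent (A_Udot D) (A_Uhat D)"
    by (rule theta_alg_hom) (simp_all add: th_A_Uhat A_Uhat_simps(2-4))
  show "theta \<in> extensional (carrier (A_Udot D))"
    by (simp add: theta_def)
  show "phat_map P (theta x) = pdot_map D P x" if "P \<in> finite_saturated D" "x \<in> carrier (A_Udot D)" for P x
    using that by (simp add: theta_th phat_map_def th_def)
qed

text \<open>Extensionality is used twice: for the map off its domain, and for each of its values off
  the finite saturated sets.\<close>

lemma is_dot_theta_unique:
  assumes "is_dot_theta D \<theta>"
  shows "\<theta> = theta"
proof (rule extensionalityI)
  show "\<theta> \<in> extensional (carrier (A_Udot D))" "theta \<in> extensional (carrier (A_Udot D))"
    using assms is_dot_theta_theta unfolding is_dot_theta_def by blast+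
  fix x assume x: "x \<in> carrier (A_Udot D)"
  have "\<theta> x \<in> carrier (A_Uhat D)"
    using assms x unfolding is_dot_theta_def alg_hom_def by blast
  then have "\<theta> x \<in> extensional (finite_saturated D)"
    by (auto simp: A_Uhat_simps Uhat_def PiE_def)
  then show "\<theta> x = theta x"
  proof (rule extensionalityI)
    show "theta x \<in> extensional (finite_saturated D)"
      using x by (simp add: theta_th th_def)
    fix P assume P: "P \<in> finite_saturated D"
    have "\<theta> x P = pdot_map D P x"
      using assms x P unfolding is_dot_theta_def phat_map_def by blast
    then show "\<theta> x P = theta x P"
      using x P by (simp add: theta_th th_def)
  qed
qed

lemma Udot_E_A_Udot: "i \<in> I \<Longrightarrow> Udot_E D s i m \<kappa> \<in> carrier (A_Udot D)"
  unfolding A_Udot_simps by (rule subalgebra_gen.gen) blast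

lemma theta_inj: "inj_on theta (carrier (A_Udot D))"
proof -
  have "inj_on th (carrier (A_Udot D))"
    by (rule inj_on_subset[OF th_inj]) (auto simp: A_Udot_simps A_Udot_Udot)
  then show ?thesis
    by (simp add: theta_def inj_on_restrict_eq)
qed

text \<open>A homomorphism maps the subalgebra generated by a set onto the one generated by the
  image of that set; the two inclusions are inductions over the generation on either side.\<close>

lemma theta_image: "theta ` carrier (A_Udot D) = carrier (A_Uhat_sub D)"
proof (intro equalityI subsetI)
  have U: "x \<in> carrier (A_Udot D) \<Longrightarrow> x \<in> carrier (Udot D)" for x
    by (simp add: A_Udot_simps A_Udot_Udot)
  have "x \<in> subalgebra_gen laurent (Udot D) Egens \<Longrightarrow> th x \<in> carrier (A_Uhat_sub D)" for x
  proof (induction rule: subalgebra_gen.induct)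
    case zero
    show ?case
      unfolding A_Uhat_sub_simps th_zero A_Uhat_simps(5)[symmetric] by (rule subalgebra_gen.zero)
  next
    case (gen x)
    then obtain s i m \<kappa> where "x = Udot_E D s i m \<kappa>" "i \<in> I" by blast
    then have "th x = Uhat_E1 D s i m \<kappa>" "i \<in> I" by (simp_all add: th_Udot_E)
    then show ?case
      unfolding A_Uhat_sub_simps by (intro subalgebra_gen.gen) blast
  next
    case (add x y)
    then show ?case
      using subalgebra_gen.add[of "th x" laurent "A_Uhat D" _ "th y"]
      by (simp add: A_Uhat_sub_simps A_Uhat_simps(2) th_hom A_Udot_Udot)
  next
    case (mult x y)
    then show ?case
      using subalgebra_gen.mult[of "th x" laurent "A_Uhat D" _ "th y"]
      by (simp add: A_Uhat_sub_simps A_Uhat_simps(3) th_hom A_Udot_Udot)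
  next
    case (smult c x)
    then show ?case
      using subalgebra_gen.smult[of c laurent "th x" "A_Uhat D"]
      by (simp add: A_Uhat_sub_simps A_Uhat_simps(4) th_smult A_Udot_Udot)
  qed
  from this[folded A_Udot_simps(1)]
  show "y \<in> carrier (A_Uhat_sub D)" if "y \<in> theta ` carrier (A_Udot D)" for y
    using that by (auto simp: theta_th)
  have "y \<in> subalgebra_gen laurent (A_Uhat D) {Uhat_E1 D s i m \<kappa> | s i m \<kappa>. i \<in> I} \<Longrightarrow> \<exists>x\<in>carrier (A_Udot D). y = th x" for y
  proof (induction rule: subalgebra_gen.induct)
    case zero
    show ?case
      unfolding A_Uhat_simps(5) th_zero[symmetric] A_Udot_simps(1) using subalgebra_gen.zero by blast
  next
    case (gen y)
    then obtain s i m \<kappa> where "y = Uhat_E1 D s i m \<kappa>" "i \<in> I" by blast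
    then show ?case
      by (intro bexI[of _ "Udot_E D s i m \<kappa>"]) (simp_all add: th_Udot_E Udot_E_A_Udot)
  next
    case (add y z)
    then obtain a b where "a \<in> carrier (A_Udot D)" "b \<in> carrier (A_Udot D)" "y = th a" "z = th b" by blast
    then show ?case
      by (intro bexI[of _ "a \<oplus>\<^bsub>Udot D\<^esub> b"]) (simp_all add: A_Uhat_simps(2) th_hom U A_Udot_closed)
  next
    case (mult y z)
    then obtain a b where "a \<in> carrier (A_Udot D)" "b \<in> carrier (A_Udot D)" "y = th a" "z = th b" by blast
    then show ?case
      by (intro bexI[of _ "a \<otimes>\<^bsub>Udot D\<^esub> b"]) (simp_all add: A_Uhat_simps(3) th_hom U A_Udot_closed)
  next
    case (smult c y)
    then obtain a where "a \<in> carrier (A_Udot D)" "y = th a" by blast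
    then show ?case
      using smult.hyps(1) by (intro bexI[of _ "c \<odot>\<^bsub>Udot D\<^esub> a"]) (simp_all add: A_Uhat_simps(4) th_smult U A_Udot_closed)
  qed
  from this[folded A_Uhat_sub_simps(1)]
  show "y \<in> theta ` carrier (A_Udot D)" if "y \<in> carrier (A_Uhat_sub D)" for y
    using that theta_th by (metis imageI)
qed

lemma theta_iso: "theta \<in> alg_iso laurent (A_Udot D) (A_Uhat_sub D)"
proof -
  have "theta \<in> alg_hom laurent (A_Udot D) (A_Uhat_sub D)"
    using theta_image by (intro theta_alg_hom) (auto simp: A_Uhat_sub_simps(2-4) theta_th[symmetric])
  then show ?thesis
    using theta_inj theta_image by (simp add: alg_iso_def bij_betw_def)
qed

end

theorem theorem4p4:
  fixes D :: "('i, 'x :: ab_group_add, 'y :: ab_group_add) root_data"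
  assumes "root_datum D" and "finite_type D"
  shows "(\<exists>!\<theta>. is_dot_theta D \<theta>) \<and>
    (\<forall>\<theta>. is_dot_theta D \<theta> \<longrightarrow>
      inj_on \<theta> (carrier (A_Udot D)) \<and>
      (\<forall>s. \<forall>i\<in>index D. \<forall>m \<kappa>. \<theta> (Udot_E D s i m \<kappa>) = Uhat_E1 D s i m \<kappa>)) \<and>
    alg_iso laurent (A_Udot D) (A_Uhat_sub D) \<noteq> {}"
proof -
  interpret finite_root_datum D using assms by unfold_locales
  have "\<exists>!\<theta>. is_dot_theta D \<theta>"
    using is_dot_theta_theta is_dot_theta_unique by (rule ex1I)
  moreover have "theta (Udot_E D s i m \<kappa>) = Uhat_E1 D s i m \<kappa>" if "i \<in> I" for s i m \<kappa>
    using that by (simp add: theta_th Udot_E_A_Udot th_Udot_E)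
  ultimately show ?thesis
    using is_dot_theta_unique theta_inj theta_iso by blast
qed

end
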